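(* Let $X$ be a normal algebraic variety over $k$ with function field $K(X)$, let $D$ be a simple normal crossing divisor on $X$, and for every prime divisor $P$ in the support of $D$ choose a unit $h_P\in\kappa(P)^*$. Then the map $\mathcal W\colon K(X)^2\setminus\{(0,0)\}\to\mathrm{Div}(X)$ given by $$\mathcal W(f,g)_P=\begin{cases}\min\{\mathrm{ord}_P(f),\mathrm{ord}_P(g)\}+1,& P\in\mathrm{supp}(D)\text{ and }(f/g)(P)=h_P,\\ \min\{\mathrm{ord}_P(f),\mathrm{ord}_P(g)\},&\text{else,}\end{cases}$$ for all prime divisors $P$ of $X$, defines a Weil decoration.
   Context: Conventions: $k$ is an algebraically closed field of characteristic $0$. A normal algebraic variety over $k$ is a normal, separated, integral scheme of finite type over $k$. Write $K=K(X)$. $\mathrm{Div}(X)$ is the group of Weil divisors; $D_P$ denotes the coefficient of $D\in\mathrm{Div}(X)$ at a prime divisor $P$; $D\ge D'$ means $D-D'$ is effective; $D\wedge D'$ has coefficients $\min\{D_P,D'_P\}$. "$P\in\mathrm{supp}(D)$" means that $P$ is one of the prime components of $D$. $\mathrm{ord}_P$ is the valuation of the discrete valuation ring $\mathcal O_{X,P}$ (local ring at the generic point of $P$), with $\mathrm{ord}_P(0)=\infty$, and $\kappa(P)=\mathcal O_{X,P}/\mathfrak m_{X,P}$. For $f\in K$ the value $f(P)\in\kappa(P)\cup\{\infty\}$ is the residue class of $f$ if $f\in\mathcal O_{X,P}$, and $\infty$ otherwise; for $f\neq0$, $f/0$ has value $\infty$. A formal value $\infty$, larger than every divisor, is adjoined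 to $\mathrm{Div}(X)$, and $\mathrm{div}(0)=\infty$. A pre-Weil decoration on a finite-dimensional $K$-vector space $\mathcal V$ is a map $\mathcal W\colon\mathcal V\to\mathrm{Div}(X)\cup\{\infty\}$ with: (W0) $\mathcal W(v)=\infty$ iff $v=0$; (W1) $\mathcal W(f v)=\mathrm{div}(f)+\mathcal W(v)$ for all $f\in K$, $v\in\mathcal V$; (W2) $\mathcal W(v+v')\ge\mathcal W(v)\wedge\mathcal W(v')$. A map given only on $\mathcal V\setminus\{0\}$ is extended by $\mathcal W(0)=\infty$. Its associated sheaf is $\mathcal O_X(\mathcal W)(U)=\{v\in\mathcal V\mid\mathcal W(v)|_U\ge0\}$. A Weil decoration is a pre-Weil decoration whose associated sheaf is coherent. *)

theory Defs
  imports
    "HOL-Algebra.Algebra"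
    "HOL-Analysis.Abstract_Topology"
    "HOL-Library.Extended"
    "HOL-Library.Extended_Nat"
    "HOL-Library.Function_Algebras"
begin

section \<open>Commutative algebra\<close>

definition local_ring :: "'a ring \<Rightarrow> bool" where
  "local_ring R \<longleftrightarrow> cring R \<and> (\<exists>!M. maximalideal M R)"

definition max_ideal :: "'a ring \<Rightarrow> 'a set" where
  "max_ideal R = (THE M. maximalideal M R)"

definition residue_ring_of :: "'a ring \<Rightarrow> 'a set ring" where
  "residue_ring_of R = R Quot (max_ideal R)"

definition krull_dim :: "'a ring \<Rightarrow> enat" where
  "krull_dim R = Sup {enat n |n. \<exists>p. (\<forall>i\<le>n. primeideal (p i) R) \<and> (\<forall>i<n. p i \<subset> p (Suc i))}"

definition regular_system_of_parameters :: "'a ring \<Rightarrow> nat \<Rightarrow> (nat \<Rightarrow> 'a) \<Rightarrow> bool" where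
  "regular_system_of_parameters R d x \<longleftrightarrow>
     local_ring R \<and> noetherian_ring R \<and> krull_dim R = enat d \<and>
     x \<in> {..<d} \<rightarrow> carrier R \<and> max_ideal R = Idl\<^bsub>R\<^esub> (x ` {..<d})"

definition char_zero :: "'a ring \<Rightarrow> bool" where
  "char_zero R \<longleftrightarrow> (\<forall>n::nat. n > 0 \<longrightarrow> add_pow R n \<one>\<^bsub>R\<^esub> \<noteq> \<zero>\<^bsub>R\<^esub>)"

text \<open>The fraction \<open>a / s\<close> in the localization of \<open>R\<close> at the prime ideal \<open>P\<close>, as an equivalence
  class of pairs.\<close>

definition fraction :: "'a ring \<Rightarrow> 'a set \<Rightarrow> 'a \<Rightarrow> 'a \<Rightarrow> ('a \<times> 'a) set" where
  "fraction R P a s =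
     {(b, t). b \<in> carrier R \<and> t \<in> carrier R - P \<and>
        (\<exists>u\<in>carrier R - P. u \<otimes>\<^bsub>R\<^esub> (a \<otimes>\<^bsub>R\<^esub> t \<ominus>\<^bsub>R\<^esub> b \<otimes>\<^bsub>R\<^esub> s) = \<zero>\<^bsub>R\<^esub>)}"

definition localization :: "'a ring \<Rightarrow> 'a set \<Rightarrow> ('a \<times> 'a) set ring" where
  "localization R P =
     \<lparr>carrier = {fraction R P a s |a s. a \<in> carrier R \<and> s \<in> carrier R - P},
      monoid.mult = (\<lambda>x y. \<Union>(a, s)\<in>x. \<Union>(b, t)\<in>y. fraction R P (a \<otimes>\<^bsub>R\<^esub> b) (s \<otimes>\<^bsub>R\<^esub> t)),
      monoid.one = fraction R P \<one>\<^bsub>R\<^esub> \<one>\<^bsub>R\<^esub>,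
      ring.zero = fraction R P \<zero>\<^bsub>R\<^esub> \<one>\<^bsub>R\<^esub>,
      ring.add = (\<lambda>x y. \<Union>(a, s)\<in>x. \<Union>(b, t)\<in>y.
               fraction R P (a \<otimes>\<^bsub>R\<^esub> t \<oplus>\<^bsub>R\<^esub> b \<otimes>\<^bsub>R\<^esub> s) (s \<otimes>\<^bsub>R\<^esub> t))\<rparr>"

abbreviation fraction_field :: "'a ring \<Rightarrow> ('a \<times> 'a) set ring" where
  "fraction_field R \<equiv> localization R {\<zero>\<^bsub>R\<^esub>}"

definition integrally_closed_domain :: "'a ring \<Rightarrow> bool" where
  "integrally_closed_domain R \<longleftrightarrow> domain R \<and>
     (let F = fraction_field R; \<iota> = (\<lambda>r. fraction R {\<zero>\<^bsub>R\<^esub>} r \<one>\<^bsub>R\<^esub>) in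
      \<forall>x\<in>carrier F. \<forall>(n::nat) c.
        c \<in> {..<n} \<rightarrow> carrier R \<and>
        x [^]\<^bsub>F\<^esub> n \<oplus>\<^bsub>F\<^esub> (\<Oplus>\<^bsub>F\<^esub>i\<in>{..<n}. \<iota> (c i) \<otimes>\<^bsub>F\<^esub> x [^]\<^bsub>F\<^esub> i) = \<zero>\<^bsub>F\<^esub>
        \<longrightarrow> x \<in> \<iota> ` carrier R)"


section \<open>Locally ringed spaces\<close>

record ('x, 'a) rspace =
  topol :: "'x topology"
  sections :: "'x set \<Rightarrow> 'a ring"
  restr :: "'x set \<Rightarrow> 'x set \<Rightarrow> 'a \<Rightarrow> 'a"

text \<open>\<open>restr \<XX> U V\<close> is the restriction map from \<open>U\<close> to \<open>V \<subseteq> U\<close>. The sheaf axioms for the empty cover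
  force the sections over the empty set to be the zero ring.\<close>

locale ringed_space =
  fixes \<XX> :: "('x, 'a) rspace"
  assumes cring_sections: "openin (topol \<XX>) U \<Longrightarrow> cring (sections \<XX> U)"
    and restr_hom: "\<lbrakk>openin (topol \<XX>) U; openin (topol \<XX>) V; V \<subseteq> U\<rbrakk>
        \<Longrightarrow> restr \<XX> U V \<in> ring_hom (sections \<XX> U) (sections \<XX> V)"
    and restr_id: "\<lbrakk>openin (topol \<XX>) U; s \<in> carrier (sections \<XX> U)\<rbrakk> \<Longrightarrow> restr \<XX> U U s = s"
    and restr_comp: "\<lbrakk>openin (topol \<XX>) U; openin (topol \<XX>) V; openin (topol \<XX>) W; W \<subseteq> V; V \<subseteq> U;
          s \<in> carrier (sections \<XX> U)\<rbrakk> \<Longrightarrow> restr \<XX> V W (restr \<XX> U V s) = restr \<XX> U W s"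
    and locality: "\<lbrakk>\<And>U. U \<in> \<U> \<Longrightarrow> openin (topol \<XX>) U;
          s \<in> carrier (sections \<XX> (\<Union>\<U>)); t \<in> carrier (sections \<XX> (\<Union>\<U>));
          \<And>U. U \<in> \<U> \<Longrightarrow> restr \<XX> (\<Union>\<U>) U s = restr \<XX> (\<Union>\<U>) U t\<rbrakk> \<Longrightarrow> s = t"
    and gluing: "\<lbrakk>\<And>U. U \<in> \<U> \<Longrightarrow> openin (topol \<XX>) U;
          \<And>U. U \<in> \<U> \<Longrightarrow> \<sigma> U \<in> carrier (sections \<XX> U);
          \<And>U V. \<lbrakk>U \<in> \<U>; V \<in> \<U>\<rbrakk> \<Longrightarrow> restr \<XX> U (U \<inter> V) (\<sigma> U) = restr \<XX> V (U \<inter> V) (\<sigma> V)\<rbrakk>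
        \<Longrightarrow> \<exists>t\<in>carrier (sections \<XX> (\<Union>\<U>)). \<forall>U\<in>\<U>. restr \<XX> (\<Union>\<U>) U t = \<sigma> U"

definition germ :: "('x, 'a) rspace \<Rightarrow> 'x \<Rightarrow> 'x set \<Rightarrow> 'a \<Rightarrow> ('x set \<times> 'a) set" where
  "germ \<XX> x U s =
     {(V, t). openin (topol \<XX>) V \<and> x \<in> V \<and> t \<in> carrier (sections \<XX> V) \<and>
        (\<exists>W. openin (topol \<XX>) W \<and> x \<in> W \<and> W \<subseteq> U \<inter> V \<and> restr \<XX> U W s = restr \<XX> V W t)}"

definition stalk :: "('x, 'a) rspace \<Rightarrow> 'x \<Rightarrow> ('x set \<times> 'a) set ring" where
  "stalk \<XX> x =
     \<lparr>carrier = {germ \<XX> x U s |U s. openin (topol \<XX>) U \<and> x \<in> U \<and> s \<in> carrier (sections \<XX> U)},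
      monoid.mult = (\<lambda>A B. \<Union>(U, s)\<in>A. \<Union>(V, t)\<in>B.
        germ \<XX> x (U \<inter> V) (restr \<XX> U (U \<inter> V) s \<otimes>\<^bsub>sections \<XX> (U \<inter> V)\<^esub> restr \<XX> V (U \<inter> V) t)),
      monoid.one = germ \<XX> x (topspace (topol \<XX>)) \<one>\<^bsub>sections \<XX> (topspace (topol \<XX>))\<^esub>,
      ring.zero = germ \<XX> x (topspace (topol \<XX>)) \<zero>\<^bsub>sections \<XX> (topspace (topol \<XX>))\<^esub>,
      ring.add = (\<lambda>A B. \<Union>(U, s)\<in>A. \<Union>(V, t)\<in>B.
        germ \<XX> x (U \<inter> V) (restr \<XX> U (U \<inter> V) s \<oplus>\<^bsub>sections \<XX> (U \<inter> V)\<^esub> restr \<XX> V (U \<inter> V) t))\<rparr>"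

locale locally_ringed_space = ringed_space +
  assumes local_stalks: "x \<in> topspace (topol \<XX>) \<Longrightarrow> local_ring (stalk \<XX> x)"

record ('x, 'a, 'y, 'b) rmorphism =
  pt :: "'x \<Rightarrow> 'y"
  pull :: "'y set \<Rightarrow> 'b \<Rightarrow> 'a"

definition preimage :: "('x, 'a) rspace \<Rightarrow> ('x, 'a, 'y, 'b) rmorphism \<Rightarrow> 'y set \<Rightarrow> 'x set" where
  "preimage \<XX> f V = {x \<in> topspace (topol \<XX>). pt f x \<in> V}"

definition stalk_map ::
    "('x, 'a) rspace \<Rightarrow> ('x, 'a, 'y, 'b) rmorphism \<Rightarrow> 'x \<Rightarrow> ('y set \<times> 'b) set \<Rightarrow> ('x set \<times> 'a) set" where
  "stalk_map \<XX> f x A = (\<Union>(V, s)\<in>A. germ \<XX> x (preimage \<XX> f V) (pull f V s))"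

definition lrs_morphism ::
    "('x, 'a) rspace \<Rightarrow> ('y, 'b) rspace \<Rightarrow> ('x, 'a, 'y, 'b) rmorphism \<Rightarrow> bool" where
  "lrs_morphism \<XX> Y f \<longleftrightarrow>
     continuous_map (topol \<XX>) (topol Y) (pt f) \<and>
     (\<forall>V. openin (topol Y) V \<longrightarrow> pull f V \<in> ring_hom (sections Y V) (sections \<XX> (preimage \<XX> f V))) \<and>
     (\<forall>V W. openin (topol Y) V \<and> openin (topol Y) W \<and> W \<subseteq> V \<longrightarrow>
        (\<forall>s\<in>carrier (sections Y V).
           pull f W (restr Y V W s) = restr \<XX> (preimage \<XX> f V) (preimage \<XX> f W) (pull f V s))) \<and>
     (\<forall>x\<in>topspace (topol \<XX>). \<forall>A\<in>max_ideal (stalk Y (pt f x)). stalk_map \<XX> f x A \<in> max_ideal (stalk \<XX> x))"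

definition lrs_isomorphism ::
    "('x, 'a) rspace \<Rightarrow> ('y, 'b) rspace \<Rightarrow> ('x, 'a, 'y, 'b) rmorphism \<Rightarrow> bool" where
  "lrs_isomorphism \<XX> Y f \<longleftrightarrow>
     lrs_morphism \<XX> Y f \<and> homeomorphic_map (topol \<XX>) (topol Y) (pt f) \<and>
     (\<forall>V. openin (topol Y) V \<longrightarrow>
        bij_betw (pull f V) (carrier (sections Y V)) (carrier (sections \<XX> (preimage \<XX> f V))))"

definition open_subspace :: "('x, 'a) rspace \<Rightarrow> 'x set \<Rightarrow> ('x, 'a) rspace" where
  "open_subspace \<XX> U = \<XX>\<lparr>topol := subtopology (topol \<XX>) U\<rparr>"


section \<open>Schemes\<close>

definition prime_spectrum :: "'a ring \<Rightarrow> 'a set set" where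
  "prime_spectrum R = {P. primeideal P R}"

definition zariski_topology :: "'a ring \<Rightarrow> 'a set topology" where
  "zariski_topology R = topology (\<lambda>U. \<exists>S\<subseteq>carrier R. U = {P \<in> prime_spectrum R. \<not> S \<subseteq> P})"

lemma openin_zariski_topology:
  assumes "cring R"
  shows "openin (zariski_topology R) U \<longleftrightarrow> (\<exists>S\<subseteq>carrier R. U = {P \<in> prime_spectrum R. \<not> S \<subseteq> P})"
proof -
  interpret cring R by fact
  define N where "N S = {P \<in> prime_spectrum R. \<not> S \<subseteq> P}" for S
  have inter: "\<exists>ST\<subseteq>carrier R. N S \<inter> N T = N ST" if S: "S \<subseteq> carrier R" and T: "T \<subseteq> carrier R" for S T
  proof (intro exI conjI)
    let ?ST = "(\<lambda>(s, t). s \<otimes>\<^bsub>R\<^esub> t) ` (S \<times> T)"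
    show "?ST \<subseteq> carrier R" using S T by auto
    have "\<not> ?ST \<subseteq> P \<longleftrightarrow> \<not> S \<subseteq> P \<and> \<not> T \<subseteq> P" if "primeideal P R" for P
    proof -
      interpret P: primeideal P R by fact
      have "s \<otimes>\<^bsub>R\<^esub> t \<in> P \<longleftrightarrow> s \<in> P \<or> t \<in> P" if "s \<in> S" "t \<in> T" for s t
        using that S T P.I_prime P.I_l_closed P.I_r_closed by blast
      then show ?thesis by fastforce
    qed
    then show "N S \<inter> N T = N ?ST"
      unfolding N_def prime_spectrum_def by blast
  qed
  have union: "\<exists>S\<subseteq>carrier R. \<Union>\<U> = N S" if opens: "\<forall>U\<in>\<U>. \<exists>S\<subseteq>carrier R. U = N S" for \<U>
  proof (intro exI conjI)
    let ?SS = "\<Union>{S. S \<subseteq> carrier R \<and> N S \<in> \<U>}"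
    show "?SS \<subseteq> carrier R" by blast
    show "\<Union>\<U> = N ?SS"
    proof (intro subset_antisym subsetI)
      fix P assume "P \<in> \<Union>\<U>"
      then obtain S where "S \<subseteq> carrier R" "N S \<in> \<U>" "P \<in> N S" using opens by (metis UnionE)
      then show "P \<in> N ?SS" unfolding N_def by blast
    next
      fix P assume "P \<in> N ?SS"
      then obtain S where "N S \<in> \<U>" "\<not> S \<subseteq> P" "P \<in> prime_spectrum R" unfolding N_def by blast
      then have "P \<in> N S" unfolding N_def by simp
      then show "P \<in> \<Union>\<U>" using \<open>N S \<in> \<U>\<close> by (rule UnionI[rotated])
    qed
  qed
  have "istopology (\<lambda>U. \<exists>S\<subseteq>carrier R. U = N S)"
    unfolding istopology_def
  proof (intro conjI allI impI)
    fix U V assume "\<exists>S\<subseteq>carrier R. U = N S" "\<exists>S\<subseteq>carrier R. V = N S"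
    then show "\<exists>S\<subseteq>carrier R. U \<inter> V = N S" using inter by (elim exE conjE) simp
  next
    fix \<U> assume "\<forall>U\<in>\<U>. \<exists>S\<subseteq>carrier R. U = N S"
    then show "\<exists>S\<subseteq>carrier R. \<Union>\<U> = N S" by (rule union)
  qed
  then show ?thesis
    unfolding zariski_topology_def N_def by (simp add: topology_inverse')
qed

definition Spec :: "'a ring \<Rightarrow> ('a set, 'a set \<Rightarrow> ('a \<times> 'a) set) rspace" where
  "Spec R =
     \<lparr>topol = zariski_topology R,
      sections = (\<lambda>U.
        \<lparr>carrier = {s \<in> (\<Pi>\<^sub>E P\<in>U. carrier (localization R P)).
           \<forall>P\<in>U. \<exists>V a f. openin (zariski_topology R) V \<and> P \<in> V \<and> V \<subseteq> U \<and>
             a \<in> carrier R \<and> f \<in> carrier R \<and> (\<forall>Q\<in>V. f \<notin> Q \<and> s Q = fraction R Q a f)},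
         monoid.mult = (\<lambda>s t. \<lambda>P\<in>U. s P \<otimes>\<^bsub>localization R P\<^esub> t P),
         monoid.one = (\<lambda>P\<in>U. \<one>\<^bsub>localization R P\<^esub>),
         ring.zero = (\<lambda>P\<in>U. \<zero>\<^bsub>localization R P\<^esub>),
         ring.add = (\<lambda>s t. \<lambda>P\<in>U. s P \<oplus>\<^bsub>localization R P\<^esub> t P)\<rparr>),
      restr = (\<lambda>U V s. restrict s V)\<rparr>"

text \<open>A ring \<open>R\<close> whose spectrum is isomorphic to \<open>U\<close> is isomorphic to the ring of sections over \<open>U\<close>,
  so it is no loss to take \<open>R\<close> over the same type.\<close>

definition affine_open :: "('x, 'a) rspace \<Rightarrow> 'x set \<Rightarrow> bool" where
  "affine_open \<XX> U \<longleftrightarrow> openin (topol \<XX>) U \<and>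
     (\<exists>(R :: 'a ring) f. cring R \<and> lrs_isomorphism (open_subspace \<XX> U) (Spec R) f)"

definition scheme :: "('x, 'a) rspace \<Rightarrow> bool" where
  "scheme \<XX> \<longleftrightarrow> locally_ringed_space \<XX> \<and> (\<forall>x\<in>topspace (topol \<XX>). \<exists>U. x \<in> U \<and> affine_open \<XX> U)"

definition integral_scheme :: "('x, 'a) rspace \<Rightarrow> bool" where
  "integral_scheme \<XX> \<longleftrightarrow> scheme \<XX> \<and> topspace (topol \<XX>) \<noteq> {} \<and>
     (\<forall>U. openin (topol \<XX>) U \<and> U \<noteq> {} \<longrightarrow> domain (sections \<XX> U))"

definition normal_scheme :: "('x, 'a) rspace \<Rightarrow> bool" where
  "normal_scheme \<XX> \<longleftrightarrow> scheme \<XX> \<and> (\<forall>x\<in>topspace (topol \<XX>). integrally_closed_domain (stalk \<XX> x))"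

text \<open>The diagonal is a closed immersion, read off on the affine charts
  \<open>Spec (\<O>(U) \<otimes> \<O>(V))\<close> of the fibre product of \<open>\<XX>\<close> with itself over an affine base: the preimage
  \<open>U \<inter> V\<close> of each chart is affine and \<open>\<O>(U) \<otimes> \<O>(V) \<rightarrow> \<O>(U \<inter> V)\<close> is surjective. Over which
  affine base the tensor product is formed does not affect surjectivity.\<close>

definition separated_scheme :: "('x, 'a) rspace \<Rightarrow> bool" where
  "separated_scheme \<XX> \<longleftrightarrow> scheme \<XX> \<and>
     (\<forall>U V. affine_open \<XX> U \<and> affine_open \<XX> V \<longrightarrow> affine_open \<XX> (U \<inter> V) \<and>
        (\<forall>t\<in>carrier (sections \<XX> (U \<inter> V)). \<exists>(n::nat) a b.
           a \<in> {..<n} \<rightarrow> carrier (sections \<XX> U) \<and> b \<in> {..<n} \<rightarrow> carrier (sections \<XX> V) \<and>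
           t = (\<Oplus>\<^bsub>sections \<XX> (U \<inter> V)\<^esub>i\<in>{..<n}.
                  restr \<XX> U (U \<inter> V) (a i) \<otimes>\<^bsub>sections \<XX> (U \<inter> V)\<^esub> restr \<XX> V (U \<inter> V) (b i))))"

text \<open>The ring homomorphism \<open>k \<rightarrow> \<O>(U)\<close> induced by a morphism \<open>\<pi>\<close> from \<open>\<XX>\<close> to \<open>Spec k\<close>.\<close>

definition scalar_map ::
    "'k ring \<Rightarrow> ('x, 'a) rspace \<Rightarrow> ('x, 'a, 'k set, 'k set \<Rightarrow> ('k \<times> 'k) set) rmorphism \<Rightarrow>
     'x set \<Rightarrow> 'k \<Rightarrow> 'a" where
  "scalar_map k \<XX> \<pi> U c =
     restr \<XX> (topspace (topol \<XX>)) U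
       (pull \<pi> (prime_spectrum k) (\<lambda>P\<in>prime_spectrum k. fraction k P c \<one>\<^bsub>k\<^esub>))"

definition finite_type_over ::
    "'k ring \<Rightarrow> ('x, 'a) rspace \<Rightarrow> ('x, 'a, 'k set, 'k set \<Rightarrow> ('k \<times> 'k) set) rmorphism \<Rightarrow> bool" where
  "finite_type_over k \<XX> \<pi> \<longleftrightarrow>
     (\<exists>\<U>. finite \<U> \<and> \<Union>\<U> = topspace (topol \<XX>) \<and>
        (\<forall>U\<in>\<U>. affine_open \<XX> U \<and>
           (\<exists>S\<subseteq>carrier (sections \<XX> U). finite S \<and>
              generate_ring (sections \<XX> U) (scalar_map k \<XX> \<pi> U ` carrier k \<union> S)
                = carrier (sections \<XX> U))))"

definition normal_variety ::
    "'k ring \<Rightarrow> ('x, 'a) rspace \<Rightarrow> ('x, 'a, 'k set, 'k set \<Rightarrow> ('k \<times> 'k) set) rmorphism \<Rightarrow> bool" where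
  "normal_variety k \<XX> \<pi> \<longleftrightarrow>
     integral_scheme \<XX> \<and> separated_scheme \<XX> \<and> normal_scheme \<XX> \<and>
     lrs_morphism \<XX> (Spec k) \<pi> \<and> finite_type_over k \<XX> \<pi>"


section \<open>Weil divisors\<close>

definition irreducible_closed :: "'x topology \<Rightarrow> 'x set \<Rightarrow> bool" where
  "irreducible_closed T Z \<longleftrightarrow> closedin T Z \<and> Z \<noteq> {} \<and>
     (\<forall>A B. closedin T A \<and> closedin T B \<and> Z \<subseteq> A \<union> B \<longrightarrow> Z \<subseteq> A \<or> Z \<subseteq> B)"

definition codim :: "'x topology \<Rightarrow> 'x set \<Rightarrow> enat" where
  "codim T Z = Sup {enat n |n. \<exists>C. C 0 = Z \<and> (\<forall>i\<le>n. irreducible_closed T (C i)) \<and>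
     (\<forall>i<n. C i \<subset> C (Suc i))}"

definition generic_point :: "('x, 'a) rspace \<Rightarrow> 'x set \<Rightarrow> 'x" where
  "generic_point \<XX> Z = (THE z. z \<in> topspace (topol \<XX>) \<and> Abstract_Topology.closure_of (topol \<XX>) {z} = Z)"

text \<open>Prime divisors are represented by their underlying closed subsets.\<close>

definition prime_divisor :: "('x, 'a) rspace \<Rightarrow> 'x set \<Rightarrow> bool" where
  "prime_divisor \<XX> P \<longleftrightarrow> irreducible_closed (topol \<XX>) P \<and> codim (topol \<XX>) P = 1"

definition weil_divisors :: "('x, 'a) rspace \<Rightarrow> ('x set \<Rightarrow> int) set" where
  "weil_divisors \<XX> = {D. (\<forall>P. D P \<noteq> 0 \<longrightarrow> prime_divisor \<XX> P) \<and> finite {P. D P \<noteq> 0}}"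

definition supp :: "('x set \<Rightarrow> int) \<Rightarrow> 'x set set" where
  "supp D = {P. D P \<noteq> 0}"

definition function_field :: "('x, 'a) rspace \<Rightarrow> ('x set \<times> 'a) set ring" where
  "function_field \<XX> = stalk \<XX> (generic_point \<XX> (topspace (topol \<XX>)))"

definition section_to_K :: "('x, 'a) rspace \<Rightarrow> 'x set \<Rightarrow> 'a \<Rightarrow> ('x set \<times> 'a) set" where
  "section_to_K \<XX> U s = germ \<XX> (generic_point \<XX> (topspace (topol \<XX>))) U s"

definition stalk_to_K :: "('x, 'a) rspace \<Rightarrow> ('x set \<times> 'a) set \<Rightarrow> ('x set \<times> 'a) set" where
  "stalk_to_K \<XX> A = (\<Union>(U, s)\<in>A. section_to_K \<XX> U s)"

definition local_ring_at :: "('x, 'a) rspace \<Rightarrow> 'x set \<Rightarrow> ('x set \<times> 'a) set ring" where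
  "local_ring_at \<XX> P = stalk \<XX> (generic_point \<XX> P)"

definition residue_field_at :: "('x, 'a) rspace \<Rightarrow> 'x set \<Rightarrow> ('x set \<times> 'a) set set ring" where
  "residue_field_at \<XX> P = residue_ring_of (local_ring_at \<XX> P)"

text \<open>A nonzero \<open>f\<close> has order \<open>n\<close> along \<open>P\<close> if \<open>f = u t\<^sup>n\<close> for a unit \<open>u\<close> and a uniformizer \<open>t\<close>
  of the discrete valuation ring at \<open>P\<close>.\<close>

definition ord :: "('x, 'a) rspace \<Rightarrow> 'x set \<Rightarrow> ('x set \<times> 'a) set \<Rightarrow> int extended" where
  "ord \<XX> P f =
     (let K = function_field \<XX>; R = local_ring_at \<XX> P in
      if f = \<zero>\<^bsub>K\<^esub> then Pinf
      else Fin (THE n::int. \<exists>t\<in>carrier R. \<exists>u\<in>Units R. max_ideal R = PIdl\<^bsub>R\<^esub> t \<and>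
                  f = stalk_to_K \<XX> u \<otimes>\<^bsub>K\<^esub> (stalk_to_K \<XX> t) [^]\<^bsub>K\<^esub> n))"

text \<open>The value of a rational function along \<open>P\<close>; \<open>None\<close> stands for the value \<open>\<infinity>\<close>.\<close>

definition value_at ::
    "('x, 'a) rspace \<Rightarrow> 'x set \<Rightarrow> ('x set \<times> 'a) set \<Rightarrow> ('x set \<times> 'a) set set option" where
  "value_at \<XX> P f =
     (let R = local_ring_at \<XX> P in
      if f \<in> stalk_to_K \<XX> ` carrier R
      then Some (max_ideal R +>\<^bsub>R\<^esub> (THE a. a \<in> carrier R \<and> stalk_to_K \<XX> a = f))
      else None)"

definition quotient_value_at ::
    "('x, 'a) rspace \<Rightarrow> 'x set \<Rightarrow> ('x set \<times> 'a) set \<Rightarrow> ('x set \<times> 'a) set \<Rightarrow>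
     ('x set \<times> 'a) set set option" where
  "quotient_value_at \<XX> P f g =
     (let K = function_field \<XX> in
      if g = \<zero>\<^bsub>K\<^esub> then None else value_at \<XX> P (f \<otimes>\<^bsub>K\<^esub> inv\<^bsub>K\<^esub> g))"

text \<open>\<open>Div(\<XX>) \<union> {\<infinity>}\<close> is the following subset of \<^typ>\<open>('x set \<Rightarrow> int) extended\<close>, with \<open>Pinf\<close> in the role
  of \<open>\<infinity>\<close>; the library order, sum and infimum on this type are the coefficientwise ones.\<close>

definition extended_divisors :: "('x, 'a) rspace \<Rightarrow> ('x set \<Rightarrow> int) extended set" where
  "extended_divisors \<XX> = insert Pinf (Fin ` weil_divisors \<XX>)"

definition fin_part :: "int extended \<Rightarrow> int" where
  "fin_part e = (case e of Fin n \<Rightarrow> n | _ \<Rightarrow> 0)"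

definition principal_divisor ::
    "('x, 'a) rspace \<Rightarrow> ('x set \<times> 'a) set \<Rightarrow> ('x set \<Rightarrow> int) extended" where
  "principal_divisor \<XX> f =
     (if f = \<zero>\<^bsub>function_field \<XX>\<^esub> then Pinf
      else Fin (\<lambda>P. if prime_divisor \<XX> P then fin_part (ord \<XX> P f) else 0))"

text \<open>At every point \<open>x\<close> of \<open>D\<close> the local ring is regular and \<open>D\<close> is cut out near \<open>x\<close> by
  a product \<open>y\<^sub>1 \<cdots> y\<^sub>r\<close> of members of a regular system of parameters. In particular \<open>D\<close> is reduced,
  and \<open>\<XX>\<close> is regular along \<open>D\<close> but possibly not elsewhere.\<close>

definition snc_divisor :: "('x, 'a) rspace \<Rightarrow> ('x set \<Rightarrow> int) \<Rightarrow> bool" where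
  "snc_divisor \<XX> D \<longleftrightarrow> D \<in> weil_divisors \<XX> \<and>
     (\<forall>x\<in>\<Union>(supp D). \<exists>d r y.
        regular_system_of_parameters (stalk \<XX> x) d y \<and> 1 \<le> r \<and> r \<le> d \<and>
        (\<forall>P. prime_divisor \<XX> P \<and> x \<in> P \<longrightarrow>
           ord \<XX> P (stalk_to_K \<XX> (\<Otimes>\<^bsub>stalk \<XX> x\<^esub>i\<in>{..<r}. y i)) = Fin (D P)))"


section \<open>Coherent sheaves\<close>

text \<open>The ring multiplication and unit contained in the record type of modules play no role and are
  left unspecified below.\<close>

record ('x, 'a, 'm) mod_sheaf =
  msections :: "'x set \<Rightarrow> ('a, 'm) module"
  mrestr :: "'x set \<Rightarrow> 'x set \<Rightarrow> 'm \<Rightarrow> 'm"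

locale sheaf_of_modules = ringed_space \<XX>
  for \<XX> :: "('x, 'a) rspace" and F :: "('x, 'a, 'm) mod_sheaf" +
  assumes module_sections: "openin (topol \<XX>) U \<Longrightarrow> Module.module (sections \<XX> U) (msections F U)"
    and mrestr_closed: "\<lbrakk>openin (topol \<XX>) U; openin (topol \<XX>) V; V \<subseteq> U; s \<in> carrier (msections F U)\<rbrakk>
        \<Longrightarrow> mrestr F U V s \<in> carrier (msections F V)"
    and mrestr_add: "\<lbrakk>openin (topol \<XX>) U; openin (topol \<XX>) V; V \<subseteq> U;
          s \<in> carrier (msections F U); t \<in> carrier (msections F U)\<rbrakk>
        \<Longrightarrow> mrestr F U V (s \<oplus>\<^bsub>msections F U\<^esub> t) = mrestr F U V s \<oplus>\<^bsub>msections F V\<^esub> mrestr F U V t"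
    and mrestr_smult: "\<lbrakk>openin (topol \<XX>) U; openin (topol \<XX>) V; V \<subseteq> U;
          a \<in> carrier (sections \<XX> U); s \<in> carrier (msections F U)\<rbrakk>
        \<Longrightarrow> mrestr F U V (a \<odot>\<^bsub>msections F U\<^esub> s) = restr \<XX> U V a \<odot>\<^bsub>msections F V\<^esub> mrestr F U V s"
    and mrestr_id: "\<lbrakk>openin (topol \<XX>) U; s \<in> carrier (msections F U)\<rbrakk> \<Longrightarrow> mrestr F U U s = s"
    and mrestr_comp: "\<lbrakk>openin (topol \<XX>) U; openin (topol \<XX>) V; openin (topol \<XX>) W; W \<subseteq> V; V \<subseteq> U;
          s \<in> carrier (msections F U)\<rbrakk> \<Longrightarrow> mrestr F V W (mrestr F U V s) = mrestr F U W s"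
    and mlocality: "\<lbrakk>\<And>U. U \<in> \<U> \<Longrightarrow> openin (topol \<XX>) U;
          s \<in> carrier (msections F (\<Union>\<U>)); t \<in> carrier (msections F (\<Union>\<U>));
          \<And>U. U \<in> \<U> \<Longrightarrow> mrestr F (\<Union>\<U>) U s = mrestr F (\<Union>\<U>) U t\<rbrakk> \<Longrightarrow> s = t"
    and mgluing: "\<lbrakk>\<And>U. U \<in> \<U> \<Longrightarrow> openin (topol \<XX>) U;
          \<And>U. U \<in> \<U> \<Longrightarrow> \<sigma> U \<in> carrier (msections F U);
          \<And>U V. \<lbrakk>U \<in> \<U>; V \<in> \<U>\<rbrakk> \<Longrightarrow> mrestr F U (U \<inter> V) (\<sigma> U) = mrestr F V (U \<inter> V) (\<sigma> V)\<rbrakk>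
        \<Longrightarrow> \<exists>t\<in>carrier (msections F (\<Union>\<U>)). \<forall>U\<in>\<U>. mrestr F (\<Union>\<U>) U t = \<sigma> U"

text \<open>The image of \<open>a\<close> under the map \<open>\<O>(V)\<^sup>n \<rightarrow> F(V)\<close> given by sections \<open>s\<close> of \<open>F\<close> over \<open>U \<supseteq> V\<close>.\<close>

definition lin_comb ::
    "('x, 'a, 'm) mod_sheaf \<Rightarrow> 'x set \<Rightarrow> nat \<Rightarrow> (nat \<Rightarrow> 'm) \<Rightarrow> 'x set \<Rightarrow> (nat \<Rightarrow> 'a) \<Rightarrow> 'm" where
  "lin_comb F U n s V a = (\<Oplus>\<^bsub>msections F V\<^esub>i\<in>{..<n}. a i \<odot>\<^bsub>msections F V\<^esub> mrestr F U V (s i))"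

definition generated_over ::
    "('x, 'a) rspace \<Rightarrow> ('x, 'a, 'm) mod_sheaf \<Rightarrow> 'x set \<Rightarrow> nat \<Rightarrow> (nat \<Rightarrow> 'm) \<Rightarrow> bool" where
  "generated_over \<XX> F U n s \<longleftrightarrow>
     (\<forall>V t x. openin (topol \<XX>) V \<and> V \<subseteq> U \<and> t \<in> carrier (msections F V) \<and> x \<in> V \<longrightarrow>
        (\<exists>W a. openin (topol \<XX>) W \<and> x \<in> W \<and> W \<subseteq> V \<and> a \<in> {..<n} \<rightarrow> carrier (sections \<XX> W) \<and>
           mrestr F V W t = lin_comb F U n s W a))"

definition finite_type_sheaf :: "('x, 'a) rspace \<Rightarrow> ('x, 'a, 'm) mod_sheaf \<Rightarrow> bool" where
  "finite_type_sheaf \<XX> F \<longleftrightarrow>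
     (\<forall>x\<in>topspace (topol \<XX>). \<exists>U n s. openin (topol \<XX>) U \<and> x \<in> U \<and>
        s \<in> {..<n} \<rightarrow> carrier (msections F U) \<and> generated_over \<XX> F U n s)"

text \<open>The kernel of the morphism from the free module of rank \<open>n\<close> on \<open>U\<close> to the restriction of
  \<open>F\<close> to \<open>U\<close> given by \<open>s\<close>.\<close>

definition relation_sheaf ::
    "('x, 'a) rspace \<Rightarrow> ('x, 'a, 'm) mod_sheaf \<Rightarrow> 'x set \<Rightarrow> nat \<Rightarrow> (nat \<Rightarrow> 'm) \<Rightarrow>
     ('x, 'a, nat \<Rightarrow> 'a) mod_sheaf" where
  "relation_sheaf \<XX> F U n s =
     \<lparr>msections = (\<lambda>V.
        \<lparr>carrier = {a \<in> {..<n} \<rightarrow>\<^sub>E carrier (sections \<XX> V). lin_comb F U n s V a = \<zero>\<^bsub>msections F V\<^esub>},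
         monoid.mult = undefined, monoid.one = undefined,
         ring.zero = (\<lambda>i\<in>{..<n}. \<zero>\<^bsub>sections \<XX> V\<^esub>),
         ring.add = (\<lambda>a b. \<lambda>i\<in>{..<n}. a i \<oplus>\<^bsub>sections \<XX> V\<^esub> b i),
         smult = (\<lambda>c a. \<lambda>i\<in>{..<n}. c \<otimes>\<^bsub>sections \<XX> V\<^esub> a i)\<rparr>),
      mrestr = (\<lambda>V W a. \<lambda>i\<in>{..<n}. restr \<XX> V W (a i))\<rparr>"

definition coherent :: "('x, 'a) rspace \<Rightarrow> ('x, 'a, 'm) mod_sheaf \<Rightarrow> bool" where
  "coherent \<XX> F \<longleftrightarrow> sheaf_of_modules \<XX> F \<and> finite_type_sheaf \<XX> F \<and>
     (\<forall>U n s. openin (topol \<XX>) U \<and> s \<in> {..<n} \<rightarrow> carrier (msections F U) \<longrightarrow>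
        finite_type_sheaf (open_subspace \<XX> U) (relation_sheaf \<XX> F U n s))"


section \<open>Weil decorations\<close>

definition finite_dim_vector_space :: "'b ring \<Rightarrow> ('b, 'v) module \<Rightarrow> bool" where
  "finite_dim_vector_space K V \<longleftrightarrow> Ring.field K \<and> Module.module K V \<and>
     (\<exists>(n::nat) b. b \<in> {..<n} \<rightarrow> carrier V \<and>
        (\<forall>v\<in>carrier V. \<exists>c\<in>{..<n} \<rightarrow> carrier K. v = (\<Oplus>\<^bsub>V\<^esub>i\<in>{..<n}. c i \<odot>\<^bsub>V\<^esub> b i)))"

definition pre_weil_decoration ::
    "('x, 'a) rspace \<Rightarrow> (('x set \<times> 'a) set, 'v) module \<Rightarrow> ('v \<Rightarrow> ('x set \<Rightarrow> int) extended) \<Rightarrow> bool" where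
  "pre_weil_decoration \<XX> V W \<longleftrightarrow>
     finite_dim_vector_space (function_field \<XX>) V \<and>
     W \<in> carrier V \<rightarrow> extended_divisors \<XX> \<and>
     (\<forall>v\<in>carrier V. W v = Pinf \<longleftrightarrow> v = \<zero>\<^bsub>V\<^esub>) \<and>
     (\<forall>f\<in>carrier (function_field \<XX>). \<forall>v\<in>carrier V. W (f \<odot>\<^bsub>V\<^esub> v) = principal_divisor \<XX> f + W v) \<and>
     (\<forall>v\<in>carrier V. \<forall>w\<in>carrier V. W (v \<oplus>\<^bsub>V\<^esub> w) \<ge> inf (W v) (W w))"

definition nonneg_on ::
    "('x, 'a) rspace \<Rightarrow> 'x set \<Rightarrow> ('x set \<Rightarrow> int) extended \<Rightarrow> bool" where
  "nonneg_on \<XX> U d \<longleftrightarrow>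
     (case d of Fin D \<Rightarrow> \<forall>P. prime_divisor \<XX> P \<and> P \<inter> U \<noteq> {} \<longrightarrow> 0 \<le> D P
              | Pinf \<Rightarrow> True | Minf \<Rightarrow> False)"

text \<open>The defining formula applies to nonempty open sets; as for every sheaf, the module of sections
  over the empty set is zero.\<close>

definition decoration_sheaf ::
    "('x, 'a) rspace \<Rightarrow> (('x set \<times> 'a) set, 'v) module \<Rightarrow> ('v \<Rightarrow> ('x set \<Rightarrow> int) extended) \<Rightarrow>
     ('x, 'a, 'v) mod_sheaf" where
  "decoration_sheaf \<XX> V W =
     \<lparr>msections = (\<lambda>U.
        \<lparr>carrier = (if U = {} then {\<zero>\<^bsub>V\<^esub>} else {v \<in> carrier V. nonneg_on \<XX> U (W v)}),
         monoid.mult = undefined, monoid.one = undefined,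
         ring.zero = \<zero>\<^bsub>V\<^esub>,
         ring.add = (\<lambda>v w. v \<oplus>\<^bsub>V\<^esub> w),
         smult = (\<lambda>a v. if U = {} then \<zero>\<^bsub>V\<^esub> else section_to_K \<XX> U a \<odot>\<^bsub>V\<^esub> v)\<rparr>),
      mrestr = (\<lambda>U U' v. if U' = {} then \<zero>\<^bsub>V\<^esub> else v)\<rparr>"

definition weil_decoration ::
    "('x, 'a) rspace \<Rightarrow> (('x set \<times> 'a) set, 'v) module \<Rightarrow> ('v \<Rightarrow> ('x set \<Rightarrow> int) extended) \<Rightarrow> bool" where
  "weil_decoration \<XX> V W \<longleftrightarrow> pre_weil_decoration \<XX> V W \<and> coherent \<XX> (decoration_sheaf \<XX> V W)"

definition plane :: "'b ring \<Rightarrow> ('b, 'b \<times> 'b) module" where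
  "plane K =
     \<lparr>carrier = carrier K \<times> carrier K,
      monoid.mult = undefined, monoid.one = undefined,
      ring.zero = (\<zero>\<^bsub>K\<^esub>, \<zero>\<^bsub>K\<^esub>),
      ring.add = (\<lambda>(f, g) (f', g'). (f \<oplus>\<^bsub>K\<^esub> f', g \<oplus>\<^bsub>K\<^esub> g')),
      smult = (\<lambda>c (f, g). (c \<otimes>\<^bsub>K\<^esub> f, c \<otimes>\<^bsub>K\<^esub> g))\<rparr>"

definition snc_decoration ::
    "('x, 'a) rspace \<Rightarrow> ('x set \<Rightarrow> int) \<Rightarrow> ('x set \<Rightarrow> ('x set \<times> 'a) set set) \<Rightarrow>
     ('x set \<times> 'a) set \<times> ('x set \<times> 'a) set \<Rightarrow> ('x set \<Rightarrow> int) extended" where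
  "snc_decoration \<XX> D h = (\<lambda>(f, g).
     if (f, g) = \<zero>\<^bsub>plane (function_field \<XX>)\<^esub> then Pinf
     else Fin (\<lambda>P.
       if prime_divisor \<XX> P then
         (if P \<in> supp D \<and> quotient_value_at \<XX> P f g = Some (h P)
          then fin_part (min (ord \<XX> P f) (ord \<XX> P g)) + 1
          else fin_part (min (ord \<XX> P f) (ord \<XX> P g)))
       else 0))"

end

theory Submission
  imports Defs
begin

text \<open>Choose for every component \<open>P\<close> of \<open>D\<close> a lift \<open>H\<close> of \<open>h\<^sub>P\<close> to the discrete valuation ring at \<open>P\<close>.
  Then \<open>\<W>(f, g)\<^sub>P = min (ord g + 1) (ord (f - H g))\<close>, so that every coefficient of \<open>\<W>\<close> is a minimum of
  valuations of linear forms. This yields the axioms of a pre-Weil decoration.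

  For coherence let \<open>U\<close> be an affine open set and \<open>A = \<O>(U)\<close>, a Noetherian ring. For a nonzero \<open>d \<in> A\<close>
  vanishing along the components of \<open>D\<close> that meet \<open>U\<close>, the coordinates of \<open>d v\<close>, for \<open>v\<close> a section over \<open>U\<close>,
  have no poles; by normality (algebraic Hartogs) they lie in \<open>A\<close>. So the sections over \<open>U\<close> form a
  submodule of \<open>d\<^sup>-\<^sup>1 A\<^sup>2\<close> and are finitely generated. A section \<open>t\<close> near \<open>y \<in> U\<close> has negative
  coefficients only along finitely many prime divisors of \<open>U\<close>, none of them through \<open>y\<close>, so \<open>b t\<close> is a section over \<open>U\<close>
  for some \<open>b \<in> A\<close> that is a unit at \<open>y\<close>. Hence the same generators work on all of \<open>U\<close>. Relations between
  finitely many sections are treated in the same way inside \<open>A\<^sup>n\<close>.\<close>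

section \<open>Noetherian rings\<close>

text \<open>The case distinction in the formula is the obstacle: whether (f/g)(P) equals
  \<open>h P\<close> is not stable under sums, whereas f - H g is linear in (f, g), and the value is
  \<open>h P\<close> exactly when this form has larger order than g. Both geometric inputs, the
  valuation ring at a prime divisor and Hartogs, rest on one device. For x in K outside a Noetherian
  ring A choose a multiple c x outside A whose ideal of denominators is as large as possible; this
  ideal is prime, hence belongs to a point y, and c x carries the maximal ideal at y into the local
  ring. Integral closedness then makes that maximal ideal principal. At a point of height one the
  prime can only be the maximal ideal, which gives the uniformizer; in a chart the principal maximal
  ideal forces y to have height one, where f was assumed regular. Points of a chart are compared by
  the functions that are units at them: y lies in the closure of z iff every function on the chart
  that is a unit at y is a unit at z. Height one is expressed through specialization, so that
  dimension theory is confined to one lemma about \<open>codim\<close>.\<close>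

text \<open>All rings of regular functions are subrings of the function field. Accordingly ideals, primes and
  units are considered for a subset \<open>A\<close> of an ambient ring \<open>R\<close>.\<close>

definition submodule_over :: "('a, 'm) ring_scheme \<Rightarrow> 'a set \<Rightarrow> 'a set \<Rightarrow> bool" where
  "submodule_over R A I \<longleftrightarrow> I \<subseteq> carrier R \<and> \<zero>\<^bsub>R\<^esub> \<in> I \<and>
     (\<forall>x\<in>I. \<forall>y\<in>I. x \<oplus>\<^bsub>R\<^esub> y \<in> I) \<and> (\<forall>a\<in>A. \<forall>x\<in>I. a \<otimes>\<^bsub>R\<^esub> x \<in> I)"

text \<open>Finite generation is expressed by closure instead of sums: S generates I if every
  submodule containing S contains I. This makes images and contractions of ideals easy to handle;
  explicit coefficients are recovered only in \<open>vectors_over_generators\<close>.\<close>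

definition noetherian_over :: "('a, 'm) ring_scheme \<Rightarrow> 'a set \<Rightarrow> bool" where
  "noetherian_over R A \<longleftrightarrow>
     (\<forall>I. submodule_over R A I \<and> I \<subseteq> A \<longrightarrow>
        (\<exists>S. finite S \<and> S \<subseteq> I \<and> (\<forall>J. submodule_over R A J \<and> S \<subseteq> J \<longrightarrow> I \<subseteq> J)))"

lemma submodule_overD:
  assumes "submodule_over R A I"
  shows "I \<subseteq> carrier R" "\<zero>\<^bsub>R\<^esub> \<in> I" "\<And>x y. \<lbrakk>x \<in> I; y \<in> I\<rbrakk> \<Longrightarrow> x \<oplus>\<^bsub>R\<^esub> y \<in> I"
    "\<And>a x. \<lbrakk>a \<in> A; x \<in> I\<rbrakk> \<Longrightarrow> a \<otimes>\<^bsub>R\<^esub> x \<in> I"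
  using assms unfolding submodule_over_def by auto

lemma submodule_overI:
  assumes "I \<subseteq> carrier R" "\<zero>\<^bsub>R\<^esub> \<in> I" "\<And>x y. \<lbrakk>x \<in> I; y \<in> I\<rbrakk> \<Longrightarrow> x \<oplus>\<^bsub>R\<^esub> y \<in> I"
    "\<And>a x. \<lbrakk>a \<in> A; x \<in> I\<rbrakk> \<Longrightarrow> a \<otimes>\<^bsub>R\<^esub> x \<in> I"
  shows "submodule_over R A I"
  using assms unfolding submodule_over_def by auto

lemma noetherian_overD:
  assumes "noetherian_over R A" "submodule_over R A I" "I \<subseteq> A"
  obtains S where "finite S" "S \<subseteq> I" "\<And>J. submodule_over R A J \<Longrightarrow> S \<subseteq> J \<Longrightarrow> I \<subseteq> J"
  using assms unfolding noetherian_over_def by meson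

section \<open>Hilbert's basis theorem inside an ambient ring\<close>

context cring
begin

lemma submodule_over_minus:
  assumes "subring A R" "submodule_over R A I" "x \<in> I" "y \<in> I"
  shows "x \<ominus> y \<in> I"
proof -
  have c: "x \<in> carrier R" "y \<in> carrier R" using assms(3,4) submodule_overD(1)[OF assms(2)] by auto
  have "\<ominus> \<one> \<in> A" using subringE(3,5)[OF assms(1)] by blast
  then have "(\<ominus> \<one>) \<otimes> y \<in> I" using submodule_overD(4)[OF assms(2)] assms(4) by blast
  then have "x \<oplus> (\<ominus> \<one>) \<otimes> y \<in> I" using submodule_overD(3)[OF assms(2)] assms(3) by blast
  moreover have "x \<oplus> (\<ominus> \<one>) \<otimes> y = x \<ominus> y" using c by algebra
  ultimately show ?thesis by simp
qed

text \<open>The values at s of polynomials over B of degree less than n. As s may be algebraic over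
  B, one value can have several expressions; n bounds the length of some expression and is not a
  degree. The same sets later state integrality: \<open>x [^] n\<close> in
  \<open>poly_values Q x n\<close> is a monic equation for x.\<close>

primrec poly_values :: "'a set \<Rightarrow> 'a \<Rightarrow> nat \<Rightarrow> 'a set" where
  "poly_values B s 0 = {\<zero>}"
| "poly_values B s (Suc n) = {c \<otimes> s [^] n \<oplus> p |c p. c \<in> B \<and> p \<in> poly_values B s n}"

lemma poly_values_submodule:
  assumes B: "subring B R" and s: "s \<in> carrier R"
  shows "submodule_over R B (poly_values B s n)"
proof (induction n)
  case 0
  show ?case using subringE(1)[OF B] by (auto intro!: submodule_overI)
next
  case (Suc n)
  note IH = submodule_overD[OF Suc]
  note Bc = subsetD[OF subringE(1)[OF B]]
  show ?case
  proof (rule submodule_overI)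
    show "poly_values B s (Suc n) \<subseteq> carrier R" using IH(1) Bc s by auto
    have "\<zero> = \<zero> \<otimes> s [^] n \<oplus> \<zero>" using s by simp
    then show "\<zero> \<in> poly_values B s (Suc n)" using IH(2) subringE(2)[OF B] by auto
  next
    fix x y assume "x \<in> poly_values B s (Suc n)" "y \<in> poly_values B s (Suc n)"
    then obtain c p d q where x: "x = c \<otimes> s [^] n \<oplus> p" "c \<in> B" "p \<in> poly_values B s n"
      and y: "y = d \<otimes> s [^] n \<oplus> q" "d \<in> B" "q \<in> poly_values B s n" by auto
    have "c \<in> carrier R" "d \<in> carrier R" "p \<in> carrier R" "q \<in> carrier R" "s [^] n \<in> carrier R"
      using x y Bc IH(1) s by auto
    then have "x \<oplus> y = (c \<oplus> d) \<otimes> s [^] n \<oplus> (p \<oplus> q)" unfolding x y by algebra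
    moreover have "c \<oplus> d \<in> B" "p \<oplus> q \<in> poly_values B s n" using x y IH(3) subringE(7)[OF B] by auto
    ultimately show "x \<oplus> y \<in> poly_values B s (Suc n)" unfolding poly_values.simps by blast
  next
    fix a x assume a: "a \<in> B" and "x \<in> poly_values B s (Suc n)"
    then obtain c p where x: "x = c \<otimes> s [^] n \<oplus> p" "c \<in> B" "p \<in> poly_values B s n" by auto
    have "a \<in> carrier R" "c \<in> carrier R" "p \<in> carrier R" "s [^] n \<in> carrier R"
      using a x Bc IH(1) s by auto
    then have "a \<otimes> x = (a \<otimes> c) \<otimes> s [^] n \<oplus> (a \<otimes> p)" unfolding x by algebra
    moreover have "a \<otimes> c \<in> B" "a \<otimes> p \<in> poly_values B s n" using a x IH(4) subringE(6)[OF B] by auto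
    ultimately show "a \<otimes> x \<in> poly_values B s (Suc n)" unfolding poly_values.simps by blast
  qed
qed

lemma poly_values_mono:
  assumes B: "subring B R" and s: "s \<in> carrier R" and "m \<le> n"
  shows "poly_values B s m \<subseteq> poly_values B s n"
  using \<open>m \<le> n\<close>
proof (induction n rule: dec_induct)
  case (step n)
  have "poly_values B s n \<subseteq> poly_values B s (Suc n)"
  proof
    fix p assume p: "p \<in> poly_values B s n"
    then have "p \<in> carrier R" using submodule_overD(1)[OF poly_values_submodule[OF B s]] by blast
    then have "p = \<zero> \<otimes> s [^] n \<oplus> p" using s by simp
    then show "p \<in> poly_values B s (Suc n)" using p subringE(2)[OF B] by auto
  qed
  then show ?case using step.IH by blast
qed simp

lemma poly_values_times:
  assumes B: "subring B R" and s: "s \<in> carrier R" and "p \<in> poly_values B s n"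
  shows "s \<otimes> p \<in> poly_values B s (Suc n)"
  using assms(3)
proof (induction n arbitrary: p)
  case 0
  then show ?case using s submodule_overD(2)[OF poly_values_submodule[OF B s, of "Suc 0"]]
    by (auto simp del: poly_values.simps(2))
next
  case (Suc n)
  then obtain c q where p: "p = c \<otimes> s [^] n \<oplus> q" "c \<in> B" "q \<in> poly_values B s n" by auto
  have "c \<in> carrier R" "q \<in> carrier R" "s [^] n \<in> carrier R"
    using p subringE(1)[OF B] submodule_overD(1)[OF poly_values_submodule[OF B s]] s by auto
  then have "s \<otimes> p = c \<otimes> (s [^] n \<otimes> s) \<oplus> s \<otimes> q" unfolding p using s by algebra
  also have "\<dots> = c \<otimes> s [^] Suc n \<oplus> s \<otimes> q" by simp
  finally show ?case using p Suc.IH[OF p(3)] poly_values.simps(2)[of B s "Suc n"] by blast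
qed

lemma poly_values_pow_times:
  assumes B: "subring B R" and s: "s \<in> carrier R" and "p \<in> poly_values B s n"
  shows "s [^] (m::nat) \<otimes> p \<in> poly_values B s (m + n)"
proof (induction m)
  case 0
  have "p \<in> carrier R" using assms(3) submodule_overD(1)[OF poly_values_submodule[OF B s]] by blast
  then show ?case using assms(3) by simp
next
  case (Suc m)
  have "p \<in> carrier R" "s [^] m \<in> carrier R"
    using assms(3) s submodule_overD(1)[OF poly_values_submodule[OF B s]] by auto
  then have "s [^] Suc m \<otimes> p = s \<otimes> (s [^] m \<otimes> p)" using s by (simp add: m_ac)
  then show ?case using poly_values_times[OF B s Suc] by (simp del: poly_values.simps)
qed

lemma poly_values_mult:
  assumes B: "subring B R" and s: "s \<in> carrier R" and "p \<in> poly_values B s m" "q \<in> poly_values B s n"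
  shows "p \<otimes> q \<in> poly_values B s (m + n)"
  using assms(3)
proof (induction m arbitrary: p)
  case 0
  have "q \<in> carrier R" using assms(4) submodule_overD(1)[OF poly_values_submodule[OF B s]] by blast
  then show ?case using 0 submodule_overD(2)[OF poly_values_submodule[OF B s]] by simp
next
  case (Suc m)
  then obtain c r where p: "p = c \<otimes> s [^] m \<oplus> r" "c \<in> B" "r \<in> poly_values B s m" by auto
  note sub = submodule_overD[OF poly_values_submodule[OF B s, of "m + n"]]
  have "c \<in> carrier R" "q \<in> carrier R" "r \<in> carrier R" "s [^] m \<in> carrier R"
    using p assms(4) subringE(1)[OF B] submodule_overD(1)[OF poly_values_submodule[OF B s]] s by auto
  then have "p \<otimes> q = c \<otimes> (s [^] m \<otimes> q) \<oplus> r \<otimes> q" unfolding p by algebra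
  moreover have "\<dots> \<in> poly_values B s (m + n)"
    using sub(3)[OF sub(4)[OF p(2) poly_values_pow_times[OF B s assms(4)]] Suc.IH[OF p(3)]] .
  ultimately show ?case using poly_values_mono[OF B s, of "m+n" "Suc m + n"] by auto
qed

lemma poly_values_Un_subring:
  assumes B: "subring B R" and s: "s \<in> carrier R"
  shows "subring (\<Union>n. poly_values B s n) R" "B \<subseteq> (\<Union>n. poly_values B s n)"
    "s \<in> (\<Union>n. poly_values B s n)"
proof -
  note sub = submodule_overD[OF poly_values_submodule[OF B s]]
  show Bsub: "B \<subseteq> (\<Union>n. poly_values B s n)"
  proof
    fix b assume b: "b \<in> B"
    then have "b = b \<otimes> s [^] (0::nat) \<oplus> \<zero>" using subringE(1)[OF B] by auto
    then have "b \<in> poly_values B s (Suc 0)" using b by auto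
    then show "b \<in> (\<Union>n. poly_values B s n)" by blast
  qed
  show "s \<in> (\<Union>n. poly_values B s n)"
  proof -
    have "s = \<one> \<otimes> s [^] (Suc 0) \<oplus> (\<zero> \<otimes> s [^] (0::nat) \<oplus> \<zero>)" using s by simp
    then have "s \<in> poly_values B s (Suc (Suc 0))"
      unfolding poly_values.simps using subringE(2,3)[OF B] by blast
    then show ?thesis by blast
  qed
  show "subring (\<Union>n. poly_values B s n) R"
  proof (rule subringI)
    show "(\<Union>n. poly_values B s n) \<subseteq> carrier R" using sub(1) by blast
    show "\<one> \<in> (\<Union>n. poly_values B s n)" using Bsub subringE(3)[OF B] by blast
  next
    fix x assume "x \<in> (\<Union>n. poly_values B s n)"
    then obtain n where x: "x \<in> poly_values B s n" by blast
    have "\<ominus> \<one> \<in> B" using subringE(3,5)[OF B] by blast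
    then have "(\<ominus> \<one>) \<otimes> x \<in> poly_values B s n" using sub(4) x by blast
    moreover have "(\<ominus> \<one>) \<otimes> x = \<ominus> x" using x sub(1)[of n] by (simp add: subset_iff l_minus)
    ultimately show "\<ominus> x \<in> (\<Union>n. poly_values B s n)" by auto
  next
    fix x y assume "x \<in> (\<Union>n. poly_values B s n)" "y \<in> (\<Union>n. poly_values B s n)"
    then obtain m n where xy: "x \<in> poly_values B s m" "y \<in> poly_values B s n" by blast
    show "x \<otimes> y \<in> (\<Union>n. poly_values B s n)" using poly_values_mult[OF B s xy] by blast
    have "x \<in> poly_values B s (max m n)" "y \<in> poly_values B s (max m n)"
      using poly_values_mono[OF B s, of m "max m n"] poly_values_mono[OF B s, of n "max m n"] xy by auto
    then show "x \<oplus> y \<in> (\<Union>n. poly_values B s n)" using sub(3) by blast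
  qed
qed

text \<open>Hilbert's basis theorem carried out on values of polynomials. \<open>lc I n\<close>
  collects the possible coefficients of \<open>s [^] n\<close> in expressions of elements of I with
  no higher power; it is an ideal of B and grows with n, because I is closed under multiplication by
  s. Two elements with the same coefficient at \<open>s [^] n\<close> differ by an element with a
  shorter expression, and this takes the place of an induction on degrees.\<close>

lemma noetherian_over_adjoin:
  assumes B: "subring B R" and s: "s \<in> carrier R" and N: "noetherian_over R B"
  shows "noetherian_over R (\<Union>n. poly_values B s n)"
proof -
  define C where "C = (\<Union>n. poly_values B s n)"
  have C: "subring C R" and BC: "B \<subseteq> C" and sC: "s \<in> C"
    using poly_values_Un_subring[OF B s] unfolding C_def by auto
  note sub = submodule_overD[OF poly_values_submodule[OF B s]]
  define lc where "lc I n = {b \<in> B. \<exists>p\<in>poly_values B s n. b \<otimes> s [^] n \<oplus> p \<in> I}" for I n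
  have lcsub: "submodule_over R B (lc I n)" if I: "submodule_over R C I" for I n
  proof (rule submodule_overI)
    note I' = submodule_overD[OF I]
    show "lc I n \<subseteq> carrier R" using subringE(1)[OF B] by (auto simp: lc_def)
    have "\<zero> \<otimes> s [^] n \<oplus> \<zero> \<in> I" using s I' by simp
    then show "\<zero> \<in> lc I n" using sub(2) subringE(2)[OF B] by (auto simp: lc_def)
  next
    note I' = submodule_overD[OF I]
    fix x y assume "x \<in> lc I n" "y \<in> lc I n"
    then obtain p q where *: "x \<in> B" "p \<in> poly_values B s n" "x \<otimes> s [^] n \<oplus> p \<in> I"
      "y \<in> B" "q \<in> poly_values B s n" "y \<otimes> s [^] n \<oplus> q \<in> I" by (auto simp: lc_def)
    have "x \<in> carrier R" "y \<in> carrier R" "p \<in> carrier R" "q \<in> carrier R" "s [^] n \<in> carrier R"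
      using * sub(1) subringE(1)[OF B] s by auto
    then have "(x \<otimes> s [^] n \<oplus> p) \<oplus> (y \<otimes> s [^] n \<oplus> q) = (x \<oplus> y) \<otimes> s [^] n \<oplus> (p \<oplus> q)" by algebra
    then have "(x \<oplus> y) \<otimes> s [^] n \<oplus> (p \<oplus> q) \<in> I" using I'(3)[OF *(3) *(6)] by simp
    moreover have "x \<oplus> y \<in> B" "p \<oplus> q \<in> poly_values B s n" using * sub(3) subringE(7)[OF B] by auto
    ultimately show "x \<oplus> y \<in> lc I n" unfolding lc_def by blast
  next
    note I' = submodule_overD[OF I]
    fix a x assume a: "a \<in> B" and "x \<in> lc I n"
    then obtain p where *: "x \<in> B" "p \<in> poly_values B s n" "x \<otimes> s [^] n \<oplus> p \<in> I"
      by (auto simp: lc_def)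
    have "x \<in> carrier R" "a \<in> carrier R" "p \<in> carrier R" "s [^] n \<in> carrier R"
      using * a sub(1) subringE(1)[OF B] s by auto
    then have "a \<otimes> (x \<otimes> s [^] n \<oplus> p) = (a \<otimes> x) \<otimes> s [^] n \<oplus> (a \<otimes> p)" by algebra
    then have "(a \<otimes> x) \<otimes> s [^] n \<oplus> (a \<otimes> p) \<in> I" using I'(4)[OF subsetD[OF BC a] *(3)] by simp
    moreover have "a \<otimes> x \<in> B" "a \<otimes> p \<in> poly_values B s n" using * a sub(4) subringE(6)[OF B] by auto
    ultimately show "a \<otimes> x \<in> lc I n" unfolding lc_def by blast
  qed
  have lcmono: "lc I m \<subseteq> lc I n" if I: "submodule_over R C I" and "m \<le> n" for I m n
    using \<open>m \<le> n\<close>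
  proof (induction n rule: dec_induct)
    case (step n)
    have "lc I n \<subseteq> lc I (Suc n)"
    proof
      fix b assume "b \<in> lc I n"
      then obtain p where *: "b \<in> B" "p \<in> poly_values B s n" "b \<otimes> s [^] n \<oplus> p \<in> I"
        by (auto simp: lc_def)
      have "b \<in> carrier R" "p \<in> carrier R" "s [^] n \<in> carrier R"
        using * sub(1) subringE(1)[OF B] s by auto
      then have "s \<otimes> (b \<otimes> s [^] n \<oplus> p) = b \<otimes> (s [^] n \<otimes> s) \<oplus> s \<otimes> p" using s by algebra
      then have "b \<otimes> s [^] Suc n \<oplus> s \<otimes> p \<in> I"
        using submodule_overD(4)[OF I sC *(3)] by simp
      then show "b \<in> lc I (Suc n)" using * poly_values_times[OF B s *(2)]
        unfolding lc_def by blast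
    qed
    then show ?case using step.IH by blast
  qed simp
  show ?thesis
    unfolding noetherian_over_def C_def[symmetric]
  proof (intro allI impI, elim conjE)
    fix I assume I: "submodule_over R C I" and IC: "I \<subseteq> C"
    have "\<exists>S. finite S \<and> S \<subseteq> lc I n \<and> (\<forall>J. submodule_over R B J \<and> S \<subseteq> J \<longrightarrow> lc I n \<subseteq> J)" for n
    proof -
      have "lc I n \<subseteq> B" by (auto simp: lc_def)
      then show ?thesis using N lcsub[OF I, of n] unfolding noetherian_over_def by blast
    qed
    then obtain S where S: "\<And>n. finite (S n)" "\<And>n. S n \<subseteq> lc I n"
      "\<And>n J. submodule_over R B J \<Longrightarrow> S n \<subseteq> J \<Longrightarrow> lc I n \<subseteq> J" by metis
    have Usub: "submodule_over R B (\<Union>n. lc I n)"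
    proof (rule submodule_overI)
      fix x y assume "x \<in> (\<Union>n. lc I n)" "y \<in> (\<Union>n. lc I n)"
      then obtain m n where "x \<in> lc I m" "y \<in> lc I n" by blast
      then have "x \<in> lc I (max m n)" "y \<in> lc I (max m n)"
        using lcmono[OF I, of m "max m n"] lcmono[OF I, of n "max m n"] by auto
      then show "x \<oplus> y \<in> (\<Union>n. lc I n)" using submodule_overD(3)[OF lcsub[OF I]] by blast
    next
      show "(\<Union>n. lc I n) \<subseteq> carrier R" using submodule_overD(1)[OF lcsub[OF I]] by blast
      show "\<zero> \<in> (\<Union>n. lc I n)" using submodule_overD(2)[OF lcsub[OF I]] by blast
      show "a \<otimes> x \<in> (\<Union>n. lc I n)" if "a \<in> B" "x \<in> (\<Union>n. lc I n)" for a x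
        using submodule_overD(4)[OF lcsub[OF I] that(1)] that(2) by blast
    qed
    obtain S' where S': "finite S'" "S' \<subseteq> (\<Union>n. lc I n)"
      "\<And>J. submodule_over R B J \<Longrightarrow> S' \<subseteq> J \<Longrightarrow> (\<Union>n. lc I n) \<subseteq> J"
    proof (rule noetherian_overD[OF N Usub])
      show "(\<Union>n. lc I n) \<subseteq> B" by (auto simp: lc_def)
    qed blast
    \<comment> \<open>The ideals \<open>lc I n\<close> increase, so a finite generating set of their
      union lies in one of them; from this index on the chain is constant.\<close>
    have "\<exists>N. S' \<subseteq> lc I N"
      using S'(1,2)
    proof (induction S')
      case (insert x F)
      then obtain m n where "F \<subseteq> lc I m" "x \<in> lc I n" by blast
      then have "insert x F \<subseteq> lc I (max m n)"
        using lcmono[OF I, of m "max m n"] lcmono[OF I, of n "max m n"] by auto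
      then show ?case by blast
    qed simp
    then obtain N where N: "S' \<subseteq> lc I N" by blast
    have stab: "lc I n \<subseteq> lc I N" for n using S'(3)[OF lcsub[OF I] N] by blast
    define v where "v n b = (SOME v. v \<in> I \<and> (\<exists>p\<in>poly_values B s n. v = b \<otimes> s [^] n \<oplus> p))" for n b
    have "\<exists>v. v \<in> I \<and> (\<exists>p\<in>poly_values B s n. v = b \<otimes> s [^] n \<oplus> p)" if "b \<in> S n" for b n
      using that S(2)[of n] unfolding lc_def by blast
    from someI_ex[OF this, folded v_def]
    have v: "\<And>n b. b \<in> S n \<Longrightarrow> v n b \<in> I"
      "\<And>n b. b \<in> S n \<Longrightarrow> \<exists>p\<in>poly_values B s n. v n b = b \<otimes> s [^] n \<oplus> p" by blast+
    \<comment> \<open>The generators of I: for each n up to N, elements of I that realize generators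
      of \<open>lc I n\<close>. Larger n contribute no new coefficients by
      \<open>stab\<close>.\<close>
    define T where "T = (\<Union>n\<in>{..N}. v n ` S n)"
    have "I \<subseteq> J" if J: "submodule_over R C J" and TJ: "T \<subseteq> J" for J
    proof -
      \<comment> \<open>The reduction below subtracts from x an element with the same leading
        coefficient; it has to come from I as well as from J, since the induction hypothesis speaks
        of elements of I only.\<close>
      have IJ: "submodule_over R C (I \<inter> J)"
        using I J unfolding submodule_over_def by blast
      have TIJ: "T \<subseteq> I \<inter> J" using TJ v(1) unfolding T_def by blast
      have small: "lc I n \<subseteq> lc (I \<inter> J) n" if "n \<le> N" for n
      proof (rule S(3)[OF lcsub[OF IJ]], rule subsetI)
        fix b assume b: "b \<in> S n"
        then have vb: "v n b \<in> I \<inter> J" using TIJ that unfolding T_def by blast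
        have "b \<in> B" using b S(2) unfolding lc_def by blast
        moreover obtain p where "p \<in> poly_values B s n" "v n b = b \<otimes> s [^] n \<oplus> p" using v(2)[OF b] by blast
        ultimately show "b \<in> lc (I \<inter> J) n" using vb unfolding lc_def by force
      qed
      have lcle: "lc I n \<subseteq> lc (I \<inter> J) n" for n
      proof (cases "n \<le> N")
        case False
        then have "lc (I \<inter> J) N \<subseteq> lc (I \<inter> J) n" using lcmono[OF IJ] by simp
        then show ?thesis using small[of N] stab[of n] by blast
      qed (rule small)
      have "poly_values B s n \<inter> I \<subseteq> J" for n
      proof (induction n)
        case 0
        show ?case unfolding poly_values.simps using submodule_overD(2)[OF J] by blast
      next
        case (Suc n)
        show ?case
        proof
          fix x assume x: "x \<in> poly_values B s (Suc n) \<inter> I"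
          then obtain c p where xp: "x = c \<otimes> s [^] n \<oplus> p" "c \<in> B" "p \<in> poly_values B s n" by auto
          have "c \<in> lc I n" using x xp unfolding lc_def by blast
          then have "c \<in> lc (I \<inter> J) n" using lcle by blast
          then obtain q where q: "q \<in> poly_values B s n" "c \<otimes> s [^] n \<oplus> q \<in> I \<inter> J" by (auto simp: lc_def)
          define y where "y = c \<otimes> s [^] n \<oplus> q"
          have car: "c \<in> carrier R" "p \<in> carrier R" "q \<in> carrier R" "s [^] n \<in> carrier R"
            using xp q sub(1) subringE(1)[OF B] s by auto
          have "x \<ominus> y \<in> I" using submodule_over_minus[OF C I] x q by (auto simp: y_def)
          moreover have "x \<ominus> y = p \<ominus> q" unfolding xp y_def using car by algebra
          moreover have "p \<ominus> q \<in> poly_values B s n"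
            using submodule_over_minus[OF B poly_values_submodule[OF B s] xp(3) q(1)] .
          ultimately have "x \<ominus> y \<in> J" using Suc by auto
          then have "(x \<ominus> y) \<oplus> y \<in> J" using submodule_overD(3)[OF J] q by (auto simp: y_def)
          moreover have "(x \<ominus> y) \<oplus> y = x" unfolding xp y_def using car by algebra
          ultimately show "x \<in> J" by simp
        qed
      qed
      then show ?thesis using IC unfolding C_def by blast
    qed
    moreover have "finite T" "T \<subseteq> I" using S(1) v(1) unfolding T_def by auto
    ultimately show "\<exists>S. finite S \<and> S \<subseteq> I \<and> (\<forall>J. submodule_over R C J \<and> S \<subseteq> J \<longrightarrow> I \<subseteq> J)" by blast
  qed
qed

lemma noetherian_over_adjoin_finite:
  assumes "finite S" "S \<subseteq> carrier R" "subring B R" "noetherian_over R B"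
  shows "\<exists>C. subring C R \<and> B \<subseteq> C \<and> S \<subseteq> C \<and> noetherian_over R C"
  using assms(1,2)
proof (induction S)
  case empty then show ?case using assms by blast
next
  case (insert s S)
  then obtain C where C: "subring C R" "B \<subseteq> C" "S \<subseteq> C" "noetherian_over R C" by auto
  have s: "s \<in> carrier R" using insert by auto
  show ?case
    using poly_values_Un_subring[OF C(1) s] noetherian_over_adjoin[OF C(1) s C(4)] C(2,3) by blast
qed

lemma noetherian_over_generate_ring:
  assumes "finite S" "S \<subseteq> carrier R" "subring B R" "noetherian_over R B"
    and "generate_ring R (B \<union> S) = carrier R"
  shows "noetherian_over R (carrier R)"
proof -
  obtain C where C: "subring C R" "B \<subseteq> C" "S \<subseteq> C" "noetherian_over R C"
    using noetherian_over_adjoin_finite[OF assms(1-4)] by blast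
  have "carrier R \<subseteq> C"
    using generate_ring_min_subring1[of "B \<union> S" C] assms(2,5) C subringE(1)[OF assms(3)] by auto
  then show ?thesis using C subringE(1)[OF C(1)] by (metis subset_antisym)
qed

end

lemma subring_hom_image:
  assumes "cring R" "cring S" "h \<in> ring_hom R S"
  shows "subring (h ` carrier R) S"
proof -
  interpret R: cring R by fact
  interpret S: cring S by fact
  show ?thesis
    by (rule ring_hom_ring.img_is_subring[OF ring_hom_ringI2[OF R.ring_axioms S.ring_axioms assms(3)] R.carrier_is_subring])
qed

text \<open>Generators of the preimage of I map to generators of I. It is applied to the base field
  mapping to sections, and to sections mapping into the function field.\<close>

lemma noetherian_over_hom_image:
  assumes "cring R" "cring S" and h: "h \<in> ring_hom R S" and N: "noetherian_over R (carrier R)"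
  shows "noetherian_over S (h ` carrier R)"
  unfolding noetherian_over_def
proof (intro allI impI, elim conjE)
  interpret ring_hom_cring R S h using assms by (simp add: ring_hom_cring_def ring_hom_cring_axioms_def)
  fix I assume I: "submodule_over S (h ` carrier R) I" and IC: "I \<subseteq> h ` carrier R"
  define pre where "pre J = {r \<in> carrier R. h r \<in> J}" for J
  have presub: "submodule_over R (carrier R) (pre J)" if "submodule_over S (h ` carrier R) J" for J
    using submodule_overD[OF that] by (intro submodule_overI) (auto simp: pre_def)
  obtain T where T: "finite T" "T \<subseteq> pre I"
    "\<And>J. submodule_over R (carrier R) J \<Longrightarrow> T \<subseteq> J \<Longrightarrow> pre I \<subseteq> J"
    by (rule noetherian_overD[OF N presub[OF I]]) (auto simp: pre_def)
  have "I \<subseteq> J" if J: "submodule_over S (h ` carrier R) J" "h ` T \<subseteq> J" for J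
  proof
    fix x assume x: "x \<in> I"
    then obtain r where r: "r \<in> carrier R" "x = h r" using IC by auto
    have "T \<subseteq> pre J" using J(2) T(2) by (auto simp: pre_def)
    then have "pre I \<subseteq> pre J" using T(3)[OF presub[OF J(1)]] by blast
    then show "x \<in> J" using r x by (auto simp: pre_def)
  qed
  then show "\<exists>S'. finite S' \<and> S' \<subseteq> I \<and> (\<forall>J. submodule_over S (h ` carrier R) J \<and> S' \<subseteq> J \<longrightarrow> I \<subseteq> J)"
    using T(1,2) by (intro exI[of _ "h ` T"]) (auto simp: pre_def)
qed

lemma (in field) noetherian_over_field: "noetherian_over R (carrier R)"
  unfolding noetherian_over_def
proof (intro allI impI, elim conjE)
  fix I assume I: "submodule_over R (carrier R) I"
  note I' = submodule_overD[OF I]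
  show "\<exists>S. finite S \<and> S \<subseteq> I \<and> (\<forall>J. submodule_over R (carrier R) J \<and> S \<subseteq> J \<longrightarrow> I \<subseteq> J)"
  proof (cases "I \<subseteq> {\<zero>}")
    case True
    then show ?thesis by (intro exI[of _ "{}"]) (auto simp: submodule_over_def)
  next
    case False
    then obtain x where x: "x \<in> I" "x \<noteq> \<zero>" by blast
    have "I \<subseteq> J" if J: "submodule_over R (carrier R) J" "{x} \<subseteq> J" for J
    proof
      fix y assume "y \<in> I"
      then have "y \<in> carrier R" "x \<in> carrier R" "x \<in> Units R" using I'(1) x field_Units by auto
      then have "y = (y \<otimes> inv x) \<otimes> x" "y \<otimes> inv x \<in> carrier R" by (simp_all add: m_assoc)
      then show "y \<in> J" using submodule_overD(4)[OF J(1)] J(2) by (metis insert_subset)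
    qed
    then show ?thesis using x by (intro exI[of _ "{x}"]) auto
  qed
qed

section \<open>Primes and finitely generated modules over a Noetherian subring\<close>

definition prime_over :: "('a, 'm) ring_scheme \<Rightarrow> 'a set \<Rightarrow> 'a set \<Rightarrow> bool" where
  "prime_over R A p \<longleftrightarrow> submodule_over R A p \<and> p \<subseteq> A \<and> \<one>\<^bsub>R\<^esub> \<notin> p \<and>
     (\<forall>a\<in>A. \<forall>b\<in>A. a \<otimes>\<^bsub>R\<^esub> b \<in> p \<longrightarrow> a \<in> p \<or> b \<in> p)"

definition units_in :: "('a, 'm) ring_scheme \<Rightarrow> 'a set \<Rightarrow> 'a set" where
  "units_in R A = {u \<in> A. \<exists>w\<in>A. u \<otimes>\<^bsub>R\<^esub> w = \<one>\<^bsub>R\<^esub>}"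

text \<open>Vectors are indexed by all natural numbers; finite length is imposed separately, by
  letting the entries vanish from some n on. This permits induction on the length within one
  type.\<close>

definition vectors_over :: "('a, 'm) ring_scheme \<Rightarrow> 'a set \<Rightarrow> (nat \<Rightarrow> 'a) set \<Rightarrow> bool" where
  "vectors_over R A N \<longleftrightarrow> (\<forall>v\<in>N. \<forall>i. v i \<in> carrier R) \<and> (\<lambda>i. \<zero>\<^bsub>R\<^esub>) \<in> N \<and>
     (\<forall>v\<in>N. \<forall>w\<in>N. (\<lambda>i. v i \<oplus>\<^bsub>R\<^esub> w i) \<in> N) \<and> (\<forall>a\<in>A. \<forall>v\<in>N. (\<lambda>i. a \<otimes>\<^bsub>R\<^esub> v i) \<in> N)"

lemma vectors_overD:
  assumes "vectors_over R A N"
  shows "\<And>v i. v \<in> N \<Longrightarrow> v i \<in> carrier R" "(\<lambda>i. \<zero>\<^bsub>R\<^esub>) \<in> N"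
    "\<And>v w. v \<in> N \<Longrightarrow> w \<in> N \<Longrightarrow> (\<lambda>i. v i \<oplus>\<^bsub>R\<^esub> w i) \<in> N"
    "\<And>a v. a \<in> A \<Longrightarrow> v \<in> N \<Longrightarrow> (\<lambda>i. a \<otimes>\<^bsub>R\<^esub> v i) \<in> N"
  using assms unfolding vectors_over_def by simp_all

lemma noetherian_over_ex:
  assumes "noetherian_over R A" "submodule_over R A I" "I \<subseteq> A"
  shows "\<exists>S. finite S \<and> S \<subseteq> I \<and> (\<forall>J. submodule_over R A J \<and> S \<subseteq> J \<longrightarrow> I \<subseteq> J)"
  using assms unfolding noetherian_over_def by simp

context cring
begin

text \<open>The union of a chain is finitely generated, and its generators already lie in one member
  of the chain, so this member is the union; Zorn's lemma applies.\<close>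

lemma noetherian_over_maximal:
  assumes N: "noetherian_over R A" and ne: "\<A> \<noteq> {}"
    and sub: "\<And>I. I \<in> \<A> \<Longrightarrow> submodule_over R A I \<and> I \<subseteq> A"
  shows "\<exists>M\<in>\<A>. \<forall>I\<in>\<A>. M \<subseteq> I \<longrightarrow> I = M"
proof (rule subset_Zorn_nonempty[OF ne])
  fix \<C> assume C: "\<C> \<noteq> {}" "subset.chain \<A> \<C>"
  have CsubA: "\<C> \<subseteq> \<A>" using C(2) unfolding subset_chain_def by simp
  have CA: "submodule_over R A I \<and> I \<subseteq> A" if "I \<in> \<C>" for I
    by (rule sub[OF subsetD[OF CsubA that]])
  have comp: "I \<subseteq> J \<or> J \<subseteq> I" if "I \<in> \<C>" "J \<in> \<C>" for I J
    using C(2) that unfolding subset_chain_def by blast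
  have U: "submodule_over R A (\<Union>\<C>)"
  proof (rule submodule_overI)
    fix x y assume "x \<in> \<Union>\<C>" "y \<in> \<Union>\<C>"
    then obtain I J where IJ: "I \<in> \<C>" "x \<in> I" "J \<in> \<C>" "y \<in> J" by blast
    then have "\<exists>L\<in>\<C>. x \<in> L \<and> y \<in> L" using comp[OF IJ(1,3)] by blast
    then obtain L where L: "L \<in> \<C>" "x \<in> L" "y \<in> L" by blast
    then show "x \<oplus> y \<in> \<Union>\<C>" using submodule_overD(3)[OF conjunct1[OF CA[OF L(1)]] L(2,3)] by blast
  next
    fix a x assume a: "a \<in> A" and "x \<in> \<Union>\<C>"
    then obtain L where L: "L \<in> \<C>" "x \<in> L" by blast
    then show "a \<otimes> x \<in> \<Union>\<C>" using submodule_overD(4)[OF conjunct1[OF CA[OF L(1)]] a L(2)] by blast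
  next
    show "\<Union>\<C> \<subseteq> carrier R" using submodule_overD(1)[OF conjunct1[OF CA]] by blast
    obtain L where L: "L \<in> \<C>" using C(1) by blast
    then show "\<zero> \<in> \<Union>\<C>" using submodule_overD(2)[OF conjunct1[OF CA[OF L]]] by blast
  qed
  have UA: "\<Union>\<C> \<subseteq> A" using CA by blast
  obtain S where S0: "finite S \<and> S \<subseteq> \<Union>\<C> \<and> (\<forall>J. submodule_over R A J \<and> S \<subseteq> J \<longrightarrow> \<Union>\<C> \<subseteq> J)"
    using noetherian_over_ex[OF N U UA] by (rule exE)
  then have S: "finite S" "S \<subseteq> \<Union>\<C>" "\<And>J. submodule_over R A J \<Longrightarrow> S \<subseteq> J \<Longrightarrow> \<Union>\<C> \<subseteq> J"
    by simp_all
  obtain B where B: "B \<in> \<C>" "S \<subseteq> B"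
    by (rule finite_subset_Union_chain[OF S(1,2) C])
  then have "\<Union>\<C> \<subseteq> B" using S(3) CA by blast
  then have "\<Union>\<C> = B" using B by blast
  then show "\<Union>\<C> \<in> \<A>" using B CsubA by auto
qed

text \<open>An associated prime of the module R / A, found below the class of f. Among the
  annihilators \<open>ann c\<close> of the nonzero classes of multiples c f choose a maximal one.
  Multiplying c by an element b outside it keeps the class nonzero and can only enlarge the
  annihilator, hence does not change it; this is primality.\<close>

lemma associated_prime_exists:
  assumes A: "subring A R" and N: "noetherian_over R A" and f: "f \<in> carrier R" "f \<notin> A"
  shows "\<exists>c\<in>A. c \<otimes> f \<notin> A \<and> prime_over R A {r \<in> A. r \<otimes> (c \<otimes> f) \<in> A}"
proof -
  note Ac = subsetD[OF subringE(1)[OF A]]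
  define ann where "ann c = {r \<in> A. r \<otimes> (c \<otimes> f) \<in> A}" for c
  have annsub: "submodule_over R A (ann c) \<and> ann c \<subseteq> A" if c: "c \<in> A" for c
  proof (intro conjI submodule_overI)
    show "ann c \<subseteq> carrier R" "ann c \<subseteq> A" using Ac by (auto simp: ann_def)
    show "\<zero> \<in> ann c" using subringE(2)[OF A] Ac[OF c] f by (simp add: ann_def)
  next
    fix x y assume xy: "x \<in> ann c" "y \<in> ann c"
    then have "(x \<oplus> y) \<otimes> (c \<otimes> f) = x \<otimes> (c \<otimes> f) \<oplus> y \<otimes> (c \<otimes> f)"
      using Ac[OF c] f Ac by (intro l_distr) (auto simp: ann_def)
    then show "x \<oplus> y \<in> ann c" using xy subringE(7)[OF A] by (auto simp: ann_def)
  next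
    fix a x assume ax: "a \<in> A" "x \<in> ann c"
    then have "(a \<otimes> x) \<otimes> (c \<otimes> f) = a \<otimes> (x \<otimes> (c \<otimes> f))"
      using Ac[OF c] f Ac by (intro m_assoc) (auto simp: ann_def)
    then show "a \<otimes> x \<in> ann c" using ax subringE(6)[OF A] by (auto simp: ann_def)
  qed
  define \<A> where "\<A> = ann ` {c \<in> A. c \<otimes> f \<notin> A}"
  have "\<one> \<otimes> f \<notin> A" "\<one> \<in> A" using f subringE(3)[OF A] by auto
  then have "\<A> \<noteq> {}" unfolding \<A>_def by blast
  then have "\<exists>M\<in>\<A>. \<forall>I\<in>\<A>. M \<subseteq> I \<longrightarrow> I = M"
    by (rule noetherian_over_maximal[OF N]) (use annsub in \<open>auto simp: \<A>_def\<close>)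
  then obtain c where c: "c \<in> A" "c \<otimes> f \<notin> A" and
    max: "\<And>d. d \<in> A \<Longrightarrow> d \<otimes> f \<notin> A \<Longrightarrow> ann c \<subseteq> ann d \<Longrightarrow> ann d = ann c"
    unfolding \<A>_def by blast
  have "prime_over R A (ann c)"
    unfolding prime_over_def
  proof (intro conjI ballI impI)
    show "submodule_over R A (ann c)" "ann c \<subseteq> A" using annsub[OF c(1)] by auto
    show "\<one> \<notin> ann c" using c Ac f by (simp add: ann_def)
  next
    fix a b assume ab: "a \<in> A" "b \<in> A" "a \<otimes> b \<in> ann c"
    have car: "a \<in> carrier R" "b \<in> carrier R" "c \<in> carrier R" using ab c Ac by auto
    show "a \<in> ann c \<or> b \<in> ann c"
    proof (cases "b \<in> ann c")
      case False
      have bcf: "b \<otimes> (c \<otimes> f) = (b \<otimes> c) \<otimes> f" using car f by algebra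
      have "b \<otimes> c \<in> A" using ab c subringE(6)[OF A] by blast
      moreover have "(b \<otimes> c) \<otimes> f \<notin> A" using False ab bcf by (auto simp: ann_def)
      moreover have "ann c \<subseteq> ann (b \<otimes> c)"
      proof
        fix r assume r: "r \<in> ann c"
        then have "r \<in> carrier R" using Ac by (auto simp: ann_def)
        then have "r \<otimes> ((b \<otimes> c) \<otimes> f) = b \<otimes> (r \<otimes> (c \<otimes> f))" using car f by algebra
        then show "r \<in> ann (b \<otimes> c)" using r ab(2) subringE(6)[OF A] by (auto simp: ann_def)
      qed
      ultimately have eq: "ann (b \<otimes> c) = ann c" by (rule max)
      have "a \<otimes> ((b \<otimes> c) \<otimes> f) = (a \<otimes> b) \<otimes> (c \<otimes> f)" using car f by algebra
      then have "a \<in> ann (b \<otimes> c)" using ab by (simp add: ann_def)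
      then show ?thesis using eq by simp
    qed simp
  qed
  then show ?thesis using c unfolding ann_def by blast
qed

text \<open>Noetherian induction: a maximal counterexample M is not prime and does not contain
  \<one>, so some product a b lies in M with a and b outside. A prime containing M contains a or b,
  hence one of the larger ideals M + (a) and M + (b), and the finite families for these two together
  serve M.\<close>

lemma finitely_many_minimal_primes:
  assumes A: "subring A R" and N: "noetherian_over R A" and I: "submodule_over R A I" "I \<subseteq> A"
  shows "\<exists>F. finite F \<and> (\<forall>p\<in>F. prime_over R A p \<and> I \<subseteq> p) \<and>
    (\<forall>q. prime_over R A q \<and> I \<subseteq> q \<longrightarrow> (\<exists>p\<in>F. p \<subseteq> q))" (is "?good I")
proof (rule ccontr)
  assume bad: "\<not> ?good I"
  note Ac = subsetD[OF subringE(1)[OF A]]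
  define \<A> where "\<A> = {I. submodule_over R A I \<and> I \<subseteq> A \<and> \<not> ?good I}"
  have "\<A> \<noteq> {}" using bad I unfolding \<A>_def by blast
  then have "\<exists>M\<in>\<A>. \<forall>I\<in>\<A>. M \<subseteq> I \<longrightarrow> I = M"
    by (rule noetherian_over_maximal[OF N]) (simp add: \<A>_def)
  then obtain M where MA: "M \<in> \<A>" and maxA: "\<forall>I\<in>\<A>. M \<subseteq> I \<longrightarrow> I = M" by (rule bexE)
  have M: "submodule_over R A M" "M \<subseteq> A" and Mbad: "\<not> ?good M" using MA unfolding \<A>_def by simp_all
  have max: "?good I" if "submodule_over R A I" "I \<subseteq> A" "M \<subseteq> I" "I \<noteq> M" for I
  proof (rule ccontr)
    assume "\<not> ?good I"
    then have "I \<in> \<A>" using that unfolding \<A>_def by simp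
    then show False using maxA that by simp
  qed
  have "\<not> prime_over R A M"
  proof
    assume "prime_over R A M"
    then have "?good M" by (intro exI[of _ "{M}"]) auto
    then show False using Mbad by contradiction
  qed
  moreover have "\<one> \<notin> M"
  proof
    assume "\<one> \<in> M"
    \<comment> \<open>No prime contains \<one>, so the empty family serves.\<close>
    then have "?good M" by (intro exI[of _ "{}"]) (auto simp: prime_over_def)
    then show False using Mbad by contradiction
  qed
  ultimately obtain a b where ab: "a \<in> A" "b \<in> A" "a \<otimes> b \<in> M" "a \<notin> M" "b \<notin> M"
    using M unfolding prime_over_def by blast
  define ext where "ext x = {m \<oplus> r \<otimes> x |m r. m \<in> M \<and> r \<in> A}" for x
  note M' = submodule_overD[OF M(1)]
  have ext: "submodule_over R A (ext x) \<and> ext x \<subseteq> A \<and> M \<subseteq> ext x \<and> x \<in> ext x" if x: "x \<in> A" for x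
  proof (intro conjI submodule_overI)
    show "ext x \<subseteq> A" using x M(2) subringE(6,7)[OF A] unfolding ext_def by blast
    then show "ext x \<subseteq> carrier R" using Ac by blast
    have "m = m \<oplus> \<zero> \<otimes> x" if "m \<in> M" for m using that M'(1) x Ac by auto
    then show sub: "M \<subseteq> ext x" using subringE(2)[OF A] unfolding ext_def by blast
    then show "\<zero> \<in> ext x" using M'(2) by blast
    have "x = \<zero> \<oplus> \<one> \<otimes> x" using x Ac by simp
    then show "x \<in> ext x" using M'(2) subringE(3)[OF A] unfolding ext_def by blast
  next
    fix y z assume "y \<in> ext x" "z \<in> ext x"
    then obtain m r n s where *: "y = m \<oplus> r \<otimes> x" "z = n \<oplus> s \<otimes> x" "m \<in> M" "n \<in> M" "r \<in> A" "s \<in> A"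
      unfolding ext_def by blast
    then have "m \<in> carrier R" "n \<in> carrier R" "r \<in> carrier R" "s \<in> carrier R" "x \<in> carrier R"
      using M'(1) Ac x by auto
    then have "y \<oplus> z = (m \<oplus> n) \<oplus> (r \<oplus> s) \<otimes> x" unfolding * by algebra
    then show "y \<oplus> z \<in> ext x" using M'(3)[OF *(3,4)] subringE(7)[OF A *(5,6)] unfolding ext_def by blast
  next
    fix c y assume c: "c \<in> A" and "y \<in> ext x"
    then obtain m r where *: "y = m \<oplus> r \<otimes> x" "m \<in> M" "r \<in> A" unfolding ext_def by blast
    then have "m \<in> carrier R" "r \<in> carrier R" "x \<in> carrier R" "c \<in> carrier R"
      using M'(1) Ac x c by auto
    then have "c \<otimes> y = c \<otimes> m \<oplus> (c \<otimes> r) \<otimes> x" unfolding * by algebra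
    then show "c \<otimes> y \<in> ext x" using M'(4)[OF c *(2)] subringE(6)[OF A c *(3)] unfolding ext_def by blast
  qed
  have "ext a \<noteq> M" using ext[OF ab(1)] ab(4) by auto
  then have "?good (ext a)" using max ext[OF ab(1)] by simp
  then obtain F where F0: "finite F \<and> (\<forall>p\<in>F. prime_over R A p \<and> ext a \<subseteq> p) \<and>
    (\<forall>q. prime_over R A q \<and> ext a \<subseteq> q \<longrightarrow> (\<exists>p\<in>F. p \<subseteq> q))" by (rule exE)
  then have F: "finite F" "\<And>p. p \<in> F \<Longrightarrow> prime_over R A p \<and> ext a \<subseteq> p"
    "\<And>q. prime_over R A q \<Longrightarrow> ext a \<subseteq> q \<Longrightarrow> \<exists>p\<in>F. p \<subseteq> q" by simp_all
  have "ext b \<noteq> M" using ext[OF ab(2)] ab(5) by auto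
  then have "?good (ext b)" using max ext[OF ab(2)] by simp
  then obtain G where G0: "finite G \<and> (\<forall>p\<in>G. prime_over R A p \<and> ext b \<subseteq> p) \<and>
    (\<forall>q. prime_over R A q \<and> ext b \<subseteq> q \<longrightarrow> (\<exists>p\<in>G. p \<subseteq> q))" by (rule exE)
  then have G: "finite G" "\<And>p. p \<in> G \<Longrightarrow> prime_over R A p \<and> ext b \<subseteq> p"
    "\<And>q. prime_over R A q \<Longrightarrow> ext b \<subseteq> q \<Longrightarrow> \<exists>p\<in>G. p \<subseteq> q" by simp_all
  have "?good M"
  proof (intro exI[of _ "F \<union> G"] conjI ballI allI impI)
    show "finite (F \<union> G)" using F G by simp
    fix p assume "p \<in> F \<union> G"
    then show "prime_over R A p" "M \<subseteq> p" using F(2) G(2) ext[OF ab(1)] ext[OF ab(2)] by blast+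
  next
    fix q assume q: "prime_over R A q \<and> M \<subseteq> q"
    have le: "ext x \<subseteq> q" if "x \<in> q" for x
    proof
      fix y assume "y \<in> ext x"
      then obtain m r where "y = m \<oplus> r \<otimes> x" "m \<in> M" "r \<in> A" unfolding ext_def by blast
      then show "y \<in> q"
        using q that submodule_overD(3,4)[of R A q] unfolding prime_over_def by blast
    qed
    have "a \<in> q \<or> b \<in> q" using q ab unfolding prime_over_def by blast
    then show "\<exists>p\<in>F \<union> G. p \<subseteq> q"
    proof
      assume "a \<in> q"
      then have "\<exists>p\<in>F. p \<subseteq> q" using q by (intro F(3) le) auto
      then show ?thesis by blast
    next
      assume "b \<in> q"
      then have "\<exists>p\<in>G. p \<subseteq> q" using q by (intro G(3) le) auto
      then show ?thesis by blast
    qed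
  qed
  then show False using Mbad by contradiction
qed

text \<open>Induction on the length: the last entries of the vectors in V form an ideal of A, and
  the vectors with last entry zero are shorter. Generators of this kernel together with lifts of
  generators of the ideal generate V.\<close>

lemma vectors_over_finitely_generated:
  assumes A: "subring A R" and N: "noetherian_over R A"
  shows "\<lbrakk>vectors_over R A V; \<And>v i. v \<in> V \<Longrightarrow> v i \<in> A; \<And>v i. v \<in> V \<Longrightarrow> i \<ge> n \<Longrightarrow> v i = \<zero>\<rbrakk> \<Longrightarrow>
    \<exists>S. finite S \<and> S \<subseteq> V \<and> (\<forall>W. vectors_over R A W \<and> S \<subseteq> W \<longrightarrow> V \<subseteq> W)"
proof (induction n arbitrary: V)
  case 0
  then have "V \<subseteq> {\<lambda>i. \<zero>}" by fastforce
  then show ?case by (intro exI[of _ "{}"]) (auto simp: vectors_over_def)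
next
  case (Suc n)
  note Ac = subsetD[OF subringE(1)[OF A]]
  note VA = Suc.prems(2)
  define lc where "lc V = (\<lambda>v. v n) ` V" for V :: "(nat \<Rightarrow> 'a) set"
  have lcsub: "submodule_over R A (lc W)" if W: "vectors_over R A W" for W
  proof (rule submodule_overI)
    show "lc W \<subseteq> carrier R" using W unfolding vectors_over_def lc_def by blast
    show "\<zero> \<in> lc W" using W unfolding vectors_over_def lc_def by (metis (no_types, lifting) imageI)
  next
    fix x y assume "x \<in> lc W" "y \<in> lc W"
    then obtain v w where vw: "v \<in> W" "w \<in> W" "x = v n" "y = w n" unfolding lc_def by blast
    then have "(\<lambda>i. v i \<oplus> w i) \<in> W" using vectors_overD(3)[OF W] by simp
    then show "x \<oplus> y \<in> lc W" using vw unfolding lc_def by force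
  next
    fix a x assume a: "a \<in> A" and "x \<in> lc W"
    then obtain v where v: "v \<in> W" "x = v n" unfolding lc_def by blast
    then have "(\<lambda>i. a \<otimes> v i) \<in> W" using vectors_overD(4)[OF W a] by simp
    then show "a \<otimes> x \<in> lc W" using v unfolding lc_def by force
  qed
  have lcA: "lc V \<subseteq> A" using VA unfolding lc_def by auto
  obtain T where T0: "finite T \<and> T \<subseteq> lc V \<and> (\<forall>J. submodule_over R A J \<and> T \<subseteq> J \<longrightarrow> lc V \<subseteq> J)"
    using noetherian_over_ex[OF N lcsub[OF Suc.prems(1)] lcA] by (rule exE)
  then have T: "finite T" "T \<subseteq> lc V" "\<And>J. submodule_over R A J \<Longrightarrow> T \<subseteq> J \<Longrightarrow> lc V \<subseteq> J"
    by simp_all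
  obtain T' where T': "finite T'" "T' \<subseteq> V" "T = (\<lambda>v. v n) ` T'"
    using finite_subset_image[OF T(1), of "\<lambda>v. v n" V] T(2) unfolding lc_def by auto
  define V0 where "V0 = {v \<in> V. v n = \<zero>}"
  have V0: "vectors_over R A V0"
    unfolding vectors_over_def
  proof (intro conjI ballI allI)
    show "(\<lambda>i. \<zero>) \<in> V0" using Suc.prems(1) by (auto simp: vectors_over_def V0_def)
    show "v i \<in> carrier R" if "v \<in> V0" for v i using that Suc.prems(1) by (auto simp: vectors_over_def V0_def)
    show "(\<lambda>i. v i \<oplus> w i) \<in> V0" if "v \<in> V0" "w \<in> V0" for v w
      using that Suc.prems(1) by (auto simp: vectors_over_def V0_def)
    show "(\<lambda>i. a \<otimes> v i) \<in> V0" if "a \<in> A" "v \<in> V0" for a v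
      using that Suc.prems(1) Ac by (auto simp: vectors_over_def V0_def)
  qed
  have "\<exists>S. finite S \<and> S \<subseteq> V0 \<and> (\<forall>W. vectors_over R A W \<and> S \<subseteq> W \<longrightarrow> V0 \<subseteq> W)"
  proof (rule Suc.IH[OF V0])
    show "v i \<in> A" if "v \<in> V0" for v i using that VA by (auto simp: V0_def)
    show "v i = \<zero>" if "v \<in> V0" "n \<le> i" for v i
      using that Suc.prems(3)[of v i] by (cases "i = n") (auto simp: V0_def)
  qed
  then obtain S where S0: "finite S \<and> S \<subseteq> V0 \<and> (\<forall>W. vectors_over R A W \<and> S \<subseteq> W \<longrightarrow> V0 \<subseteq> W)"
    by (rule exE)
  then have S: "finite S" "S \<subseteq> V0" "\<And>W. vectors_over R A W \<Longrightarrow> S \<subseteq> W \<Longrightarrow> V0 \<subseteq> W" by simp_all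
  have "V \<subseteq> W" if W: "vectors_over R A W" "S \<union> T' \<subseteq> W" for W
  proof
    fix v assume v: "v \<in> V"
    \<comment> \<open>The lift w is sought in V and W at once, so that v - w stays in V and
      therefore lies in the kernel \<open>V0\<close>.\<close>
    have VW: "vectors_over R A (V \<inter> W)" using Suc.prems(1) W(1) unfolding vectors_over_def by blast
    have "T \<subseteq> lc (V \<inter> W)" using W(2) T' unfolding lc_def by blast
    then have "lc V \<subseteq> lc (V \<inter> W)" using T(3)[OF lcsub[OF VW]] by blast
    then obtain w where w: "w \<in> V" "w \<in> W" "v n = w n" using v unfolding lc_def by blast
    have car: "v i \<in> carrier R" "w i \<in> carrier R" for i using v w VA Ac by blast+
    have m1: "\<ominus> \<one> \<in> A" using subringE(3,5)[OF A] by blast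
    have "(\<lambda>i. (\<ominus> \<one>) \<otimes> w i) \<in> V" using vectors_overD(4)[OF Suc.prems(1) m1 w(1)] .
    then have "(\<lambda>i. v i \<oplus> (\<ominus> \<one>) \<otimes> w i) \<in> V" by (rule vectors_overD(3)[OF Suc.prems(1) v])
    moreover have "v n \<oplus> (\<ominus> \<one>) \<otimes> w n = \<zero>" unfolding w(3) using car by algebra
    ultimately have "(\<lambda>i. v i \<oplus> (\<ominus> \<one>) \<otimes> w i) \<in> V0" unfolding V0_def by simp
    then have "(\<lambda>i. v i \<oplus> (\<ominus> \<one>) \<otimes> w i) \<in> W" using S(3)[OF W(1)] W(2) by auto
    from vectors_overD(3)[OF W(1) this w(2)]
    have "(\<lambda>i. (v i \<oplus> (\<ominus> \<one>) \<otimes> w i) \<oplus> w i) \<in> W" .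
    moreover have "(v i \<oplus> (\<ominus> \<one>) \<otimes> w i) \<oplus> w i = v i" for i using car[of i] by algebra
    ultimately show "v \<in> W" by simp
  qed
  moreover have "finite (S \<union> T')" "S \<union> T' \<subseteq> V" using S T' unfolding V0_def by auto
  ultimately show ?case by blast
qed

text \<open>The combinations of a list of generators form a module W in the sense of
  \<open>vectors_over\<close> that contains the generators, so the closure property puts V inside W.
  This is the place where coefficients become available.\<close>

lemma vectors_over_generators:
  assumes A: "subring A R" and N: "noetherian_over R A"
    and V: "vectors_over R A V" "\<And>v i. v \<in> V \<Longrightarrow> v i \<in> A" "\<And>v i. v \<in> V \<Longrightarrow> i \<ge> n \<Longrightarrow> v i = \<zero>"
  obtains m :: nat and g where "\<And>j. j < m \<Longrightarrow> g j \<in> V"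
    "\<And>v. v \<in> V \<Longrightarrow> \<exists>c\<in>{..<m} \<rightarrow> A. \<forall>i. v i = (\<Oplus>j\<in>{..<m}. c j \<otimes> g j i)"
proof -
  note Ac = subsetD[OF subringE(1)[OF A]]
  have "\<exists>S. finite S \<and> S \<subseteq> V \<and> (\<forall>W. vectors_over R A W \<and> S \<subseteq> W \<longrightarrow> V \<subseteq> W)"
    by (rule vectors_over_finitely_generated[OF A N V(1)]) (use V in auto)
  then obtain S where S0: "finite S \<and> S \<subseteq> V \<and> (\<forall>W. vectors_over R A W \<and> S \<subseteq> W \<longrightarrow> V \<subseteq> W)"
    by (rule exE)
  then have S: "finite S" "S \<subseteq> V" "\<And>W. vectors_over R A W \<Longrightarrow> S \<subseteq> W \<Longrightarrow> V \<subseteq> W" by simp_all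
  obtain xs where xs: "set xs = S" using finite_list[OF S(1)] by blast
  define m where "m = length xs"
  define g where "g j = xs ! j" for j
  have gS: "g ` {..<m} = S" using xs unfolding g_def m_def by (auto simp: in_set_conv_nth)
  have gc: "g j i \<in> carrier R" if "j < m" for j i
  proof -
    have "g j \<in> V" using that gS S(2) by blast
    then show ?thesis using V(1) unfolding vectors_over_def by blast
  qed
  define W where "W = {\<lambda>i. \<Oplus>j\<in>{..<m}. c j \<otimes> g j i |c. c \<in> {..<m} \<rightarrow> A}"
  have cg: "(\<lambda>j. c j \<otimes> g j i) \<in> {..<m} \<rightarrow> carrier R" if "c \<in> {..<m} \<rightarrow> A" for c i
  proof
    fix j assume j: "j \<in> {..<m}"
    then have "c j \<in> A" using that by blast
    then show "c j \<otimes> g j i \<in> carrier R" using j gc Ac by auto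
  qed
  have WI: "v \<in> W" if "c \<in> {..<m} \<rightarrow> A" "\<And>i. v i = (\<Oplus>j\<in>{..<m}. c j \<otimes> g j i)" for v c
    unfolding W_def using that by (intro CollectI exI[of _ c]) auto
  have W: "vectors_over R A W"
    unfolding vectors_over_def
  proof (intro conjI ballI allI)
    fix v i assume "v \<in> W" then show "v i \<in> carrier R" unfolding W_def using cg by (auto intro!: finsum_closed)
  next
    show "(\<lambda>i. \<zero>) \<in> W"
    proof (rule WI)
      show "(\<lambda>_. \<zero>) \<in> {..<m} \<rightarrow> A" using subringE(2)[OF A] by auto
      fix i
      have "(\<Oplus>j\<in>{..<m}. \<zero> \<otimes> g j i) = (\<Oplus>j\<in>{..<m}. \<zero>)"
        by (rule finsum_cong') (use gc in auto)
      then show "\<zero> = (\<Oplus>j\<in>{..<m}. \<zero> \<otimes> g j i)" by simp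
    qed
  next
    fix v w assume "v \<in> W" "w \<in> W"
    then obtain c d where c: "c \<in> {..<m} \<rightarrow> A" "v = (\<lambda>i. \<Oplus>j\<in>{..<m}. c j \<otimes> g j i)"
      and d: "d \<in> {..<m} \<rightarrow> A" "w = (\<lambda>i. \<Oplus>j\<in>{..<m}. d j \<otimes> g j i)" unfolding W_def by blast
    have cd: "(\<lambda>j. c j \<oplus> d j) \<in> {..<m} \<rightarrow> A" using c(1) d(1) subringE(7)[OF A] by blast
    have "v i \<oplus> w i = (\<Oplus>j\<in>{..<m}. (c j \<oplus> d j) \<otimes> g j i)" for i
    proof -
      have "v i \<oplus> w i = (\<Oplus>j\<in>{..<m}. c j \<otimes> g j i \<oplus> d j \<otimes> g j i)"
        unfolding c(2) d(2) using finsum_addf[OF cg[OF c(1)] cg[OF d(1)]] by simp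
      also have "\<dots> = (\<Oplus>j\<in>{..<m}. (c j \<oplus> d j) \<otimes> g j i)"
      proof (rule finsum_cong'[OF refl cg[OF cd]])
        fix j assume "j \<in> {..<m}"
        then have "c j \<in> carrier R" "d j \<in> carrier R" "g j i \<in> carrier R" using c d Ac gc by auto
        then show "c j \<otimes> g j i \<oplus> d j \<otimes> g j i = (c j \<oplus> d j) \<otimes> g j i" by algebra
      qed
      finally show ?thesis .
    qed
    then show "(\<lambda>i. v i \<oplus> w i) \<in> W" by (rule WI[OF cd])
  next
    fix a v assume a: "a \<in> A" and "v \<in> W"
    then obtain c where c: "c \<in> {..<m} \<rightarrow> A" "v = (\<lambda>i. \<Oplus>j\<in>{..<m}. c j \<otimes> g j i)" unfolding W_def by blast
    have ac: "(\<lambda>j. a \<otimes> c j) \<in> {..<m} \<rightarrow> A" using c(1) a subringE(6)[OF A] by blast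
    have "a \<otimes> v i = (\<Oplus>j\<in>{..<m}. (a \<otimes> c j) \<otimes> g j i)" for i
    proof -
      have "a \<otimes> v i = (\<Oplus>j\<in>{..<m}. a \<otimes> (c j \<otimes> g j i))"
        unfolding c(2) using finsum_rdistr[OF _ Ac[OF a] cg[OF c(1)]] by simp
      also have "\<dots> = (\<Oplus>j\<in>{..<m}. (a \<otimes> c j) \<otimes> g j i)"
      proof (rule finsum_cong'[OF refl cg[OF ac]])
        fix j assume "j \<in> {..<m}"
        then have "c j \<in> carrier R" "a \<in> carrier R" "g j i \<in> carrier R" using c a Ac gc by auto
        then show "a \<otimes> (c j \<otimes> g j i) = (a \<otimes> c j) \<otimes> g j i" by algebra
      qed
      finally show ?thesis .
    qed
    then show "(\<lambda>i. a \<otimes> v i) \<in> W" by (rule WI[OF ac])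
  qed
  have "S \<subseteq> W"
  proof
    fix v assume "v \<in> S"
    then obtain k where k: "k < m" "v = g k" using gS by auto
    define c where "c j = (if j = k then \<one> else \<zero>)" for j
    have "\<And>i. v i = (\<Oplus>j\<in>{..<m}. c j \<otimes> g j i)"
    proof -
      fix i
      have "(\<Oplus>j\<in>{..<m}. c j \<otimes> g j i) = (\<Oplus>j\<in>{..<m}. if k = j then g j i else \<zero>)"
        by (rule finsum_cong') (use gc in \<open>auto simp: c_def\<close>)
      also have "\<dots> = g k i" using add.finprod_singleton[of k "{..<m}" "\<lambda>j. g j i"] k gc by auto
      finally show "v i = (\<Oplus>j\<in>{..<m}. c j \<otimes> g j i)" using k by simp
    qed
    moreover have "c \<in> {..<m} \<rightarrow> A" using subringE(2,3)[OF A] by (auto simp: c_def)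
    ultimately show "v \<in> W" by (rule WI[rotated])
  qed
  then have VW: "V \<subseteq> W" using S(3)[OF W] by blast
  show ?thesis
  proof (rule that[of m g])
    show "g j \<in> V" if "j < m" for j using that gS S(2) by blast
    show "\<exists>c\<in>{..<m} \<rightarrow> A. \<forall>i. v i = (\<Oplus>j\<in>{..<m}. c j \<otimes> g j i)" if "v \<in> V" for v
      using that VW unfolding W_def by force
  qed
qed

end

context field
begin

text \<open>If \<open>x\<close> maps the maximal ideal \<open>\<mm>\<close> into itself, then \<open>Q[x] b \<subseteq> \<mm>\<close> is a Noetherian module, so
  \<open>x\<close> is integral over \<open>Q\<close>. Otherwise some \<open>x s\<close> with \<open>s \<in> \<mm>\<close> is a unit, and \<open>s\<close> generates \<open>\<mm>\<close>.\<close>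

lemma maximal_ideal_principal:
  assumes Q: "subring Q R" and N: "noetherian_over R Q"
    and loc: "submodule_over R Q (Q - units_in R Q)"
    and ic: "\<And>x n. x \<in> carrier R \<Longrightarrow> x [^] (n::nat) \<in> poly_values Q x n \<Longrightarrow> x \<in> Q"
    and x: "x \<in> carrier R" "x \<notin> Q" "\<And>a. a \<in> Q - units_in R Q \<Longrightarrow> x \<otimes> a \<in> Q"
    and b: "b \<in> Q - units_in R Q" "b \<noteq> \<zero>"
  shows "\<exists>t\<in>Q - units_in R Q. t \<noteq> \<zero> \<and> Q - units_in R Q = {t \<otimes> a |a. a \<in> Q}"
proof -
  define \<mm> where "\<mm> = Q - units_in R Q"
  note Oc = subsetD[OF subringE(1)[OF Q]]
  note m' = submodule_overD[OF loc[folded \<mm>_def]]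
  show ?thesis
  proof (cases "\<exists>s\<in>\<mm>. x \<otimes> s \<notin> \<mm>")
    case True
    then obtain s where s: "s \<in> \<mm>" "x \<otimes> s \<notin> \<mm>" by blast
    then have "x \<otimes> s \<in> units_in R Q" using x(3) unfolding \<mm>_def by blast
    then obtain w where w: "w \<in> Q" "x \<otimes> s \<otimes> w = \<one>" unfolding units_in_def by blast
    have car: "s \<in> carrier R" "w \<in> carrier R" using s w Oc m'(1) by auto
    have "s \<noteq> \<zero>" using w car x by auto
    moreover have "\<mm> = {s \<otimes> a |a. a \<in> Q}"
    proof (intro subset_antisym subsetI)
      fix a assume a: "a \<in> \<mm>"
      then have ac: "a \<in> carrier R" using m'(1) by blast
      have "a = \<one> \<otimes> a" using ac by simp
      also have "\<dots> = s \<otimes> (w \<otimes> (x \<otimes> a))" unfolding w(2)[symmetric] using car ac x(1) by algebra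
      finally have "a = s \<otimes> (w \<otimes> (x \<otimes> a))" .
      moreover have "w \<otimes> (x \<otimes> a) \<in> Q" using w x(3) a subringE(6)[OF Q] unfolding \<mm>_def by blast
      ultimately show "a \<in> {s \<otimes> a |a. a \<in> Q}" by blast
    next
      fix y assume "y \<in> {s \<otimes> a |a. a \<in> Q}"
      then obtain a where a: "a \<in> Q" "y = s \<otimes> a" by blast
      then have "y = a \<otimes> s" using car Oc by (simp add: m_comm)
      then show "y \<in> \<mm>" using m'(4) a s by blast
    qed
    ultimately show ?thesis using s unfolding \<mm>_def by blast
  next
    case False
    have bm: "b \<in> \<mm>" using b unfolding \<mm>_def by blast
    have bc: "b \<in> carrier R" using bm m'(1) by blast
    note sub = submodule_overD[OF poly_values_submodule[OF Q x(1)]]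
    have powm: "x [^] n \<otimes> b \<in> \<mm>" for n :: nat
    proof (induction n)
      case 0 then show ?case using bm bc by simp
    next
      case (Suc n)
      have "x [^] Suc n \<otimes> b = x \<otimes> (x [^] n \<otimes> b)" using x(1) bc by (simp add: m_ac)
      then show ?case using Suc False by simp
    qed
    have inO: "p \<otimes> b \<in> \<mm>" if "p \<in> poly_values Q x n" for n p
      using that
    proof (induction n arbitrary: p)
      case 0 then show ?case using m'(2) bc by simp
    next
      case (Suc n)
      then obtain c q where p: "p = c \<otimes> x [^] n \<oplus> q" "c \<in> Q" "q \<in> poly_values Q x n" by auto
      have "c \<in> carrier R" "q \<in> carrier R" "x [^] n \<in> carrier R" using p Oc sub(1) x(1) by auto
      then have "p \<otimes> b = c \<otimes> (x [^] n \<otimes> b) \<oplus> q \<otimes> b" unfolding p using bc by algebra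
      then show ?case using m'(3)[OF m'(4)[OF p(2) powm[of n]] Suc.IH[OF p(3)]] by simp
    qed
    define J where "J n = (\<lambda>p. p \<otimes> b) ` poly_values Q x n" for n
    have Jsub: "submodule_over R Q (J n)" for n
    proof (rule submodule_overI)
      show "J n \<subseteq> carrier R" using inO m'(1) unfolding J_def by blast
      have "\<zero> = \<zero> \<otimes> b" using bc by simp
      then show "\<zero> \<in> J n" using sub(2) unfolding J_def by blast
    next
      fix y z assume "y \<in> J n" "z \<in> J n"
      then obtain p q where pq: "p \<in> poly_values Q x n" "q \<in> poly_values Q x n" "y = p \<otimes> b" "z = q \<otimes> b"
        unfolding J_def by blast
      then have "y \<oplus> z = (p \<oplus> q) \<otimes> b" using sub(1) bc by (simp add: l_distr subset_iff)
      then show "y \<oplus> z \<in> J n" using sub(3)[OF pq(1,2)] unfolding J_def by blast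
    next
      fix a y assume a: "a \<in> Q" and "y \<in> J n"
      then obtain p where p: "p \<in> poly_values Q x n" "y = p \<otimes> b" unfolding J_def by blast
      then have "a \<otimes> y = (a \<otimes> p) \<otimes> b" using sub(1) bc a Oc by (simp add: m_assoc subset_iff)
      then show "a \<otimes> y \<in> J n" using sub(4)[OF a p(1)] unfolding J_def by blast
    qed
    have Jmono: "J m \<subseteq> J n" if "m \<le> n" for m n
      using poly_values_mono[OF Q x(1) that] unfolding J_def by blast
    have U: "submodule_over R Q (\<Union>n. J n)"
    proof (rule submodule_overI)
      show "(\<Union>n. J n) \<subseteq> carrier R" using submodule_overD(1)[OF Jsub] by blast
      show "\<zero> \<in> (\<Union>n. J n)" using submodule_overD(2)[OF Jsub] by blast
      show "a \<otimes> y \<in> (\<Union>n. J n)" if "a \<in> Q" "y \<in> (\<Union>n. J n)" for a y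
        using submodule_overD(4)[OF Jsub that(1)] that(2) by blast
      fix y z assume "y \<in> (\<Union>n. J n)" "z \<in> (\<Union>n. J n)"
      then obtain m n where "y \<in> J m" "z \<in> J n" by blast
      then have "y \<in> J (max m n)" "z \<in> J (max m n)" using Jmono[of m "max m n"] Jmono[of n "max m n"] by auto
      then show "y \<oplus> z \<in> (\<Union>n. J n)" using submodule_overD(3)[OF Jsub] by blast
    qed
    have UQ: "(\<Union>n. J n) \<subseteq> Q" using inO unfolding J_def \<mm>_def by blast
    obtain S where S0: "finite S \<and> S \<subseteq> (\<Union>n. J n) \<and> (\<forall>L. submodule_over R Q L \<and> S \<subseteq> L \<longrightarrow> (\<Union>n. J n) \<subseteq> L)"
      using noetherian_over_ex[OF N U UQ] by (rule exE)
    then have S: "finite S" "S \<subseteq> (\<Union>n. J n)" "\<And>L. submodule_over R Q L \<Longrightarrow> S \<subseteq> L \<Longrightarrow> (\<Union>n. J n) \<subseteq> L"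
      by simp_all
    have "\<exists>n. S \<subseteq> J n"
      using S(1,2)
    proof (induction S)
      case (insert y F)
      then obtain m n where "F \<subseteq> J m" "y \<in> J n" by blast
      then have "insert y F \<subseteq> J (max m n)" using Jmono[of m "max m n"] Jmono[of n "max m n"] by auto
      then show ?case by blast
    qed simp
    then obtain n where "S \<subseteq> J n" by blast
    then have JU: "(\<Union>n. J n) \<subseteq> J n" using S(3)[OF Jsub] by blast
    \<comment> \<open>The chain \<open>J\<close> is constant from n on, so
      \<open>x [^] n \<otimes> b\<close> lies in \<open>J n\<close>; cancelling b writes
      \<open>x [^] n\<close> through lower powers, which is the monic equation that
      \<open>ic\<close> asks for.\<close>
    have "x [^] n = \<one> \<otimes> x [^] n \<oplus> \<zero>" using x(1) by simp
    then have "x [^] n \<in> poly_values Q x (Suc n)"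
      unfolding poly_values.simps using sub(2)[of n] subringE(3)[OF Q] by blast
    then have "x [^] n \<otimes> b \<in> J (Suc n)" unfolding J_def by blast
    then have "x [^] n \<otimes> b \<in> J n" using JU by blast
    then obtain p where p: "p \<in> poly_values Q x n" "x [^] n \<otimes> b = p \<otimes> b" unfolding J_def by blast
    then have "x [^] n = p" using m_rcancel[OF b(2) bc] x(1) sub(1) by (simp add: subset_iff)
    then have "x [^] n \<in> poly_values Q x n" using p(1) by (simp only:)
    then have "x \<in> Q" by (rule ic[OF x(1)])
    then show ?thesis using x(2) by contradiction
  qed
qed

end

section \<open>Discrete valuations\<close>

lemma int_pow_nonneg: "0 \<le> n \<Longrightarrow> x [^]\<^bsub>G\<^esub> (n::int) = x [^]\<^bsub>G\<^esub> nat n"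
  by (subst int_pow_def2) simp

lemma int_pow_negative: "n < 0 \<Longrightarrow> x [^]\<^bsub>G\<^esub> (n::int) = inv\<^bsub>G\<^esub> (x [^]\<^bsub>G\<^esub> nat (- n))"
  by (subst int_pow_def2) simp

context field
begin

text \<open>Integer powers of a nonzero field element are powers in the group of units, where the
  power laws for groups apply.\<close>

lemma int_pow_units_of:
  assumes "x \<in> Units R"
  shows "x [^]\<^bsub>units_of R\<^esub> (n::int) = x [^] n"
proof (cases "0 \<le> n")
  case True
  then show ?thesis using units_of_pow[OF assms] by (simp only: int_pow_nonneg)
next
  case False
  then have n: "n < 0" by simp
  show ?thesis
    unfolding int_pow_negative[OF n] units_of_pow[OF assms]
    by (rule units_of_inv[OF Units_pow_closed[OF assms]])
qed

lemma int_pow_nonzero: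
  assumes "x \<in> carrier R" "x \<noteq> \<zero>"
  shows "x [^] (n::int) \<in> carrier R" "x [^] n \<noteq> \<zero>"
proof -
  have u: "x \<in> Units R" using assms field_Units by simp
  interpret G: group "units_of R" by (rule units_group)
  have x: "x \<in> carrier (units_of R)" using u by (simp add: units_of_carrier)
  have "x [^]\<^bsub>units_of R\<^esub> n \<in> carrier (units_of R)" by (rule G.int_pow_closed[OF x])
  then have "x [^] n \<in> Units R" by (simp add: int_pow_units_of[OF u] units_of_carrier)
  then show "x [^] (n::int) \<in> carrier R" "x [^] n \<noteq> \<zero>" using field_Units by simp_all
qed

lemma int_pow_add:
  assumes "x \<in> carrier R" "x \<noteq> \<zero>"
  shows "x [^] (m + n :: int) = x [^] m \<otimes> x [^] n"
proof -
  have u: "x \<in> Units R" using assms field_Units by simp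
  interpret G: group "units_of R" by (rule units_group)
  have x: "x \<in> carrier (units_of R)" using u by (simp add: units_of_carrier)
  show ?thesis using G.int_pow_mult[OF x, of m n] by (simp add: int_pow_units_of[OF u] units_of_mult)
qed

lemma int_pow_mult_distrib_field:
  assumes "x \<in> carrier R" "x \<noteq> \<zero>" "y \<in> carrier R" "y \<noteq> \<zero>"
  shows "(x \<otimes> y) [^] (n :: int) = x [^] n \<otimes> y [^] n"
proof -
  have u: "x \<in> Units R" "y \<in> Units R" "x \<otimes> y \<in> Units R" using assms field_Units integral_iff by auto
  interpret G: group "units_of R" by (rule units_group)
  have x: "x \<in> carrier (units_of R)" "y \<in> carrier (units_of R)" using u by (simp_all add: units_of_carrier)
  have "x \<otimes>\<^bsub>units_of R\<^esub> y = y \<otimes>\<^bsub>units_of R\<^esub> x" using m_comm[OF assms(1,3)] by (simp only: units_of_mult)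
  from G.int_pow_mult_distrib[OF this x, of n] show ?thesis
    by (simp only: int_pow_units_of[OF u(1)] int_pow_units_of[OF u(2)] int_pow_units_of[OF u(3)] units_of_mult)
qed

lemma units_in_facts:
  assumes Q: "subring Q R"
  shows "\<And>u. u \<in> units_in R Q \<Longrightarrow> u \<in> Q \<and> u \<in> carrier R \<and> u \<noteq> \<zero> \<and> inv u \<in> units_in R Q"
    "\<And>u w. u \<in> units_in R Q \<Longrightarrow> w \<in> units_in R Q \<Longrightarrow> u \<otimes> w \<in> units_in R Q"
    "\<one> \<in> units_in R Q"
    "\<And>u n. u \<in> units_in R Q \<Longrightarrow> u [^] (n::int) \<in> units_in R Q"
proof -
  note Qc = subsetD[OF subringE(1)[OF Q]]
  show 1: "u \<in> Q \<and> u \<in> carrier R \<and> u \<noteq> \<zero> \<and> inv u \<in> units_in R Q" if u: "u \<in> units_in R Q" for u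
  proof -
    obtain w where w: "u \<in> Q" "w \<in> Q" "u \<otimes> w = \<one>" using u unfolding units_in_def by blast
    have c: "u \<in> carrier R" "w \<in> carrier R" using w Qc by auto
    have inv: "inv u = w" by (rule comm_inv_char[OF c w(3)])
    have "w \<otimes> u = \<one>" using w(3) m_comm[OF c] by simp
    then have "w \<in> units_in R Q" using w(1,2) unfolding units_in_def by blast
    moreover have "u \<noteq> \<zero>" using w(3) c(2) by auto
    ultimately show ?thesis using w(1) c(1) inv by simp
  qed
  show 2: "u \<otimes> w \<in> units_in R Q" if uw: "u \<in> units_in R Q" "w \<in> units_in R Q" for u w
  proof -
    obtain u' w' where *: "u \<in> Q" "u' \<in> Q" "u \<otimes> u' = \<one>" "w \<in> Q" "w' \<in> Q" "w \<otimes> w' = \<one>"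
      using uw unfolding units_in_def by blast
    have c: "u \<in> carrier R" "w \<in> carrier R" "u' \<in> carrier R" "w' \<in> carrier R" using * Qc by auto
    have "(u \<otimes> w) \<otimes> (u' \<otimes> w') = (u \<otimes> u') \<otimes> (w \<otimes> w')" using c by algebra
    then have "(u \<otimes> w) \<otimes> (u' \<otimes> w') = \<one>" using * by simp
    then show ?thesis using subringE(6)[OF Q *(1,4)] subringE(6)[OF Q *(2,5)] unfolding units_in_def by blast
  qed
  show 3: "\<one> \<in> units_in R Q" using subringE(3)[OF Q] unfolding units_in_def by (intro CollectI conjI bexI[of _ \<one>]) simp_all
  have 4: "u [^] (n::nat) \<in> units_in R Q" if "u \<in> units_in R Q" for u n
  proof (induction n)
    case 0 show ?case using 3 by simp
  next
    case (Suc n) show ?case using 2[OF Suc that] by simp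
  qed
  show "u [^] (n::int) \<in> units_in R Q" if "u \<in> units_in R Q" for u n
  proof (cases "0 \<le> n")
    case True
    show ?thesis using 4[OF that, of "nat n"] unfolding int_pow_nonneg[OF True] .
  next
    case False
    then have n: "n < 0" by simp
    show ?thesis using 1[OF 4[OF that, of "nat (- n)"]] unfolding int_pow_negative[OF n] by blast
  qed
qed

text \<open>Every nonzero element of Q is a unit times a power of t: a counterexample b with b Q
  maximal is a nonunit, so b = t c, and c is a counterexample with a strictly larger ideal. The
  second property allows every generator t' of the maximal ideal because \<open>ord\<close> is
  defined without fixing a uniformizer.\<close>

lemma dvr_valuation:
  assumes Q: "subring Q R" and N: "noetherian_over R Q"
    and t: "t \<in> Q - units_in R Q" "t \<noteq> \<zero>" "Q - units_in R Q = {t \<otimes> a |a. a \<in> Q}"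
    and frac: "\<And>f. f \<in> carrier R \<Longrightarrow> \<exists>a\<in>Q. \<exists>b\<in>Q. b \<noteq> \<zero> \<and> b \<otimes> f = a"
  obtains v :: "'a \<Rightarrow> int" where
    "\<And>f. f \<in> carrier R \<Longrightarrow> f \<noteq> \<zero> \<Longrightarrow> \<exists>u\<in>units_in R Q. f = u \<otimes> t [^] v f"
    "\<And>t' u n. t' \<in> Q \<Longrightarrow> Q - units_in R Q = {t' \<otimes> a |a. a \<in> Q} \<Longrightarrow> u \<in> units_in R Q \<Longrightarrow> v (u \<otimes> t' [^] n) = n"
    "\<And>f g. f \<in> carrier R \<Longrightarrow> f \<noteq> \<zero> \<Longrightarrow> g \<in> carrier R \<Longrightarrow> g \<noteq> \<zero> \<Longrightarrow> v (f \<otimes> g) = v f + v g"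
    "\<And>f g. f \<in> carrier R \<Longrightarrow> f \<noteq> \<zero> \<Longrightarrow> g \<in> carrier R \<Longrightarrow> g \<noteq> \<zero> \<Longrightarrow> f \<oplus> g \<noteq> \<zero> \<Longrightarrow>
       min (v f) (v g) \<le> v (f \<oplus> g)"
    "\<And>f. f \<in> carrier R \<Longrightarrow> f \<noteq> \<zero> \<Longrightarrow> 0 \<le> v f \<longleftrightarrow> f \<in> Q"
    "\<And>f. f \<in> carrier R \<Longrightarrow> f \<noteq> \<zero> \<Longrightarrow> 1 \<le> v f \<longleftrightarrow> f \<in> Q - units_in R Q"
proof -
  define U where "U = units_in R Q"
  note Qc = subsetD[OF subringE(1)[OF Q]]
  note U = units_in_facts[OF Q, folded U_def]
  have UQ: "U \<subseteq> Q" unfolding U_def units_in_def by blast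
  have tQ: "t \<in> Q" and tc: "t \<in> carrier R" using t Qc by auto
  note tp = int_pow_nonzero[OF tc t(2)]
  note tadd = int_pow_add[OF tc t(2)]
  have tpow: "t [^] (n::nat) \<in> Q" for n
    using subringE(3,6)[OF Q] tQ by (induction n) auto
  have tnn: "t [^] n \<in> Q" if "0 \<le> n" for n :: int using tpow[of "nat n"] unfolding int_pow_nonneg[OF that] .
  have nonU: "t \<otimes> a \<notin> U" if "a \<in> Q" for a using t(3) that unfolding U_def by blast
  have decQ: "\<exists>n::nat. \<exists>u\<in>U. a = u \<otimes> t [^] n" if a: "a \<in> Q" "a \<noteq> \<zero>" for a
  proof (rule ccontr)
    assume bad: "\<not> (\<exists>n::nat. \<exists>u\<in>U. a = u \<otimes> t [^] n)"
    define P where "P a = {a \<otimes> r |r. r \<in> Q}" for a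
    define B where "B = {a \<in> Q. a \<noteq> \<zero> \<and> \<not> (\<exists>n::nat. \<exists>u\<in>U. a = u \<otimes> t [^] n)}"
    have Psub: "submodule_over R Q (P a) \<and> P a \<subseteq> Q" if a: "a \<in> Q" for a
    proof (intro conjI submodule_overI)
      show PQ: "P a \<subseteq> Q" using subringE(6)[OF Q a] unfolding P_def by blast
      then show "P a \<subseteq> carrier R" using Qc by blast
      have "\<zero> = a \<otimes> \<zero>" using Qc[OF a] by simp
      then show "\<zero> \<in> P a" using subringE(2)[OF Q] unfolding P_def by blast
    next
      fix x y assume "x \<in> P a" "y \<in> P a"
      then obtain r s where *: "r \<in> Q" "s \<in> Q" "x = a \<otimes> r" "y = a \<otimes> s" unfolding P_def by blast
      then have "x \<oplus> y = a \<otimes> (r \<oplus> s)" using Qc a by (simp add: r_distr)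
      then show "x \<oplus> y \<in> P a" using subringE(7)[OF Q *(1,2)] unfolding P_def by blast
    next
      fix c x assume c: "c \<in> Q" and "x \<in> P a"
      then obtain r where *: "r \<in> Q" "x = a \<otimes> r" unfolding P_def by blast
      then have "c \<otimes> x = a \<otimes> (c \<otimes> r)" using Qc a c by (simp add: m_lcomm)
      then show "c \<otimes> x \<in> P a" using subringE(6)[OF Q c *(1)] unfolding P_def by blast
    qed
    have "P ` B \<noteq> {}" using a bad unfolding B_def by blast
    then have "\<exists>M\<in>P ` B. \<forall>I\<in>P ` B. M \<subseteq> I \<longrightarrow> I = M"
      by (rule noetherian_over_maximal[OF N]) (use Psub in \<open>auto simp: B_def\<close>)
    then obtain b where b: "b \<in> B" and max: "\<And>c. c \<in> B \<Longrightarrow> P b \<subseteq> P c \<Longrightarrow> P c = P b" by auto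
    have bQ: "b \<in> Q" "b \<noteq> \<zero>" using b unfolding B_def by auto
    have "b \<notin> U"
    proof
      assume "b \<in> U"
      moreover have "b = b \<otimes> t [^] (0::nat)" using Qc bQ by simp
      ultimately show False using b unfolding B_def by blast
    qed
    then have "b \<in> Q - units_in R Q" using bQ unfolding U_def by blast
    then obtain c where c: "c \<in> Q" "b = t \<otimes> c" unfolding t(3) by blast
    have cc: "c \<in> carrier R" "c \<noteq> \<zero>" using c Qc bQ tc by auto
    have cB: "c \<in> B"
    proof (rule ccontr)
      assume "c \<notin> B"
      then obtain n :: nat and u where u: "u \<in> U" "c = u \<otimes> t [^] n" using c cc unfolding B_def by blast
      then have "b = u \<otimes> t [^] Suc n" using U(1)[OF u(1)] tc c by (simp add: m_ac)
      then show False using b u unfolding B_def by blast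
    qed
    have "P b \<subseteq> P c"
    proof
      fix x assume "x \<in> P b"
      then obtain r where r: "r \<in> Q" "x = b \<otimes> r" unfolding P_def by blast
      then have "x = c \<otimes> (t \<otimes> r)" using c cc tc Qc by (simp add: m_ac)
      then show "x \<in> P c" using subringE(6)[OF Q tQ r(1)] unfolding P_def by blast
    qed
    then have "P c = P b" using max cB by blast
    moreover have "c = c \<otimes> \<one>" using cc by simp
    then have "c \<in> P c" using subringE(3)[OF Q] unfolding P_def by blast
    ultimately obtain r where r: "r \<in> Q" "c = b \<otimes> r" unfolding P_def by blast
    then have "c \<otimes> (t \<otimes> r) = c \<otimes> \<one>" using c cc tc Qc by (simp add: m_ac)
    then have "t \<otimes> r = \<one>" using m_lcancel[OF cc(2,1)] tc Qc r by auto
    then show False using nonU[OF r(1)] U(3) by simp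
  qed
  have dec: "\<exists>n::int. \<exists>u\<in>U. f = u \<otimes> t [^] n" if f: "f \<in> carrier R" "f \<noteq> \<zero>" for f
  proof -
    obtain a b where ab: "a \<in> Q" "b \<in> Q" "b \<noteq> \<zero>" "b \<otimes> f = a" using frac[OF f(1)] by blast
    have bc: "b \<in> carrier R" using ab Qc by blast
    have "a \<noteq> \<zero>" using ab f bc integral_iff by auto
    then obtain m u where u: "u \<in> U" "a = u \<otimes> t [^] (m::nat)" using decQ[OF ab(1)] by blast
    obtain n w where w: "w \<in> U" "b = w \<otimes> t [^] (n::nat)" using decQ[OF ab(2,3)] by blast
    have c: "u \<in> carrier R" "w \<in> carrier R" "inv w \<in> U" "inv w \<in> carrier R" "w \<noteq> \<zero>"
      using U(1)[OF u(1)] U(1)[OF w(1)] U(1) by auto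
    have ww: "w \<otimes> inv w = \<one>" using c field_Units by (intro Units_r_inv) auto
    let ?g = "(u \<otimes> inv w) \<otimes> t [^] (int m - int n)"
    have tpc: "t [^] (int m - int n) \<in> carrier R" "t [^] int n \<in> carrier R" using tp by auto
    have "b \<otimes> ?g = (w \<otimes> inv w) \<otimes> u \<otimes> (t [^] int n \<otimes> t [^] (int m - int n))"
      unfolding w(2) int_pow_int[symmetric] using c tpc by algebra
    also have "t [^] int n \<otimes> t [^] (int m - int n) = t [^] int m" using tadd[of "int n" "int m - int n"] by simp
    also have "(w \<otimes> inv w) \<otimes> u \<otimes> t [^] int m = a" unfolding ww u(2) int_pow_int using c tc by simp
    finally have "b \<otimes> ?g = b \<otimes> f" using ab by simp
    then have "?g = f" using m_lcancel[OF ab(3) bc] f c tpc by auto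
    then show ?thesis using U(2)[OF u(1) c(3)] by blast
  qed
  \<comment> \<open>Cancelling \<open>t [^] m\<close> would exhibit the unit u as a multiple of
    t.\<close>
  have less: "u \<otimes> t [^] m \<noteq> w \<otimes> t [^] n" if "u \<in> U" "w \<in> U" "m < n" for u w and m n :: int
  proof
    assume eq: "u \<otimes> t [^] m = w \<otimes> t [^] n"
    have c: "u \<in> carrier R" "w \<in> carrier R" "w \<in> Q" using U(1) that by auto
    define k where "k = n - m - 1"
    have k: "k \<ge> 0" "n = m + (1 + k)" using that unfolding k_def by auto
    have tpc: "t [^] m \<in> carrier R" "t [^] k \<in> carrier R" using tp by auto
    have t1: "t [^] (1::int) = t" using int_pow_int[of R t 1] tc by simp
    have "t [^] m \<otimes> u = t [^] m \<otimes> (t \<otimes> (w \<otimes> t [^] k))"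
    proof -
      have "t [^] m \<otimes> u = w \<otimes> t [^] n" using eq c tpc m_comm by simp
      also have "t [^] n = t [^] m \<otimes> (t \<otimes> t [^] k)" unfolding k(2) tadd t1 by simp
      also have "w \<otimes> (t [^] m \<otimes> (t \<otimes> t [^] k)) = t [^] m \<otimes> (t \<otimes> (w \<otimes> t [^] k))"
        using c tpc tc by algebra
      finally show ?thesis .
    qed
    then have "u = t \<otimes> (w \<otimes> t [^] k)" using m_lcancel[OF tp(2)[of m] tpc(1)] c tpc tc by auto
    moreover have "w \<otimes> t [^] k \<in> Q" using subringE(6)[OF Q c(3) tnn[OF k(1)]] .
    ultimately show False using nonU that by auto
  qed
  have uniq: "m = n" if "u \<in> U" "w \<in> U" "u \<otimes> t [^] m = w \<otimes> t [^] n" for u w and m n :: int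
    using less[of u w m n] less[of w u n m] that by (cases m n rule: linorder_cases) auto
  define v where "v f = (THE n::int. \<exists>u\<in>U. f = u \<otimes> t [^] n)" for f
  have veq: "v f = n" if "u \<in> U" "f = u \<otimes> t [^] n" for u f n
    unfolding v_def using that uniq by (intro the_equality) blast+
  have v1: "\<exists>u\<in>U. f = u \<otimes> t [^] v f" if f: "f \<in> carrier R" "f \<noteq> \<zero>" for f
  proof -
    obtain n :: int and u where u: "u \<in> U" "f = u \<otimes> t [^] n" using dec[OF f] by blast
    then show ?thesis using veq[OF u] by (intro bexI[of _ u]) simp_all
  qed
  have vmult: "v (f \<otimes> g) = v f + v g" if fg0: "f \<in> carrier R" "f \<noteq> \<zero>" "g \<in> carrier R" "g \<noteq> \<zero>" for f g
  proof -
    obtain u where u: "u \<in> U" "f = u \<otimes> t [^] v f" using v1[OF fg0(1,2)] by blast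
    obtain w where w: "w \<in> U" "g = w \<otimes> t [^] v g" using v1[OF fg0(3,4)] by blast
    have c: "u \<in> carrier R" "w \<in> carrier R" "t [^] v f \<in> carrier R" "t [^] v g \<in> carrier R"
      using U(1) u w tp by auto
    have "f \<otimes> g = (u \<otimes> t [^] v f) \<otimes> (w \<otimes> t [^] v g)" using u(2) w(2) by simp
    also have "\<dots> = (u \<otimes> w) \<otimes> (t [^] v f \<otimes> t [^] v g)" using c by algebra
    also have "\<dots> = (u \<otimes> w) \<otimes> t [^] (v f + v g)" unfolding tadd ..
    finally show ?thesis by (rule veq[OF U(2)[OF u(1) w(1)]])
  qed
  have v0: "0 \<le> v f \<longleftrightarrow> f \<in> Q" if f: "f \<in> carrier R" "f \<noteq> \<zero>" for f
  proof
    assume "0 \<le> v f"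
    obtain u where u: "u \<in> U" "f = u \<otimes> t [^] v f" using v1[OF f] by blast
    then have "u \<in> Q" using U(1) by blast
    then have "u \<otimes> t [^] v f \<in> Q" using subringE(6)[OF Q _ tnn[OF \<open>0 \<le> v f\<close>]] by blast
    then show "f \<in> Q" using u(2) by simp
  next
    assume "f \<in> Q"
    then obtain n u where "u \<in> U" "f = u \<otimes> t [^] (n::nat)" using decQ f by blast
    then have "v f = int n" using veq[of u f "int n"] by (simp add: int_pow_int)
    then show "0 \<le> v f" by simp
  qed
  have vn1: "1 \<le> v f \<longleftrightarrow> f \<in> Q - units_in R Q" if f: "f \<in> carrier R" "f \<noteq> \<zero>" for f
  proof -
    obtain u where u: "u \<in> U" "f = u \<otimes> t [^] v f" using v1[OF f] by blast
    have uc: "u \<in> carrier R" "u \<in> Q" using U(1)[OF u(1)] by auto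
    have z: "v f = 0 \<longleftrightarrow> f \<in> U"
    proof
      assume "v f = 0" then show "f \<in> U" using u uc by simp
    next
      assume "f \<in> U"
      moreover have "f = f \<otimes> t [^] (0::int)" using f by simp
      ultimately show "v f = 0" by (rule veq)
    qed
    have "1 \<le> v f \<longleftrightarrow> 0 \<le> v f \<and> v f \<noteq> 0" by auto
    then show ?thesis using v0[OF f] z unfolding U_def by blast
  qed
  \<comment> \<open>Factoring out the smaller power of t leaves an element of Q, whose valuation is
    nonnegative; \<open>vadd\<close> then follows by symmetry.\<close>
  have aux: "v f \<le> v (f \<oplus> g)" if fg0: "f \<in> carrier R" "f \<noteq> \<zero>" "g \<in> carrier R" "g \<noteq> \<zero>" "f \<oplus> g \<noteq> \<zero>" "v f \<le> v g" for f g
  proof -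
    obtain u where u: "u \<in> U" "f = u \<otimes> t [^] v f" using v1[OF fg0(1,2)] by blast
    obtain w where w: "w \<in> U" "g = w \<otimes> t [^] v g" using v1[OF fg0(3,4)] by blast
    define k where "k = v g - v f"
    have k: "0 \<le> k" "v g = v f + k" using that unfolding k_def by auto
    have c: "u \<in> carrier R" "w \<in> carrier R" "t [^] v f \<in> carrier R" "t [^] k \<in> carrier R" "u \<in> Q" "w \<in> Q"
      using U(1)[OF u(1)] U(1)[OF w(1)] tp by auto
    let ?h = "u \<oplus> w \<otimes> t [^] k"
    have hQ: "?h \<in> Q" using subringE(7)[OF Q c(5) subringE(6)[OF Q c(6) tnn[OF k(1)]]] .
    have "f \<oplus> g = (u \<otimes> t [^] v f) \<oplus> (w \<otimes> t [^] v g)" using u(2) w(2) by simp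
    also have "\<dots> = t [^] v f \<otimes> ?h" unfolding k(2) tadd using c by algebra
    finally have fg: "f \<oplus> g = t [^] v f \<otimes> ?h" .
    have hn: "?h \<noteq> \<zero>" using fg that(5) c by auto
    have "v (t [^] v f) = v f" using veq[OF U(3), of "t [^] v f" "v f"] c by simp
    then have "v (f \<oplus> g) = v f + v ?h" unfolding fg using vmult[OF c(3) tp(2) _ hn] Qc[OF hQ] by simp
    then show ?thesis using v0[OF Qc[OF hQ] hn] hQ by simp
  qed
  have vadd: "min (v f) (v g) \<le> v (f \<oplus> g)"
    if "f \<in> carrier R" "f \<noteq> \<zero>" "g \<in> carrier R" "g \<noteq> \<zero>" "f \<oplus> g \<noteq> \<zero>" for f g
  proof (cases "v f \<le> v g")
    case True then show ?thesis using aux[OF that] by simp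
  next
    case False
    then have "v g \<le> v (g \<oplus> f)" using aux[OF that(3,4,1,2)] that a_comm by simp
    then show ?thesis using a_comm that by (simp add: min_def)
  qed
  \<comment> \<open>Two generators of the maximal ideal differ by a unit a, so
    \<open>t' [^] n\<close> is \<open>a [^] n\<close> times \<open>t [^] n\<close>, and the exponent
    is unchanged.\<close>
  have vt': "v (u \<otimes> t' [^] n) = n"
    if t': "t' \<in> Q" "Q - units_in R Q = {t' \<otimes> a |a. a \<in> Q}" and u: "u \<in> units_in R Q" for t' u n
  proof -
    have "t' = t' \<otimes> \<one>" using Qc t' by simp
    then have "t' \<in> Q - units_in R Q" using subringE(3)[OF Q] unfolding t'(2) by blast
    then obtain a where a: "a \<in> Q" "t' = t \<otimes> a" unfolding t(3) by blast
    have "t \<in> {t' \<otimes> a |a. a \<in> Q}" using t(1) t'(2) by simp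
    then obtain b where b: "b \<in> Q" "t = t' \<otimes> b" by blast
    have c: "a \<in> carrier R" "b \<in> carrier R" using a b Qc by auto
    have "t \<otimes> (a \<otimes> b) = t' \<otimes> b" unfolding a(2) using c tc by algebra
    then have "t \<otimes> (a \<otimes> b) = t \<otimes> \<one>" using b(2) tc by simp
    then have "a \<otimes> b = \<one>" using m_lcancel[OF t(2) tc] c by auto
    then have aU: "a \<in> U" using a b unfolding U_def units_in_def by blast
    have an: "a \<noteq> \<zero>" using U(1)[OF aU] by blast
    have pc: "a [^] n \<in> carrier R" "t [^] n \<in> carrier R" "u \<in> carrier R"
      using int_pow_nonzero[OF c(1) an] tp U(1) u unfolding U_def by auto
    have "t' [^] n = t [^] n \<otimes> a [^] n" unfolding a(2) by (rule int_pow_mult_distrib_field[OF tc t(2) c(1) an])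
    then have "u \<otimes> t' [^] n = (u \<otimes> a [^] n) \<otimes> t [^] n" using pc by (simp add: m_ac)
    then show ?thesis by (rule veq[OF U(2)[OF u[folded U_def] U(4)[OF aU]]])
  qed
  show ?thesis by (rule that[of v, OF v1[unfolded U_def] vt' vmult vadd v0 vn1])
qed

end

section \<open>Stalks and localizations\<close>

context ringed_space
begin

abbreviation open_set :: "'x set \<Rightarrow> bool" where "open_set \<equiv> openin (topol \<XX>)"

lemma germ_self:
  assumes "open_set U" "x \<in> U" "s \<in> carrier (sections \<XX> U)"
  shows "(U, s) \<in> germ \<XX> x U s"
  using assms unfolding germ_def by blast

lemma restr_closed:
  assumes "open_set U" "open_set V" "V \<subseteq> U" "s \<in> carrier (sections \<XX> U)"
  shows "restr \<XX> U V s \<in> carrier (sections \<XX> V)"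
  by (rule ring_hom_closed[OF restr_hom[OF assms(1-3)] assms(4)])

lemma germ_subset:
  assumes U: "open_set U" "s \<in> carrier (sections \<XX> U)" and V: "open_set V" "t \<in> carrier (sections \<XX> V)"
    and W: "open_set W" "x \<in> W" "W \<subseteq> U" "W \<subseteq> V" "restr \<XX> U W s = restr \<XX> V W t"
  shows "germ \<XX> x U s \<subseteq> germ \<XX> x V t"
proof
  fix z assume "z \<in> germ \<XX> x U s"
  then obtain V' t' W' where z: "z = (V', t')" "open_set V'" "x \<in> V'" "t' \<in> carrier (sections \<XX> V')"
    and W': "open_set W'" "x \<in> W'" "W' \<subseteq> U \<inter> V'" "restr \<XX> U W' s = restr \<XX> V' W' t'"
    unfolding germ_def by blast
  let ?W = "W \<inter> W'"
  have o: "open_set ?W" using W W' by blast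
  have "restr \<XX> V ?W t = restr \<XX> W ?W (restr \<XX> V W t)"
    using restr_comp[OF V(1) W(1) o _ W(4) V(2)] by simp
  also have "\<dots> = restr \<XX> U ?W s" unfolding W(5)[symmetric] using restr_comp[OF U(1) W(1) o _ W(3) U(2)] by simp
  also have "\<dots> = restr \<XX> W' ?W (restr \<XX> U W' s)" using restr_comp[OF U(1) W'(1) o _ _ U(2)] W'(3) by simp
  also have "\<dots> = restr \<XX> V' ?W t'" unfolding W'(4) using restr_comp[OF z(2) W'(1) o _ _ z(4)] W'(3) by simp
  finally have eq: "restr \<XX> V ?W t = restr \<XX> V' ?W t'" .
  have "?W \<subseteq> V \<inter> V'" "x \<in> ?W" using W W' by auto
  then show "z \<in> germ \<XX> x V t" unfolding germ_def z(1) using z o eq by blast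
qed

lemma germ_eqI:
  assumes U: "open_set U" "s \<in> carrier (sections \<XX> U)" and V: "open_set V" "t \<in> carrier (sections \<XX> V)"
    and W: "open_set W" "x \<in> W" "W \<subseteq> U" "W \<subseteq> V" "restr \<XX> U W s = restr \<XX> V W t"
  shows "germ \<XX> x U s = germ \<XX> x V t"
  using germ_subset[OF assms] germ_subset[OF V U W(1,2,4,3) W(5)[symmetric]] by (rule subset_antisym)

lemma germ_eqD:
  assumes "germ \<XX> x U s = germ \<XX> x V t" "open_set V" "x \<in> V" "t \<in> carrier (sections \<XX> V)"
  shows "\<exists>W. open_set W \<and> x \<in> W \<and> W \<subseteq> U \<inter> V \<and> restr \<XX> U W s = restr \<XX> V W t"
proof -
  have "(V, t) \<in> germ \<XX> x U s" using germ_self[OF assms(2-4)] assms(1) by simp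
  then show ?thesis unfolding germ_def by simp
qed

lemma germ_restr:
  assumes "open_set U" "open_set V" "V \<subseteq> U" "x \<in> V" "s \<in> carrier (sections \<XX> U)"
  shows "germ \<XX> x V (restr \<XX> U V s) = germ \<XX> x U s"
proof (rule germ_eqI[OF assms(2) restr_closed[OF assms(1-3,5)] assms(1,5) assms(2,4) subset_refl assms(3)])
  show "restr \<XX> V V (restr \<XX> U V s) = restr \<XX> U V s" by (rule restr_id[OF assms(2) restr_closed[OF assms(1-3,5)]])
qed

text \<open>The operations of \<open>stalk\<close> are unions over all pairs of representatives. All
  members of such a union agree after restriction to a common neighbourhood of x, so the union is a
  single germ. Sum and product are treated at once through an operation \<open>opr\<close> that
  commutes with restriction.\<close>

lemma stalk_op:
  assumes op: "\<And>W V a b. open_set V \<Longrightarrow> open_set W \<Longrightarrow> W \<subseteq> V \<Longrightarrow> a \<in> carrier (sections \<XX> V) \<Longrightarrow>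
      b \<in> carrier (sections \<XX> V) \<Longrightarrow> opr V a b \<in> carrier (sections \<XX> V) \<and>
      restr \<XX> V W (opr V a b) = opr W (restr \<XX> V W a) (restr \<XX> V W b)"
    and U: "open_set U" "x \<in> U" "s \<in> carrier (sections \<XX> U)"
    and V: "open_set V" "x \<in> V" "t \<in> carrier (sections \<XX> V)"
  shows "(\<Union>(U, s)\<in>germ \<XX> x U s. \<Union>(V, t)\<in>germ \<XX> x V t.
      germ \<XX> x (U \<inter> V) (opr (U \<inter> V) (restr \<XX> U (U \<inter> V) s) (restr \<XX> V (U \<inter> V) t))) =
    germ \<XX> x (U \<inter> V) (opr (U \<inter> V) (restr \<XX> U (U \<inter> V) s) (restr \<XX> V (U \<inter> V) t))" (is "?L = ?G U s V t")
proof -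
  have eq: "?G U' s' V' t' = ?G U s V t" if U': "(U', s') \<in> germ \<XX> x U s" and V': "(V', t') \<in> germ \<XX> x V t" for U' s' V' t'
  proof -
    obtain W1 where 1: "open_set U'" "x \<in> U'" "s' \<in> carrier (sections \<XX> U')" "open_set W1" "x \<in> W1" "W1 \<subseteq> U" "W1 \<subseteq> U'"
      "restr \<XX> U W1 s = restr \<XX> U' W1 s'" using U' unfolding germ_def by blast
    obtain W2 where 2: "open_set V'" "x \<in> V'" "t' \<in> carrier (sections \<XX> V')" "open_set W2" "x \<in> W2" "W2 \<subseteq> V" "W2 \<subseteq> V'"
      "restr \<XX> V W2 t = restr \<XX> V' W2 t'" using V' unfolding germ_def by blast
    define W where "W = W1 \<inter> W2"
    have W: "open_set W" "x \<in> W" "W \<subseteq> W1" "W \<subseteq> W2" using 1 2 unfolding W_def by auto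
    have val: "opr (A \<inter> B) (restr \<XX> A (A \<inter> B) a) (restr \<XX> B (A \<inter> B) b) \<in> carrier (sections \<XX> (A \<inter> B)) \<and>
        restr \<XX> (A \<inter> B) W (opr (A \<inter> B) (restr \<XX> A (A \<inter> B) a) (restr \<XX> B (A \<inter> B) b)) = opr W (restr \<XX> A W a) (restr \<XX> B W b)"
      if AB: "open_set A" "open_set B" "a \<in> carrier (sections \<XX> A)" "b \<in> carrier (sections \<XX> B)" "W \<subseteq> A" "W \<subseteq> B" for A B a b
    proof -
      have o: "open_set (A \<inter> B)" using AB by blast
      have c: "restr \<XX> A (A \<inter> B) a \<in> carrier (sections \<XX> (A \<inter> B))" "restr \<XX> B (A \<inter> B) b \<in> carrier (sections \<XX> (A \<inter> B))"
        using restr_closed[OF AB(1) o _ AB(3)] restr_closed[OF AB(2) o _ AB(4)] by auto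
      have "restr \<XX> (A \<inter> B) W (restr \<XX> A (A \<inter> B) a) = restr \<XX> A W a"
        "restr \<XX> (A \<inter> B) W (restr \<XX> B (A \<inter> B) b) = restr \<XX> B W b"
        using restr_comp[OF AB(1) o W(1) _ _ AB(3)] restr_comp[OF AB(2) o W(1) _ _ AB(4)] AB by auto
      then show ?thesis using op[OF o W(1) _ c] AB by auto
    qed
    have "restr \<XX> U W s = restr \<XX> U' W s'"
      using restr_comp[OF U(1) 1(4) W(1,3) 1(6) U(3)] restr_comp[OF 1(1,4) W(1,3) 1(7,3)] 1(8) by simp
    moreover have "restr \<XX> V W t = restr \<XX> V' W t'"
      using restr_comp[OF V(1) 2(4) W(1,4) 2(6) V(3)] restr_comp[OF 2(1,4) W(1,4) 2(7,3)] 2(8) by simp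
    moreover note val[OF 1(1) 2(1) 1(3) 2(3)] val[OF U(1) V(1) U(3) V(3)]
    moreover have "W \<subseteq> U" "W \<subseteq> V" "W \<subseteq> U'" "W \<subseteq> V'" using 1 2 W by auto
    moreover have "open_set (U' \<inter> V')" "open_set (U \<inter> V)" using 1(1) 2(1) U(1) V(1) by blast+
    ultimately show ?thesis using W(1,2) by (intro germ_eqI[where W = W]) auto
  qed
  show ?thesis
  proof (intro subset_antisym subsetI)
    fix z assume "z \<in> ?L"
    then obtain U' s' V' t' where "(U', s') \<in> germ \<XX> x U s" "(V', t') \<in> germ \<XX> x V t" "z \<in> ?G U' s' V' t'"
      by blast
    then show "z \<in> ?G U s V t" using eq by simp
  next
    fix z assume "z \<in> ?G U s V t"
    then show "z \<in> ?L" using germ_self[OF U] germ_self[OF V] by blast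
  qed
qed

lemma stalk_mult:
  assumes U: "open_set U" "x \<in> U" "s \<in> carrier (sections \<XX> U)"
    and V: "open_set V" "x \<in> V" "t \<in> carrier (sections \<XX> V)"
  shows "germ \<XX> x U s \<otimes>\<^bsub>stalk \<XX> x\<^esub> germ \<XX> x V t =
    germ \<XX> x (U \<inter> V) (restr \<XX> U (U \<inter> V) s \<otimes>\<^bsub>sections \<XX> (U \<inter> V)\<^esub> restr \<XX> V (U \<inter> V) t)"
proof -
  have "monoid (sections \<XX> V)" if "open_set V" for V
    using cring_sections[OF that] by (simp add: cring_def ring_def)
  then show ?thesis
    unfolding stalk_def monoid.simps
    by (intro stalk_op[OF _ assms]) (simp add: monoid.m_closed ring_hom_mult[OF restr_hom])
qed

lemma stalk_add:
  assumes U: "open_set U" "x \<in> U" "s \<in> carrier (sections \<XX> U)"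
    and V: "open_set V" "x \<in> V" "t \<in> carrier (sections \<XX> V)"
  shows "germ \<XX> x U s \<oplus>\<^bsub>stalk \<XX> x\<^esub> germ \<XX> x V t =
    germ \<XX> x (U \<inter> V) (restr \<XX> U (U \<inter> V) s \<oplus>\<^bsub>sections \<XX> (U \<inter> V)\<^esub> restr \<XX> V (U \<inter> V) t)"
proof -
  have "ring (sections \<XX> V)" if "open_set V" for V
    using cring_sections[OF that] by (simp add: cring_def)
  then show ?thesis
    unfolding stalk_def ring.simps
    by (intro stalk_op[OF _ assms]) (simp add: ring.ring_simprules(1) ring_hom_add[OF restr_hom])
qed

lemma stalk_carrier:
  "carrier (stalk \<XX> x) = {germ \<XX> x U s |U s. open_set U \<and> x \<in> U \<and> s \<in> carrier (sections \<XX> U)}"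
  unfolding stalk_def by simp

lemma germ_hom:
  assumes U: "open_set U" "x \<in> U"
  shows "germ \<XX> x U \<in> ring_hom (sections \<XX> U) (stalk \<XX> x)"
proof (rule ring_hom_memI)
  fix s assume "s \<in> carrier (sections \<XX> U)"
  then show "germ \<XX> x U s \<in> carrier (stalk \<XX> x)" unfolding stalk_carrier using U by blast
next
  fix s t assume st: "s \<in> carrier (sections \<XX> U)" "t \<in> carrier (sections \<XX> U)"
  show "germ \<XX> x U (s \<otimes>\<^bsub>sections \<XX> U\<^esub> t) = germ \<XX> x U s \<otimes>\<^bsub>stalk \<XX> x\<^esub> germ \<XX> x U t"
    using stalk_mult[OF U st(1) U st(2)] restr_id[OF U(1)] st by simp
  show "germ \<XX> x U (s \<oplus>\<^bsub>sections \<XX> U\<^esub> t) = germ \<XX> x U s \<oplus>\<^bsub>stalk \<XX> x\<^esub> germ \<XX> x U t"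
    using stalk_add[OF U st(1) U st(2)] restr_id[OF U(1)] st by simp
next
  let ?T = "topspace (topol \<XX>)"
  have o: "open_set ?T" by simp
  have sub: "U \<subseteq> ?T" using openin_subset[OF U(1)] .
  have one: "\<one>\<^bsub>sections \<XX> ?T\<^esub> \<in> carrier (sections \<XX> ?T)"
    using cring_sections[OF o] by (simp add: cring_def ring.ring_simprules(6))
  have "germ \<XX> x U (restr \<XX> ?T U \<one>\<^bsub>sections \<XX> ?T\<^esub>) = germ \<XX> x ?T \<one>\<^bsub>sections \<XX> ?T\<^esub>"
    by (rule germ_restr[OF o U(1) sub U(2) one])
  then show "germ \<XX> x U \<one>\<^bsub>sections \<XX> U\<^esub> = \<one>\<^bsub>stalk \<XX> x\<^esub>"
    using ring_hom_one[OF restr_hom[OF o U(1) sub]] by (simp add: stalk_def)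
qed

end

text \<open>\<^const>\<open>fraction\<close> and \<^const>\<open>localization\<close> are typed for rings without record extension.\<close>

locale plain_cring = cring R for R :: "'a ring" (structure)
begin

section \<open>Fractions at a prime ideal\<close>

lemma fraction_self:
  assumes "primeideal P R" "a \<in> carrier R" "s \<in> carrier R - P"
  shows "(a, s) \<in> fraction R P a s"
proof -
  interpret P: primeideal P R by fact
  have "\<one> \<in> carrier R - P" using P.I_notcarr P.one_imp_carrier by auto
  moreover have "\<one> \<otimes> (a \<otimes> s \<ominus> a \<otimes> s) = \<zero>" using assms by (simp add: a_minus_def r_neg)
  ultimately show ?thesis using assms unfolding fraction_def by blast
qed

lemma fraction_subset:
  assumes P: "primeideal P R" and a: "a \<in> carrier R" "s \<in> carrier R - P" and b: "b \<in> carrier R" "t \<in> carrier R - P"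
    and u: "u \<in> carrier R - P" "u \<otimes> (a \<otimes> t \<ominus> b \<otimes> s) = \<zero>"
  shows "fraction R P a s \<subseteq> fraction R P b t"
proof
  interpret P: primeideal P R by fact
  fix z assume "z \<in> fraction R P a s"
  then obtain c r w where z: "z = (c, r)" "c \<in> carrier R" "r \<in> carrier R - P" "w \<in> carrier R - P"
    "w \<otimes> (a \<otimes> r \<ominus> c \<otimes> s) = \<zero>" unfolding fraction_def by blast
  have car: "a \<in> carrier R" "s \<in> carrier R" "b \<in> carrier R" "t \<in> carrier R" "u \<in> carrier R"
    "c \<in> carrier R" "r \<in> carrier R" "w \<in> carrier R" using assms z by auto
  \<comment> \<open>Transitivity of the relation between fractions: s u w lies outside P and can
    serve as the multiplier.\<close>
  have "(s \<otimes> u \<otimes> w) \<otimes> (b \<otimes> r \<ominus> c \<otimes> t) =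
      (u \<otimes> t) \<otimes> (w \<otimes> (a \<otimes> r \<ominus> c \<otimes> s)) \<ominus> (w \<otimes> r) \<otimes> (u \<otimes> (a \<otimes> t \<ominus> b \<otimes> s))"
    using car by algebra
  also have "\<dots> = \<zero>" unfolding z(5) u(2) using car by algebra
  finally have eq: "(s \<otimes> u \<otimes> w) \<otimes> (b \<otimes> r \<ominus> c \<otimes> t) = \<zero>" .
  have "s \<otimes> u \<in> carrier R - P" using a(2) u(1) P.I_prime by auto
  then have "s \<otimes> u \<otimes> w \<in> carrier R - P" using z(4) P.I_prime[of "s \<otimes> u" w] by auto
  then show "z \<in> fraction R P b t" unfolding fraction_def z(1) using z eq by blast
qed

lemma fraction_eqI:
  assumes P: "primeideal P R" and a: "a \<in> carrier R" "s \<in> carrier R - P" and b: "b \<in> carrier R" "t \<in> carrier R - P"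
    and u: "u \<in> carrier R - P" "u \<otimes> (a \<otimes> t \<ominus> b \<otimes> s) = \<zero>"
  shows "fraction R P a s = fraction R P b t"
proof (rule subset_antisym)
  show "fraction R P a s \<subseteq> fraction R P b t" by (rule fraction_subset[OF assms])
  have car: "a \<in> carrier R" "s \<in> carrier R" "b \<in> carrier R" "t \<in> carrier R" "u \<in> carrier R" using assms by auto
  have "u \<otimes> (b \<otimes> s \<ominus> a \<otimes> t) = \<ominus> (u \<otimes> (a \<otimes> t \<ominus> b \<otimes> s))" using car by algebra
  also have "\<dots> = \<zero>" unfolding u(2) by simp
  finally show "fraction R P b t \<subseteq> fraction R P a s" by (rule fraction_subset[OF P b a u(1)])
qed

lemma fraction_eqI1:
  assumes P: "primeideal P R" and a: "a \<in> carrier R" "s \<in> carrier R - P" and b: "b \<in> carrier R" "t \<in> carrier R - P"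
    and eq: "a \<otimes> t = b \<otimes> s"
  shows "fraction R P a s = fraction R P b t"
proof (rule fraction_eqI[OF assms(1-5)])
  interpret P: primeideal P R by fact
  show "\<one> \<in> carrier R - P" using P.I_notcarr P.one_imp_carrier by auto
  show "\<one> \<otimes> (a \<otimes> t \<ominus> b \<otimes> s) = \<zero>" using assms by (simp add: a_minus_def r_neg)
qed

lemma fraction_eqD:
  assumes "primeideal P R" "fraction R P a s = fraction R P b t" "b \<in> carrier R" "t \<in> carrier R - P"
  shows "\<exists>u\<in>carrier R - P. u \<otimes> (a \<otimes> t \<ominus> b \<otimes> s) = \<zero>"
proof -
  have "(b, t) \<in> fraction R P a s" using fraction_self[OF assms(1,3,4)] assms(2) by simp
  then show ?thesis unfolding fraction_def by simp
qed

lemma prime_compl_mult: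
  assumes "primeideal P R" "s \<in> carrier R - P" "t \<in> carrier R - P"
  shows "s \<otimes> t \<in> carrier R - P"
  using assms primeideal.I_prime[OF assms(1), of s t] by auto

lemma prime_compl_one:
  assumes "primeideal P R"
  shows "\<one> \<in> carrier R - P"
proof -
  interpret P: primeideal P R by fact
  show ?thesis using P.I_notcarr P.one_imp_carrier by auto
qed

text \<open>As for stalks, the product is a union over representatives whose members all coincide;
  the product of the two multipliers witnesses this.\<close>

lemma localization_mult:
  assumes P: "primeideal P R" and a: "a \<in> carrier R" "s \<in> carrier R - P" and b: "b \<in> carrier R" "t \<in> carrier R - P"
  shows "fraction R P a s \<otimes>\<^bsub>localization R P\<^esub> fraction R P b t = fraction R P (a \<otimes> b) (s \<otimes> t)"
proof -
  have eq: "fraction R P (a' \<otimes> b') (s' \<otimes> t') = fraction R P (a \<otimes> b) (s \<otimes> t)"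
    if 1: "(a', s') \<in> fraction R P a s" and 2: "(b', t') \<in> fraction R P b t" for a' s' b' t'
  proof -
    obtain u where u: "a' \<in> carrier R" "s' \<in> carrier R - P" "u \<in> carrier R - P" "u \<otimes> (a \<otimes> s' \<ominus> a' \<otimes> s) = \<zero>"
      using 1 unfolding fraction_def by blast
    obtain w where w: "b' \<in> carrier R" "t' \<in> carrier R - P" "w \<in> carrier R - P" "w \<otimes> (b \<otimes> t' \<ominus> b' \<otimes> t) = \<zero>"
      using 2 unfolding fraction_def by blast
    have car: "a \<in> carrier R" "s \<in> carrier R" "b \<in> carrier R" "t \<in> carrier R" "u \<in> carrier R" "w \<in> carrier R"
      "a' \<in> carrier R" "s' \<in> carrier R" "b' \<in> carrier R" "t' \<in> carrier R" using assms u w by auto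
    have "(u \<otimes> w) \<otimes> ((a \<otimes> b) \<otimes> (s' \<otimes> t') \<ominus> (a' \<otimes> b') \<otimes> (s \<otimes> t)) =
      (w \<otimes> b \<otimes> t') \<otimes> (u \<otimes> (a \<otimes> s' \<ominus> a' \<otimes> s)) \<oplus> (u \<otimes> a' \<otimes> s) \<otimes> (w \<otimes> (b \<otimes> t' \<ominus> b' \<otimes> t))"
      using car by algebra
    also have "\<dots> = \<zero>" unfolding u(4) w(4) using car by algebra
    finally have z: "(u \<otimes> w) \<otimes> ((a \<otimes> b) \<otimes> (s' \<otimes> t') \<ominus> (a' \<otimes> b') \<otimes> (s \<otimes> t)) = \<zero>" .
    have "fraction R P (a \<otimes> b) (s \<otimes> t) = fraction R P (a' \<otimes> b') (s' \<otimes> t')"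
      by (rule fraction_eqI[OF P _ prime_compl_mult[OF P a(2) b(2)] _ prime_compl_mult[OF P u(2) w(2)]
          prime_compl_mult[OF P u(3) w(3)] z]) (use car in auto)
    then show ?thesis by simp
  qed
  have "fraction R P a s \<otimes>\<^bsub>localization R P\<^esub> fraction R P b t =
    (\<Union>(a', s')\<in>fraction R P a s. \<Union>(b', t')\<in>fraction R P b t. fraction R P (a' \<otimes> b') (s' \<otimes> t'))"
    unfolding localization_def by simp
  also have "\<dots> = fraction R P (a \<otimes> b) (s \<otimes> t)"
  proof (intro subset_antisym subsetI)
    fix z assume "z \<in> (\<Union>(a', s')\<in>fraction R P a s. \<Union>(b', t')\<in>fraction R P b t. fraction R P (a' \<otimes> b') (s' \<otimes> t'))"
    then obtain a' s' b' t' where "(a', s') \<in> fraction R P a s" "(b', t') \<in> fraction R P b t"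
      "z \<in> fraction R P (a' \<otimes> b') (s' \<otimes> t')" by blast
    then show "z \<in> fraction R P (a \<otimes> b) (s \<otimes> t)" using eq by simp
  qed (use fraction_self[OF P a] fraction_self[OF P b] in blast)
  finally show ?thesis .
qed

lemma localization_add:
  assumes P: "primeideal P R" and a: "a \<in> carrier R" "s \<in> carrier R - P" and b: "b \<in> carrier R" "t \<in> carrier R - P"
  shows "fraction R P a s \<oplus>\<^bsub>localization R P\<^esub> fraction R P b t = fraction R P (a \<otimes> t \<oplus> b \<otimes> s) (s \<otimes> t)"
proof -
  have eq: "fraction R P (a' \<otimes> t' \<oplus> b' \<otimes> s') (s' \<otimes> t') = fraction R P (a \<otimes> t \<oplus> b \<otimes> s) (s \<otimes> t)"
    if 1: "(a', s') \<in> fraction R P a s" and 2: "(b', t') \<in> fraction R P b t" for a' s' b' t'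
  proof -
    obtain u where u: "a' \<in> carrier R" "s' \<in> carrier R - P" "u \<in> carrier R - P" "u \<otimes> (a \<otimes> s' \<ominus> a' \<otimes> s) = \<zero>"
      using 1 unfolding fraction_def by blast
    obtain w where w: "b' \<in> carrier R" "t' \<in> carrier R - P" "w \<in> carrier R - P" "w \<otimes> (b \<otimes> t' \<ominus> b' \<otimes> t) = \<zero>"
      using 2 unfolding fraction_def by blast
    have car: "a \<in> carrier R" "s \<in> carrier R" "b \<in> carrier R" "t \<in> carrier R" "u \<in> carrier R" "w \<in> carrier R"
      "a' \<in> carrier R" "s' \<in> carrier R" "b' \<in> carrier R" "t' \<in> carrier R" using assms u w by auto
    have "(u \<otimes> w) \<otimes> ((a \<otimes> t \<oplus> b \<otimes> s) \<otimes> (s' \<otimes> t') \<ominus> (a' \<otimes> t' \<oplus> b' \<otimes> s') \<otimes> (s \<otimes> t)) =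
      (w \<otimes> t \<otimes> t') \<otimes> (u \<otimes> (a \<otimes> s' \<ominus> a' \<otimes> s)) \<oplus> (u \<otimes> s \<otimes> s') \<otimes> (w \<otimes> (b \<otimes> t' \<ominus> b' \<otimes> t))"
      using car by algebra
    also have "\<dots> = \<zero>" unfolding u(4) w(4) using car by algebra
    finally have z: "(u \<otimes> w) \<otimes> ((a \<otimes> t \<oplus> b \<otimes> s) \<otimes> (s' \<otimes> t') \<ominus> (a' \<otimes> t' \<oplus> b' \<otimes> s') \<otimes> (s \<otimes> t)) = \<zero>" .
    have "fraction R P (a \<otimes> t \<oplus> b \<otimes> s) (s \<otimes> t) = fraction R P (a' \<otimes> t' \<oplus> b' \<otimes> s') (s' \<otimes> t')"
      by (rule fraction_eqI[OF P _ prime_compl_mult[OF P a(2) b(2)] _ prime_compl_mult[OF P u(2) w(2)]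
          prime_compl_mult[OF P u(3) w(3)] z]) (use car in auto)
    then show ?thesis by simp
  qed
  have "fraction R P a s \<oplus>\<^bsub>localization R P\<^esub> fraction R P b t =
    (\<Union>(a', s')\<in>fraction R P a s. \<Union>(b', t')\<in>fraction R P b t. fraction R P (a' \<otimes> t' \<oplus> b' \<otimes> s') (s' \<otimes> t'))"
    unfolding localization_def by simp
  also have "\<dots> = fraction R P (a \<otimes> t \<oplus> b \<otimes> s) (s \<otimes> t)"
  proof (intro subset_antisym subsetI)
    fix z assume "z \<in> (\<Union>(a', s')\<in>fraction R P a s. \<Union>(b', t')\<in>fraction R P b t. fraction R P (a' \<otimes> t' \<oplus> b' \<otimes> s') (s' \<otimes> t'))"
    then obtain a' s' b' t' where "(a', s') \<in> fraction R P a s" "(b', t') \<in> fraction R P b t"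
      "z \<in> fraction R P (a' \<otimes> t' \<oplus> b' \<otimes> s') (s' \<otimes> t')" by blast
    then show "z \<in> fraction R P (a \<otimes> t \<oplus> b \<otimes> s) (s \<otimes> t)" using eq by simp
  qed (use fraction_self[OF P a] fraction_self[OF P b] in blast)
  finally show ?thesis .
qed

lemma localization_carrierE:
  assumes "x \<in> carrier (localization R P)"
  obtains a s where "a \<in> carrier R" "s \<in> carrier R - P" "x = fraction R P a s"
  using assms unfolding localization_def by auto

lemma localization_carrierI:
  assumes "a \<in> carrier R" "s \<in> carrier R - P"
  shows "fraction R P a s \<in> carrier (localization R P)"
  using assms unfolding localization_def by auto

text \<open>Serves the comparison of the fraction field of a stalk with the function field, where a
  polynomial equation has to be evaluated in the fraction field.\<close>

lemma localization_cring:
  assumes P: "primeideal P R"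
  shows "cring (localization R P)"
proof -
  let ?L = "localization R P"
  note m = localization_mult[OF P] and a = localization_add[OF P] and pm = prime_compl_mult[OF P]
  note o = prime_compl_one[OF P]
  have one: "\<one>\<^bsub>?L\<^esub> = fraction R P \<one> \<one>" and zero: "\<zero>\<^bsub>?L\<^esub> = fraction R P \<zero> \<one>"
    unfolding localization_def by simp_all
  have cl: "x \<otimes>\<^bsub>?L\<^esub> y \<in> carrier ?L" "x \<oplus>\<^bsub>?L\<^esub> y \<in> carrier ?L"
      "x \<otimes>\<^bsub>?L\<^esub> y = y \<otimes>\<^bsub>?L\<^esub> x" "x \<oplus>\<^bsub>?L\<^esub> y = y \<oplus>\<^bsub>?L\<^esub> x"
    if x: "x \<in> carrier ?L" and y: "y \<in> carrier ?L" for x y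
  proof -
    obtain b s where b: "b \<in> carrier R" "s \<in> carrier R - P" "x = fraction R P b s" by (rule localization_carrierE[OF x])
    obtain c t where c: "c \<in> carrier R" "t \<in> carrier R - P" "y = fraction R P c t" by (rule localization_carrierE[OF y])
    have car: "b \<in> carrier R" "c \<in> carrier R" "s \<in> carrier R" "t \<in> carrier R" using b c by auto
    show "x \<otimes>\<^bsub>?L\<^esub> y \<in> carrier ?L" "x \<oplus>\<^bsub>?L\<^esub> y \<in> carrier ?L"
      unfolding b(3) c(3) m[OF b(1,2) c(1,2)] a[OF b(1,2) c(1,2)]
      using car pm[OF b(2) c(2)] by (auto intro!: localization_carrierI)
    show "x \<otimes>\<^bsub>?L\<^esub> y = y \<otimes>\<^bsub>?L\<^esub> x"
      unfolding b(3) c(3) m[OF b(1,2) c(1,2)] m[OF c(1,2) b(1,2)] using car by (simp add: m_comm)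
    show "x \<oplus>\<^bsub>?L\<^esub> y = y \<oplus>\<^bsub>?L\<^esub> x"
      unfolding b(3) c(3) a[OF b(1,2) c(1,2)] a[OF c(1,2) b(1,2)] using car by (simp add: m_comm a_comm)
  qed
  have ass: "x \<otimes>\<^bsub>?L\<^esub> y \<otimes>\<^bsub>?L\<^esub> z = x \<otimes>\<^bsub>?L\<^esub> (y \<otimes>\<^bsub>?L\<^esub> z)"
      "x \<oplus>\<^bsub>?L\<^esub> y \<oplus>\<^bsub>?L\<^esub> z = x \<oplus>\<^bsub>?L\<^esub> (y \<oplus>\<^bsub>?L\<^esub> z)"
      "(x \<oplus>\<^bsub>?L\<^esub> y) \<otimes>\<^bsub>?L\<^esub> z = x \<otimes>\<^bsub>?L\<^esub> z \<oplus>\<^bsub>?L\<^esub> y \<otimes>\<^bsub>?L\<^esub> z"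
    if x: "x \<in> carrier ?L" and y: "y \<in> carrier ?L" and z: "z \<in> carrier ?L" for x y z
  proof -
    obtain b s where b: "b \<in> carrier R" "s \<in> carrier R - P" "x = fraction R P b s" by (rule localization_carrierE[OF x])
    obtain c t where c: "c \<in> carrier R" "t \<in> carrier R - P" "y = fraction R P c t" by (rule localization_carrierE[OF y])
    obtain d r where d: "d \<in> carrier R" "r \<in> carrier R - P" "z = fraction R P d r" by (rule localization_carrierE[OF z])
    have car: "b \<in> carrier R" "c \<in> carrier R" "s \<in> carrier R" "t \<in> carrier R" "d \<in> carrier R" "r \<in> carrier R" using b c d by auto
    note st = pm[OF b(2) c(2)] and tr = pm[OF c(2) d(2)] and sr = pm[OF b(2) d(2)]
    have "b \<otimes> c \<in> carrier R" "c \<otimes> d \<in> carrier R" "b \<otimes> d \<in> carrier R"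
      "b \<otimes> t \<oplus> c \<otimes> s \<in> carrier R" "c \<otimes> r \<oplus> d \<otimes> t \<in> carrier R" using car by auto
    note comb = this
    show "x \<otimes>\<^bsub>?L\<^esub> y \<otimes>\<^bsub>?L\<^esub> z = x \<otimes>\<^bsub>?L\<^esub> (y \<otimes>\<^bsub>?L\<^esub> z)"
      unfolding b(3) c(3) d(3) m[OF b(1,2) c(1,2)] m[OF c(1,2) d(1,2)] m[OF comb(1) st d(1,2)] m[OF b(1,2) comb(2) tr]
      using car by (simp add: m_assoc)
    show "x \<oplus>\<^bsub>?L\<^esub> y \<oplus>\<^bsub>?L\<^esub> z = x \<oplus>\<^bsub>?L\<^esub> (y \<oplus>\<^bsub>?L\<^esub> z)"
      unfolding b(3) c(3) d(3) a[OF b(1,2) c(1,2)] a[OF c(1,2) d(1,2)] a[OF comb(4) st d(1,2)] a[OF b(1,2) comb(5) tr]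
    proof (rule fraction_eqI1[OF P _ pm[OF st d(2)] _ pm[OF b(2) tr]])
      show "((b \<otimes> t \<oplus> c \<otimes> s) \<otimes> r \<oplus> d \<otimes> (s \<otimes> t)) \<otimes> (s \<otimes> (t \<otimes> r)) =
        (b \<otimes> (t \<otimes> r) \<oplus> (c \<otimes> r \<oplus> d \<otimes> t) \<otimes> s) \<otimes> (s \<otimes> t \<otimes> r)" using car by algebra
    qed (use car in auto)
    show "(x \<oplus>\<^bsub>?L\<^esub> y) \<otimes>\<^bsub>?L\<^esub> z = x \<otimes>\<^bsub>?L\<^esub> z \<oplus>\<^bsub>?L\<^esub> y \<otimes>\<^bsub>?L\<^esub> z"
      unfolding b(3) c(3) d(3) a[OF b(1,2) c(1,2)] m[OF comb(4) st d(1,2)] m[OF b(1,2) d(1,2)] m[OF c(1,2) d(1,2)]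
        a[OF comb(3) sr comb(2) tr]
    proof (rule fraction_eqI1[OF P _ pm[OF st d(2)] _ pm[OF sr tr]])
      show "(b \<otimes> t \<oplus> c \<otimes> s) \<otimes> d \<otimes> (s \<otimes> r \<otimes> (t \<otimes> r)) =
        (b \<otimes> d \<otimes> (t \<otimes> r) \<oplus> c \<otimes> d \<otimes> (s \<otimes> r)) \<otimes> (s \<otimes> t \<otimes> r)" using car by algebra
    qed (use car in auto)
  qed
  have unit: "\<one>\<^bsub>?L\<^esub> \<otimes>\<^bsub>?L\<^esub> x = x" "\<zero>\<^bsub>?L\<^esub> \<oplus>\<^bsub>?L\<^esub> x = x" "\<exists>y\<in>carrier ?L. y \<oplus>\<^bsub>?L\<^esub> x = \<zero>\<^bsub>?L\<^esub>"
    if x: "x \<in> carrier ?L" for x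
  proof -
    obtain b s where b: "b \<in> carrier R" "s \<in> carrier R - P" "x = fraction R P b s" by (rule localization_carrierE[OF x])
    have car: "b \<in> carrier R" "s \<in> carrier R" using b by auto
    show "\<one>\<^bsub>?L\<^esub> \<otimes>\<^bsub>?L\<^esub> x = x" unfolding one b(3) m[OF one_closed o b(1,2)] using car by simp
    show "\<zero>\<^bsub>?L\<^esub> \<oplus>\<^bsub>?L\<^esub> x = x" unfolding zero b(3) a[OF zero_closed o b(1,2)] using car by simp
    have nb: "\<ominus> b \<in> carrier R" using car by simp
    have "fraction R P (\<ominus> b) s \<oplus>\<^bsub>?L\<^esub> x = \<zero>\<^bsub>?L\<^esub>"
      unfolding zero b(3) a[OF nb b(2) b(1,2)]
    proof (rule fraction_eqI1[OF P _ pm[OF b(2) b(2)] _ o])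
      show "(\<ominus> b \<otimes> s \<oplus> b \<otimes> s) \<otimes> \<one> = \<zero> \<otimes> (s \<otimes> s)" using car by algebra
    qed (use car in auto)
    then show "\<exists>y\<in>carrier ?L. y \<oplus>\<^bsub>?L\<^esub> x = \<zero>\<^bsub>?L\<^esub>" using localization_carrierI[OF nb b(2)] by blast
  qed
  have oc: "\<one>\<^bsub>?L\<^esub> \<in> carrier ?L" "\<zero>\<^bsub>?L\<^esub> \<in> carrier ?L"
    unfolding one zero using o by (auto intro!: localization_carrierI)
  show ?thesis
  proof (rule cringI)
    show "abelian_group ?L" by (rule abelian_groupI) (use cl ass unit oc in auto)
    show "comm_monoid ?L" by (rule comm_monoidI) (use cl ass unit oc in auto)
    show "(x \<oplus>\<^bsub>?L\<^esub> y) \<otimes>\<^bsub>?L\<^esub> z = x \<otimes>\<^bsub>?L\<^esub> z \<oplus>\<^bsub>?L\<^esub> y \<otimes>\<^bsub>?L\<^esub> z"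
      if "x \<in> carrier ?L" "y \<in> carrier ?L" "z \<in> carrier ?L" for x y z using ass that by blast
  qed
qed

end

section \<open>Affine charts\<close>

definition const_section :: "'a ring \<Rightarrow> 'a \<Rightarrow> 'a set set \<Rightarrow> 'a set \<Rightarrow> ('a \<times> 'a) set" where
  "const_section R r V = (\<lambda>P\<in>V. fraction R P r \<one>\<^bsub>R\<^esub>)"

context plain_cring
begin

lemma topspace_zariski: "topspace (zariski_topology R) = prime_spectrum R"
proof (rule subset_antisym)
  have "openin (zariski_topology R) (topspace (zariski_topology R))" by simp
  then show "topspace (zariski_topology R) \<subseteq> prime_spectrum R"
    unfolding openin_zariski_topology[OF cring_axioms] by blast
  have "prime_spectrum R = {P \<in> prime_spectrum R. \<not> {\<one>} \<subseteq> P}"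
    using prime_compl_one unfolding prime_spectrum_def by auto
  then have "openin (zariski_topology R) (prime_spectrum R)"
    unfolding openin_zariski_topology[OF cring_axioms] by (intro exI[of _ "{\<one>}"]) auto
  then show "prime_spectrum R \<subseteq> topspace (zariski_topology R)" by (rule openin_subset)
qed

lemma zariski_prime:
  assumes "openin (zariski_topology R) V" "P \<in> V"
  shows "primeideal P R"
  using openin_subset[OF assms(1)] assms(2) unfolding topspace_zariski prime_spectrum_def by blast

lemma const_section_carrier:
  assumes V: "openin (zariski_topology R) V" and r: "r \<in> carrier R"
  shows "const_section R r V \<in> carrier (sections (Spec R) V)"
proof -
  have one: "\<one> \<in> carrier R - P" if "P \<in> V" for P using prime_compl_one[OF zariski_prime[OF V that]] .
  have "const_section R r V \<in> (\<Pi>\<^sub>E P\<in>V. carrier (localization R P))"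
    unfolding const_section_def using localization_carrierI[OF r one] by (intro restrict_PiE_iff[THEN iffD2]) blast
  moreover have "\<exists>V' a f. openin (zariski_topology R) V' \<and> P \<in> V' \<and> V' \<subseteq> V \<and>
             a \<in> carrier R \<and> f \<in> carrier R \<and> (\<forall>Q\<in>V'. f \<notin> Q \<and> const_section R r V Q = fraction R Q a f)" if "P \<in> V" for P
    using V that r one by (intro exI[of _ V] exI[of _ r] exI[of _ \<one>]) (auto simp: const_section_def)
  ultimately show ?thesis by (simp add: Spec_def)
qed

lemma Spec_simps:
  "s \<otimes>\<^bsub>sections (Spec R) V\<^esub> t = (\<lambda>P\<in>V. s P \<otimes>\<^bsub>localization R P\<^esub> t P)"
  "s \<oplus>\<^bsub>sections (Spec R) V\<^esub> t = (\<lambda>P\<in>V. s P \<oplus>\<^bsub>localization R P\<^esub> t P)"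
  "\<one>\<^bsub>sections (Spec R) V\<^esub> = const_section R \<one> V" "restr (Spec R) V W s = restrict s W"
  "topol (Spec R) = zariski_topology R"
  unfolding Spec_def const_section_def localization_def by simp_all

lemma const_section_hom:
  assumes V: "openin (zariski_topology R) V"
  shows "(\<lambda>r. const_section R r V) \<in> ring_hom R (sections (Spec R) V)"
proof (rule ring_hom_memI)
  note P = zariski_prime[OF V] and o = prime_compl_one[OF zariski_prime[OF V]]
  show "const_section R r V \<in> carrier (sections (Spec R) V)" if "r \<in> carrier R" for r
    by (rule const_section_carrier[OF V that])
  show "const_section R \<one> V = \<one>\<^bsub>sections (Spec R) V\<^esub>" by (simp add: Spec_simps)
  fix r s assume rs: "r \<in> carrier R" "s \<in> carrier R"
  show "const_section R (r \<otimes> s) V = const_section R r V \<otimes>\<^bsub>sections (Spec R) V\<^esub> const_section R s V"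
    unfolding Spec_simps const_section_def
  proof (rule restrict_ext)
    fix Q assume Q: "Q \<in> V"
    show "fraction R Q (r \<otimes> s) \<one> = (\<lambda>P\<in>V. fraction R P r \<one>) Q \<otimes>\<^bsub>localization R Q\<^esub> (\<lambda>P\<in>V. fraction R P s \<one>) Q"
      using localization_mult[OF P[OF Q] rs(1) o[OF Q] rs(2) o[OF Q]] Q by simp
  qed
  show "const_section R (r \<oplus> s) V = const_section R r V \<oplus>\<^bsub>sections (Spec R) V\<^esub> const_section R s V"
    unfolding Spec_simps const_section_def
  proof (rule restrict_ext)
    fix Q assume Q: "Q \<in> V"
    show "fraction R Q (r \<oplus> s) \<one> = (\<lambda>P\<in>V. fraction R P r \<one>) Q \<oplus>\<^bsub>localization R Q\<^esub> (\<lambda>P\<in>V. fraction R P s \<one>) Q"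
      using localization_add[OF P[OF Q] rs(1) o[OF Q] rs(2) o[OF Q]] Q rs by simp
  qed
qed

end

text \<open>The coordinate ring \<open>R\<close> is kept abstract and is not replaced by the ring of
  sections over U. Its elements reach the sections through the map \<open>sec\<close> below, and its
  primes are the points of U through \<open>pt f\<close>.\<close>

locale affine_chart = locally_ringed_space \<XX> + C: plain_cring R
  for \<XX> :: "('x, 'a) rspace" and U :: "'x set" and R :: "'a ring" (structure)
    and f :: "('x, 'a, 'a set, 'a set \<Rightarrow> ('a \<times> 'a) set) rmorphism" +
  assumes openU: "openin (topol \<XX>) U"
    and iso: "lrs_isomorphism (open_subspace \<XX> U) (Spec R) f"
begin

lemma sub_simps:
  "topol (open_subspace \<XX> U) = subtopology (topol \<XX>) U"
  "sections (open_subspace \<XX> U) = sections \<XX>" "restr (open_subspace \<XX> U) = restr \<XX>"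
  unfolding open_subspace_def by simp_all

lemma topspace_sub: "topspace (subtopology (topol \<XX>) U) = U"
  using openin_subset[OF openU] by (simp add: topspace_subtopology Int_absorb1)

lemma preimage_eq: "preimage (open_subspace \<XX> U) f V = {x \<in> U. pt f x \<in> V}"
  unfolding preimage_def sub_simps topspace_sub ..

lemma homeo: "homeomorphic_map (subtopology (topol \<XX>) U) (zariski_topology R) (pt f)"
  using iso unfolding lrs_isomorphism_def sub_simps C.Spec_simps by blast

lemma pt_image: "pt f ` U = prime_spectrum R" and pt_inj: "inj_on (pt f) U"
  using homeo unfolding homeomorphic_map_def quotient_map_def topspace_sub C.topspace_zariski by auto

lemma pt_prime: "x \<in> U \<Longrightarrow> primeideal (pt f x) R"
  using pt_image unfolding prime_spectrum_def by blast

lemma open_iff: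
  assumes "V \<subseteq> prime_spectrum R"
  shows "open_set {x \<in> U. pt f x \<in> V} \<longleftrightarrow> openin (zariski_topology R) V"
proof -
  have "openin (subtopology (topol \<XX>) U) {x \<in> U. pt f x \<in> V} \<longleftrightarrow> openin (zariski_topology R) V"
    using homeo assms unfolding homeomorphic_map_def quotient_map_def topspace_sub C.topspace_zariski by blast
  then show ?thesis unfolding openin_open_subtopology[OF openU] by auto
qed

lemma preimage_image:
  assumes "W \<subseteq> U"
  shows "{x \<in> U. pt f x \<in> pt f ` W} = W"
  using assms pt_inj by (auto simp: inj_on_def)

lemma open_image:
  assumes "open_set W" "W \<subseteq> U"
  shows "openin (zariski_topology R) (pt f ` W)"
proof -
  have "pt f ` W \<subseteq> prime_spectrum R" using assms pt_image by blast
  from open_iff[OF this] show ?thesis using assms preimage_image by simp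
qed

text \<open>The distinguished open set D(r) of the spectrum, viewed as a subset of U.\<close>

definition basic :: "'a \<Rightarrow> 'x set" where "basic r = {x \<in> U. r \<notin> pt f x}"

lemma basic_open:
  assumes "r \<in> carrier R"
  shows "open_set (basic r)"
proof -
  let ?V = "{P \<in> prime_spectrum R. \<not> {r} \<subseteq> P}"
  have "openin (zariski_topology R) ?V"
    unfolding openin_zariski_topology[OF C.cring_axioms] using assms by (intro exI[of _ "{r}"]) auto
  then have "open_set {x \<in> U. pt f x \<in> ?V}" using open_iff[of ?V] by blast
  moreover have "{x \<in> U. pt f x \<in> ?V} = basic r" using pt_image unfolding basic_def by blast
  ultimately show ?thesis by simp
qed

lemma basic_basis:
  assumes W: "open_set W" "W \<subseteq> U" and y: "y \<in> W"
  shows "\<exists>r\<in>carrier R. y \<in> basic r \<and> basic r \<subseteq> W"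
proof -
  obtain S where S: "S \<subseteq> carrier R" "pt f ` W = {P \<in> prime_spectrum R. \<not> S \<subseteq> P}"
    using open_image[OF W] unfolding openin_zariski_topology[OF C.cring_axioms] by blast
  have "pt f y \<in> pt f ` W" using y by blast
  then obtain r where r: "r \<in> S" "r \<notin> pt f y" unfolding S(2) by blast
  have "basic r \<subseteq> W"
  proof
    fix x assume "x \<in> basic r"
    then have x: "x \<in> U" "r \<notin> pt f x" unfolding basic_def by auto
    then have "pt f x \<in> {P \<in> prime_spectrum R. \<not> S \<subseteq> P}" using r pt_image by blast
    then have "pt f x \<in> pt f ` W" unfolding S(2) .
    then show "x \<in> W" using preimage_image[OF W(2)] x by blast
  qed
  moreover have "y \<in> basic r" using r y W unfolding basic_def by blast
  ultimately show ?thesis using r S by blast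
qed

lemma pull_hom:
  assumes "open_set W" "W \<subseteq> U"
  shows "pull f (pt f ` W) \<in> ring_hom (sections (Spec R) (pt f ` W)) (sections \<XX> W)"
    "bij_betw (pull f (pt f ` W)) (carrier (sections (Spec R) (pt f ` W))) (carrier (sections \<XX> W))"
proof -
  have m: "lrs_morphism (open_subspace \<XX> U) (Spec R) f"
    "\<forall>V. openin (topol (Spec R)) V \<longrightarrow>
        bij_betw (pull f V) (carrier (sections (Spec R) V)) (carrier (sections (open_subspace \<XX> U) (preimage (open_subspace \<XX> U) f V)))"
    using iso unfolding lrs_isomorphism_def by blast+
  have o: "openin (topol (Spec R)) (pt f ` W)" using open_image[OF assms] by (simp add: C.Spec_simps)
  have p: "preimage (open_subspace \<XX> U) f (pt f ` W) = W" unfolding preimage_eq by (rule preimage_image[OF assms(2)])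
  have "\<forall>V. openin (topol (Spec R)) V \<longrightarrow> pull f V \<in> ring_hom (sections (Spec R) V)
      (sections (open_subspace \<XX> U) (preimage (open_subspace \<XX> U) f V))" using m(1) unfolding lrs_morphism_def by blast
  then show "pull f (pt f ` W) \<in> ring_hom (sections (Spec R) (pt f ` W)) (sections \<XX> W)"
    using o p by (metis sub_simps(2))
  show "bij_betw (pull f (pt f ` W)) (carrier (sections (Spec R) (pt f ` W))) (carrier (sections \<XX> W))"
    using m(2) o p by (metis sub_simps(2))
qed

lemma pull_restr:
  assumes W: "open_set W" "W \<subseteq> U" and W': "open_set W'" "W' \<subseteq> W" and s: "s \<in> carrier (sections (Spec R) (pt f ` W))"
  shows "pull f (pt f ` W') (restrict s (pt f ` W')) = restr \<XX> W W' (pull f (pt f ` W) s)"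
proof -
  have m: "lrs_morphism (open_subspace \<XX> U) (Spec R) f" using iso unfolding lrs_isomorphism_def by blast
  have W'U: "W' \<subseteq> U" using W W' by blast
  have o: "openin (topol (Spec R)) (pt f ` W)" "openin (topol (Spec R)) (pt f ` W')"
    using open_image[OF W] open_image[OF W'(1) W'U] by (simp_all add: C.Spec_simps)
  have p: "preimage (open_subspace \<XX> U) f (pt f ` W) = W" "preimage (open_subspace \<XX> U) f (pt f ` W') = W'"
    unfolding preimage_eq using preimage_image W W'U by blast+
  have "\<forall>V W. openin (topol (Spec R)) V \<and> openin (topol (Spec R)) W \<and> W \<subseteq> V \<longrightarrow>
        (\<forall>s\<in>carrier (sections (Spec R) V).
           pull f W (restr (Spec R) V W s) = restr (open_subspace \<XX> U) (preimage (open_subspace \<XX> U) f V) (preimage (open_subspace \<XX> U) f W) (pull f V s))"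
    using m unfolding lrs_morphism_def by blast
  then have "pull f (pt f ` W') (restr (Spec R) (pt f ` W) (pt f ` W') s) =
    restr (open_subspace \<XX> U) (preimage (open_subspace \<XX> U) f (pt f ` W)) (preimage (open_subspace \<XX> U) f (pt f ` W')) (pull f (pt f ` W) s)"
    using o s W'(2) by (simp add: image_mono)
  then show ?thesis unfolding p sub_simps C.Spec_simps .
qed

text \<open>The structure map from the coordinate ring to the sections over W: the constant fraction
  r / 1, carried over by the isomorphism.\<close>

definition sec :: "'x set \<Rightarrow> 'a \<Rightarrow> 'a" where "sec W r = pull f (pt f ` W) (const_section R r (pt f ` W))"

lemma sec_hom:
  assumes "open_set W" "W \<subseteq> U"
  shows "sec W \<in> ring_hom R (sections \<XX> W)"
proof -
  have "pull f (pt f ` W) \<circ> (\<lambda>r. const_section R r (pt f ` W)) \<in> ring_hom R (sections \<XX> W)"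
    by (rule ring_hom_trans[OF C.const_section_hom[OF open_image[OF assms]] pull_hom(1)[OF assms]])
  moreover have "pull f (pt f ` W) \<circ> (\<lambda>r. const_section R r (pt f ` W)) = sec W" unfolding sec_def by auto
  ultimately show ?thesis by simp
qed

lemma sec_restr:
  assumes W: "open_set W" "W \<subseteq> U" and W': "open_set W'" "W' \<subseteq> W" and r: "r \<in> carrier R"
  shows "restr \<XX> W W' (sec W r) = sec W' r"
proof -
  have "restrict (const_section R r (pt f ` W)) (pt f ` W') = const_section R r (pt f ` W')"
    unfolding const_section_def using W'(2) by (intro ext) (auto simp: restrict_def)
  then show ?thesis unfolding sec_def
    using pull_restr[OF W W' C.const_section_carrier[OF open_image[OF W] r]] by simp
qed

lemma pull_ex:
  assumes "open_set W" "W \<subseteq> U" "t \<in> carrier (sections \<XX> W)"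
  obtains s where "s \<in> carrier (sections (Spec R) (pt f ` W))" "t = pull f (pt f ` W) s"
  using pull_hom(2)[OF assms(1,2)] assms(3) unfolding bij_betw_def by blast

text \<open>On W the function r is a permitted denominator, so 1 / r is a section there.\<close>

lemma sec_unit:
  assumes W: "open_set W" "W \<subseteq> basic r" and r: "r \<in> carrier R"
  shows "\<exists>t\<in>carrier (sections \<XX> W). sec W r \<otimes>\<^bsub>sections \<XX> W\<^esub> t = \<one>\<^bsub>sections \<XX> W\<^esub>"
proof -
  have WU: "W \<subseteq> U" using W unfolding basic_def by blast
  let ?V = "pt f ` W"
  note V = open_image[OF W(1) WU]
  have rV: "r \<in> carrier R - Q" if "Q \<in> ?V" for Q using that W r unfolding basic_def by blast
  define s where "s = (\<lambda>Q\<in>?V. fraction R Q \<one> r)"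
  have "s \<in> (\<Pi>\<^sub>E P\<in>?V. carrier (localization R P))"
    unfolding s_def using C.localization_carrierI[OF C.one_closed rV] by (intro restrict_PiE_iff[THEN iffD2]) blast
  moreover have "\<exists>V' a b. openin (zariski_topology R) V' \<and> P \<in> V' \<and> V' \<subseteq> ?V \<and>
             a \<in> carrier R \<and> b \<in> carrier R \<and> (\<forall>Q\<in>V'. b \<notin> Q \<and> s Q = fraction R Q a b)" if "P \<in> ?V" for P
    using V that r rV by (intro exI[of _ ?V] exI[of _ \<one>] exI[of _ r]) (auto simp: s_def)
  ultimately have s: "s \<in> carrier (sections (Spec R) ?V)" by (simp add: Spec_def)
  have "const_section R r ?V \<otimes>\<^bsub>sections (Spec R) ?V\<^esub> s = \<one>\<^bsub>sections (Spec R) ?V\<^esub>"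
    unfolding C.Spec_simps const_section_def
  proof (rule restrict_ext)
    fix Q assume Q: "Q \<in> ?V"
    note P = C.zariski_prime[OF V Q]
    have "fraction R Q r \<one> \<otimes>\<^bsub>localization R Q\<^esub> fraction R Q \<one> r = fraction R Q (r \<otimes> \<one>) (\<one> \<otimes> r)"
      by (rule C.localization_mult[OF P r C.prime_compl_one[OF P] C.one_closed rV[OF Q]])
    also have "\<dots> = fraction R Q \<one> \<one>"
      by (rule C.fraction_eqI1[OF P _ C.prime_compl_mult[OF P C.prime_compl_one[OF P] rV[OF Q]] _ C.prime_compl_one[OF P]])
        (use r in auto)
    finally show "(\<lambda>P\<in>?V. fraction R P r \<one>) Q \<otimes>\<^bsub>localization R Q\<^esub> s Q = fraction R Q \<one> \<one>"
      using Q by (simp add: s_def)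
  qed
  note eq = this
  have "sec W r \<otimes>\<^bsub>sections \<XX> W\<^esub> pull f ?V s = pull f ?V (const_section R r ?V \<otimes>\<^bsub>sections (Spec R) ?V\<^esub> s)"
    unfolding sec_def using ring_hom_mult[OF pull_hom(1)[OF W(1) WU] C.const_section_carrier[OF V r] s] by simp
  also have "\<dots> = \<one>\<^bsub>sections \<XX> W\<^esub>" unfolding eq by (rule ring_hom_one[OF pull_hom(1)[OF W(1) WU]])
  finally show ?thesis using ring_hom_closed[OF pull_hom(1)[OF W(1) WU] s] by blast
qed

text \<open>A section over the spectrum is by definition locally a fraction a / b. Clearing the
  denominator turns this into an equation between sections from the coordinate ring, after which the
  spectrum itself need not be mentioned.\<close>

lemma sec_fraction:
  assumes W: "open_set W" "W \<subseteq> U" and y: "y \<in> W" and t: "t \<in> carrier (sections \<XX> W)"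
  obtains W' a b where "open_set W'" "y \<in> W'" "W' \<subseteq> W" "a \<in> carrier R" "b \<in> carrier R" "W' \<subseteq> basic b"
    "sec W' b \<otimes>\<^bsub>sections \<XX> W'\<^esub> restr \<XX> W W' t = sec W' a"
proof -
  let ?V = "pt f ` W" and ?q = "pt f y"
  note V = open_image[OF W]
  obtain s where s: "s \<in> carrier (sections (Spec R) ?V)" "t = pull f ?V s" by (rule pull_ex[OF W t(1)])
  have qV: "?q \<in> ?V" using y by blast
  obtain V' c d where V': "openin (zariski_topology R) V'" "?q \<in> V'" "V' \<subseteq> ?V" "c \<in> carrier R" "d \<in> carrier R"
    "\<And>Q. Q \<in> V' \<Longrightarrow> d \<notin> Q \<and> s Q = fraction R Q c d" using s(1) qV unfolding Spec_def by auto
  let ?W' = "{x \<in> U. pt f x \<in> V'}"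
  have V'sub: "V' \<subseteq> prime_spectrum R" using openin_subset[OF V'(1)] unfolding C.topspace_zariski .
  have W'o: "open_set ?W'" using open_iff[OF V'sub] V'(1) by blast
  have W'W: "?W' \<subseteq> W" using V'(3) preimage_image[OF W(2)] by blast
  have W'U: "?W' \<subseteq> U" by blast
  have im: "pt f ` ?W' = V'"
  proof (intro subset_antisym subsetI)
    fix Q assume Q: "Q \<in> V'"
    then have "Q \<in> pt f ` U" using V'sub pt_image by auto
    then show "Q \<in> pt f ` ?W'" using Q by auto
  qed auto
  have s': "restrict s V' \<in> carrier (sections (Spec R) V')"
  proof -
    have "restrict s V' \<in> (\<Pi>\<^sub>E P\<in>V'. carrier (localization R P))"
      using C.localization_carrierI[of c d] V' by (intro restrict_PiE_iff[THEN iffD2]) auto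
    moreover have "\<exists>V'' a f. openin (zariski_topology R) V'' \<and> P \<in> V'' \<and> V'' \<subseteq> V' \<and>
           a \<in> carrier R \<and> f \<in> carrier R \<and> (\<forall>Q\<in>V''. f \<notin> Q \<and> restrict s V' Q = fraction R Q a f)" if "P \<in> V'" for P
      using V' that by (intro exI[of _ V'] exI[of _ c] exI[of _ d]) auto
    ultimately show ?thesis by (simp add: Spec_def)
  qed
  have prod: "const_section R d V' \<otimes>\<^bsub>sections (Spec R) V'\<^esub> restrict s V' = const_section R c V'"
    unfolding C.Spec_simps const_section_def
  proof (rule restrict_ext)
    fix Q assume Q: "Q \<in> V'"
    note PQ = C.zariski_prime[OF V'(1) Q]
    have dQ: "d \<in> carrier R - Q" using V' Q by blast
    have "fraction R Q d \<one> \<otimes>\<^bsub>localization R Q\<^esub> fraction R Q c d = fraction R Q (d \<otimes> c) (\<one> \<otimes> d)"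
      by (rule C.localization_mult[OF PQ V'(5) C.prime_compl_one[OF PQ] V'(4) dQ])
    also have "\<dots> = fraction R Q c \<one>"
      by (rule C.fraction_eqI1[OF PQ _ C.prime_compl_mult[OF PQ C.prime_compl_one[OF PQ] dQ] _ C.prime_compl_one[OF PQ]])
        (use V' in \<open>auto simp: C.m_comm\<close>)
    finally show "(\<lambda>P\<in>V'. fraction R P d \<one>) Q \<otimes>\<^bsub>localization R Q\<^esub> restrict s V' Q = fraction R Q c \<one>"
      using Q V'(6) by simp
  qed
  have h: "pull f V' \<in> ring_hom (sections (Spec R) V') (sections \<XX> ?W')"
    using pull_hom(1)[OF W'o W'U] unfolding im .
  have "sec ?W' d \<otimes>\<^bsub>sections \<XX> ?W'\<^esub> restr \<XX> W ?W' t =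
    pull f V' (const_section R d V') \<otimes>\<^bsub>sections \<XX> ?W'\<^esub> pull f V' (restrict s V')"
    unfolding sec_def im s(2) using pull_restr[OF W W'o W'W s(1)] unfolding im by simp
  also have "\<dots> = sec ?W' c"
    unfolding sec_def im prod[symmetric]
    by (rule ring_hom_mult[OF h C.const_section_carrier[OF V'(1,5)] s', symmetric])
  finally have eq: "sec ?W' d \<otimes>\<^bsub>sections \<XX> ?W'\<^esub> restr \<XX> W ?W' t = sec ?W' c" .
  have "?W' \<subseteq> basic d" using V'(6) unfolding basic_def by blast
  moreover have "y \<in> ?W'" using V'(2) y W by blast
  ultimately show ?thesis using that[OF W'o _ W'W V'(4,5) _ eq] by blast
qed

text \<open>The isomorphism is injective on sections, so a / 1 and 0 / 1 are the same fraction at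
  the prime of y, and equality of fractions supplies the multiplier u.\<close>

lemma sec_zero:
  assumes W: "open_set W" "W \<subseteq> U" and y: "y \<in> W" and a: "a \<in> carrier R" "sec W a = \<zero>\<^bsub>sections \<XX> W\<^esub>"
  shows "\<exists>u\<in>carrier R - pt f y. u \<otimes> a = \<zero>"
proof -
  let ?V = "pt f ` W" and ?q = "pt f y"
  note V = open_image[OF W]
  have P: "primeideal ?q R" using pt_prime y W by blast
  have "ring (sections \<XX> W)" using cring_sections[OF W(1)] unfolding cring_def by blast
  then have "sec W \<zero> = \<zero>\<^bsub>sections \<XX> W\<^esub>" using ring_hom_zero[OF sec_hom[OF W] C.ring_axioms] by blast
  then have "pull f ?V (const_section R a ?V) = pull f ?V (const_section R \<zero> ?V)" using a(2) unfolding sec_def by simp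
  moreover have "inj_on (pull f ?V) (carrier (sections (Spec R) ?V))" using pull_hom(2)[OF W] unfolding bij_betw_def by blast
  ultimately have "const_section R a ?V = const_section R \<zero> ?V"
    using C.const_section_carrier[OF V a(1)] C.const_section_carrier[OF V C.zero_closed] by (meson inj_onD)
  then have "const_section R a ?V ?q = const_section R \<zero> ?V ?q" by simp
  then have "fraction R ?q a \<one> = fraction R ?q \<zero> \<one>" using y by (simp add: const_section_def)
  from C.fraction_eqD[OF P this C.zero_closed C.prime_compl_one[OF P]]
  obtain u where u: "u \<in> carrier R - ?q" "u \<otimes> (a \<otimes> \<one> \<ominus> \<zero> \<otimes> \<one>) = \<zero>" by blast
  have "u \<in> carrier R" using u by blast
  then have "u \<otimes> a = u \<otimes> (a \<otimes> \<one> \<ominus> \<zero> \<otimes> \<one>)" using a(1) by algebra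
  then show ?thesis using u by auto
qed

text \<open>The converse of \<open>sec_unit\<close>, pointwise. Near y the inverse of r is a
  fraction a / b, so u (b - r a) = 0 for some u outside the prime of y. If r were in that prime, so
  would be u b, although u and b are not.\<close>

lemma sec_unit_imp:
  assumes W: "open_set W" "W \<subseteq> U" and r: "r \<in> carrier R" and y: "y \<in> W"
    and t: "t \<in> carrier (sections \<XX> W)" "sec W r \<otimes>\<^bsub>sections \<XX> W\<^esub> t = \<one>\<^bsub>sections \<XX> W\<^esub>"
  shows "r \<notin> pt f y"
proof
  assume ry: "r \<in> pt f y"
  obtain W' a b where W': "open_set W'" "y \<in> W'" "W' \<subseteq> W" and ab: "a \<in> carrier R" "b \<in> carrier R" "W' \<subseteq> basic b"
    "sec W' b \<otimes>\<^bsub>sections \<XX> W'\<^esub> restr \<XX> W W' t = sec W' a" by (rule sec_fraction[OF W y t(1)])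
  have W'U: "W' \<subseteq> U" using W W' by blast
  interpret S: cring "sections \<XX> W'" by (rule cring_sections[OF W'(1)])
  note h = sec_hom[OF W'(1) W'U]
  let ?t = "restr \<XX> W W' t"
  note rh = restr_hom[OF W(1) W'(1,3)]
  have tc: "?t \<in> carrier (sections \<XX> W')" by (rule ring_hom_closed[OF rh t(1)])
  have "sec W' r \<otimes>\<^bsub>sections \<XX> W'\<^esub> ?t = restr \<XX> W W' (sec W r) \<otimes>\<^bsub>sections \<XX> W'\<^esub> ?t"
    using sec_restr[OF W W'(1,3) r] by simp
  also have "\<dots> = restr \<XX> W W' (sec W r \<otimes>\<^bsub>sections \<XX> W\<^esub> t)"
    by (rule ring_hom_mult[OF rh ring_hom_closed[OF sec_hom[OF W] r] t(1), symmetric])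
  also have "\<dots> = \<one>\<^bsub>sections \<XX> W'\<^esub>" unfolding t(2) by (rule ring_hom_one[OF rh])
  finally have rt: "sec W' r \<otimes>\<^bsub>sections \<XX> W'\<^esub> ?t = \<one>\<^bsub>sections \<XX> W'\<^esub>" .
  have sc: "sec W' r \<in> carrier (sections \<XX> W')" "sec W' b \<in> carrier (sections \<XX> W')"
    using ring_hom_closed[OF h] r ab by auto
  have "sec W' (r \<otimes> a) = sec W' r \<otimes>\<^bsub>sections \<XX> W'\<^esub> (sec W' b \<otimes>\<^bsub>sections \<XX> W'\<^esub> ?t)"
    unfolding ab(4) by (rule ring_hom_mult[OF h r ab(1)])
  also have "\<dots> = sec W' b \<otimes>\<^bsub>sections \<XX> W'\<^esub> (sec W' r \<otimes>\<^bsub>sections \<XX> W'\<^esub> ?t)" by (rule S.m_lcomm[OF sc tc])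
  also have "\<dots> = sec W' b" unfolding rt using sc by simp
  finally have "sec W' (r \<otimes> a) = sec W' b" .
  interpret H: ring_hom_cring R "sections \<XX> W'" "sec W'"
    using h by (simp add: ring_hom_cring_def ring_hom_cring_axioms_def C.cring_axioms S.cring_axioms)
  have "sec W' (b \<ominus> r \<otimes> a) = \<zero>\<^bsub>sections \<XX> W'\<^esub>"
    using \<open>sec W' (r \<otimes> a) = sec W' b\<close> ab r sc by (simp add: a_minus_def S.r_neg del: H.hom_mult)
  moreover have "b \<ominus> r \<otimes> a \<in> carrier R" using ab r by simp
  ultimately obtain u where u: "u \<in> carrier R - pt f y" "u \<otimes> (b \<ominus> r \<otimes> a) = \<zero>"
    using sec_zero[OF W'(1) W'U W'(2)] by blast
  interpret q: primeideal "pt f y" R using pt_prime y W by blast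
  have uc: "u \<in> carrier R" using u by blast
  have "u \<otimes> b = (u \<otimes> a) \<otimes> r \<oplus> u \<otimes> (b \<ominus> r \<otimes> a)" using uc ab(1,2) r by algebra
  also have "\<dots> = (u \<otimes> a) \<otimes> r" unfolding u(2) using uc ab(1) r by simp
  finally have "u \<otimes> b \<in> pt f y" using q.I_l_closed[OF ry, of "u \<otimes> a"] uc ab(1) by simp
  moreover have "b \<in> carrier R - pt f y" using ab(2,3) W'(2) unfolding basic_def by blast
  ultimately show False using C.prime_compl_mult[OF q.primeideal_axioms u(1)] by blast
qed

end

section \<open>The function field\<close>

locale integral_space = locally_ringed_space \<XX> for \<XX> :: "('x, 'a) rspace" +
  assumes integral: "integral_scheme \<XX>"
begin

abbreviation "TX \<equiv> topspace (topol \<XX>)"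

lemma sections_domain: "open_set U \<Longrightarrow> U \<noteq> {} \<Longrightarrow> domain (sections \<XX> U)"
  using integral unfolding integral_scheme_def by blast

lemma TX_nonempty: "TX \<noteq> {}"
  using integral unfolding integral_scheme_def by blast

lemma chart_of_affine:
  assumes "affine_open \<XX> U"
  obtains R f where "affine_chart \<XX> U R f"
proof -
  obtain R :: "'a ring" and f where Rf: "cring R" "lrs_isomorphism (open_subspace \<XX> U) (Spec R) f" "open_set U"
    using assms unfolding affine_open_def by blast
  have "affine_chart \<XX> U R f"
    using Rf locally_ringed_space_axioms
    by (simp add: affine_chart_def affine_chart_axioms_def plain_cring_def)
  then show ?thesis by (rule that)
qed

lemma chart_at:
  assumes "x \<in> TX"
  obtains U R f where "x \<in> U" "affine_chart \<XX> U R f"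
proof -
  obtain U where U: "x \<in> U" "affine_open \<XX> U"
    using integral assms unfolding integral_scheme_def scheme_def by blast
  obtain R f where "affine_chart \<XX> U R f" by (rule chart_of_affine[OF U(2)])
  then show ?thesis using that U by blast
qed

text \<open>Locality for the empty cover of the empty set.\<close>

lemma empty_sections_eq:
  assumes "s \<in> carrier (sections \<XX> {})" "t \<in> carrier (sections \<XX> {})"
  shows "s = t"
  using locality[of "{}" s t] assms by simp

text \<open>The gluing condition on the empty intersection is automatic, as there is only one
  section over the empty set.\<close>

lemma glue_one_zero:
  assumes U: "open_set U" "U \<noteq> {}" and V: "open_set V" "V \<noteq> {}" and disj: "U \<inter> V = {}"
  obtains e where "e \<in> carrier (sections \<XX> (U \<union> V))" "restr \<XX> (U \<union> V) U e = \<one>\<^bsub>sections \<XX> U\<^esub>"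
    "restr \<XX> (U \<union> V) V e = \<zero>\<^bsub>sections \<XX> V\<^esub>"
proof -
  define \<sigma> where "\<sigma> W = (if W = U then \<one>\<^bsub>sections \<XX> U\<^esub> else \<zero>\<^bsub>sections \<XX> V\<^esub>)" for W
  have ne: "U \<noteq> V" using U V disj by blast
  have cU: "cring (sections \<XX> U)" "cring (sections \<XX> V)" using cring_sections U V by auto
  have sc: "\<sigma> W \<in> carrier (sections \<XX> W)" if "W \<in> {U, V}" for W
    using that cU ne by (auto simp: \<sigma>_def cring_def ring.ring_simprules)
  have o: "open_set W" if "W \<in> {U, V}" for W using that U V by auto
  have comp: "restr \<XX> A (A \<inter> B) (\<sigma> A) = restr \<XX> B (A \<inter> B) (\<sigma> B)" if A: "A \<in> {U, V}" and B: "B \<in> {U, V}" for A B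
  proof (cases "A = B")
    case False
    then have e: "A \<inter> B = {}" using A B disj by auto
    show ?thesis unfolding e
      by (rule empty_sections_eq) (use restr_closed[OF o[OF A] _ _ sc[OF A]] restr_closed[OF o[OF B] _ _ sc[OF B]] in auto)
  qed simp
  have "\<exists>t\<in>carrier (sections \<XX> (\<Union>{U, V})). \<forall>W\<in>{U, V}. restr \<XX> (\<Union>{U, V}) W t = \<sigma> W"
    by (rule gluing) (use o sc comp in auto)
  then obtain t where t: "t \<in> carrier (sections \<XX> (U \<union> V))" "restr \<XX> (U \<union> V) U t = \<sigma> U" "restr \<XX> (U \<union> V) V t = \<sigma> V"
    by auto
  then show ?thesis using that ne by (auto simp: \<sigma>_def)
qed

text \<open>If U and V were disjoint, the sections (1, 0) and (0, 1) over their union would be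
  nonzero with product zero, in a domain.\<close>

lemma open_inter_nonempty:
  assumes U: "open_set U" "U \<noteq> {}" and V: "open_set V" "V \<noteq> {}"
  shows "U \<inter> V \<noteq> {}"
proof
  assume disj: "U \<inter> V = {}"
  then have disj': "V \<inter> U = {}" by blast
  let ?W = "U \<union> V"
  obtain e where e: "e \<in> carrier (sections \<XX> ?W)" "restr \<XX> ?W U e = \<one>\<^bsub>sections \<XX> U\<^esub>" "restr \<XX> ?W V e = \<zero>\<^bsub>sections \<XX> V\<^esub>"
    by (rule glue_one_zero[OF U V disj])
  obtain d where d: "d \<in> carrier (sections \<XX> ?W)" "restr \<XX> ?W V d = \<one>\<^bsub>sections \<XX> V\<^esub>" "restr \<XX> ?W U d = \<zero>\<^bsub>sections \<XX> U\<^esub>"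
    by (rule glue_one_zero[OF V U disj'], unfold Un_commute[of V U])
  have o: "open_set ?W" using U V by blast
  interpret W: domain "sections \<XX> ?W" by (rule sections_domain[OF o]) (use U in blast)
  interpret U: domain "sections \<XX> U" by (rule sections_domain[OF U])
  interpret V: domain "sections \<XX> V" by (rule sections_domain[OF V])
  have hU: "restr \<XX> ?W U \<in> ring_hom (sections \<XX> ?W) (sections \<XX> U)" by (rule restr_hom[OF o U(1)]) blast
  have hV: "restr \<XX> ?W V \<in> ring_hom (sections \<XX> ?W) (sections \<XX> V)" by (rule restr_hom[OF o V(1)]) blast
  have zU: "restr \<XX> ?W U \<zero>\<^bsub>sections \<XX> ?W\<^esub> = \<zero>\<^bsub>sections \<XX> U\<^esub>" by (rule ring_hom_zero[OF hU W.ring_axioms U.ring_axioms])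
  have zV: "restr \<XX> ?W V \<zero>\<^bsub>sections \<XX> ?W\<^esub> = \<zero>\<^bsub>sections \<XX> V\<^esub>" by (rule ring_hom_zero[OF hV W.ring_axioms V.ring_axioms])
  have "e \<otimes>\<^bsub>sections \<XX> ?W\<^esub> d = \<zero>\<^bsub>sections \<XX> ?W\<^esub>"
  proof (rule locality[of "{U, V}", unfolded Union_insert Union_empty Un_empty_right])
    show "restr \<XX> ?W A (e \<otimes>\<^bsub>sections \<XX> ?W\<^esub> d) = restr \<XX> ?W A \<zero>\<^bsub>sections \<XX> ?W\<^esub>" if "A \<in> {U, V}" for A
    proof -
      have "restr \<XX> ?W U (e \<otimes>\<^bsub>sections \<XX> ?W\<^esub> d) = restr \<XX> ?W U \<zero>\<^bsub>sections \<XX> ?W\<^esub>"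
        unfolding ring_hom_mult[OF hU e(1) d(1)] e(2) d(3) zU by simp
      moreover have "restr \<XX> ?W V (e \<otimes>\<^bsub>sections \<XX> ?W\<^esub> d) = restr \<XX> ?W V \<zero>\<^bsub>sections \<XX> ?W\<^esub>"
        unfolding ring_hom_mult[OF hV e(1) d(1)] e(3) d(2) zV by simp
      ultimately show ?thesis using \<open>A \<in> {U, V}\<close> by blast
    qed
  qed (use U V e d in auto)
  then have "e = \<zero>\<^bsub>sections \<XX> ?W\<^esub> \<or> d = \<zero>\<^bsub>sections \<XX> ?W\<^esub>" using W.integral e d by blast
  then show False
  proof
    assume "e = \<zero>\<^bsub>sections \<XX> ?W\<^esub>"
    then show False using e(2) zU U.one_not_zero by simp
  next
    assume "d = \<zero>\<^bsub>sections \<XX> ?W\<^esub>"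
    then show False using d(2) zV V.one_not_zero by simp
  qed
qed

lemma irreducible_TX: "irreducible_closed (topol \<XX>) TX"
  unfolding irreducible_closed_def
proof (intro conjI allI impI)
  show "closedin (topol \<XX>) TX" "TX \<noteq> {}" using TX_nonempty by auto
  fix A B assume AB: "closedin (topol \<XX>) A \<and> closedin (topol \<XX>) B \<and> TX \<subseteq> A \<union> B"
  then have "open_set (TX - A)" "open_set (TX - B)" "(TX - A) \<inter> (TX - B) = {}" by (auto simp: closedin_def)
  then have "TX - A = {} \<or> TX - B = {}" using open_inter_nonempty by blast
  then show "TX \<subseteq> A \<or> TX \<subseteq> B" by blast
qed

lemma closure_open:
  assumes "open_set V" "x \<in> V" "x \<in> (topol \<XX>) closure_of {y}"
  shows "y \<in> V"
  using assms unfolding in_closure_of by blast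

text \<open>Schemes are sober. In a chart that meets Z, the intersection p of the primes belonging
  to points of Z is itself prime because Z is irreducible, and the point of p is generic in Z. Two
  generic points lie in the closure of each other, hence have the same prime in the chart.\<close>

lemma generic_point_unique_existence:
  assumes Z: "irreducible_closed (topol \<XX>) Z"
  shows "\<exists>!z. z \<in> TX \<and> (topol \<XX>) closure_of {z} = Z"
proof -
  have Zc: "closedin (topol \<XX>) Z" and irr: "\<And>A B. closedin (topol \<XX>) A \<Longrightarrow> closedin (topol \<XX>) B \<Longrightarrow> Z \<subseteq> A \<union> B \<Longrightarrow> Z \<subseteq> A \<or> Z \<subseteq> B"
    using Z unfolding irreducible_closed_def by blast+
  obtain z0 where z0: "z0 \<in> Z" using Z unfolding irreducible_closed_def by blast
  have ZT: "Z \<subseteq> TX" using closedin_subset[OF Zc] .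
  obtain U R f where U: "z0 \<in> U" and ch: "affine_chart \<XX> U R f" using z0 ZT chart_at[of z0] by blast
  interpret A: affine_chart \<XX> U R f by (rule ch)
  define p where "p = \<Inter>(pt f ` (Z \<inter> U))"
  have ne: "pt f ` (Z \<inter> U) \<noteq> {}" using z0 U by blast
  have pid: "ideal p R" unfolding p_def
  proof (rule A.C.i_Intersect[OF _ ne])
    fix I assume "I \<in> pt f ` (Z \<inter> U)"
    then show "ideal I R" using A.pt_prime primeideal.axioms(1) by blast
  qed
  have pprime: "primeideal p R"
  proof (rule primeidealI[OF pid A.C.cring_axioms])
    have "\<one>\<^bsub>R\<^esub> \<notin> pt f z0" using A.C.prime_compl_one[OF A.pt_prime[OF U]] by blast
    then have "\<one>\<^bsub>R\<^esub> \<notin> p" using z0 U unfolding p_def by blast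
    then show "carrier R \<noteq> p" using A.C.one_closed by blast
  next
    fix a b assume ab: "a \<in> carrier R" "b \<in> carrier R" "a \<otimes>\<^bsub>R\<^esub> b \<in> p"
    \<comment> \<open>At each point of Z in the chart, a b lies in the prime, hence a or b does. So
      the closed complements of the two distinguished sets cover Z, and irreducibility yields
      primality of p.\<close>
    have "Z \<subseteq> (TX - A.basic a) \<union> (TX - A.basic b)"
    proof
      fix x assume x: "x \<in> Z"
      have "\<not> (x \<in> A.basic a \<and> x \<in> A.basic b)"
      proof
        assume h: "x \<in> A.basic a \<and> x \<in> A.basic b"
        then have xU: "x \<in> U" "a \<notin> pt f x" "b \<notin> pt f x" unfolding A.basic_def by auto
        then have "a \<otimes>\<^bsub>R\<^esub> b \<in> pt f x" using ab x unfolding p_def by blast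
        then show False using A.C.prime_compl_mult[OF A.pt_prime[OF xU(1)], of a b] ab xU by blast
      qed
      then show "x \<in> (TX - A.basic a) \<union> (TX - A.basic b)" using x ZT by blast
    qed
    moreover have "closedin (topol \<XX>) (TX - A.basic a)" "closedin (topol \<XX>) (TX - A.basic b)"
      using A.basic_open ab by auto
    ultimately have "Z \<subseteq> TX - A.basic a \<or> Z \<subseteq> TX - A.basic b" using irr by blast
    then show "a \<in> p \<or> b \<in> p" unfolding p_def A.basic_def by blast
  qed
  then have "p \<in> pt f ` U" unfolding A.pt_image prime_spectrum_def by simp
  then obtain y where y: "y \<in> U" "pt f y = p" by auto
  have UT: "U \<subseteq> TX" using openin_subset[OF A.openU] .
  have yZ: "y \<in> Z"
  proof (rule ccontr)
    assume n: "y \<notin> Z"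
    have o: "open_set (U \<inter> (TX - Z))" using A.openU Zc by (auto simp: closedin_def)
    obtain r where r: "r \<in> carrier R" "y \<in> A.basic r" "A.basic r \<subseteq> U \<inter> (TX - Z)"
      using A.basic_basis[OF o, of y] y n UT by blast
    then have "r \<notin> p" using y unfolding A.basic_def by blast
    then obtain x where "x \<in> Z" "x \<in> U" "r \<notin> pt f x" unfolding p_def by blast
    then show False using r(3) unfolding A.basic_def by blast
  qed
  have clos: "(topol \<XX>) closure_of {y} = Z"
  proof (rule subset_antisym)
    show "(topol \<XX>) closure_of {y} \<subseteq> Z" by (rule closure_of_minimal) (use yZ Zc in auto)
    \<comment> \<open>The chart controls only the part of Z inside U. Irreducibility extends the
      inclusion to all of Z, since \<open>z0\<close> lies in U and rules out the other
      alternative.\<close>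
    have "Z \<subseteq> (topol \<XX>) closure_of {y} \<union> (TX - U)"
    proof
      fix x assume x: "x \<in> Z"
      show "x \<in> (topol \<XX>) closure_of {y} \<union> (TX - U)"
      proof (cases "x \<in> U")
        case True
        have "y \<in> V" if V: "x \<in> V" "open_set V" for V
        proof -
          have o: "open_set (U \<inter> V)" using A.openU V by blast
          obtain r where r: "r \<in> carrier R" "x \<in> A.basic r" "A.basic r \<subseteq> U \<inter> V"
            using A.basic_basis[OF o, of x] True V by blast
          then have "r \<notin> p" using x True unfolding A.basic_def p_def by blast
          then have "y \<in> A.basic r" using y unfolding A.basic_def by blast
          then show ?thesis using r by blast
        qed
        then have "x \<in> (topol \<XX>) closure_of {y}" unfolding in_closure_of using x ZT by blast
        then show ?thesis by blast
      qed (use x ZT in blast)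
    qed
    then have "Z \<subseteq> (topol \<XX>) closure_of {y} \<or> Z \<subseteq> TX - U" using irr[of "(topol \<XX>) closure_of {y}" "TX - U"] A.openU by auto
    then show "Z \<subseteq> (topol \<XX>) closure_of {y}" using z0 U by blast
  qed
  show ?thesis
  proof (rule ex1I[of _ y])
    show "y \<in> TX \<and> (topol \<XX>) closure_of {y} = Z" using y UT clos by blast
    fix y' assume y': "y' \<in> TX \<and> (topol \<XX>) closure_of {y'} = Z"
    then have y'U: "y' \<in> U" using closure_open[OF A.openU U] z0 by blast
    have y'Z: "y' \<in> (topol \<XX>) closure_of {y'}" unfolding in_closure_of using y' by blast
    have le: "r \<notin> pt f a \<Longrightarrow> r \<in> carrier R \<Longrightarrow> r \<notin> pt f b"
      if ab: "a \<in> U" "a \<in> (topol \<XX>) closure_of {b}" for a b r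
    proof -
      assume r: "r \<notin> pt f a" "r \<in> carrier R"
      then have "a \<in> A.basic r" using ab unfolding A.basic_def by blast
      then have "b \<in> A.basic r" using closure_open[OF A.basic_open[OF r(2)]] ab by blast
      then show "r \<notin> pt f b" unfolding A.basic_def by blast
    qed
    have sub: "pt f y \<subseteq> carrier R" "pt f y' \<subseteq> carrier R"
      using A.pt_prime[OF y(1)] A.pt_prime[OF y'U] by (meson additive_subgroup.a_subset ideal.axioms(1) primeideal.axioms(1))+
    have "pt f y = pt f y'"
      using le[of y y'] le[of y' y] y(1) y'U yZ y' y'Z clos sub by blast
    then show "y' = y" using A.pt_inj y(1) y'U unfolding inj_on_def by blast
  qed
qed

lemma generic_point:
  assumes "irreducible_closed (topol \<XX>) Z"
  shows "generic_point \<XX> Z \<in> TX" "(topol \<XX>) closure_of {generic_point \<XX> Z} = Z" "generic_point \<XX> Z \<in> Z"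
    "\<And>V. open_set V \<Longrightarrow> V \<inter> Z \<noteq> {} \<Longrightarrow> generic_point \<XX> Z \<in> V"
    "\<And>z. z \<in> TX \<Longrightarrow> (topol \<XX>) closure_of {z} = Z \<Longrightarrow> generic_point \<XX> Z = z"
proof -
  note ex = generic_point_unique_existence[OF assms]
  have g: "generic_point \<XX> Z \<in> TX \<and> (topol \<XX>) closure_of {generic_point \<XX> Z} = Z"
    unfolding generic_point_def by (rule theI'[OF ex])
  then show 1: "generic_point \<XX> Z \<in> TX" and 2: "(topol \<XX>) closure_of {generic_point \<XX> Z} = Z" by auto
  have "generic_point \<XX> Z \<in> (topol \<XX>) closure_of {generic_point \<XX> Z}" using 1 by (simp add: in_closure_of)
  then show "generic_point \<XX> Z \<in> Z" unfolding 2 .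
  show "generic_point \<XX> Z \<in> V" if "open_set V" "V \<inter> Z \<noteq> {}" for V
  proof -
    obtain x where "x \<in> V" "x \<in> Z" using \<open>V \<inter> Z \<noteq> {}\<close> by blast
    then show ?thesis using closure_open[OF \<open>open_set V\<close>, of x "generic_point \<XX> Z"] 2 by simp
  qed
  show "generic_point \<XX> Z = z" if "z \<in> TX" "(topol \<XX>) closure_of {z} = Z" for z
    using ex that g by blast
qed

definition \<eta> where "\<eta> = generic_point \<XX> TX"

lemma eta_open: "open_set V \<Longrightarrow> V \<noteq> {} \<Longrightarrow> \<eta> \<in> V"
  using generic_point(4)[OF irreducible_TX] openin_subset[of "topol \<XX>" V] unfolding \<eta>_def by blast

lemma eta_TX: "\<eta> \<in> TX" using generic_point(1)[OF irreducible_TX] unfolding \<eta>_def .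

lemma eta_closure: "(topol \<XX>) closure_of {\<eta>} = TX"
  using generic_point(2)[OF irreducible_TX] unfolding \<eta>_def .

lemma chart_nonempty:
  assumes "affine_chart \<XX> U R f" "U \<noteq> {}" shows "\<eta> \<in> U"
  using eta_open affine_chart.openU[OF assms(1)] assms(2) by blast

text \<open>The kernel of the map from \<open>R\<close> to the sections over U is prime, these
  forming a domain, so it is the prime of some point y. For r outside the kernel the set
  \<open>basic r\<close> would contain y, hence be nonempty and contain \<eta>, against r lying in
  the prime of \<eta>.\<close>

lemma sec_eta_zero:
  assumes ch: "affine_chart \<XX> U R f" and U: "U \<noteq> {}" and r: "r \<in> pt f \<eta>" and W: "open_set W" "W \<subseteq> U"
  shows "affine_chart.sec R f W r = \<zero>\<^bsub>sections \<XX> W\<^esub>"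
proof -
  interpret A: affine_chart \<XX> U R f by (rule ch)
  interpret D: domain "sections \<XX> U" by (rule sections_domain[OF A.openU U])
  have rc: "r \<in> carrier R" using r A.pt_prime[OF chart_nonempty[OF ch U]]
    by (meson additive_subgroup.a_subset ideal.axioms(1) primeideal.axioms(1) subsetD)
  interpret H: ring_hom_cring R "sections \<XX> U" "A.sec U"
    using A.sec_hom[OF A.openU] by (simp add: ring_hom_cring_def ring_hom_cring_axioms_def A.C.cring_axioms D.cring_axioms)
  let ?k = "{s \<in> carrier R. A.sec U s = \<zero>\<^bsub>sections \<XX> U\<^esub>}"
  have "ideal ?k R"
    using ring_hom_ring.kernel_is_ideal[OF ring_hom_ringI2[OF A.C.ring_axioms D.ring_axioms H.homh]]
    unfolding a_kernel_def' .
  then have "primeideal ?k R"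
  proof (rule primeidealI[OF _ A.C.cring_axioms])
    have "\<one>\<^bsub>R\<^esub> \<notin> ?k" using H.hom_one D.one_not_zero by simp
    then show "carrier R \<noteq> ?k" using A.C.one_closed by blast
    show "a \<in> ?k \<or> b \<in> ?k" if ab: "a \<in> carrier R" "b \<in> carrier R" "a \<otimes>\<^bsub>R\<^esub> b \<in> ?k" for a b
    proof -
      have "A.sec U a \<otimes>\<^bsub>sections \<XX> U\<^esub> A.sec U b = \<zero>\<^bsub>sections \<XX> U\<^esub>" using ab by simp
      then have "A.sec U a = \<zero>\<^bsub>sections \<XX> U\<^esub> \<or> A.sec U b = \<zero>\<^bsub>sections \<XX> U\<^esub>"
        using D.integral[OF _ H.hom_closed[OF ab(1)] H.hom_closed[OF ab(2)]] by blast
      then show ?thesis using ab by blast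
    qed
  qed
  then have "?k \<in> pt f ` U" unfolding A.pt_image prime_spectrum_def by simp
  then obtain y where y: "y \<in> U" "pt f y = ?k" by auto
  have "r \<in> ?k"
  proof (rule ccontr)
    assume "r \<notin> ?k"
    then have "y \<in> A.basic r" using y unfolding A.basic_def by simp
    then have "\<eta> \<in> A.basic r" using eta_open[OF A.basic_open[OF rc]] by blast
    then show False using r unfolding A.basic_def by blast
  qed
  then have z: "A.sec U r = \<zero>\<^bsub>sections \<XX> U\<^esub>" by blast
  have "A.sec W r = restr \<XX> U W (A.sec U r)" using A.sec_restr[OF A.openU subset_refl W rc] by simp
  also have "\<dots> = \<zero>\<^bsub>sections \<XX> W\<^esub>" unfolding z
    by (rule ring_hom_zero[OF restr_hom[OF A.openU W] D.ring_axioms]) (use cring_sections[OF W(1)] in \<open>simp add: cring_def\<close>)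
  finally show ?thesis .
qed

text \<open>That all rings of sections are domains does not by itself make restriction injective;
  fractions in a chart do. Near any y of U0 one has b s = a with b invertible. On the part inside W
  the section s vanishes, hence so does a, and u a = 0 for some u outside the prime of \<eta>. The
  section of u is nonzero because \<eta> lies in the neighbourhood, so a, and with it s, vanishes
  near y; locality concludes.\<close>

lemma restr_zero_imp_zero:
  assumes U0: "open_set U0" and W: "open_set W" "W \<subseteq> U0" "W \<noteq> {}" and s: "s \<in> carrier (sections \<XX> U0)"
    and z: "restr \<XX> U0 W s = \<zero>\<^bsub>sections \<XX> W\<^esub>"
  shows "s = \<zero>\<^bsub>sections \<XX> U0\<^esub>"
proof -
  have zr: "restr \<XX> A B \<zero>\<^bsub>sections \<XX> A\<^esub> = \<zero>\<^bsub>sections \<XX> B\<^esub>" if AB: "open_set A" "open_set B" "B \<subseteq> A" for A B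
    by (rule ring_hom_zero[OF restr_hom[OF AB]]) (use cring_sections[OF AB(1)] cring_sections[OF AB(2)] in \<open>auto simp: cring_def\<close>)
  have loc: "\<exists>V. open_set V \<and> y \<in> V \<and> V \<subseteq> U0 \<and> restr \<XX> U0 V s = \<zero>\<^bsub>sections \<XX> V\<^esub>" if y: "y \<in> U0" for y
  proof -
    have yT: "y \<in> TX" using y openin_subset[OF U0] by blast
    obtain U R f where yU: "y \<in> U" and ch: "affine_chart \<XX> U R f" by (rule chart_at[OF yT])
    interpret A: affine_chart \<XX> U R f by (rule ch)
    let ?W1 = "U0 \<inter> U"
    have o1: "open_set ?W1" using U0 A.openU by blast
    define t where "t = restr \<XX> U0 ?W1 s"
    have t: "t \<in> carrier (sections \<XX> ?W1)" unfolding t_def by (rule restr_closed[OF U0 o1 _ s]) blast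
    obtain V a b where V: "open_set V" "y \<in> V" "V \<subseteq> ?W1" and ab: "a \<in> carrier R" "b \<in> carrier R" "V \<subseteq> A.basic b"
      "A.sec V b \<otimes>\<^bsub>sections \<XX> V\<^esub> restr \<XX> ?W1 V t = A.sec V a"
      using A.sec_fraction[OF o1 _ _ t, of y] y yU by blast
    have VU: "V \<subseteq> U" and VU0: "V \<subseteq> U0" using V by auto
    let ?s = "restr \<XX> U0 V s"
    have "restr \<XX> ?W1 V t = ?s" unfolding t_def by (rule restr_comp[OF U0 o1 V(1,3) _ s]) blast
    with ab(4) have eq: "A.sec V b \<otimes>\<^bsub>sections \<XX> V\<^esub> ?s = A.sec V a" by simp
    have sV: "?s \<in> carrier (sections \<XX> V)" by (rule restr_closed[OF U0 V(1) VU0 s])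
    have eV: "\<eta> \<in> V" using eta_open V by blast
    interpret D: domain "sections \<XX> V" by (rule sections_domain[OF V(1)]) (use V in blast)
    note hV = A.sec_hom[OF V(1) VU]
    let ?X = "V \<inter> W"
    have oX: "open_set ?X" using V W by blast
    have eX: "\<eta> \<in> ?X" using eta_open[OF oX] open_inter_nonempty[OF V(1) _ W(1,3)] V(2) by blast
    have XU: "?X \<subseteq> U" using VU by blast
    interpret DX: domain "sections \<XX> ?X" by (rule sections_domain[OF oX]) (use eX in blast)
    have "restr \<XX> V ?X ?s = restr \<XX> W ?X (restr \<XX> U0 W s)"
      using restr_comp[OF U0 V(1) oX _ VU0 s] restr_comp[OF U0 W(1) oX _ W(2) s] by simp
    also have "\<dots> = \<zero>\<^bsub>sections \<XX> ?X\<^esub>" unfolding z by (rule zr[OF W(1) oX]) blast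
    finally have sX: "restr \<XX> V ?X ?s = \<zero>\<^bsub>sections \<XX> ?X\<^esub>" .
    have hX: "restr \<XX> V ?X \<in> ring_hom (sections \<XX> V) (sections \<XX> ?X)" by (rule restr_hom[OF V(1) oX]) blast
    have "A.sec ?X a = restr \<XX> V ?X (A.sec V a)" using A.sec_restr[OF V(1) VU oX _ ab(1)] by simp
    also have "\<dots> = restr \<XX> V ?X (A.sec V b) \<otimes>\<^bsub>sections \<XX> ?X\<^esub> \<zero>\<^bsub>sections \<XX> ?X\<^esub>"
      unfolding eq[symmetric] ring_hom_mult[OF hX ring_hom_closed[OF hV ab(2)] sV] sX ..
    also have "\<dots> = \<zero>\<^bsub>sections \<XX> ?X\<^esub>" using ring_hom_closed[OF hX ring_hom_closed[OF hV ab(2)]] by simp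
    finally obtain u where u: "u \<in> carrier R - pt f \<eta>" "u \<otimes>\<^bsub>R\<^esub> a = \<zero>\<^bsub>R\<^esub>"
      using A.sec_zero[OF oX XU eX ab(1)] by blast
    have uc: "u \<in> carrier R" using u by blast
    have sz: "A.sec V \<zero>\<^bsub>R\<^esub> = \<zero>\<^bsub>sections \<XX> V\<^esub>" by (rule ring_hom_zero[OF hV A.C.ring_axioms D.ring_axioms])
    have "A.sec V u \<otimes>\<^bsub>sections \<XX> V\<^esub> A.sec V a = \<zero>\<^bsub>sections \<XX> V\<^esub>"
      using ring_hom_mult[OF hV uc ab(1)] unfolding u(2) sz by simp
    moreover have "A.sec V u \<noteq> \<zero>\<^bsub>sections \<XX> V\<^esub>"
    proof
      assume "A.sec V u = \<zero>\<^bsub>sections \<XX> V\<^esub>"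
      then obtain w where w: "w \<in> carrier R - pt f \<eta>" "w \<otimes>\<^bsub>R\<^esub> u = \<zero>\<^bsub>R\<^esub>" using A.sec_zero[OF V(1) VU eV uc] by blast
      have pe: "primeideal (pt f \<eta>) R" using A.pt_prime eV VU by blast
      have "\<zero>\<^bsub>R\<^esub> \<in> pt f \<eta>" using pe by (meson additive_subgroup.zero_closed ideal.axioms(1) primeideal.axioms(1))
      then show False using A.C.prime_compl_mult[OF pe w(1) u(1)] w(2) by simp
    qed
    ultimately have "A.sec V a = \<zero>\<^bsub>sections \<XX> V\<^esub>"
      using D.integral ring_hom_closed[OF hV uc] ring_hom_closed[OF hV ab(1)] by blast
    then have bs: "A.sec V b \<otimes>\<^bsub>sections \<XX> V\<^esub> ?s = \<zero>\<^bsub>sections \<XX> V\<^esub>" using eq by simp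
    obtain c where c: "c \<in> carrier (sections \<XX> V)" "A.sec V b \<otimes>\<^bsub>sections \<XX> V\<^esub> c = \<one>\<^bsub>sections \<XX> V\<^esub>"
      using A.sec_unit[OF V(1) ab(3,2)] by blast
    have "A.sec V b \<noteq> \<zero>\<^bsub>sections \<XX> V\<^esub>" using c by auto
    then have "?s = \<zero>\<^bsub>sections \<XX> V\<^esub>" using D.integral[OF bs ring_hom_closed[OF hV ab(2)] sV] by blast
    then show ?thesis using V(1,2) VU0 by blast
  qed
  define \<U> where "\<U> = {V. open_set V \<and> V \<subseteq> U0 \<and> restr \<XX> U0 V s = \<zero>\<^bsub>sections \<XX> V\<^esub>}"
  have un: "\<Union>\<U> = U0" using loc unfolding \<U>_def by blast
  have zc: "\<zero>\<^bsub>sections \<XX> U0\<^esub> \<in> carrier (sections \<XX> U0)"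
    using cring_sections[OF U0] by (simp add: cring_def ring.ring_simprules)
  show ?thesis
  proof (rule locality[of \<U>, unfolded un])
    show "open_set V" if "V \<in> \<U>" for V using that unfolding \<U>_def by blast
    show "restr \<XX> U0 V s = restr \<XX> U0 V \<zero>\<^bsub>sections \<XX> U0\<^esub>" if "V \<in> \<U>" for V
      using that zr[OF U0] unfolding \<U>_def by auto
  qed (use s zc in auto)
qed

lemma restr_inj:
  assumes U: "open_set U" and W: "open_set W" "W \<subseteq> U" "W \<noteq> {}" and s: "s \<in> carrier (sections \<XX> U)" "t \<in> carrier (sections \<XX> U)"
    and eq: "restr \<XX> U W s = restr \<XX> U W t"
  shows "s = t"
proof -
  interpret R: cring "sections \<XX> U" by (rule cring_sections[OF U])
  interpret S: cring "sections \<XX> W" by (rule cring_sections[OF W(1)])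
  interpret H: ring_hom_cring "sections \<XX> U" "sections \<XX> W" "restr \<XX> U W"
    using restr_hom[OF U W(1,2)] by (simp add: ring_hom_cring_def ring_hom_cring_axioms_def R.cring_axioms S.cring_axioms)
  have "restr \<XX> U W (s \<ominus>\<^bsub>sections \<XX> U\<^esub> t) = \<zero>\<^bsub>sections \<XX> W\<^esub>"
    using s eq by (simp add: a_minus_def S.r_neg)
  then have "s \<ominus>\<^bsub>sections \<XX> U\<^esub> t = \<zero>\<^bsub>sections \<XX> U\<^esub>" using restr_zero_imp_zero[OF U W] s by simp
  then show ?thesis using s by (simp add: R.r_right_minus_eq)
qed

definition KX where "KX = function_field \<XX>"

lemma KX_stalk: "KX = stalk \<XX> \<eta>" unfolding KX_def function_field_def \<eta>_def ..

lemma section_to_K_germ: "section_to_K \<XX> U s = germ \<XX> \<eta> U s" unfolding section_to_K_def \<eta>_def ..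

lemma section_to_K_hom:
  assumes "open_set U" "U \<noteq> {}"
  shows "section_to_K \<XX> U \<in> ring_hom (sections \<XX> U) KX"
proof -
  have "section_to_K \<XX> U = germ \<XX> \<eta> U" by (rule ext) (rule section_to_K_germ)
  then show ?thesis using germ_hom[OF assms(1) eta_open[OF assms]] unfolding KX_stalk by simp
qed

lemma section_to_K_inj:
  assumes U: "open_set U" "U \<noteq> {}"
  shows "inj_on (section_to_K \<XX> U) (carrier (sections \<XX> U))"
proof (rule inj_onI)
  fix s t assume st: "s \<in> carrier (sections \<XX> U)" "t \<in> carrier (sections \<XX> U)" "section_to_K \<XX> U s = section_to_K \<XX> U t"
  obtain W where W: "open_set W" "\<eta> \<in> W" "W \<subseteq> U" "restr \<XX> U W s = restr \<XX> U W t"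
    using germ_eqD[OF st(3)[unfolded section_to_K_germ] U(1) eta_open[OF U] st(2)] by blast
  then show "s = t" using restr_inj[OF U(1) W(1,3) _ st(1,2)] by blast
qed

lemma section_to_K_restr:
  assumes "open_set U" "open_set V" "V \<subseteq> U" "V \<noteq> {}" "s \<in> carrier (sections \<XX> U)"
  shows "section_to_K \<XX> V (restr \<XX> U V s) = section_to_K \<XX> U s"
  unfolding section_to_K_germ by (rule germ_restr[OF assms(1-3) eta_open[OF assms(2,4)] assms(5)])

lemma KX_cring: "cring KX"
  using local_stalks[OF eta_TX] unfolding KX_stalk local_ring_def by blast

lemma KX_carrier:
  assumes "c \<in> carrier KX"
  obtains U s where "open_set U" "U \<noteq> {}" "s \<in> carrier (sections \<XX> U)" "c = section_to_K \<XX> U s"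
proof -
  have "\<exists>U s. c = germ \<XX> \<eta> U s \<and> open_set U \<and> \<eta> \<in> U \<and> s \<in> carrier (sections \<XX> U)"
    using assms unfolding KX_stalk stalk_carrier by simp
  then obtain U s where Us: "c = germ \<XX> \<eta> U s" "open_set U" "\<eta> \<in> U" "s \<in> carrier (sections \<XX> U)"
    by (elim exE conjE)
  show ?thesis by (rule that[of U s]) (use Us in \<open>auto simp: section_to_K_germ\<close>)
qed

text \<open>Near \<eta> a nonzero c is a fraction a / b with b invertible. The numerator a lies
  outside the prime of \<eta>, since otherwise its section and hence c would vanish by
  \<open>sec_eta_zero\<close>; so a is invertible on \<open>basic a\<close>, which contains
  \<eta>.\<close>

lemma KX_field: "field KX"
proof -
  interpret K: cring KX by (rule KX_cring)
  show ?thesis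
  proof (rule K.cring_fieldI2)
    have "open_set TX" by simp
    note TX = this TX_nonempty
    interpret D: domain "sections \<XX> TX" by (rule sections_domain[OF TX])
    show "\<zero>\<^bsub>KX\<^esub> \<noteq> \<one>\<^bsub>KX\<^esub>"
      using ring_hom_zero[OF section_to_K_hom[OF TX] D.ring_axioms K.ring_axioms] ring_hom_one[OF section_to_K_hom[OF TX]]
        inj_onD[OF section_to_K_inj[OF TX], of "\<zero>\<^bsub>sections \<XX> TX\<^esub>" "\<one>\<^bsub>sections \<XX> TX\<^esub>"] by auto
  next
    fix c assume c: "c \<in> carrier KX" "c \<noteq> \<zero>\<^bsub>KX\<^esub>"
    obtain W s where W: "open_set W" "W \<noteq> {}" "s \<in> carrier (sections \<XX> W)" "c = section_to_K \<XX> W s"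
      by (rule KX_carrier[OF c(1)])
    obtain U R f where eU: "\<eta> \<in> U" and ch: "affine_chart \<XX> U R f" by (rule chart_at[OF eta_TX])
    interpret A: affine_chart \<XX> U R f by (rule ch)
    let ?W1 = "W \<inter> U"
    have e1: "\<eta> \<in> ?W1" using eU eta_open[OF W(1,2)] by blast
    have o1: "open_set ?W1" using W A.openU by blast
    define t where "t = restr \<XX> W ?W1 s"
    have t: "t \<in> carrier (sections \<XX> ?W1)" unfolding t_def by (rule restr_closed[OF W(1) o1 _ W(3)]) blast
    obtain V a b where V: "open_set V" "\<eta> \<in> V" "V \<subseteq> ?W1" and ab: "a \<in> carrier R" "b \<in> carrier R" "V \<subseteq> A.basic b"
      "A.sec V b \<otimes>\<^bsub>sections \<XX> V\<^esub> restr \<XX> ?W1 V t = A.sec V a"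
      using A.sec_fraction[OF o1 _ e1 t] by blast
    have VU: "V \<subseteq> U" and VW: "V \<subseteq> W" and Vne: "V \<noteq> {}" using V by auto
    let ?s = "restr \<XX> W V s"
    have "restr \<XX> ?W1 V t = ?s" unfolding t_def by (rule restr_comp[OF W(1) o1 V(1,3) _ W(3)]) blast
    with ab(4) have eq: "A.sec V b \<otimes>\<^bsub>sections \<XX> V\<^esub> ?s = A.sec V a" by simp
    have sV: "?s \<in> carrier (sections \<XX> V)" by (rule restr_closed[OF W(1) V(1) VW W(3)])
    have cs: "c = section_to_K \<XX> V ?s" unfolding W(4) using section_to_K_restr[OF W(1) V(1) VW Vne W(3)] by simp
    interpret D: domain "sections \<XX> V" by (rule sections_domain[OF V(1) Vne])
    note hV = A.sec_hom[OF V(1) VU]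
    note hK = section_to_K_hom[OF V(1) Vne]
    have "a \<notin> pt f \<eta>"
    proof
      assume "a \<in> pt f \<eta>"
      then have "A.sec V a = \<zero>\<^bsub>sections \<XX> V\<^esub>" using sec_eta_zero[OF ch _ _ V(1) VU] eU by blast
      then have bs: "A.sec V b \<otimes>\<^bsub>sections \<XX> V\<^esub> ?s = \<zero>\<^bsub>sections \<XX> V\<^esub>" using eq by simp
      obtain d where d: "d \<in> carrier (sections \<XX> V)" "A.sec V b \<otimes>\<^bsub>sections \<XX> V\<^esub> d = \<one>\<^bsub>sections \<XX> V\<^esub>"
        using A.sec_unit[OF V(1) ab(3,2)] by blast
      have "A.sec V b \<noteq> \<zero>\<^bsub>sections \<XX> V\<^esub>" using d by auto
      then have "?s = \<zero>\<^bsub>sections \<XX> V\<^esub>" using D.integral[OF bs ring_hom_closed[OF hV ab(2)] sV] by blast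
      then show False using c(2) cs ring_hom_zero[OF hK D.ring_axioms K.ring_axioms] by simp
    qed
    then have eb: "\<eta> \<in> V \<inter> A.basic a" using V(2) eU unfolding A.basic_def by blast
    let ?Y = "V \<inter> A.basic a"
    have oY: "open_set ?Y" using V A.basic_open[OF ab(1)] by blast
    have YU: "?Y \<subseteq> U" and YV: "?Y \<subseteq> V" and Yne: "?Y \<noteq> {}" using VU eb by auto
    obtain d where d: "d \<in> carrier (sections \<XX> ?Y)" "A.sec ?Y a \<otimes>\<^bsub>sections \<XX> ?Y\<^esub> d = \<one>\<^bsub>sections \<XX> ?Y\<^esub>"
      using A.sec_unit[OF oY _ ab(1)] by blast
    have aY: "section_to_K \<XX> ?Y (A.sec ?Y a) = section_to_K \<XX> V (A.sec V a)"
      using section_to_K_restr[OF V(1) oY YV Yne ring_hom_closed[OF hV ab(1)]] A.sec_restr[OF V(1) VU oY YV ab(1)] by simp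
    note hY = section_to_K_hom[OF oY Yne]
    let ?b = "section_to_K \<XX> V (A.sec V b)" and ?d = "section_to_K \<XX> ?Y d"
    have bc: "?b \<in> carrier KX" using ring_hom_closed[OF hK ring_hom_closed[OF hV ab(2)]] .
    have dc: "?d \<in> carrier KX" using ring_hom_closed[OF hY d(1)] .
    have "\<one>\<^bsub>KX\<^esub> = section_to_K \<XX> ?Y (A.sec ?Y a \<otimes>\<^bsub>sections \<XX> ?Y\<^esub> d)" unfolding d(2) by (rule ring_hom_one[OF hY, symmetric])
    also have "\<dots> = section_to_K \<XX> V (A.sec V a) \<otimes>\<^bsub>KX\<^esub> ?d"
      using ring_hom_mult[OF hY ring_hom_closed[OF A.sec_hom[OF oY YU] ab(1)] d(1)] unfolding aY .
    also have "section_to_K \<XX> V (A.sec V a) = ?b \<otimes>\<^bsub>KX\<^esub> c"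
      unfolding eq[symmetric] cs by (rule ring_hom_mult[OF hK ring_hom_closed[OF hV ab(2)] sV])
    also have "?b \<otimes>\<^bsub>KX\<^esub> c \<otimes>\<^bsub>KX\<^esub> ?d = c \<otimes>\<^bsub>KX\<^esub> (?b \<otimes>\<^bsub>KX\<^esub> ?d)" using c(1) bc dc by (simp add: K.m_ac)
    finally show "\<exists>b\<in>carrier KX. c \<otimes>\<^bsub>KX\<^esub> b = \<one>\<^bsub>KX\<^esub>" using bc dc K.m_closed by metis
  qed
qed

end

section \<open>Sections and stalks as subrings of the function field\<close>

context integral_space
begin

sublocale K: field KX by (rule KX_field)

text \<open>The images of the sections in the function field, and below those of the stalks. There
  restriction maps become inclusions, and a stalk is the plain union of the rings of its
  neighbourhoods.\<close>

definition Oo :: "'x set \<Rightarrow> ('x set \<times> 'a) set set" where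
  "Oo U = section_to_K \<XX> U ` carrier (sections \<XX> U)"

definition Ox :: "'x \<Rightarrow> ('x set \<times> 'a) set set" where
  "Ox x = \<Union>{Oo U |U. open_set U \<and> x \<in> U}"

lemma Oo_subring:
  assumes U: "open_set U" "U \<noteq> {}"
  shows "subring (Oo U) KX"
  unfolding Oo_def by (rule subring_hom_image[OF cring_sections[OF U(1)] K.cring_axioms section_to_K_hom[OF U]])

lemma Oo_mono:
  assumes "open_set U" "open_set V" "V \<subseteq> U" "V \<noteq> {}"
  shows "Oo U \<subseteq> Oo V"
proof
  fix c assume "c \<in> Oo U"
  then obtain s where s: "s \<in> carrier (sections \<XX> U)" "c = section_to_K \<XX> U s" unfolding Oo_def by auto
  have "c = section_to_K \<XX> V (restr \<XX> U V s)" using section_to_K_restr[OF assms s(1)] s(2) by simp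
  then show "c \<in> Oo V" unfolding Oo_def using restr_closed[OF assms(1-3) s(1)] by blast
qed

lemma OxI: "open_set U \<Longrightarrow> x \<in> U \<Longrightarrow> c \<in> Oo U \<Longrightarrow> c \<in> Ox x"
  unfolding Ox_def by blast

lemma OxE:
  assumes "c \<in> Ox x"
  obtains U where "open_set U" "x \<in> U" "c \<in> Oo U"
  using assms unfolding Ox_def by blast

lemma Ox_common:
  assumes c: "c \<in> Ox x" and d: "d \<in> Ox x" and V: "open_set V" "x \<in> V"
  obtains U where "open_set U" "x \<in> U" "U \<subseteq> V" "c \<in> Oo U" "d \<in> Oo U"
proof -
  obtain A where A: "open_set A" "x \<in> A" "c \<in> Oo A" by (rule OxE[OF c])
  obtain B where B: "open_set B" "x \<in> B" "d \<in> Oo B" by (rule OxE[OF d])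
  let ?U = "A \<inter> B \<inter> V"
  have o: "open_set ?U" "x \<in> ?U" using A B V by auto
  then have "Oo A \<subseteq> Oo ?U" "Oo B \<subseteq> Oo ?U" using Oo_mono[OF A(1) o(1)] Oo_mono[OF B(1) o(1)] by auto
  then show ?thesis using that[OF o] A B by blast
qed

lemma Ox_subring:
  assumes x: "x \<in> TX"
  shows "subring (Ox x) KX"
proof (rule K.subringI)
  have T: "open_set TX" by simp
  show "Ox x \<subseteq> carrier KX"
  proof
    fix c assume "c \<in> Ox x"
    then obtain U where U: "open_set U" "x \<in> U" "c \<in> Oo U" by (rule OxE)
    then have s: "subring (Oo U) KX" using Oo_subring by blast
    then show "c \<in> carrier KX" using subringE(1)[OF s] U(3) by blast
  qed
  have s: "subring (Oo TX) KX" using Oo_subring[OF T] x by blast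
  show "\<one>\<^bsub>KX\<^esub> \<in> Ox x" by (rule OxI[OF T x subringE(3)[OF s]])
  show "\<ominus>\<^bsub>KX\<^esub> c \<in> Ox x" if c: "c \<in> Ox x" for c
  proof -
    obtain U where U: "open_set U" "x \<in> U" "c \<in> Oo U" by (rule OxE[OF c])
    then have s: "subring (Oo U) KX" using Oo_subring by blast
    show ?thesis by (rule OxI[OF U(1,2) subringE(5)[OF s U(3)]])
  qed
  fix c d assume cd: "c \<in> Ox x" "d \<in> Ox x"
  obtain U where U: "open_set U" "x \<in> U" "U \<subseteq> TX" "c \<in> Oo U" "d \<in> Oo U" by (rule Ox_common[OF cd T x])
  then have s: "subring (Oo U) KX" using Oo_subring by blast
  show "c \<otimes>\<^bsub>KX\<^esub> d \<in> Ox x" using OxI[OF U(1,2) subringE(6)[OF s U(4,5)]] .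
  show "c \<oplus>\<^bsub>KX\<^esub> d \<in> Ox x" using OxI[OF U(1,2) subringE(7)[OF s U(4,5)]] .
qed

lemma Ox_eta: "Ox \<eta> = carrier KX"
proof (rule subset_antisym)
  show "Ox \<eta> \<subseteq> carrier KX" using subringE(1)[OF Ox_subring[OF eta_TX]] .
  show "carrier KX \<subseteq> Ox \<eta>"
  proof
    fix c assume c: "c \<in> carrier KX"
    obtain U s where U: "open_set U" "U \<noteq> {}" "s \<in> carrier (sections \<XX> U)" "c = section_to_K \<XX> U s"
      by (rule KX_carrier[OF c])
    then show "c \<in> Ox \<eta>" using OxI[OF U(1) eta_open[OF U(1,2)]] unfolding Oo_def by blast
  qed
qed

lemma stalk_to_K_germ:
  assumes U: "open_set U" "x \<in> U" "s \<in> carrier (sections \<XX> U)"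
  shows "stalk_to_K \<XX> (germ \<XX> x U s) = section_to_K \<XX> U s"
proof -
  have eq: "section_to_K \<XX> V t = section_to_K \<XX> U s" if m: "(V, t) \<in> germ \<XX> x U s" for V t
  proof -
    obtain W where W: "open_set V" "x \<in> V" "t \<in> carrier (sections \<XX> V)" "open_set W" "x \<in> W" "W \<subseteq> U" "W \<subseteq> V"
      "restr \<XX> U W s = restr \<XX> V W t" using m unfolding germ_def by blast
    have ne: "W \<noteq> {}" using W by blast
    show ?thesis using section_to_K_restr[OF W(1,4,7) ne W(3)] section_to_K_restr[OF U(1) W(4,6) ne U(3)] W(8) by simp
  qed
  show ?thesis unfolding stalk_to_K_def
  proof (intro subset_antisym subsetI)
    fix z assume "z \<in> (\<Union>(U, s)\<in>germ \<XX> x U s. section_to_K \<XX> U s)"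
    then obtain V t where "(V, t) \<in> germ \<XX> x U s" "z \<in> section_to_K \<XX> V t" by blast
    then show "z \<in> section_to_K \<XX> U s" using eq by simp
  qed (use germ_self[OF U] in blast)
qed

lemma stalk_carrierE:
  assumes "A \<in> carrier (stalk \<XX> x)"
  obtains U s where "open_set U" "x \<in> U" "s \<in> carrier (sections \<XX> U)" "A = germ \<XX> x U s"
  using assms unfolding stalk_carrier by blast

lemma stalk_to_K_hom:
  assumes x: "x \<in> TX"
  shows "stalk_to_K \<XX> \<in> ring_hom (stalk \<XX> x) KX"
proof (rule ring_hom_memI)
  fix A assume A: "A \<in> carrier (stalk \<XX> x)"
  obtain U s where U: "open_set U" "x \<in> U" "s \<in> carrier (sections \<XX> U)" "A = germ \<XX> x U s" by (rule stalk_carrierE[OF A])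
  then show "stalk_to_K \<XX> A \<in> carrier KX" using stalk_to_K_germ[OF U(1-3)] ring_hom_closed[OF section_to_K_hom] by (metis empty_iff)
next
  fix A B assume A: "A \<in> carrier (stalk \<XX> x)" and B: "B \<in> carrier (stalk \<XX> x)"
  obtain U s where U: "open_set U" "x \<in> U" "s \<in> carrier (sections \<XX> U)" "A = germ \<XX> x U s" by (rule stalk_carrierE[OF A])
  obtain V t where V: "open_set V" "x \<in> V" "t \<in> carrier (sections \<XX> V)" "B = germ \<XX> x V t" by (rule stalk_carrierE[OF B])
  let ?W = "U \<inter> V" and ?s = "restr \<XX> U (U \<inter> V) s" and ?t = "restr \<XX> V (U \<inter> V) t"
  have W: "open_set ?W" "x \<in> ?W" "?W \<noteq> {}" using U V by auto
  interpret R: cring "sections \<XX> ?W" by (rule cring_sections[OF W(1)])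
  have sc: "?s \<in> carrier (sections \<XX> ?W)" "?t \<in> carrier (sections \<XX> ?W)"
    using restr_closed[OF U(1) W(1) _ U(3)] restr_closed[OF V(1) W(1) _ V(3)] by auto
  have K: "section_to_K \<XX> ?W ?s = stalk_to_K \<XX> A" "section_to_K \<XX> ?W ?t = stalk_to_K \<XX> B"
    unfolding U(4) V(4) stalk_to_K_germ[OF U(1-3)] stalk_to_K_germ[OF V(1-3)]
    using section_to_K_restr[OF U(1) W(1) _ W(3) U(3)] section_to_K_restr[OF V(1) W(1) _ W(3) V(3)] by auto
  have "A \<otimes>\<^bsub>stalk \<XX> x\<^esub> B = germ \<XX> x ?W (?s \<otimes>\<^bsub>sections \<XX> ?W\<^esub> ?t)" unfolding U(4) V(4) by (rule stalk_mult[OF U(1-3) V(1-3)])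
  then have "stalk_to_K \<XX> (A \<otimes>\<^bsub>stalk \<XX> x\<^esub> B) = section_to_K \<XX> ?W (?s \<otimes>\<^bsub>sections \<XX> ?W\<^esub> ?t)"
    using stalk_to_K_germ[OF W(1,2) R.m_closed[OF sc]] by simp
  then show "stalk_to_K \<XX> (A \<otimes>\<^bsub>stalk \<XX> x\<^esub> B) = stalk_to_K \<XX> A \<otimes>\<^bsub>KX\<^esub> stalk_to_K \<XX> B"
    unfolding ring_hom_mult[OF section_to_K_hom[OF W(1,3)] sc] K .
  have "A \<oplus>\<^bsub>stalk \<XX> x\<^esub> B = germ \<XX> x ?W (?s \<oplus>\<^bsub>sections \<XX> ?W\<^esub> ?t)" unfolding U(4) V(4) by (rule stalk_add[OF U(1-3) V(1-3)])
  then have "stalk_to_K \<XX> (A \<oplus>\<^bsub>stalk \<XX> x\<^esub> B) = section_to_K \<XX> ?W (?s \<oplus>\<^bsub>sections \<XX> ?W\<^esub> ?t)"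
    using stalk_to_K_germ[OF W(1,2) R.a_closed[OF sc]] by simp
  then show "stalk_to_K \<XX> (A \<oplus>\<^bsub>stalk \<XX> x\<^esub> B) = stalk_to_K \<XX> A \<oplus>\<^bsub>KX\<^esub> stalk_to_K \<XX> B"
    unfolding ring_hom_add[OF section_to_K_hom[OF W(1,3)] sc] K .
next
  have T: "open_set TX" "TX \<noteq> {}" using TX_nonempty by auto
  interpret R: cring "sections \<XX> TX" by (rule cring_sections[OF T(1)])
  have "\<one>\<^bsub>stalk \<XX> x\<^esub> = germ \<XX> x TX \<one>\<^bsub>sections \<XX> TX\<^esub>" unfolding stalk_def by simp
  then show "stalk_to_K \<XX> \<one>\<^bsub>stalk \<XX> x\<^esub> = \<one>\<^bsub>KX\<^esub>"
    using stalk_to_K_germ[OF T(1) x R.one_closed] ring_hom_one[OF section_to_K_hom[OF T]] by simp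
qed

lemma stalk_to_K_inj:
  assumes x: "x \<in> TX"
  shows "inj_on (stalk_to_K \<XX>) (carrier (stalk \<XX> x))"
proof (rule inj_onI)
  fix A B assume A: "A \<in> carrier (stalk \<XX> x)" and B: "B \<in> carrier (stalk \<XX> x)" and eq: "stalk_to_K \<XX> A = stalk_to_K \<XX> B"
  obtain U s where U: "open_set U" "x \<in> U" "s \<in> carrier (sections \<XX> U)" "A = germ \<XX> x U s" by (rule stalk_carrierE[OF A])
  obtain V t where V: "open_set V" "x \<in> V" "t \<in> carrier (sections \<XX> V)" "B = germ \<XX> x V t" by (rule stalk_carrierE[OF B])
  let ?W = "U \<inter> V" and ?s = "restr \<XX> U (U \<inter> V) s" and ?t = "restr \<XX> V (U \<inter> V) t"
  have W: "open_set ?W" "x \<in> ?W" "?W \<noteq> {}" using U V by auto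
  have sc: "?s \<in> carrier (sections \<XX> ?W)" "?t \<in> carrier (sections \<XX> ?W)"
    using restr_closed[OF U(1) W(1) _ U(3)] restr_closed[OF V(1) W(1) _ V(3)] by auto
  have "section_to_K \<XX> ?W ?s = section_to_K \<XX> ?W ?t"
    using eq section_to_K_restr[OF U(1) W(1) _ W(3) U(3)] section_to_K_restr[OF V(1) W(1) _ W(3) V(3)]
    unfolding U(4) V(4) stalk_to_K_germ[OF U(1-3)] stalk_to_K_germ[OF V(1-3)] by auto
  then have "?s = ?t" using section_to_K_inj[OF W(1,3)] sc unfolding inj_on_def by blast
  then show "A = B" unfolding U(4) V(4) by (intro germ_eqI[OF U(1,3) V(1,3) W(1,2)]) auto
qed

lemma stalk_to_K_image:
  assumes x: "x \<in> TX"
  shows "stalk_to_K \<XX> ` carrier (stalk \<XX> x) = Ox x"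
proof (intro subset_antisym subsetI)
  fix c assume "c \<in> stalk_to_K \<XX> ` carrier (stalk \<XX> x)"
  then obtain A where A: "A \<in> carrier (stalk \<XX> x)" "c = stalk_to_K \<XX> A" by auto
  obtain U s where U: "open_set U" "x \<in> U" "s \<in> carrier (sections \<XX> U)" "A = germ \<XX> x U s" by (rule stalk_carrierE[OF A(1)])
  then show "c \<in> Ox x" using stalk_to_K_germ[OF U(1-3)] A(2) OxI[OF U(1,2)] unfolding Oo_def by auto
next
  fix c assume "c \<in> Ox x"
  then obtain U where U: "open_set U" "x \<in> U" "c \<in> Oo U" by (rule OxE)
  then obtain s where s: "s \<in> carrier (sections \<XX> U)" "c = section_to_K \<XX> U s" unfolding Oo_def by auto
  have "germ \<XX> x U s \<in> carrier (stalk \<XX> x)" unfolding stalk_carrier using U s by blast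
  then show "c \<in> stalk_to_K \<XX> ` carrier (stalk \<XX> x)" using stalk_to_K_germ[OF U(1,2) s(1)] s(2) by (intro image_eqI) auto
qed

abbreviation Ux :: "'x \<Rightarrow> ('x set \<times> 'a) set set" where "Ux x \<equiv> units_in KX (Ox x)"

text \<open>Every neighbourhood of a point in the closure of z contains z, so regularity and
  invertibility pass from y to its generization z.\<close>

lemma closure_Ox:
  assumes "y \<in> (topol \<XX>) closure_of {z}"
  shows "Ox y \<subseteq> Ox z" "Ux y \<subseteq> Ux z"
proof -
  show s: "Ox y \<subseteq> Ox z" unfolding Ox_def using closure_open[OF _ _ assms] by blast
  then show "Ux y \<subseteq> Ux z" unfolding units_in_def by blast
qed

end

section \<open>The dictionary between primes of a chart and units at its points\<close>

locale integral_chart = integral_space \<XX> + A: affine_chart \<XX> U R f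
  for \<XX> :: "('x, 'a) rspace" and U R f +
  assumes nonempty: "U \<noteq> {}"
begin

definition \<phi> where "\<phi> r = section_to_K \<XX> U (A.sec U r)"

lemma etaU: "\<eta> \<in> U" using eta_open[OF A.openU nonempty] .

lemma UTX: "U \<subseteq> TX" using openin_subset[OF A.openU] .

lemma phi_hom: "\<phi> \<in> ring_hom R KX"
proof -
  have "section_to_K \<XX> U \<circ> A.sec U \<in> ring_hom R KX"
    by (rule ring_hom_trans[OF A.sec_hom[OF A.openU subset_refl] section_to_K_hom[OF A.openU nonempty]])
  moreover have "section_to_K \<XX> U \<circ> A.sec U = \<phi>" unfolding \<phi>_def by auto
  ultimately show ?thesis by simp
qed

sublocale P: ring_hom_cring R KX \<phi>
  using phi_hom by (simp add: ring_hom_cring_def ring_hom_cring_axioms_def A.C.cring_axioms K.cring_axioms)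

lemma phi_Oo: "r \<in> carrier R \<Longrightarrow> \<phi> r \<in> Oo U"
  unfolding \<phi>_def Oo_def using ring_hom_closed[OF A.sec_hom[OF A.openU subset_refl]] by blast

lemma Oo_Ox: "y \<in> U \<Longrightarrow> Oo U \<subseteq> Ox y"
  using OxI[OF A.openU] by blast

lemma phi_sec:
  assumes "open_set W" "W \<subseteq> U" "W \<noteq> {}" "r \<in> carrier R"
  shows "section_to_K \<XX> W (A.sec W r) = \<phi> r"
  unfolding \<phi>_def A.sec_restr[OF A.openU subset_refl assms(1,2,4), symmetric]
  by (rule section_to_K_restr[OF A.openU assms(1-3) ring_hom_closed[OF A.sec_hom[OF A.openU subset_refl] assms(4)]])

text \<open>Combines \<open>sec_unit\<close> and \<open>sec_unit_imp\<close>. It expresses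
  membership in the prime of a point by invertibility in the function field, and lets the primes of
  \<open>R\<close> disappear from later arguments.\<close>

lemma phi_unit_iff:
  assumes y: "y \<in> U" and r: "r \<in> carrier R"
  shows "\<phi> r \<in> Ux y \<longleftrightarrow> r \<notin> pt f y"
proof
  assume "r \<notin> pt f y"
  then have yb: "y \<in> A.basic r" using y unfolding A.basic_def by blast
  note o = A.basic_open[OF r]
  have bU: "A.basic r \<subseteq> U" and ne: "A.basic r \<noteq> {}" using yb unfolding A.basic_def by auto
  obtain t where t: "t \<in> carrier (sections \<XX> (A.basic r))" "A.sec (A.basic r) r \<otimes>\<^bsub>sections \<XX> (A.basic r)\<^esub> t = \<one>\<^bsub>sections \<XX> (A.basic r)\<^esub>"
    using A.sec_unit[OF o subset_refl r] by blast
  note h = section_to_K_hom[OF o ne]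
  have "\<phi> r \<otimes>\<^bsub>KX\<^esub> section_to_K \<XX> (A.basic r) t = section_to_K \<XX> (A.basic r) (A.sec (A.basic r) r \<otimes>\<^bsub>sections \<XX> (A.basic r)\<^esub> t)"
    unfolding phi_sec[OF o bU ne r, symmetric] by (rule ring_hom_mult[OF h ring_hom_closed[OF A.sec_hom[OF o bU] r] t(1), symmetric])
  also have "\<dots> = \<one>\<^bsub>KX\<^esub>" unfolding t(2) by (rule ring_hom_one[OF h])
  finally have e: "\<phi> r \<otimes>\<^bsub>KX\<^esub> section_to_K \<XX> (A.basic r) t = \<one>\<^bsub>KX\<^esub>" .
  have "section_to_K \<XX> (A.basic r) t \<in> Ox y" using OxI[OF o yb] t(1) unfolding Oo_def by blast
  moreover have "\<phi> r \<in> Ox y" using phi_Oo[OF r] Oo_Ox[OF y] by blast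
  ultimately show "\<phi> r \<in> Ux y" unfolding units_in_def using e by blast
next
  assume "\<phi> r \<in> Ux y"
  then obtain w where w: "w \<in> Ox y" "\<phi> r \<otimes>\<^bsub>KX\<^esub> w = \<one>\<^bsub>KX\<^esub>" unfolding units_in_def by blast
  obtain W where W: "open_set W" "y \<in> W" "W \<subseteq> U" "w \<in> Oo W" by (rule Ox_common[OF w(1) w(1) A.openU y])
  then obtain s where s: "s \<in> carrier (sections \<XX> W)" "w = section_to_K \<XX> W s" unfolding Oo_def by auto
  have ne: "W \<noteq> {}" using W by blast
  note h = section_to_K_hom[OF W(1) ne]
  interpret RW: cring "sections \<XX> W" by (rule cring_sections[OF W(1)])
  note sc = ring_hom_closed[OF A.sec_hom[OF W(1,3)] r]
  have "section_to_K \<XX> W (A.sec W r \<otimes>\<^bsub>sections \<XX> W\<^esub> s) = \<phi> r \<otimes>\<^bsub>KX\<^esub> w"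
    unfolding ring_hom_mult[OF h sc s(1)] phi_sec[OF W(1,3) ne r] s(2) ..
  also have "\<dots> = section_to_K \<XX> W \<one>\<^bsub>sections \<XX> W\<^esub>" unfolding w(2) by (rule ring_hom_one[OF h, symmetric])
  finally have "A.sec W r \<otimes>\<^bsub>sections \<XX> W\<^esub> s = \<one>\<^bsub>sections \<XX> W\<^esub>"
    using inj_onD[OF section_to_K_inj[OF W(1) ne]] RW.m_closed[OF sc s(1)] RW.one_closed by blast
  then show "r \<notin> pt f y" by (rule A.sec_unit_imp[OF W(1,3) r W(2) s(1)])
qed

lemma Ox_fraction:
  assumes y: "y \<in> U" and c: "c \<in> Ox y"
  obtains a b where "a \<in> carrier R" "b \<in> carrier R" "b \<notin> pt f y" "\<phi> b \<otimes>\<^bsub>KX\<^esub> c = \<phi> a"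
proof -
  obtain W where W: "open_set W" "y \<in> W" "W \<subseteq> U" "c \<in> Oo W" by (rule Ox_common[OF c c A.openU y])
  then obtain s where s: "s \<in> carrier (sections \<XX> W)" "c = section_to_K \<XX> W s" unfolding Oo_def by auto
  have WU: "W \<subseteq> U" using W by blast
  obtain V a b where V: "open_set V" "y \<in> V" "V \<subseteq> W" and ab: "a \<in> carrier R" "b \<in> carrier R" "V \<subseteq> A.basic b"
      "A.sec V b \<otimes>\<^bsub>sections \<XX> V\<^esub> restr \<XX> W V s = A.sec V a" by (rule A.sec_fraction[OF W(1) WU W(2) s(1)])
  have ne: "V \<noteq> {}" and VU: "V \<subseteq> U" using V WU by auto
  have "\<phi> b \<otimes>\<^bsub>KX\<^esub> c = section_to_K \<XX> V (A.sec V b) \<otimes>\<^bsub>KX\<^esub> section_to_K \<XX> V (restr \<XX> W V s)"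
    unfolding phi_sec[OF V(1) VU ne ab(2)] s(2) section_to_K_restr[OF W(1) V(1,3) ne s(1)] ..
  also have "\<dots> = section_to_K \<XX> V (A.sec V a)"
    unfolding ab(4)[symmetric]
    by (rule ring_hom_mult[OF section_to_K_hom[OF V(1) ne] ring_hom_closed[OF A.sec_hom[OF V(1) VU] ab(2)] restr_closed[OF W(1) V(1,3) s(1)], symmetric])
  also have "\<dots> = \<phi> a" by (rule phi_sec[OF V(1) VU ne ab(1)])
  finally have "\<phi> b \<otimes>\<^bsub>KX\<^esub> c = \<phi> a" .
  moreover have "b \<notin> pt f y" using ab(3) V(2) unfolding A.basic_def by blast
  ultimately show ?thesis using that ab by blast
qed

text \<open>The denominator b is a unit at y, so c and its numerator a are units at y
  simultaneously.\<close>

lemma fraction_unit_iff: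
  assumes y: "y \<in> U" and c: "c \<in> Ox y" and ab: "a \<in> carrier R" "b \<in> carrier R" "b \<notin> pt f y" "\<phi> b \<otimes>\<^bsub>KX\<^esub> c = \<phi> a"
  shows "c \<in> Ux y \<longleftrightarrow> a \<notin> pt f y"
proof -
  have yT: "y \<in> TX" using y UTX by blast
  note sub = Ox_subring[OF yT] and un = K.units_in_facts[OF Ox_subring[OF yT]]
  have bu: "\<phi> b \<in> Ux y" using phi_unit_iff[OF y ab(2)] ab by blast
  have cc: "c \<in> carrier KX" using subringE(1)[OF sub] c by blast
  show ?thesis
  proof
    assume "c \<in> Ux y"
    from un(2)[OF bu this] have "\<phi> a \<in> Ux y" unfolding ab(4) .
    then show "a \<notin> pt f y" using phi_unit_iff[OF y ab(1)] by blast
  next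
    assume "a \<notin> pt f y"
    then have au: "\<phi> a \<in> Ux y" using phi_unit_iff[OF y ab(1)] by blast
    then obtain w where w: "w \<in> Ox y" "\<phi> a \<otimes>\<^bsub>KX\<^esub> w = \<one>\<^bsub>KX\<^esub>" unfolding units_in_def by blast
    have wc: "w \<in> carrier KX" using subringE(1)[OF sub] w by blast
    have "c \<otimes>\<^bsub>KX\<^esub> (\<phi> b \<otimes>\<^bsub>KX\<^esub> w) = \<one>\<^bsub>KX\<^esub>"
    proof -
      have "c \<otimes>\<^bsub>KX\<^esub> (\<phi> b \<otimes>\<^bsub>KX\<^esub> w) = (\<phi> b \<otimes>\<^bsub>KX\<^esub> c) \<otimes>\<^bsub>KX\<^esub> w" using cc wc P.hom_closed[OF ab(2)] by algebra
      then show ?thesis unfolding ab(4) w(2) .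
    qed
    moreover have "\<phi> b \<otimes>\<^bsub>KX\<^esub> w \<in> Ox y" using subringE(6)[OF sub _ w(1)] bu unfolding units_in_def by blast
    ultimately show "c \<in> Ux y" unfolding units_in_def using c by blast
  qed
qed

text \<open>By \<open>fraction_unit_iff\<close> the nonunits at y are the fractions with numerator
  in the prime of y. Over the common denominator b b' the sum of two such fractions again has its
  numerator in the prime.\<close>

lemma chart_local:
  assumes y: "y \<in> U"
  shows "submodule_over KX (Ox y) (Ox y - Ux y)"
proof -
  have yT: "y \<in> TX" using y UTX by blast
  note sub = Ox_subring[OF yT]
  note Oc = subsetD[OF subringE(1)[OF sub]]
  interpret q: primeideal "pt f y" R by (rule A.pt_prime[OF y])
  have bb: "b \<otimes>\<^bsub>R\<^esub> b' \<notin> pt f y" if "b \<in> carrier R" "b \<notin> pt f y" "b' \<in> carrier R" "b' \<notin> pt f y" for b b'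
    using that q.I_prime by blast
  show ?thesis
  proof (rule submodule_overI)
    show "Ox y - Ux y \<subseteq> carrier KX" using Oc by blast
    show "\<zero>\<^bsub>KX\<^esub> \<in> Ox y - Ux y" using subringE(2)[OF sub] K.units_in_facts(1)[OF sub, of "\<zero>\<^bsub>KX\<^esub>"] by blast
  next
    fix c d assume c: "c \<in> Ox y - Ux y" and d: "d \<in> Ox y - Ux y"
    have cd: "c \<in> Ox y" "d \<in> Ox y" using c d by auto
    obtain a b where ab: "a \<in> carrier R" "b \<in> carrier R" "b \<notin> pt f y" "\<phi> b \<otimes>\<^bsub>KX\<^esub> c = \<phi> a" by (rule Ox_fraction[OF y cd(1)])
    obtain a' b' where ab': "a' \<in> carrier R" "b' \<in> carrier R" "b' \<notin> pt f y" "\<phi> b' \<otimes>\<^bsub>KX\<^esub> d = \<phi> a'" by (rule Ox_fraction[OF y cd(2)])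
    have aq: "a \<in> pt f y" "a' \<in> pt f y" using fraction_unit_iff[OF y cd(1) ab] fraction_unit_iff[OF y cd(2) ab'] c d by blast+
    have car: "c \<in> carrier KX" "d \<in> carrier KX" "\<phi> b \<in> carrier KX" "\<phi> b' \<in> carrier KX" using cd Oc ab ab' by auto
    have "\<phi> (b \<otimes>\<^bsub>R\<^esub> b') \<otimes>\<^bsub>KX\<^esub> (c \<oplus>\<^bsub>KX\<^esub> d) = \<phi> b' \<otimes>\<^bsub>KX\<^esub> (\<phi> b \<otimes>\<^bsub>KX\<^esub> c) \<oplus>\<^bsub>KX\<^esub> \<phi> b \<otimes>\<^bsub>KX\<^esub> (\<phi> b' \<otimes>\<^bsub>KX\<^esub> d)"
      unfolding P.hom_mult[OF ab(2) ab'(2)] using car by algebra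
    also have "\<dots> = \<phi> (b' \<otimes>\<^bsub>R\<^esub> a \<oplus>\<^bsub>R\<^esub> b \<otimes>\<^bsub>R\<^esub> a')" unfolding ab(4) ab'(4) using ab ab' by simp
    finally have eq: "\<phi> (b \<otimes>\<^bsub>R\<^esub> b') \<otimes>\<^bsub>KX\<^esub> (c \<oplus>\<^bsub>KX\<^esub> d) = \<phi> (b' \<otimes>\<^bsub>R\<^esub> a \<oplus>\<^bsub>R\<^esub> b \<otimes>\<^bsub>R\<^esub> a')" .
    have s: "c \<oplus>\<^bsub>KX\<^esub> d \<in> Ox y" by (rule subringE(7)[OF sub cd])
    have "b' \<otimes>\<^bsub>R\<^esub> a \<oplus>\<^bsub>R\<^esub> b \<otimes>\<^bsub>R\<^esub> a' \<in> pt f y"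
      by (rule q.a_closed[OF q.I_l_closed[OF aq(1) ab'(2)] q.I_l_closed[OF aq(2) ab(2)]])
    moreover have "c \<oplus>\<^bsub>KX\<^esub> d \<in> Ux y \<longleftrightarrow> b' \<otimes>\<^bsub>R\<^esub> a \<oplus>\<^bsub>R\<^esub> b \<otimes>\<^bsub>R\<^esub> a' \<notin> pt f y"
      by (rule fraction_unit_iff[OF y s _ _ bb[OF ab(2,3) ab'(2,3)] eq]) (use ab ab' in auto)
    ultimately show "c \<oplus>\<^bsub>KX\<^esub> d \<in> Ox y - Ux y" using s by blast
  next
    fix c d assume c: "c \<in> Ox y" and d: "d \<in> Ox y - Ux y"
    have dO: "d \<in> Ox y" using d by auto
    have "c \<otimes>\<^bsub>KX\<^esub> d \<notin> Ux y"
    proof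
      assume "c \<otimes>\<^bsub>KX\<^esub> d \<in> Ux y"
      then obtain w where w: "w \<in> Ox y" "c \<otimes>\<^bsub>KX\<^esub> d \<otimes>\<^bsub>KX\<^esub> w = \<one>\<^bsub>KX\<^esub>" unfolding units_in_def by blast
      have "d \<otimes>\<^bsub>KX\<^esub> (c \<otimes>\<^bsub>KX\<^esub> w) = c \<otimes>\<^bsub>KX\<^esub> d \<otimes>\<^bsub>KX\<^esub> w" using Oc[OF c] Oc[OF dO] Oc[OF w(1)] by algebra
      then have "d \<otimes>\<^bsub>KX\<^esub> (c \<otimes>\<^bsub>KX\<^esub> w) = \<one>\<^bsub>KX\<^esub>" unfolding w(2) .
      then have "d \<in> Ux y" unfolding units_in_def using dO subringE(6)[OF sub c w(1)] by blast
      then show False using d by blast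
    qed
    then show "c \<otimes>\<^bsub>KX\<^esub> d \<in> Ox y - Ux y" using subringE(6)[OF sub c dO] by blast
  qed
qed

lemma chart_basis:
  assumes V: "open_set V" "V \<subseteq> U" and y: "y \<in> V"
  shows "\<exists>b\<in>Oo U. b \<in> Ux y \<and> (\<forall>z\<in>U. b \<in> Ux z \<longrightarrow> z \<in> V)"
proof -
  obtain r where r: "r \<in> carrier R" "y \<in> A.basic r" "A.basic r \<subseteq> V" using A.basic_basis[OF V y] by blast
  have "\<phi> r \<in> Ux y" using phi_unit_iff[OF _ r(1)] r(2) unfolding A.basic_def by blast
  moreover have "z \<in> V" if z: "z \<in> U" "\<phi> r \<in> Ux z" for z
    using phi_unit_iff[OF z(1) r(1)] z r(3) unfolding A.basic_def by blast
  ultimately show ?thesis using phi_Oo[OF r(1)] by blast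
qed

lemma chart_fraction:
  assumes y: "y \<in> U" and c: "c \<in> Ox y"
  shows "\<exists>a\<in>Oo U. \<exists>b\<in>Oo U. b \<in> Ux y \<and> b \<otimes>\<^bsub>KX\<^esub> c = a"
proof -
  obtain a b where ab: "a \<in> carrier R" "b \<in> carrier R" "b \<notin> pt f y" "\<phi> b \<otimes>\<^bsub>KX\<^esub> c = \<phi> a" by (rule Ox_fraction[OF assms])
  have "\<phi> b \<in> Ux y" using phi_unit_iff[OF y ab(2)] ab by blast
  then show ?thesis using phi_Oo ab by blast
qed

lemma chart_inj:
  assumes y: "y \<in> U" "z \<in> U" and eq: "\<And>b. b \<in> Oo U \<Longrightarrow> b \<in> Ux y \<longleftrightarrow> b \<in> Ux z"
  shows "y = z"
proof -
  have sub: "pt f y \<subseteq> carrier R" "pt f z \<subseteq> carrier R"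
    using A.pt_prime[OF y(1)] A.pt_prime[OF y(2)]
    by (meson additive_subgroup.a_subset ideal.axioms(1) primeideal.axioms(1))+
  have "r \<in> pt f y \<longleftrightarrow> r \<in> pt f z" if r: "r \<in> carrier R" for r
    using phi_unit_iff[OF y(1) r] phi_unit_iff[OF y(2) r] eq[OF phi_Oo[OF r]] by blast
  then have "pt f y = pt f z" using sub by blast
  then show ?thesis using A.pt_inj y unfolding inj_on_def by blast
qed

text \<open>The pullback of p to \<open>R\<close> is prime, hence belongs to a point y. An element c
  of \<open>Oo U\<close> is tested through an equation b c = a with b outside the prime of y: c lies
  in p iff a does, and c is a unit at y iff a is.\<close>

lemma chart_surj:
  assumes p: "prime_over KX (Oo U) p"
  shows "\<exists>y\<in>U. p = Oo U - Ux y"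
proof -
  have pm: "submodule_over KX (Oo U) p" "p \<subseteq> Oo U" "\<one>\<^bsub>KX\<^esub> \<notin> p"
    "\<And>a b. a \<in> Oo U \<Longrightarrow> b \<in> Oo U \<Longrightarrow> a \<otimes>\<^bsub>KX\<^esub> b \<in> p \<Longrightarrow> a \<in> p \<or> b \<in> p"
    using p unfolding prime_over_def by blast+
  note pD = submodule_overD[OF pm(1)]
  define q where "q = {r \<in> carrier R. \<phi> r \<in> p}"
  have "ideal q R"
  proof (rule idealI[OF A.C.ring_axioms])
    show "subgroup q (add_monoid R)"
    proof (rule A.C.add.subgroupI)
      show "q \<subseteq> carrier R" unfolding q_def by blast
      have "\<zero>\<^bsub>R\<^esub> \<in> q" using pD(2) unfolding q_def by simp
      then show "q \<noteq> {}" by blast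
      show "\<ominus>\<^bsub>R\<^esub> a \<in> q" if "a \<in> q" for a
      proof -
        have a: "a \<in> carrier R" "\<phi> a \<in> p" using that unfolding q_def by auto
        have "\<zero>\<^bsub>KX\<^esub> \<ominus>\<^bsub>KX\<^esub> \<phi> a \<in> p" by (rule K.submodule_over_minus[OF Oo_subring[OF A.openU nonempty] pm(1) pD(2) a(2)])
        then show ?thesis using a unfolding q_def by (simp add: a_minus_def)
      qed
      show "a \<oplus>\<^bsub>R\<^esub> b \<in> q" if "a \<in> q" "b \<in> q" for a b using that pD(3) unfolding q_def by simp
    qed
    show "x \<otimes>\<^bsub>R\<^esub> a \<in> q" if "a \<in> q" "x \<in> carrier R" for a x
      using that pD(4)[OF phi_Oo[OF that(2)]] unfolding q_def by simp
    then show "a \<otimes>\<^bsub>R\<^esub> x \<in> q" if "a \<in> q" "x \<in> carrier R" for a x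
      using that A.C.m_comm[of a x] unfolding q_def by auto
  qed
  then have "primeideal q R"
  proof (rule primeidealI[OF _ A.C.cring_axioms])
    have "\<one>\<^bsub>R\<^esub> \<notin> q" using pm(3) unfolding q_def by simp
    then show "carrier R \<noteq> q" using A.C.one_closed by blast
    show "a \<in> q \<or> b \<in> q" if ab: "a \<in> carrier R" "b \<in> carrier R" "a \<otimes>\<^bsub>R\<^esub> b \<in> q" for a b
      using pm(4)[OF phi_Oo[OF ab(1)] phi_Oo[OF ab(2)]] ab unfolding q_def by simp
  qed
  then have "q \<in> pt f ` U" unfolding A.pt_image prime_spectrum_def by simp
  then obtain y where y: "y \<in> U" "pt f y = q" by auto
  have "c \<in> p \<longleftrightarrow> c \<notin> Ux y" if c: "c \<in> Oo U" for c
  proof -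
    have cO: "c \<in> Ox y" using c Oo_Ox[OF y(1)] by blast
    obtain a b where ab: "a \<in> carrier R" "b \<in> carrier R" "b \<notin> pt f y" "\<phi> b \<otimes>\<^bsub>KX\<^esub> c = \<phi> a" by (rule Ox_fraction[OF y(1) cO])
    have "c \<in> p \<longleftrightarrow> \<phi> a \<in> p"
    proof
      assume "c \<in> p" then show "\<phi> a \<in> p" using pD(4)[OF phi_Oo[OF ab(2)], of c] ab(4) by simp
    next
      assume "\<phi> a \<in> p"
      then have "\<phi> b \<in> p \<or> c \<in> p" using pm(4)[OF phi_Oo[OF ab(2)] c] ab(4) by simp
      then show "c \<in> p" using ab(2,3) y(2) unfolding q_def by blast
    qed
    also have "\<dots> \<longleftrightarrow> a \<in> pt f y" using y(2) ab(1) unfolding q_def by blast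
    also have "\<dots> \<longleftrightarrow> c \<notin> Ux y" using fraction_unit_iff[OF y(1) cO ab] by blast
    finally show ?thesis .
  qed
  then have "p = Oo U - Ux y" using pm(2) by blast
  then show ?thesis using y(1) by blast
qed

end

section \<open>Prime divisors on a normal Noetherian scheme\<close>

text \<open>\<open>codim\<close> is a supremum of lengths of chains rising from P, and every such
  chain ends inside the whole space, which is irreducible itself. Length one therefore means that
  nothing irreducible fits strictly between P and the space.\<close>

lemma prime_divisor_iff:
  assumes top: "irreducible_closed (topol \<XX>) (topspace (topol \<XX>))"
  shows "prime_divisor \<XX> P \<longleftrightarrow> irreducible_closed (topol \<XX>) P \<and> P \<noteq> topspace (topol \<XX>) \<and>
    (\<forall>Z. irreducible_closed (topol \<XX>) Z \<and> P \<subseteq> Z \<longrightarrow> Z = P \<or> Z = topspace (topol \<XX>))"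
proof -
  let ?T = "topspace (topol \<XX>)" and ?irr = "irreducible_closed (topol \<XX>)"
  have le: "Z \<subseteq> ?T" if "?irr Z" for Z using that closedin_subset unfolding irreducible_closed_def by blast
  define N where "N = {enat n |n. \<exists>C. C 0 = P \<and> (\<forall>i\<le>n. ?irr (C i)) \<and> (\<forall>i<n. C i \<subset> C (Suc i))}"
  have cod: "codim (topol \<XX>) P = Sup N" unfolding codim_def N_def ..
  have "Sup N = 1 \<longleftrightarrow> P \<noteq> ?T \<and> (\<forall>Z. ?irr Z \<and> P \<subseteq> Z \<longrightarrow> Z = P \<or> Z = ?T)" if P: "?irr P"
  proof
    assume S: "Sup N = 1"
    have "P \<noteq> ?T"
    proof
      assume PT: "P = ?T"
      have "x \<le> 0" if "x \<in> N" for x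
      proof -
        obtain n C where n: "x = enat n" "C 0 = P" "\<forall>i\<le>n. ?irr (C i)" "\<forall>i<n. C i \<subset> C (Suc i)"
          using \<open>x \<in> N\<close> unfolding N_def by blast
        have "n = 0"
        proof (rule ccontr)
          assume "n \<noteq> 0"
          then have "C 0 \<subset> C (Suc 0)" "?irr (C (Suc 0))" using n(3,4) by auto
          then show False using le n(2) PT by blast
        qed
        then show ?thesis using n(1) by (simp add: zero_enat_def)
      qed
      then have "Sup N \<le> 0" by (rule Sup_least)
      then show False using S by simp
    qed
    moreover have "Z = P \<or> Z = ?T" if Z: "?irr Z" "P \<subseteq> Z" for Z
    proof (rule ccontr)
      assume n: "\<not> (Z = P \<or> Z = ?T)"
      \<comment> \<open>An intermediate Z gives a chain with two steps and codimension at least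
        two.\<close>
      define C where "C i = (if i = 0 then P else if i = Suc 0 then Z else ?T)" for i :: nat
      have "C 0 = P" by (simp add: C_def)
      moreover have "\<forall>i\<le>2. ?irr (C i)" using P Z top by (auto simp: C_def)
      moreover have "\<forall>i<2. C i \<subset> C (Suc i)" using n Z le[OF Z(1)] by (auto simp: C_def less_2_cases_iff)
      ultimately have "enat 2 \<in> N" unfolding N_def by blast
      then have "enat 2 \<le> Sup N" by (rule Sup_upper)
      then show False using S by (simp add: one_enat_def)
    qed
    ultimately show "P \<noteq> ?T \<and> (\<forall>Z. ?irr Z \<and> P \<subseteq> Z \<longrightarrow> Z = P \<or> Z = ?T)" by blast
  next
    assume h: "P \<noteq> ?T \<and> (\<forall>Z. ?irr Z \<and> P \<subseteq> Z \<longrightarrow> Z = P \<or> Z = ?T)"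
    show "Sup N = 1"
    proof (rule antisym)
      show "Sup N \<le> 1"
      proof (rule Sup_least)
        fix x assume "x \<in> N"
        then obtain n C where n: "x = enat n" "C 0 = P" "\<forall>i\<le>n. ?irr (C i)" "\<forall>i<n. C i \<subset> C (Suc i)"
          unfolding N_def by blast
        have "n \<le> 1"
        proof (rule ccontr)
          assume "\<not> n \<le> 1"
          then have c: "C 0 \<subset> C (Suc 0)" "C (Suc 0) \<subset> C (Suc (Suc 0))" "?irr (C (Suc 0))" "?irr (C (Suc (Suc 0)))"
            using n(3,4) by auto
          then have "C (Suc 0) = ?T" using h n(2) by blast
          then show False using c le by blast
        qed
        then show "x \<le> 1" using n(1) by (simp add: one_enat_def)
      qed
      define C where "C i = (if i = 0 then P else ?T)" for i :: nat
      have "C 0 = P" by (simp add: C_def)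
      moreover have "\<forall>i\<le>1. ?irr (C i)" using P top by (auto simp: C_def)
      moreover have "\<forall>i<1. C i \<subset> C (Suc i)" using h le[OF P] by (auto simp: C_def)
      ultimately have "enat 1 \<in> N" unfolding N_def by blast
      then have "enat 1 \<le> Sup N" by (rule Sup_upper)
      then show "1 \<le> Sup N" by (simp add: one_enat_def)
    qed
  qed
  then show ?thesis unfolding prime_divisor_def cod by blast
qed

context cring
begin

lemma poly_values_sum:
  assumes B: "subring B R" and x: "x \<in> carrier R" and "p \<in> poly_values B x n"
  shows "\<exists>c\<in>{..<n} \<rightarrow> B. p = (\<Oplus>i\<in>{..<n}. c i \<otimes> x [^] i)"
  using assms(3)
proof (induction n arbitrary: p)
  case 0
  then show ?case by simp
next
  case (Suc n)
  note Bc = subsetD[OF subringE(1)[OF B]]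
  obtain c q where p: "p = c \<otimes> x [^] n \<oplus> q" "c \<in> B" "q \<in> poly_values B x n" using Suc.prems by auto
  obtain d where d: "d \<in> {..<n} \<rightarrow> B" "q = (\<Oplus>i\<in>{..<n}. d i \<otimes> x [^] i)" using Suc.IH[OF p(3)] by blast
  define d' where "d' i = (if i = n then c else d i)" for i
  have d'B: "d' \<in> {..<Suc n} \<rightarrow> B" using d(1) p(2) by (auto simp: d'_def Pi_def less_Suc_eq)
  have ins: "{..<Suc n} = insert n {..<n}" by auto
  have cl: "(\<lambda>i. d' i \<otimes> x [^] i) \<in> {..<n} \<rightarrow> carrier R" using d'B Bc x by (auto simp: Pi_def)
  have "(\<Oplus>i\<in>{..<Suc n}. d' i \<otimes> x [^] i) = d' n \<otimes> x [^] n \<oplus> (\<Oplus>i\<in>{..<n}. d' i \<otimes> x [^] i)"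
    unfolding ins by (rule finsum_insert) (use cl p Bc x in \<open>auto simp: d'_def\<close>)
  also have "(\<Oplus>i\<in>{..<n}. d' i \<otimes> x [^] i) = q"
    unfolding d(2) by (rule finsum_cong') (use d Bc x in \<open>auto simp: d'_def Pi_def\<close>)
  also have "d' n = c" by (simp add: d'_def)
  finally show ?case using p(1) d'B by metis
qed

end

text \<open>\<open>integrally_closed_domain\<close> speaks of the abstract fraction field of S,
  whereas integrality is given in K. The map \<open>\<psi>\<close> embeds the fraction field into K;
  x = h a / h b is the image of the fraction a / b, and by injectivity its monic equation holds
  already for that fraction.\<close>

lemma integrally_closed_in_field:
  fixes S :: "'b ring" and K :: "'c ring"
  assumes ic: "integrally_closed_domain S" and "field K" and h: "h \<in> ring_hom S K" and inj: "inj_on h (carrier S)"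
    and x: "x \<in> carrier K" and ab: "a \<in> carrier S" "b \<in> carrier S" "b \<noteq> \<zero>\<^bsub>S\<^esub>" "h b \<otimes>\<^bsub>K\<^esub> x = h a"
    and int: "x [^]\<^bsub>K\<^esub> (n::nat) \<in> cring.poly_values K (h ` carrier S) x n"
  shows "x \<in> h ` carrier S"
proof -
  interpret S: domain S using ic unfolding integrally_closed_domain_def by blast
  interpret SP: plain_cring S by unfold_locales
  interpret K: field K by fact
  interpret H: ring_hom_cring S K h using h by (simp add: ring_hom_cring_def ring_hom_cring_axioms_def S.cring_axioms K.cring_axioms)
  let ?F = "localization S {\<zero>\<^bsub>S\<^esub>}" and ?fr = "fraction S {\<zero>\<^bsub>S\<^esub>}"
  have P: "primeideal {\<zero>\<^bsub>S\<^esub>} S" by (rule S.zeroprimeideal)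
  interpret F: cring ?F by (rule SP.localization_cring[OF P])
  have hn: "h s \<noteq> \<zero>\<^bsub>K\<^esub>" if "s \<in> carrier S - {\<zero>\<^bsub>S\<^esub>}" for s
    using that inj_onD[OF inj, of s "\<zero>\<^bsub>S\<^esub>"] by auto
  \<comment> \<open>Sends the fraction a / s to h a / h s. The description is definite because equal
    fractions have equal quotients in K, which is the content of \<open>psi\<close>.\<close>
  define \<psi> where "\<psi> z = (THE k. \<exists>a\<in>carrier S. \<exists>s\<in>carrier S - {\<zero>\<^bsub>S\<^esub>}. z = ?fr a s \<and> k = h a \<otimes>\<^bsub>K\<^esub> inv\<^bsub>K\<^esub> (h s))" for z
  have invK: "h s \<otimes>\<^bsub>K\<^esub> inv\<^bsub>K\<^esub> (h s) = \<one>\<^bsub>K\<^esub>" "inv\<^bsub>K\<^esub> (h s) \<in> carrier K" "h s \<in> carrier K" if "s \<in> carrier S - {\<zero>\<^bsub>S\<^esub>}" for s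
  proof -
    have "h s \<in> Units K" using hn[OF that] that K.field_Units by auto
    then show "h s \<otimes>\<^bsub>K\<^esub> inv\<^bsub>K\<^esub> (h s) = \<one>\<^bsub>K\<^esub>" "inv\<^bsub>K\<^esub> (h s) \<in> carrier K" "h s \<in> carrier K" by auto
  qed
  have psi: "\<psi> (?fr a s) = h a \<otimes>\<^bsub>K\<^esub> inv\<^bsub>K\<^esub> (h s)" if as: "a \<in> carrier S" "s \<in> carrier S - {\<zero>\<^bsub>S\<^esub>}" for a s
    unfolding \<psi>_def
  proof (rule the_equality)
    show "\<exists>a'\<in>carrier S. \<exists>s'\<in>carrier S - {\<zero>\<^bsub>S\<^esub>}. ?fr a s = ?fr a' s' \<and> h a \<otimes>\<^bsub>K\<^esub> inv\<^bsub>K\<^esub> (h s) = h a' \<otimes>\<^bsub>K\<^esub> inv\<^bsub>K\<^esub> (h s')"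
      using as by blast
    fix k assume "\<exists>a'\<in>carrier S. \<exists>s'\<in>carrier S - {\<zero>\<^bsub>S\<^esub>}. ?fr a s = ?fr a' s' \<and> k = h a' \<otimes>\<^bsub>K\<^esub> inv\<^bsub>K\<^esub> (h s')"
    then obtain a' s' where a': "a' \<in> carrier S" "s' \<in> carrier S - {\<zero>\<^bsub>S\<^esub>}" "?fr a s = ?fr a' s'" "k = h a' \<otimes>\<^bsub>K\<^esub> inv\<^bsub>K\<^esub> (h s')" by blast
    obtain u where u: "u \<in> carrier S - {\<zero>\<^bsub>S\<^esub>}" "u \<otimes>\<^bsub>S\<^esub> (a \<otimes>\<^bsub>S\<^esub> s' \<ominus>\<^bsub>S\<^esub> a' \<otimes>\<^bsub>S\<^esub> s) = \<zero>\<^bsub>S\<^esub>"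
      using SP.fraction_eqD[OF P a'(3,1,2)] by blast
    have sc: "s \<in> carrier S" "s' \<in> carrier S" "u \<in> carrier S" using as a' u by auto
    have "a \<otimes>\<^bsub>S\<^esub> s' \<ominus>\<^bsub>S\<^esub> a' \<otimes>\<^bsub>S\<^esub> s = \<zero>\<^bsub>S\<^esub>" using S.integral[OF u(2)] u(1) sc as(1) a'(1) by auto
    then have "a \<otimes>\<^bsub>S\<^esub> s' = a' \<otimes>\<^bsub>S\<^esub> s" using S.r_right_minus_eq sc as(1) a'(1) by auto
    then have e: "h a \<otimes>\<^bsub>K\<^esub> h s' = h a' \<otimes>\<^bsub>K\<^esub> h s" using H.hom_mult[OF as(1) sc(2)] H.hom_mult[OF a'(1) sc(1)] by simp
    note i = invK[OF as(2)] and i' = invK[OF a'(2)]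
    have car: "h a \<in> carrier K" "h a' \<in> carrier K" using as a' by auto
    have "k = (h a' \<otimes>\<^bsub>K\<^esub> (h s \<otimes>\<^bsub>K\<^esub> inv\<^bsub>K\<^esub> (h s))) \<otimes>\<^bsub>K\<^esub> inv\<^bsub>K\<^esub> (h s')" unfolding a'(4) i(1) using car by simp
    also have "\<dots> = (h a' \<otimes>\<^bsub>K\<^esub> h s) \<otimes>\<^bsub>K\<^esub> (inv\<^bsub>K\<^esub> (h s) \<otimes>\<^bsub>K\<^esub> inv\<^bsub>K\<^esub> (h s'))" using car i(2,3) i'(2,3) by algebra
    also have "\<dots> = (h a \<otimes>\<^bsub>K\<^esub> h s') \<otimes>\<^bsub>K\<^esub> (inv\<^bsub>K\<^esub> (h s') \<otimes>\<^bsub>K\<^esub> inv\<^bsub>K\<^esub> (h s))" unfolding e using i(2) i'(2) by (simp add: K.m_comm)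
    also have "\<dots> = (h a \<otimes>\<^bsub>K\<^esub> (h s' \<otimes>\<^bsub>K\<^esub> inv\<^bsub>K\<^esub> (h s'))) \<otimes>\<^bsub>K\<^esub> inv\<^bsub>K\<^esub> (h s)" using car i(2,3) i'(2,3) by algebra
    also have "\<dots> = h a \<otimes>\<^bsub>K\<^esub> inv\<^bsub>K\<^esub> (h s)" unfolding i'(1) using car by simp
    finally show "k = h a \<otimes>\<^bsub>K\<^esub> inv\<^bsub>K\<^esub> (h s)" .
  qed
  have invmult: "inv\<^bsub>K\<^esub> (h (s \<otimes>\<^bsub>S\<^esub> t)) = inv\<^bsub>K\<^esub> (h s) \<otimes>\<^bsub>K\<^esub> inv\<^bsub>K\<^esub> (h t)"
    if st: "s \<in> carrier S - {\<zero>\<^bsub>S\<^esub>}" "t \<in> carrier S - {\<zero>\<^bsub>S\<^esub>}" for s t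
  proof -
    note i = invK[OF st(1)] and j = invK[OF st(2)]
    have "(h s \<otimes>\<^bsub>K\<^esub> h t) \<otimes>\<^bsub>K\<^esub> (inv\<^bsub>K\<^esub> (h s) \<otimes>\<^bsub>K\<^esub> inv\<^bsub>K\<^esub> (h t)) = (h s \<otimes>\<^bsub>K\<^esub> inv\<^bsub>K\<^esub> (h s)) \<otimes>\<^bsub>K\<^esub> (h t \<otimes>\<^bsub>K\<^esub> inv\<^bsub>K\<^esub> (h t))"
      using i(2,3) j(2,3) by algebra
    then have "(h s \<otimes>\<^bsub>K\<^esub> h t) \<otimes>\<^bsub>K\<^esub> (inv\<^bsub>K\<^esub> (h s) \<otimes>\<^bsub>K\<^esub> inv\<^bsub>K\<^esub> (h t)) = \<one>\<^bsub>K\<^esub>" unfolding i(1) j(1) by simp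
    then have "inv\<^bsub>K\<^esub> (h s \<otimes>\<^bsub>K\<^esub> h t) = inv\<^bsub>K\<^esub> (h s) \<otimes>\<^bsub>K\<^esub> inv\<^bsub>K\<^esub> (h t)"
      by (intro K.comm_inv_char) (use i(2,3) j(2,3) in auto)
    moreover have "h (s \<otimes>\<^bsub>S\<^esub> t) = h s \<otimes>\<^bsub>K\<^esub> h t" using st by simp
    ultimately show ?thesis by simp
  qed
  note pm = SP.prime_compl_mult[OF P]
  have psihom: "\<psi> \<in> ring_hom ?F K"
  proof (rule ring_hom_memI)
    fix z assume "z \<in> carrier ?F"
    then obtain a s where "a \<in> carrier S" "s \<in> carrier S - {\<zero>\<^bsub>S\<^esub>}" "z = ?fr a s" by (rule SP.localization_carrierE)
    then show "\<psi> z \<in> carrier K" using psi invK by simp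
  next
    fix z w assume z: "z \<in> carrier ?F" and w: "w \<in> carrier ?F"
    obtain a s where a: "a \<in> carrier S" "s \<in> carrier S - {\<zero>\<^bsub>S\<^esub>}" "z = ?fr a s" by (rule SP.localization_carrierE[OF z])
    obtain b t where b: "b \<in> carrier S" "t \<in> carrier S - {\<zero>\<^bsub>S\<^esub>}" "w = ?fr b t" by (rule SP.localization_carrierE[OF w])
    note i = invK[OF a(2)] and j = invK[OF b(2)] and st = pm[OF a(2) b(2)]
    have car: "h a \<in> carrier K" "h b \<in> carrier K" "s \<in> carrier S" "t \<in> carrier S" using a b by auto
    have "\<psi> (z \<otimes>\<^bsub>?F\<^esub> w) = h (a \<otimes>\<^bsub>S\<^esub> b) \<otimes>\<^bsub>K\<^esub> inv\<^bsub>K\<^esub> (h (s \<otimes>\<^bsub>S\<^esub> t))"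
      unfolding a(3) b(3) SP.localization_mult[OF P a(1,2) b(1,2)] by (rule psi[OF _ st]) (use a b in auto)
    also have "\<dots> = (h a \<otimes>\<^bsub>K\<^esub> h b) \<otimes>\<^bsub>K\<^esub> (inv\<^bsub>K\<^esub> (h s) \<otimes>\<^bsub>K\<^esub> inv\<^bsub>K\<^esub> (h t))"
      unfolding invmult[OF a(2) b(2)] H.hom_mult[OF a(1) b(1)] ..
    also have "\<dots> = (h a \<otimes>\<^bsub>K\<^esub> inv\<^bsub>K\<^esub> (h s)) \<otimes>\<^bsub>K\<^esub> (h b \<otimes>\<^bsub>K\<^esub> inv\<^bsub>K\<^esub> (h t))" using car(1,2) i(2) j(2) by algebra
    also have "\<dots> = \<psi> z \<otimes>\<^bsub>K\<^esub> \<psi> w" unfolding a(3) b(3) psi[OF a(1,2)] psi[OF b(1,2)] ..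
    finally show "\<psi> (z \<otimes>\<^bsub>?F\<^esub> w) = \<psi> z \<otimes>\<^bsub>K\<^esub> \<psi> w" .
    have "\<psi> (z \<oplus>\<^bsub>?F\<^esub> w) = h (a \<otimes>\<^bsub>S\<^esub> t \<oplus>\<^bsub>S\<^esub> b \<otimes>\<^bsub>S\<^esub> s) \<otimes>\<^bsub>K\<^esub> inv\<^bsub>K\<^esub> (h (s \<otimes>\<^bsub>S\<^esub> t))"
      unfolding a(3) b(3) SP.localization_add[OF P a(1,2) b(1,2)] by (rule psi[OF _ st]) (use a b in auto)
    also have "\<dots> = (h a \<otimes>\<^bsub>K\<^esub> h t \<oplus>\<^bsub>K\<^esub> h b \<otimes>\<^bsub>K\<^esub> h s) \<otimes>\<^bsub>K\<^esub> (inv\<^bsub>K\<^esub> (h s) \<otimes>\<^bsub>K\<^esub> inv\<^bsub>K\<^esub> (h t))"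
      unfolding invmult[OF a(2) b(2)] using a(1) b(1) car by simp
    also have "\<dots> = (h a \<otimes>\<^bsub>K\<^esub> inv\<^bsub>K\<^esub> (h s)) \<otimes>\<^bsub>K\<^esub> (h t \<otimes>\<^bsub>K\<^esub> inv\<^bsub>K\<^esub> (h t)) \<oplus>\<^bsub>K\<^esub> (h b \<otimes>\<^bsub>K\<^esub> inv\<^bsub>K\<^esub> (h t)) \<otimes>\<^bsub>K\<^esub> (h s \<otimes>\<^bsub>K\<^esub> inv\<^bsub>K\<^esub> (h s))"
      using car(1,2) i(2,3) j(2,3) by algebra
    also have "\<dots> = \<psi> z \<oplus>\<^bsub>K\<^esub> \<psi> w" unfolding a(3) b(3) psi[OF a(1,2)] psi[OF b(1,2)] i(1) j(1) using car i(2) j(2) by simp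
    finally show "\<psi> (z \<oplus>\<^bsub>?F\<^esub> w) = \<psi> z \<oplus>\<^bsub>K\<^esub> \<psi> w" .
  next
    have "\<one>\<^bsub>?F\<^esub> = ?fr \<one>\<^bsub>S\<^esub> \<one>\<^bsub>S\<^esub>" unfolding localization_def by simp
    then show "\<psi> \<one>\<^bsub>?F\<^esub> = \<one>\<^bsub>K\<^esub>" using psi[OF S.one_closed SP.prime_compl_one[OF P]] by simp
  qed
  interpret G: ring_hom_cring ?F K \<psi>
    using psihom by (simp add: ring_hom_cring_def ring_hom_cring_axioms_def F.cring_axioms K.cring_axioms)
  have ker: "z = \<zero>\<^bsub>?F\<^esub>" if z: "z \<in> carrier ?F" "\<psi> z = \<zero>\<^bsub>K\<^esub>" for z
  proof -
    obtain a s where a: "a \<in> carrier S" "s \<in> carrier S - {\<zero>\<^bsub>S\<^esub>}" "z = ?fr a s" by (rule SP.localization_carrierE[OF z(1)])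
    have "h a \<otimes>\<^bsub>K\<^esub> inv\<^bsub>K\<^esub> (h s) = \<zero>\<^bsub>K\<^esub>" using z(2) unfolding a(3) psi[OF a(1,2)] .
    moreover have "inv\<^bsub>K\<^esub> (h s) \<noteq> \<zero>\<^bsub>K\<^esub>" using invK[OF a(2)] by auto
    ultimately have "h a = \<zero>\<^bsub>K\<^esub>" using K.integral[of "h a" "inv\<^bsub>K\<^esub> (h s)"] invK[OF a(2)] a(1) by auto
    then have "a = \<zero>\<^bsub>S\<^esub>" using inj_onD[OF inj, of a "\<zero>\<^bsub>S\<^esub>"] a(1) by simp
    then have "z = ?fr \<zero>\<^bsub>S\<^esub> \<one>\<^bsub>S\<^esub>" unfolding a(3)
      by (intro SP.fraction_eqI1[OF P _ a(2) _ SP.prime_compl_one[OF P]]) (use a(2) in auto)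
    then show ?thesis unfolding localization_def by simp
  qed
  have bn: "b \<in> carrier S - {\<zero>\<^bsub>S\<^esub>}" using ab by blast
  let ?X = "?fr a b"
  have Xc: "?X \<in> carrier ?F" by (rule SP.localization_carrierI[OF ab(1) bn])
  have psiX: "\<psi> ?X = x"
  proof -
    note i = invK[OF bn]
    have "\<psi> ?X = (h b \<otimes>\<^bsub>K\<^esub> x) \<otimes>\<^bsub>K\<^esub> inv\<^bsub>K\<^esub> (h b)" unfolding psi[OF ab(1) bn] ab(4) ..
    also have "\<dots> = x \<otimes>\<^bsub>K\<^esub> (h b \<otimes>\<^bsub>K\<^esub> inv\<^bsub>K\<^esub> (h b))" using x i(2,3) by algebra
    finally show ?thesis unfolding i(1) using x by simp
  qed
  let ?\<iota> = "\<lambda>r. ?fr r \<one>\<^bsub>S\<^esub>"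
  have psiI: "\<psi> (?\<iota> r) = h r" if "r \<in> carrier S" for r using psi[OF that SP.prime_compl_one[OF P]] that by simp
  have iF: "?\<iota> r \<in> carrier ?F" if "r \<in> carrier S" for r by (rule SP.localization_carrierI[OF that SP.prime_compl_one[OF P]])
  obtain c where c: "c \<in> {..<n} \<rightarrow> h ` carrier S" "x [^]\<^bsub>K\<^esub> n = (\<Oplus>\<^bsub>K\<^esub>i\<in>{..<n}. c i \<otimes>\<^bsub>K\<^esub> x [^]\<^bsub>K\<^esub> i)"
    using K.poly_values_sum[OF subring_hom_image[OF S.cring_axioms K.cring_axioms h] x int] by blast
  have "\<forall>i\<in>{..<n}. \<exists>s. s \<in> carrier S \<and> c i = h s" using c(1) by blast
  then obtain d where d: "\<And>i. i < n \<Longrightarrow> d i \<in> carrier S \<and> c i = h (d i)" using bchoice[of "{..<n}" "\<lambda>i s. s \<in> carrier S \<and> c i = h s"] by auto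
  \<comment> \<open>The sign comes from the form of the equation: here \<open>x [^] n\<close> equals
    the sum, while integral closedness is stated for a vanishing total.\<close>
  define e where "e i = \<ominus>\<^bsub>S\<^esub> d i" for i
  have eS: "e \<in> {..<n} \<rightarrow> carrier S" using d unfolding e_def by auto
  let ?Z = "?X [^]\<^bsub>?F\<^esub> n \<oplus>\<^bsub>?F\<^esub> (\<Oplus>\<^bsub>?F\<^esub>i\<in>{..<n}. ?\<iota> (e i) \<otimes>\<^bsub>?F\<^esub> ?X [^]\<^bsub>?F\<^esub> i)"
  have tc: "(\<lambda>i. ?\<iota> (e i) \<otimes>\<^bsub>?F\<^esub> ?X [^]\<^bsub>?F\<^esub> i) \<in> {..<n} \<rightarrow> carrier ?F"
    using eS iF Xc by (auto intro!: F.m_closed F.nat_pow_closed)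
  have powh: "\<psi> (?X [^]\<^bsub>?F\<^esub> i) = x [^]\<^bsub>K\<^esub> i" for i :: nat
    using psiX Xc by (induction i) auto
  have kc: "(\<lambda>i. h (d i) \<otimes>\<^bsub>K\<^esub> x [^]\<^bsub>K\<^esub> i) \<in> {..<n} \<rightarrow> carrier K" using d x by auto
  have "\<psi> ?Z = x [^]\<^bsub>K\<^esub> n \<oplus>\<^bsub>K\<^esub> (\<Oplus>\<^bsub>K\<^esub>i\<in>{..<n}. \<psi> (?\<iota> (e i) \<otimes>\<^bsub>?F\<^esub> ?X [^]\<^bsub>?F\<^esub> i))"
  proof -
    have "\<psi> ?Z = \<psi> (?X [^]\<^bsub>?F\<^esub> n) \<oplus>\<^bsub>K\<^esub> \<psi> (\<Oplus>\<^bsub>?F\<^esub>i\<in>{..<n}. ?\<iota> (e i) \<otimes>\<^bsub>?F\<^esub> ?X [^]\<^bsub>?F\<^esub> i)"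
      by (rule G.hom_add[OF F.nat_pow_closed[OF Xc] F.finsum_closed[OF tc]])
    then show ?thesis unfolding powh G.hom_finsum[OF tc] by (simp add: comp_def)
  qed
  also have "(\<Oplus>\<^bsub>K\<^esub>i\<in>{..<n}. \<psi> (?\<iota> (e i) \<otimes>\<^bsub>?F\<^esub> ?X [^]\<^bsub>?F\<^esub> i)) = (\<Oplus>\<^bsub>K\<^esub>i\<in>{..<n}. (\<ominus>\<^bsub>K\<^esub> \<one>\<^bsub>K\<^esub>) \<otimes>\<^bsub>K\<^esub> (h (d i) \<otimes>\<^bsub>K\<^esub> x [^]\<^bsub>K\<^esub> i))"
  proof (rule K.finsum_cong')
    show "(\<lambda>i. (\<ominus>\<^bsub>K\<^esub> \<one>\<^bsub>K\<^esub>) \<otimes>\<^bsub>K\<^esub> (h (d i) \<otimes>\<^bsub>K\<^esub> x [^]\<^bsub>K\<^esub> i)) \<in> {..<n} \<rightarrow> carrier K" using d x by auto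
    fix i assume i: "i \<in> {..<n}"
    then have di: "d i \<in> carrier S" "e i \<in> carrier S" using d eS by auto
    have "\<psi> (?\<iota> (e i) \<otimes>\<^bsub>?F\<^esub> ?X [^]\<^bsub>?F\<^esub> i) = h (e i) \<otimes>\<^bsub>K\<^esub> x [^]\<^bsub>K\<^esub> i"
      using G.hom_mult[OF iF[OF di(2)] F.nat_pow_closed[OF Xc]] unfolding powh psiI[OF di(2)] .
    also have "h (e i) = \<ominus>\<^bsub>K\<^esub> h (d i)" unfolding e_def using di by simp
    finally show "\<psi> (?\<iota> (e i) \<otimes>\<^bsub>?F\<^esub> ?X [^]\<^bsub>?F\<^esub> i) = (\<ominus>\<^bsub>K\<^esub> \<one>\<^bsub>K\<^esub>) \<otimes>\<^bsub>K\<^esub> (h (d i) \<otimes>\<^bsub>K\<^esub> x [^]\<^bsub>K\<^esub> i)"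
      using di x by (simp add: K.l_minus)
  qed simp
  also have "\<dots> = (\<ominus>\<^bsub>K\<^esub> \<one>\<^bsub>K\<^esub>) \<otimes>\<^bsub>K\<^esub> (\<Oplus>\<^bsub>K\<^esub>i\<in>{..<n}. h (d i) \<otimes>\<^bsub>K\<^esub> x [^]\<^bsub>K\<^esub> i)"
    by (rule K.finsum_rdistr[symmetric]) (use kc in auto)
  also have "(\<Oplus>\<^bsub>K\<^esub>i\<in>{..<n}. h (d i) \<otimes>\<^bsub>K\<^esub> x [^]\<^bsub>K\<^esub> i) = x [^]\<^bsub>K\<^esub> n"
    unfolding c(2) by (rule K.finsum_cong') (use d kc in auto)
  also have "x [^]\<^bsub>K\<^esub> n \<oplus>\<^bsub>K\<^esub> (\<ominus>\<^bsub>K\<^esub> \<one>\<^bsub>K\<^esub>) \<otimes>\<^bsub>K\<^esub> x [^]\<^bsub>K\<^esub> n = \<zero>\<^bsub>K\<^esub>" using x by (simp add: K.l_minus K.r_neg)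
  finally have "\<psi> ?Z = \<zero>\<^bsub>K\<^esub>" .
  moreover have "?Z \<in> carrier ?F" by (rule F.a_closed[OF F.nat_pow_closed[OF Xc] F.finsum_closed[OF tc]])
  ultimately have Z: "?Z = \<zero>\<^bsub>?F\<^esub>" using ker by blast
  have "?X \<in> ?\<iota> ` carrier S" using ic Xc eS Z unfolding integrally_closed_domain_def Let_def by blast
  then obtain r where "r \<in> carrier S" "?X = ?\<iota> r" by auto
  then have "x = h r" using psiX psiI by simp
  then show ?thesis using \<open>r \<in> carrier S\<close> by blast
qed

text \<open>The base field and the finite type hypothesis are condensed into a finite cover by
  affine open sets with Noetherian sections.\<close>

locale normal_noetherian = integral_space \<XX> for \<XX> :: "('x, 'a) rspace" +
  assumes normal: "normal_scheme \<XX>"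
    and cover: "\<exists>\<U>. finite \<U> \<and> \<Union>\<U> = topspace (topol \<XX>) \<and>
      (\<forall>U\<in>\<U>. affine_open \<XX> U \<and> noetherian_over (sections \<XX> U) (carrier (sections \<XX> U)))"
begin

text \<open>Empty members of the cover are excluded because \<open>Oo U\<close> is a subring of the
  function field only for nonempty U.\<close>

definition good :: "'x set \<Rightarrow> bool" where
  "good U \<longleftrightarrow> affine_open \<XX> U \<and> U \<noteq> {} \<and> noetherian_over KX (Oo U)"

lemma good_chart:
  assumes "good U"
  obtains R f where "integral_chart \<XX> U R f"
proof -
  have U: "affine_open \<XX> U" "U \<noteq> {}" using assms unfolding good_def by auto
  obtain R f where "affine_chart \<XX> U R f" by (rule chart_of_affine[OF U(1)])
  then have "integral_chart \<XX> U R f"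
    using U integral_space_axioms by (simp add: integral_chart_def integral_chart_axioms_def)
  then show ?thesis by (rule that)
qed

lemma good_cover: "\<exists>\<G>. finite \<G> \<and> \<Union>\<G> = TX \<and> (\<forall>U\<in>\<G>. good U)"
proof -
  obtain \<U> where U: "finite \<U>" "\<Union>\<U> = TX"
    "\<And>U. U \<in> \<U> \<Longrightarrow> affine_open \<XX> U \<and> noetherian_over (sections \<XX> U) (carrier (sections \<XX> U))" using cover by blast
  have "good U" if V: "U \<in> \<U> - {{}}" for U
  proof -
    have o: "open_set U" "U \<noteq> {}" using U(3) V unfolding affine_open_def by auto
    have "noetherian_over KX (Oo U)" unfolding Oo_def
      by (rule noetherian_over_hom_image[OF cring_sections[OF o(1)] K.cring_axioms section_to_K_hom[OF o]]) (use U(3) V in blast)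
    then show ?thesis unfolding good_def using U(3) V by blast
  qed
  moreover have "\<Union>(\<U> - {{}}) = TX" using U(2) by blast
  ultimately show ?thesis using U(1) by (intro exI[of _ "\<U> - {{}}"]) auto
qed

lemma good_at:
  assumes "x \<in> TX"
  obtains U where "good U" "x \<in> U"
proof -
  obtain \<G> where G: "\<Union>\<G> = TX" "\<forall>U\<in>\<G>. good U" using good_cover by blast
  then have "x \<in> \<Union>\<G>" using assms by simp
  then obtain U where "U \<in> \<G>" "x \<in> U" by blast
  then show ?thesis using that G(2) by blast
qed

lemma good_facts:
  assumes U: "good U"
  shows "open_set U" "U \<noteq> {}" "U \<subseteq> TX" "\<eta> \<in> U" "subring (Oo U) KX" "noetherian_over KX (Oo U)"
proof -
  obtain R f where "integral_chart \<XX> U R f" by (rule good_chart[OF U])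
  then interpret C: integral_chart \<XX> U R f .
  show o: "open_set U" "U \<noteq> {}" "U \<subseteq> TX" "\<eta> \<in> U" using C.A.openU C.nonempty C.UTX C.etaU by auto
  show "subring (Oo U) KX" by (rule Oo_subring[OF o(1,2)])
  show "noetherian_over KX (Oo U)" using U unfolding good_def by blast
qed

text \<open>The chart lemmas with \<open>R\<close> and \<open>f\<close> eliminated. Together with
  \<open>good_surj\<close> they are all that the arguments below know about an affine open set: its
  functions, and which of them are units at which point.\<close>

lemma good_chart_facts:
  assumes U: "good U" and y: "y \<in> U"
  shows "Oo U \<subseteq> Ox y" "submodule_over KX (Ox y) (Ox y - Ux y)"
    "\<And>V. open_set V \<Longrightarrow> V \<subseteq> U \<Longrightarrow> y \<in> V \<Longrightarrow> \<exists>b\<in>Oo U. b \<in> Ux y \<and> (\<forall>z\<in>U. b \<in> Ux z \<longrightarrow> z \<in> V)"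
    "\<And>c. c \<in> Ox y \<Longrightarrow> \<exists>a\<in>Oo U. \<exists>b\<in>Oo U. b \<in> Ux y \<and> b \<otimes>\<^bsub>KX\<^esub> c = a"
    "\<And>z. z \<in> U \<Longrightarrow> (\<And>b. b \<in> Oo U \<Longrightarrow> b \<in> Ux y \<longleftrightarrow> b \<in> Ux z) \<Longrightarrow> y = z"
proof -
  obtain R f where "integral_chart \<XX> U R f" by (rule good_chart[OF U])
  then interpret C: integral_chart \<XX> U R f .
  show "Oo U \<subseteq> Ox y" by (rule C.Oo_Ox[OF y])
  show "submodule_over KX (Ox y) (Ox y - Ux y)" by (rule C.chart_local[OF y])
  show "\<exists>b\<in>Oo U. b \<in> Ux y \<and> (\<forall>z\<in>U. b \<in> Ux z \<longrightarrow> z \<in> V)" if "open_set V" "V \<subseteq> U" "y \<in> V" for V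
    by (rule C.chart_basis[OF that])
  show "\<exists>a\<in>Oo U. \<exists>b\<in>Oo U. b \<in> Ux y \<and> b \<otimes>\<^bsub>KX\<^esub> c = a" if "c \<in> Ox y" for c by (rule C.chart_fraction[OF y that])
  show "y = z" if "z \<in> U" "\<And>b. b \<in> Oo U \<Longrightarrow> b \<in> Ux y \<longleftrightarrow> b \<in> Ux z" for z by (rule C.chart_inj[OF y that])
qed

lemma good_surj:
  assumes U: "good U" and p: "prime_over KX (Oo U) p"
  shows "\<exists>y\<in>U. p = Oo U - Ux y"
proof -
  obtain R f where "integral_chart \<XX> U R f" by (rule good_chart[OF U])
  then interpret C: integral_chart \<XX> U R f .
  show ?thesis by (rule C.chart_surj[OF p])
qed

lemma Ox_carrier: "y \<in> TX \<Longrightarrow> c \<in> Ox y \<Longrightarrow> c \<in> carrier KX"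
  using subringE(1)[OF Ox_subring] by blast

lemma Ox_local:
  assumes y: "y \<in> TX" shows "submodule_over KX (Ox y) (Ox y - Ux y)"
proof -
  obtain U where U: "good U" "y \<in> U" by (rule good_at[OF y])
  show ?thesis by (rule good_chart_facts(2)[OF U])
qed

lemma Ux_facts:
  assumes "y \<in> TX"
  shows "\<And>u. u \<in> Ux y \<Longrightarrow> u \<in> Ox y \<and> u \<in> carrier KX \<and> u \<noteq> \<zero>\<^bsub>KX\<^esub> \<and> inv\<^bsub>KX\<^esub> u \<in> Ux y"
    "\<And>u w. u \<in> Ux y \<Longrightarrow> w \<in> Ux y \<Longrightarrow> u \<otimes>\<^bsub>KX\<^esub> w \<in> Ux y"
    "\<And>u (n::int). u \<in> Ux y \<Longrightarrow> u [^]\<^bsub>KX\<^esub> n \<in> Ux y"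
  by (rule K.units_in_facts(1,2,4)[OF Ox_subring[OF assms]], assumption+)+

lemma Ux_factor:
  assumes y: "y \<in> TX" and ab: "a \<in> Ox y" "b \<in> Ox y" "a \<otimes>\<^bsub>KX\<^esub> b \<in> Ux y"
  shows "a \<in> Ux y"
proof -
  obtain w where w: "w \<in> Ox y" "a \<otimes>\<^bsub>KX\<^esub> b \<otimes>\<^bsub>KX\<^esub> w = \<one>\<^bsub>KX\<^esub>" using ab(3) unfolding units_in_def by blast
  have "a \<otimes>\<^bsub>KX\<^esub> (b \<otimes>\<^bsub>KX\<^esub> w) = \<one>\<^bsub>KX\<^esub>" using w(2) K.m_assoc Ox_carrier[OF y] ab w(1) by simp
  then show ?thesis unfolding units_in_def using ab(1) subringE(6)[OF Ox_subring[OF y] ab(2) w(1)] by blast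
qed

lemma Ux_div:
  assumes y: "y \<in> TX" and b: "b \<in> Ux y" and c: "c \<in> carrier KX" and bc: "b \<otimes>\<^bsub>KX\<^esub> c \<in> Ox y"
  shows "c \<in> Ox y"
proof -
  obtain w where w: "w \<in> Ox y" "b \<otimes>\<^bsub>KX\<^esub> w = \<one>\<^bsub>KX\<^esub>" using b unfolding units_in_def by blast
  have bw: "b \<in> carrier KX" "w \<in> carrier KX" using Ux_facts(1)[OF y b] Ox_carrier[OF y w(1)] by auto
  have "w \<otimes>\<^bsub>KX\<^esub> (b \<otimes>\<^bsub>KX\<^esub> c) = (b \<otimes>\<^bsub>KX\<^esub> w) \<otimes>\<^bsub>KX\<^esub> c" using bw c by algebra
  also have "\<dots> = c" unfolding w(2) using c by simp
  finally show ?thesis using subringE(6)[OF Ox_subring[OF y] w(1) bc] by simp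
qed

lemma Ux_eta: "c \<in> Ux \<eta> \<longleftrightarrow> c \<in> carrier KX \<and> c \<noteq> \<zero>\<^bsub>KX\<^esub>"
proof
  assume "c \<in> Ux \<eta>"
  then show "c \<in> carrier KX \<and> c \<noteq> \<zero>\<^bsub>KX\<^esub>" using Ux_facts(1)[OF eta_TX] by blast
next
  assume c: "c \<in> carrier KX \<and> c \<noteq> \<zero>\<^bsub>KX\<^esub>"
  then have "c \<in> Units KX" using K.field_Units by simp
  then have "c \<otimes>\<^bsub>KX\<^esub> inv\<^bsub>KX\<^esub> c = \<one>\<^bsub>KX\<^esub>" "inv\<^bsub>KX\<^esub> c \<in> carrier KX" by auto
  then show "c \<in> Ux \<eta>" unfolding units_in_def Ox_eta using c by blast
qed

lemma in_eta_closure: "y \<in> TX \<Longrightarrow> y \<in> (topol \<XX>) closure_of {\<eta>}"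
  unfolding eta_closure .

text \<open>Localization preserves the Noetherian property: an ideal of \<open>Ox y\<close> is
  recovered from its contraction to \<open>Oo U\<close>, because each of its elements becomes an
  element of the contraction after multiplication by a unit at y.\<close>

lemma Ox_noetherian:
  assumes y: "y \<in> TX" shows "noetherian_over KX (Ox y)"
  unfolding noetherian_over_def
proof (intro allI impI, elim conjE)
  obtain U where U: "good U" "y \<in> U" by (rule good_at[OF y])
  note g = good_facts[OF U(1)] and c = good_chart_facts[OF U]
  fix I assume I: "submodule_over KX (Ox y) I" and IO: "I \<subseteq> Ox y"
  note I' = submodule_overD[OF I]
  have IA: "submodule_over KX (Oo U) (I \<inter> Oo U)"
  proof (rule submodule_overI)
    show "I \<inter> Oo U \<subseteq> carrier KX" using I'(1) by blast
    show "\<zero>\<^bsub>KX\<^esub> \<in> I \<inter> Oo U" using I'(2) subringE(2)[OF g(5)] by blast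
    show "x \<oplus>\<^bsub>KX\<^esub> z \<in> I \<inter> Oo U" if "x \<in> I \<inter> Oo U" "z \<in> I \<inter> Oo U" for x z
      using that I'(3)[of x z] subringE(7)[OF g(5), of x z] by blast
    show "a \<otimes>\<^bsub>KX\<^esub> x \<in> I \<inter> Oo U" if "a \<in> Oo U" "x \<in> I \<inter> Oo U" for a x
      using that I'(4)[of a x] c(1) subringE(6)[OF g(5), of a x] by blast
  qed
  have sub: "I \<inter> Oo U \<subseteq> Oo U" by blast
  obtain S where S0: "finite S \<and> S \<subseteq> I \<inter> Oo U \<and> (\<forall>J. submodule_over KX (Oo U) J \<and> S \<subseteq> J \<longrightarrow> I \<inter> Oo U \<subseteq> J)"
    using noetherian_over_ex[OF g(6) IA sub] by (rule exE)
  have "I \<subseteq> J" if J: "submodule_over KX (Ox y) J" "S \<subseteq> J" for J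
  proof
    fix x assume x: "x \<in> I"
    note J' = submodule_overD[OF J(1)]
    have "submodule_over KX (Oo U) J"
      by (rule submodule_overI[OF J'(1,2)]) (use J'(3) J'(4) c(1) in auto)
    then have IJ: "I \<inter> Oo U \<subseteq> J" using S0 J(2) by simp
    have xO: "x \<in> Ox y" using x IO by blast
    obtain a b where ab: "a \<in> Oo U" "b \<in> Oo U" "b \<in> Ux y" "b \<otimes>\<^bsub>KX\<^esub> x = a" using c(4)[OF xO] by blast
    have "a \<in> I" using I'(4)[of b x] Ux_facts(1)[OF y ab(3)] x ab(4) by auto
    then have aJ: "a \<in> J" using IJ ab(1) by blast
    obtain w where w: "w \<in> Ox y" "b \<otimes>\<^bsub>KX\<^esub> w = \<one>\<^bsub>KX\<^esub>" using ab(3) unfolding units_in_def by blast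
    have bw: "b \<in> carrier KX" "w \<in> carrier KX" "x \<in> carrier KX" using Ux_facts(1)[OF y ab(3)] Ox_carrier[OF y] w(1) xO by auto
    have "w \<otimes>\<^bsub>KX\<^esub> a = (b \<otimes>\<^bsub>KX\<^esub> w) \<otimes>\<^bsub>KX\<^esub> x" unfolding ab(4)[symmetric] using bw by algebra
    also have "\<dots> = x" unfolding w(2) using bw by simp
    finally show "x \<in> J" using J'(4)[OF w(1) aJ] by simp
  qed
  then show "\<exists>S. finite S \<and> S \<subseteq> I \<and> (\<forall>J. submodule_over KX (Ox y) J \<and> S \<subseteq> J \<longrightarrow> I \<subseteq> J)"
    using S0 by (intro exI[of _ S]) auto
qed

lemma Oo_frac:
  assumes U: "good U" and c: "c \<in> carrier KX"
  obtains a b where "a \<in> Oo U" "b \<in> Oo U" "b \<noteq> \<zero>\<^bsub>KX\<^esub>" "b \<otimes>\<^bsub>KX\<^esub> c = a"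
proof -
  have "c \<in> Ox \<eta>" using c Ox_eta by simp
  from good_chart_facts(4)[OF U good_facts(4)[OF U] this]
  obtain a b where ab: "a \<in> Oo U" "b \<in> Oo U" "b \<in> Ux \<eta>" "b \<otimes>\<^bsub>KX\<^esub> c = a" by blast
  then show ?thesis using that Ux_eta by blast
qed

lemma Ox_frac:
  assumes y: "y \<in> TX" and c: "c \<in> carrier KX"
  shows "\<exists>a\<in>Ox y. \<exists>b\<in>Ox y. b \<noteq> \<zero>\<^bsub>KX\<^esub> \<and> b \<otimes>\<^bsub>KX\<^esub> c = a"
proof -
  obtain U where U: "good U" "y \<in> U" by (rule good_at[OF y])
  obtain a b where "a \<in> Oo U" "b \<in> Oo U" "b \<noteq> \<zero>\<^bsub>KX\<^esub>" "b \<otimes>\<^bsub>KX\<^esub> c = a" by (rule Oo_frac[OF U(1) c])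
  then show ?thesis using good_chart_facts(1)[OF U] by blast
qed

lemma Ox_integrally_closed:
  assumes y: "y \<in> TX" and x: "x \<in> carrier KX" "x [^]\<^bsub>KX\<^esub> (n::nat) \<in> K.poly_values (Ox y) x n"
  shows "x \<in> Ox y"
proof -
  have ic: "integrally_closed_domain (stalk \<XX> y)" using normal y unfolding normal_scheme_def by blast
  note im = stalk_to_K_image[OF y] and hom = stalk_to_K_hom[OF y] and inj = stalk_to_K_inj[OF y]
  have rS: "ring (stalk \<XX> y)" using ic unfolding integrally_closed_domain_def domain_def cring_def by blast
  obtain a b where ab: "a \<in> Ox y" "b \<in> Ox y" "b \<noteq> \<zero>\<^bsub>KX\<^esub>" "b \<otimes>\<^bsub>KX\<^esub> x = a" using Ox_frac[OF y x(1)] by blast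
  obtain a' where a': "a' \<in> carrier (stalk \<XX> y)" "a = stalk_to_K \<XX> a'" using ab(1) unfolding im[symmetric] by blast
  obtain b' where b': "b' \<in> carrier (stalk \<XX> y)" "b = stalk_to_K \<XX> b'" using ab(2) unfolding im[symmetric] by blast
  have "b' \<noteq> \<zero>\<^bsub>stalk \<XX> y\<^esub>" using ab(3) b'(2) ring_hom_zero[OF hom rS K.ring_axioms] by auto
  then have "x \<in> stalk_to_K \<XX> ` carrier (stalk \<XX> y)"
    using integrally_closed_in_field[OF ic KX_field hom inj x(1) a'(1) b'(1)] ab(4) x(2) unfolding a'(2) b'(2) im by blast
  then show ?thesis unfolding im .
qed

text \<open>Every neighbourhood of y contains, inside the chart, the locus where some function that
  is a unit at y stays a unit; so z lies in it. On a chart this is the converse of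
  \<open>closure_Ox\<close>.\<close>

lemma closureI:
  assumes U: "good U" and yz: "y \<in> U" "z \<in> U" and le: "\<And>b. b \<in> Oo U \<Longrightarrow> b \<in> Ux y \<Longrightarrow> b \<in> Ux z"
  shows "y \<in> (topol \<XX>) closure_of {z}"
proof -
  have "z \<in> V" if V: "y \<in> V" "open_set V" for V
  proof -
    have o: "open_set (U \<inter> V)" using good_facts(1)[OF U] V by blast
    obtain b where b: "b \<in> Oo U" "b \<in> Ux y" "\<forall>z\<in>U. b \<in> Ux z \<longrightarrow> z \<in> U \<inter> V"
      using good_chart_facts(3)[OF U yz(1) o] V yz(1) by blast
    then show ?thesis using le yz(2) by blast
  qed
  then show ?thesis unfolding in_closure_of using yz(1) good_facts(3)[OF U] by blast
qed

lemma irreducible_closure: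
  assumes z: "z \<in> TX"
  shows "irreducible_closed (topol \<XX>) ((topol \<XX>) closure_of {z})"
  unfolding irreducible_closed_def
proof (intro conjI allI impI)
  have zc: "z \<in> (topol \<XX>) closure_of {z}" using z by (simp add: in_closure_of)
  show "closedin (topol \<XX>) ((topol \<XX>) closure_of {z})" "(topol \<XX>) closure_of {z} \<noteq> {}" using zc by auto
  fix A B assume AB: "closedin (topol \<XX>) A \<and> closedin (topol \<XX>) B \<and> (topol \<XX>) closure_of {z} \<subseteq> A \<union> B"
  then have "z \<in> A \<or> z \<in> B" using zc by blast
  then show "(topol \<XX>) closure_of {z} \<subseteq> A \<or> (topol \<XX>) closure_of {z} \<subseteq> B"
    using AB closure_of_minimal[of "{z}" A] closure_of_minimal[of "{z}" B] by blast
qed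

text \<open>Height one stated through specialization: the only generizations of y are y itself and
  \<eta>. In this form it can be tested on the units of a chart by \<open>closureI\<close>.\<close>

definition height_one :: "'x \<Rightarrow> bool" where
  "height_one y \<longleftrightarrow> y \<in> TX \<and> y \<noteq> \<eta> \<and> (\<forall>z\<in>TX. y \<in> (topol \<XX>) closure_of {z} \<longrightarrow> z = y \<or> z = \<eta>)"

text \<open>Irreducible closed sets correspond to their generic points, and inclusion of sets to
  specialization of points; so maximality of P among the proper irreducible closed sets is height
  one of its generic point.\<close>

lemma prime_divisor_generic:
  assumes P: "prime_divisor \<XX> P"
  shows "height_one (generic_point \<XX> P)" "irreducible_closed (topol \<XX>) P"
    "P \<inter> U \<noteq> {} \<Longrightarrow> open_set U \<Longrightarrow> generic_point \<XX> P \<in> U" "(topol \<XX>) closure_of {generic_point \<XX> P} = P"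
    "generic_point \<XX> P \<in> P"
proof -
  have pd: "irreducible_closed (topol \<XX>) P" "P \<noteq> TX"
    "\<And>Z. irreducible_closed (topol \<XX>) Z \<Longrightarrow> P \<subseteq> Z \<Longrightarrow> Z = P \<or> Z = TX"
    using P unfolding prime_divisor_iff[OF irreducible_TX] by blast+
  note gp = generic_point[OF pd(1)]
  let ?y = "generic_point \<XX> P"
  show "irreducible_closed (topol \<XX>) P" "(topol \<XX>) closure_of {?y} = P" "?y \<in> P" by (rule pd(1), rule gp(2), rule gp(3))
  show "?y \<in> U" if "P \<inter> U \<noteq> {}" "open_set U" using gp(4)[OF that(2)] that(1) by blast
  have "?y \<noteq> \<eta>" using gp(2) eta_closure pd(2) by auto
  moreover have "z = ?y \<or> z = \<eta>" if z: "z \<in> TX" "?y \<in> (topol \<XX>) closure_of {z}" for z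
  proof -
    have "(topol \<XX>) closure_of {?y} \<subseteq> (topol \<XX>) closure_of {z}" by (rule closure_of_minimal) (use z in auto)
    then have "P \<subseteq> (topol \<XX>) closure_of {z}" unfolding gp(2) .
    then have "(topol \<XX>) closure_of {z} = P \<or> (topol \<XX>) closure_of {z} = TX" using pd(3)[OF irreducible_closure[OF z(1)]] by blast
    then show ?thesis using gp(5)[OF z(1)] generic_point(5)[OF irreducible_TX z(1)] unfolding \<eta>_def by auto
  qed
  ultimately show "height_one ?y" unfolding height_one_def using gp(1) by blast
qed

lemma height_one_prime_divisor:
  assumes y: "height_one y"
  shows "prime_divisor \<XX> ((topol \<XX>) closure_of {y})" "generic_point \<XX> ((topol \<XX>) closure_of {y}) = y"
proof -
  have yT: "y \<in> TX" "y \<noteq> \<eta>" and h: "\<And>z. z \<in> TX \<Longrightarrow> y \<in> (topol \<XX>) closure_of {z} \<Longrightarrow> z = y \<or> z = \<eta>"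
    using y unfolding height_one_def by blast+
  let ?P = "(topol \<XX>) closure_of {y}"
  note irr = irreducible_closure[OF yT(1)]
  show gy: "generic_point \<XX> ?P = y" by (rule generic_point(5)[OF irr yT(1) refl])
  have yP: "y \<in> ?P" using yT by (simp add: in_closure_of)
  show "prime_divisor \<XX> ?P"
    unfolding prime_divisor_iff[OF irreducible_TX]
  proof (intro conjI allI impI)
    show "irreducible_closed (topol \<XX>) ?P" by (rule irr)
    show "?P \<noteq> TX" using gy yT(2) unfolding \<eta>_def by auto
    fix Z assume Z: "irreducible_closed (topol \<XX>) Z \<and> ?P \<subseteq> Z"
    note gz = generic_point[OF conjunct1[OF Z]]
    have "y \<in> (topol \<XX>) closure_of {generic_point \<XX> Z}" using gz(2) Z yP by blast
    then have "generic_point \<XX> Z = y \<or> generic_point \<XX> Z = \<eta>" using h[OF gz(1)] by blast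
    then show "Z = ?P \<or> Z = TX" using gz(2) eta_closure by auto
  qed
qed

text \<open>Otherwise the functions on U that are units at y would be exactly the nonzero ones, as
  at \<eta>, and a point of a chart is determined by its units.\<close>

lemma nonunit_exists:
  assumes U: "good U" and y: "y \<in> U" "y \<noteq> \<eta>"
  shows "\<exists>b\<in>Oo U. b \<noteq> \<zero>\<^bsub>KX\<^esub> \<and> b \<notin> Ux y"
proof (rule ccontr)
  assume n: "\<not> (\<exists>b\<in>Oo U. b \<noteq> \<zero>\<^bsub>KX\<^esub> \<and> b \<notin> Ux y)"
  have yT: "y \<in> TX" using y good_facts(3)[OF U] by blast
  have "y = \<eta>"
  proof (rule good_chart_facts(5)[OF U y(1) good_facts(4)[OF U]])
    fix b assume b: "b \<in> Oo U"
    show "b \<in> Ux y \<longleftrightarrow> b \<in> Ux \<eta>"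
      using n b closure_Ox(2)[OF in_eta_closure[OF yT]] Ux_eta[of b] by blast
  qed
  then show False using y(2) by contradiction
qed

lemma Oo_nonunits_prime:
  assumes U: "good U" and y: "y \<in> U"
  shows "prime_over KX (Oo U) (Oo U - Ux y)"
proof -
  have yT: "y \<in> TX" using y good_facts(3)[OF U] by blast
  note g = good_facts[OF U] and c = good_chart_facts[OF U y] and l = submodule_overD[OF good_chart_facts(2)[OF U y]]
  have e: "Oo U - Ux y = Oo U \<inter> (Ox y - Ux y)" using c(1) by blast
  have "submodule_over KX (Oo U) (Oo U - Ux y)" unfolding e
  proof (rule submodule_overI)
    show "Oo U \<inter> (Ox y - Ux y) \<subseteq> carrier KX" using l(1) by blast
    show "\<zero>\<^bsub>KX\<^esub> \<in> Oo U \<inter> (Ox y - Ux y)" using l(2) subringE(2)[OF g(5)] by blast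
    show "a \<oplus>\<^bsub>KX\<^esub> b \<in> Oo U \<inter> (Ox y - Ux y)" if "a \<in> Oo U \<inter> (Ox y - Ux y)" "b \<in> Oo U \<inter> (Ox y - Ux y)" for a b
      using that l(3)[of a b] subringE(7)[OF g(5), of a b] by blast
    show "a \<otimes>\<^bsub>KX\<^esub> b \<in> Oo U \<inter> (Ox y - Ux y)" if "a \<in> Oo U" "b \<in> Oo U \<inter> (Ox y - Ux y)" for a b
      using that l(4)[of a b] c(1) subringE(6)[OF g(5), of a b] by blast
  qed
  moreover have "\<one>\<^bsub>KX\<^esub> \<notin> Oo U - Ux y" using K.units_in_facts(3)[OF Ox_subring[OF yT]] by blast
  ultimately show ?thesis unfolding prime_over_def using Ux_facts(2)[OF yT] subringE(6)[OF g(5)] by blast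
qed

text \<open>The form in which \<open>maximal_ideal_principal\<close> is used twice:
  \<open>nonunit_exists\<close> supplies its nonzero nonunit b at any point other than \<eta>, and
  normality its integral closedness.\<close>

lemma uniformizer:
  assumes y: "y \<in> TX" "y \<noteq> \<eta>" and x: "x \<in> carrier KX" "x \<notin> Ox y" "\<And>a. a \<in> Ox y - Ux y \<Longrightarrow> x \<otimes>\<^bsub>KX\<^esub> a \<in> Ox y"
  shows "\<exists>t\<in>Ox y - Ux y. t \<noteq> \<zero>\<^bsub>KX\<^esub> \<and> Ox y - Ux y = {t \<otimes>\<^bsub>KX\<^esub> a |a. a \<in> Ox y}"
proof -
  obtain U where U: "good U" "y \<in> U" by (rule good_at[OF y(1)])
  obtain b where b: "b \<in> Oo U" "b \<noteq> \<zero>\<^bsub>KX\<^esub>" "b \<notin> Ux y" using nonunit_exists[OF U y(2)] by blast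
  have bm: "b \<in> Ox y - Ux y" using b good_chart_facts(1)[OF U] by blast
  show ?thesis
    by (rule K.maximal_ideal_principal[OF Ox_subring[OF y(1)] Ox_noetherian[OF y(1)] Ox_local[OF y(1)] _ x bm b(2)])
      (use Ox_integrally_closed[OF y(1)] in blast)
qed

lemma nonunit_fraction:
  assumes U: "good U" and y: "y \<in> U" and a: "a \<in> Ox y - Ux y"
  obtains a1 b where "a1 \<in> Oo U - Ux y" "b \<in> Ux y" "b \<otimes>\<^bsub>KX\<^esub> a = a1"
proof -
  have yT: "y \<in> TX" using y good_facts(3)[OF U] by blast
  have aO: "a \<in> Ox y" using a by blast
  obtain a1 b where ab: "a1 \<in> Oo U" "b \<in> Oo U" "b \<in> Ux y" "b \<otimes>\<^bsub>KX\<^esub> a = a1" using good_chart_facts(4)[OF U y aO] by blast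
  have bO: "b \<in> Ox y" using Ux_facts(1)[OF yT ab(3)] by blast
  have "a1 \<notin> Ux y"
  proof
    assume "a1 \<in> Ux y"
    then have "a \<otimes>\<^bsub>KX\<^esub> b \<in> Ux y" using ab(4) K.m_comm Ox_carrier[OF yT aO] Ox_carrier[OF yT bO] by simp
    then show False using Ux_factor[OF yT aO bO] a by blast
  qed
  then show ?thesis using that ab by blast
qed

text \<open>For a nonzero nonunit b at y the element 1 / b is not regular at y, so there is a prime
  q of denominators of some c / b in \<open>Ox y\<close>. The trace of q on a chart is the prime of
  a point z that y specializes. Height one leaves z = y, so q is the whole maximal ideal and c / b
  carries that ideal into \<open>Ox y\<close>; this is the situation of
  \<open>uniformizer\<close>.\<close>

lemma height_one_uniformizer:
  assumes y: "height_one y"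
  shows "\<exists>t\<in>Ox y - Ux y. t \<noteq> \<zero>\<^bsub>KX\<^esub> \<and> Ox y - Ux y = {t \<otimes>\<^bsub>KX\<^esub> a |a. a \<in> Ox y}"
proof -
  have yT: "y \<in> TX" "y \<noteq> \<eta>" and h: "\<And>z. z \<in> TX \<Longrightarrow> y \<in> (topol \<XX>) closure_of {z} \<Longrightarrow> z = y \<or> z = \<eta>"
    using y unfolding height_one_def by blast+
  note sub = Ox_subring[OF yT(1)]
  obtain U where U: "good U" "y \<in> U" by (rule good_at[OF yT(1)])
  obtain b where b: "b \<in> Oo U" "b \<noteq> \<zero>\<^bsub>KX\<^esub>" "b \<notin> Ux y" using nonunit_exists[OF U yT(2)] by blast
  have bO: "b \<in> Ox y" using b good_chart_facts(1)[OF U] by blast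
  have bc: "b \<in> carrier KX" by (rule Ox_carrier[OF yT(1) bO])
  let ?f = "inv\<^bsub>KX\<^esub> b"
  have bi: "b \<otimes>\<^bsub>KX\<^esub> ?f = \<one>\<^bsub>KX\<^esub>" "?f \<in> carrier KX" using bc b(2) K.field_Units by auto
  have fO: "?f \<notin> Ox y" using bi b(3) bO unfolding units_in_def by blast
  obtain c where c: "c \<in> Ox y" "c \<otimes>\<^bsub>KX\<^esub> ?f \<notin> Ox y" "prime_over KX (Ox y) {r \<in> Ox y. r \<otimes>\<^bsub>KX\<^esub> (c \<otimes>\<^bsub>KX\<^esub> ?f) \<in> Ox y}"
    using K.associated_prime_exists[OF sub Ox_noetherian[OF yT(1)] bi(2) fO] by blast
  let ?x = "c \<otimes>\<^bsub>KX\<^esub> ?f"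
  define q where "q = {r \<in> Ox y. r \<otimes>\<^bsub>KX\<^esub> ?x \<in> Ox y}"
  have cc: "c \<in> carrier KX" by (rule Ox_carrier[OF yT(1) c(1)])
  have xc: "?x \<in> carrier KX" using cc bi by simp
  note qp = c(3)[folded q_def]
  have q: "submodule_over KX (Ox y) q" "\<one>\<^bsub>KX\<^esub> \<notin> q" "\<And>a b. a \<in> Ox y \<Longrightarrow> b \<in> Ox y \<Longrightarrow> a \<otimes>\<^bsub>KX\<^esub> b \<in> q \<Longrightarrow> a \<in> q \<or> b \<in> q"
    using qp unfolding prime_over_def by blast+
  note q' = submodule_overD[OF q(1)]
  note g = good_facts[OF U(1)] and ch = good_chart_facts[OF U]
  have pU: "prime_over KX (Oo U) (q \<inter> Oo U)"
  proof -
    have "submodule_over KX (Oo U) (q \<inter> Oo U)"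
    proof (rule submodule_overI)
      show "q \<inter> Oo U \<subseteq> carrier KX" using q'(1) by blast
      show "\<zero>\<^bsub>KX\<^esub> \<in> q \<inter> Oo U" using q'(2) subringE(2)[OF g(5)] by blast
      show "a \<oplus>\<^bsub>KX\<^esub> b \<in> q \<inter> Oo U" if "a \<in> q \<inter> Oo U" "b \<in> q \<inter> Oo U" for a b
        using that q'(3)[of a b] subringE(7)[OF g(5), of a b] by blast
      show "a \<otimes>\<^bsub>KX\<^esub> b \<in> q \<inter> Oo U" if "a \<in> Oo U" "b \<in> q \<inter> Oo U" for a b
        using that q'(4)[of a b] ch(1) subringE(6)[OF g(5), of a b] by blast
    qed
    moreover have "a \<in> q \<inter> Oo U \<or> b \<in> q \<inter> Oo U" if "a \<in> Oo U" "b \<in> Oo U" "a \<otimes>\<^bsub>KX\<^esub> b \<in> q \<inter> Oo U" for a b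
      using that q(3)[of a b] ch(1) by blast
    ultimately show ?thesis unfolding prime_over_def using q(2) by blast
  qed
  obtain z where z: "z \<in> U" "q \<inter> Oo U = Oo U - Ux z" using good_surj[OF U(1) pU] by blast
  have qU: "a \<notin> Ux y" if a: "a \<in> q" for a
  proof
    assume "a \<in> Ux y"
    then obtain w where w: "w \<in> Ox y" "a \<otimes>\<^bsub>KX\<^esub> w = \<one>\<^bsub>KX\<^esub>" unfolding units_in_def by blast
    have "w \<otimes>\<^bsub>KX\<^esub> a \<in> q" by (rule q'(4)[OF w(1) a])
    moreover have "w \<otimes>\<^bsub>KX\<^esub> a = \<one>\<^bsub>KX\<^esub>" using w(2) K.m_comm Ox_carrier[OF yT(1) w(1)] q'(1) a by auto
    ultimately show False using q(2) by simp
  qed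
  \<comment> \<open>A proper ideal of \<open>Ox y\<close> contains no unit, so a function that is a
    unit at y lies outside q and is a unit at z.\<close>
  have "y \<in> (topol \<XX>) closure_of {z}"
    by (rule closureI[OF U(1,2) z(1)]) (use qU z(2) in blast)
  then have "z = y \<or> z = \<eta>" using h z(1) g(3) by blast
  \<comment> \<open>b (c / b) = c is regular at y. Thus the nonzero function b lies in q, and z
    cannot be \<eta>, where it would be a unit.\<close>
  moreover have "b \<in> q"
  proof -
    have "b \<otimes>\<^bsub>KX\<^esub> ?x = (b \<otimes>\<^bsub>KX\<^esub> ?f) \<otimes>\<^bsub>KX\<^esub> c" using bc cc bi(2) by algebra
    then show ?thesis unfolding q_def bi(1) using c(1) cc bO by simp
  qed
  then have "z \<noteq> \<eta>" using z(2) b Ux_eta[of b] bc by blast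
  ultimately have zy: "z = y" by blast
  have "?x \<otimes>\<^bsub>KX\<^esub> a \<in> Ox y" if a: "a \<in> Ox y - Ux y" for a
  proof -
    obtain a1 d where d: "a1 \<in> Oo U - Ux y" "d \<in> Ux y" "d \<otimes>\<^bsub>KX\<^esub> a = a1" by (rule nonunit_fraction[OF U a])
    have a1: "a1 \<otimes>\<^bsub>KX\<^esub> ?x \<in> Ox y" using d(1) z(2) unfolding zy q_def by blast
    have ac: "a \<in> carrier KX" "d \<in> carrier KX" using a d Ox_carrier[OF yT(1)] Ux_facts(1)[OF yT(1) d(2)] by auto
    have "d \<otimes>\<^bsub>KX\<^esub> (?x \<otimes>\<^bsub>KX\<^esub> a) = (d \<otimes>\<^bsub>KX\<^esub> a) \<otimes>\<^bsub>KX\<^esub> ?x" using ac cc bi(2) by algebra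
    then have "d \<otimes>\<^bsub>KX\<^esub> (?x \<otimes>\<^bsub>KX\<^esub> a) \<in> Ox y" using a1 unfolding d(3) by (simp only:)
    then show ?thesis using Ux_div[OF yT(1) d(2)] xc ac by simp
  qed
  then show ?thesis by (rule uniformizer[OF yT xc c(2)])
qed

text \<open>If f were not in \<open>Oo U\<close>, some x = c f would have a prime ideal of
  denominators in \<open>Oo U\<close>, the prime of a point y. Then x is not regular at y but
  carries the maximal ideal into \<open>Ox y\<close>, so that ideal is principal and y has height
  one. Hence y is the generic point of a prime divisor meeting U, where f and therefore x is
  regular.\<close>

lemma hartogs:
  assumes U: "good U" and f: "f \<in> carrier KX" and reg: "\<And>P. prime_divisor \<XX> P \<Longrightarrow> P \<inter> U \<noteq> {} \<Longrightarrow> f \<in> Ox (generic_point \<XX> P)"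
  shows "f \<in> Oo U"
proof (rule ccontr)
  assume n: "f \<notin> Oo U"
  note g = good_facts[OF U]
  obtain c where c: "c \<in> Oo U" "c \<otimes>\<^bsub>KX\<^esub> f \<notin> Oo U" "prime_over KX (Oo U) {r \<in> Oo U. r \<otimes>\<^bsub>KX\<^esub> (c \<otimes>\<^bsub>KX\<^esub> f) \<in> Oo U}"
    using K.associated_prime_exists[OF g(5,6) f n] by blast
  let ?x = "c \<otimes>\<^bsub>KX\<^esub> f"
  have cc: "c \<in> carrier KX" using c(1) subringE(1)[OF g(5)] by blast
  have xc: "?x \<in> carrier KX" using cc f by simp
  obtain y where y: "y \<in> U" "{r \<in> Oo U. r \<otimes>\<^bsub>KX\<^esub> ?x \<in> Oo U} = Oo U - Ux y" using good_surj[OF U c(3)] by blast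
  have yT: "y \<in> TX" using y g(3) by blast
  note ch = good_chart_facts[OF U y(1)]
  have xO: "?x \<notin> Ox y"
  proof
    assume "?x \<in> Ox y"
    then obtain a b where "a \<in> Oo U" "b \<in> Oo U" "b \<in> Ux y" "b \<otimes>\<^bsub>KX\<^esub> ?x = a" using ch(4) by blast
    then show False using y(2) by blast
  qed
  have yn: "y \<noteq> \<eta>" using xO xc Ox_eta by auto
  have xm: "?x \<otimes>\<^bsub>KX\<^esub> a \<in> Ox y" if a: "a \<in> Ox y - Ux y" for a
  proof -
    obtain a1 d where d: "a1 \<in> Oo U - Ux y" "d \<in> Ux y" "d \<otimes>\<^bsub>KX\<^esub> a = a1" by (rule nonunit_fraction[OF U y(1) a])
    have a1: "a1 \<otimes>\<^bsub>KX\<^esub> ?x \<in> Ox y" using d(1) y(2) ch(1) by blast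
    have ac: "a \<in> carrier KX" "d \<in> carrier KX" using a d Ox_carrier[OF yT(1)] Ux_facts(1)[OF yT(1) d(2)] by auto
    have "d \<otimes>\<^bsub>KX\<^esub> (?x \<otimes>\<^bsub>KX\<^esub> a) = (d \<otimes>\<^bsub>KX\<^esub> a) \<otimes>\<^bsub>KX\<^esub> ?x" using ac cc f by algebra
    then have "d \<otimes>\<^bsub>KX\<^esub> (?x \<otimes>\<^bsub>KX\<^esub> a) \<in> Ox y" using a1 unfolding d(3) by (simp only:)
    then show ?thesis using Ux_div[OF yT(1) d(2)] xc ac by simp
  qed
  obtain t where t: "t \<in> Ox y - Ux y" "t \<noteq> \<zero>\<^bsub>KX\<^esub>" "Ox y - Ux y = {t \<otimes>\<^bsub>KX\<^esub> a |a. a \<in> Ox y}"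
    using uniformizer[OF yT yn xc xO xm] by blast
  obtain v :: "_ \<Rightarrow> int" where v: "\<And>f. f \<in> carrier KX \<Longrightarrow> f \<noteq> \<zero>\<^bsub>KX\<^esub> \<Longrightarrow> \<exists>u\<in>Ux y. f = u \<otimes>\<^bsub>KX\<^esub> t [^]\<^bsub>KX\<^esub> v f"
  proof (rule K.dvr_valuation[OF Ox_subring[OF yT] Ox_noetherian[OF yT] t Ox_frac[OF yT]])
    fix v :: "_ \<Rightarrow> int"
    assume "\<And>f. f \<in> carrier KX \<Longrightarrow> f \<noteq> \<zero>\<^bsub>KX\<^esub> \<Longrightarrow> \<exists>u\<in>Ux y. f = u \<otimes>\<^bsub>KX\<^esub> t [^]\<^bsub>KX\<^esub> v f"
    then show ?thesis by (rule that)
  qed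
  \<comment> \<open>A generization z other than \<eta> has a nonzero nonunit b, and b is a unit at y
    times a power of t. So t is not a unit at z, nor is any multiple of t by an element of
    \<open>Ox y\<close>; these are all the nonunits at y. Thus y and z have the same units in the
    chart and coincide.\<close>
  have "height_one y"
    unfolding height_one_def
  proof (intro conjI ballI impI)
    fix z assume zT: "z \<in> TX" and z: "y \<in> (topol \<XX>) closure_of {z}"
    have zU: "z \<in> U" by (rule closure_open[OF g(1) y(1) z])
    note le = closure_Ox[OF z]
    show "z = y \<or> z = \<eta>"
    proof (cases "z = \<eta>")
      case False
      obtain b where b: "b \<in> Oo U" "b \<noteq> \<zero>\<^bsub>KX\<^esub>" "b \<notin> Ux z" using nonunit_exists[OF U zU False] by blast
      have bc: "b \<in> carrier KX" using b(1) subringE(1)[OF g(5)] by blast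
      obtain u where u: "u \<in> Ux y" "b = u \<otimes>\<^bsub>KX\<^esub> t [^]\<^bsub>KX\<^esub> v b" using v[OF bc b(2)] by blast
      have tz: "t \<notin> Ux z"
      proof
        assume "t \<in> Ux z"
        then have "t [^]\<^bsub>KX\<^esub> v b \<in> Ux z" by (rule Ux_facts(3)[OF zT])
        moreover have "u \<in> Ux z" using u(1) le(2) by blast
        ultimately have "u \<otimes>\<^bsub>KX\<^esub> t [^]\<^bsub>KX\<^esub> v b \<in> Ux z" by (intro Ux_facts(2)[OF zT])
        then show False using b(3) u(2) by simp
      qed
      have nz: "a \<notin> Ux z" if a: "a \<in> Ox y - Ux y" for a
      proof
        assume az: "a \<in> Ux z"
        obtain d where d: "d \<in> Ox y" "a = t \<otimes>\<^bsub>KX\<^esub> d" using a unfolding t(3) by blast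
        have "t \<in> Ox z" "d \<in> Ox z" using t(1) d(1) le(1) by auto
        then show False using Ux_factor[OF zT] az tz unfolding d(2) by blast
      qed
      have "y = z"
        by (rule ch(5)[OF zU]) (use nz le(2) ch(1) in blast)
      then show ?thesis by simp
    qed simp
  qed (use yT yn in auto)
  note pd = height_one_prime_divisor[OF this]
  have "y \<in> (topol \<XX>) closure_of {y}" using yT by (simp add: in_closure_of)
  then have "f \<in> Ox y" using reg[OF pd(1)] y(1) unfolding pd(2) by blast
  then have "?x \<in> Ox y" using subringE(6)[OF Ox_subring[OF yT]] c(1) ch(1) by blast
  then show False using xO by contradiction
qed

text \<open>Such a P gives the prime of those functions on U that are not units at its generic
  point, and this prime contains a. It contains a prime of the finite family attached to the ideal
  (a), which belongs to a point z that generizes the generic point. As a is nonzero, z is not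
  \<eta>, so height one leaves equality: the prime itself is in the family.\<close>

lemma finite_prime_divisors_chart:
  assumes U: "good U" and a: "a \<in> Oo U" "a \<noteq> \<zero>\<^bsub>KX\<^esub>"
  shows "finite {P. prime_divisor \<XX> P \<and> P \<inter> U \<noteq> {} \<and> a \<notin> Ux (generic_point \<XX> P)}"
proof -
  note g = good_facts[OF U]
  note Oc = subsetD[OF subringE(1)[OF g(5)]]
  define I where "I = {a \<otimes>\<^bsub>KX\<^esub> r |r. r \<in> Oo U}"
  have IU: "I \<subseteq> Oo U" using subringE(6)[OF g(5) a(1)] unfolding I_def by blast
  have I: "submodule_over KX (Oo U) I"
  proof (rule submodule_overI)
    show "I \<subseteq> carrier KX" using IU Oc by blast
    have "\<zero>\<^bsub>KX\<^esub> = a \<otimes>\<^bsub>KX\<^esub> \<zero>\<^bsub>KX\<^esub>" using Oc[OF a(1)] by simp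
    then show "\<zero>\<^bsub>KX\<^esub> \<in> I" using subringE(2)[OF g(5)] unfolding I_def by blast
  next
    fix x y assume "x \<in> I" "y \<in> I"
    then obtain r s where rs: "r \<in> Oo U" "s \<in> Oo U" "x = a \<otimes>\<^bsub>KX\<^esub> r" "y = a \<otimes>\<^bsub>KX\<^esub> s" unfolding I_def by blast
    have "x \<oplus>\<^bsub>KX\<^esub> y = a \<otimes>\<^bsub>KX\<^esub> (r \<oplus>\<^bsub>KX\<^esub> s)" unfolding rs using Oc[OF a(1)] Oc[OF rs(1)] Oc[OF rs(2)] by algebra
    then show "x \<oplus>\<^bsub>KX\<^esub> y \<in> I" using subringE(7)[OF g(5) rs(1,2)] unfolding I_def by blast
  next
    fix b x assume b: "b \<in> Oo U" and "x \<in> I"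
    then obtain r where r: "r \<in> Oo U" "x = a \<otimes>\<^bsub>KX\<^esub> r" unfolding I_def by blast
    have "b \<otimes>\<^bsub>KX\<^esub> x = a \<otimes>\<^bsub>KX\<^esub> (b \<otimes>\<^bsub>KX\<^esub> r)" unfolding r using Oc[OF a(1)] Oc[OF b] Oc[OF r(1)] by algebra
    then show "b \<otimes>\<^bsub>KX\<^esub> x \<in> I" using subringE(6)[OF g(5) b r(1)] unfolding I_def by blast
  qed
  have "a = a \<otimes>\<^bsub>KX\<^esub> \<one>\<^bsub>KX\<^esub>" using Oc[OF a(1)] by simp
  then have aI: "a \<in> I" using subringE(3)[OF g(5)] unfolding I_def by blast
  obtain F where F0: "finite F \<and> (\<forall>p\<in>F. prime_over KX (Oo U) p \<and> I \<subseteq> p) \<and>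
    (\<forall>q. prime_over KX (Oo U) q \<and> I \<subseteq> q \<longrightarrow> (\<exists>p\<in>F. p \<subseteq> q))"
    using K.finitely_many_minimal_primes[OF g(5,6) I IU] by (rule exE)
  define S where "S = {P. prime_divisor \<XX> P \<and> P \<inter> U \<noteq> {} \<and> a \<notin> Ux (generic_point \<XX> P)}"
  define m where "m P = Oo U - Ux (generic_point \<XX> P)" for P
  have gU: "generic_point \<XX> P \<in> U" "height_one (generic_point \<XX> P)" "generic_point \<XX> P \<in> TX" if "P \<in> S" for P
  proof -
    have P: "prime_divisor \<XX> P" "P \<inter> U \<noteq> {}" using that unfolding S_def by auto
    show "generic_point \<XX> P \<in> U" "height_one (generic_point \<XX> P)" using prime_divisor_generic[OF P(1)] P(2) g(1) by auto
    then show "generic_point \<XX> P \<in> TX" using g(3) by blast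
  qed
  have "m P \<in> F" if P: "P \<in> S" for P
  proof -
    let ?y = "generic_point \<XX> P"
    note y = gU[OF P]
    have h: "\<And>z. z \<in> TX \<Longrightarrow> ?y \<in> (topol \<XX>) closure_of {z} \<Longrightarrow> z = ?y \<or> z = \<eta>" using y(2) unfolding height_one_def by blast
    have pr: "prime_over KX (Oo U) (m P)" unfolding m_def by (rule Oo_nonunits_prime[OF U y(1)])
    have "a \<in> m P" using P a(1) unfolding S_def m_def by blast
    have "I \<subseteq> m P"
    proof
      fix x assume "x \<in> I"
      then obtain r where r: "r \<in> Oo U" "x = a \<otimes>\<^bsub>KX\<^esub> r" unfolding I_def by blast
      then have "x = r \<otimes>\<^bsub>KX\<^esub> a" using K.m_comm[OF Oc[OF a(1)] Oc[OF r(1)]] by simp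
      then show "x \<in> m P" using pr submodule_overD(4)[of KX "Oo U" "m P" r a] r(1) \<open>a \<in> m P\<close> unfolding prime_over_def by simp
    qed
    then obtain p where p: "p \<in> F" "p \<subseteq> m P" using F0 pr by blast
    have pp: "prime_over KX (Oo U) p" "I \<subseteq> p" using F0 p(1) by auto
    obtain z where z: "z \<in> U" "p = Oo U - Ux z" using good_surj[OF U pp(1)] by blast
    have "?y \<in> (topol \<XX>) closure_of {z}"
      by (rule closureI[OF U y(1) z(1)]) (use p(2) z(2) in \<open>auto simp: m_def\<close>)
    then have "z = ?y \<or> z = \<eta>" using h z(1) g(3) by blast
    moreover have "z \<noteq> \<eta>" using aI pp(2) z(2) Ux_eta[of a] a(2) Oc[OF a(1)] by blast
    ultimately have "p = m P" using z(2) unfolding m_def by blast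
    then show ?thesis using p(1) by simp
  qed
  \<comment> \<open>The nonunits on U determine the point, and a prime divisor is the closure of its
    generic point.\<close>
  moreover have "inj_on m S"
  proof (rule inj_onI)
    fix P Q assume P: "P \<in> S" and Q: "Q \<in> S" and eq: "m P = m Q"
    have "generic_point \<XX> P = generic_point \<XX> Q"
      by (rule good_chart_facts(5)[OF U gU(1)[OF P] gU(1)[OF Q]]) (use eq in \<open>auto simp: m_def\<close>)
    moreover have "prime_divisor \<XX> P" "prime_divisor \<XX> Q" using P Q unfolding S_def by auto
    ultimately show "P = Q" using prime_divisor_generic(4) by metis
  qed
  ultimately have "finite S" using F0 by (meson finite_subset image_subsetI inj_on_finite)
  then show ?thesis unfolding S_def .
qed

text \<open>On each of the finitely many charts f is a quotient a / b of functions, and f is a unit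
  wherever a and b are.\<close>

lemma finite_prime_divisors:
  assumes f: "f \<in> carrier KX" "f \<noteq> \<zero>\<^bsub>KX\<^esub>"
  shows "finite {P. prime_divisor \<XX> P \<and> f \<notin> Ux (generic_point \<XX> P)}"
proof -
  obtain \<G> where G: "finite \<G>" "\<Union>\<G> = TX" "\<And>U. U \<in> \<G> \<Longrightarrow> good U" using good_cover by blast
  have fin: "finite {P. prime_divisor \<XX> P \<and> P \<inter> U \<noteq> {} \<and> f \<notin> Ux (generic_point \<XX> P)}" if UG: "U \<in> \<G>" for U
  proof -
    note U = G(3)[OF UG]
    note g = good_facts[OF U]
    note Oc = subsetD[OF subringE(1)[OF g(5)]]
    obtain a b where ab: "a \<in> Oo U" "b \<in> Oo U" "b \<noteq> \<zero>\<^bsub>KX\<^esub>" "b \<otimes>\<^bsub>KX\<^esub> f = a" by (rule Oo_frac[OF U f(1)])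
    have an: "a \<noteq> \<zero>\<^bsub>KX\<^esub>" using ab f K.integral_iff[OF Oc[OF ab(2)] f(1)] by auto
    have "f \<in> Ux (generic_point \<XX> P)"
      if P: "prime_divisor \<XX> P" "P \<inter> U \<noteq> {}" "a \<in> Ux (generic_point \<XX> P)" "b \<in> Ux (generic_point \<XX> P)" for P
    proof -
      let ?y = "generic_point \<XX> P"
      have yT: "?y \<in> TX" using prime_divisor_generic(1)[OF P(1)] unfolding height_one_def by blast
      have aO: "a \<in> Ox ?y" using Ux_facts(1)[OF yT P(3)] by blast
      have fO: "f \<in> Ox ?y" by (rule Ux_div[OF yT P(4) f(1)]) (use ab(4) aO in simp)
      have "f \<otimes>\<^bsub>KX\<^esub> b \<in> Ux ?y" using P(3) ab(4) K.m_comm[OF f(1) Oc[OF ab(2)]] by simp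
      then show ?thesis using Ux_factor[OF yT fO] Ux_facts(1)[OF yT P(4)] by blast
    qed
    then have "{P. prime_divisor \<XX> P \<and> P \<inter> U \<noteq> {} \<and> f \<notin> Ux (generic_point \<XX> P)} \<subseteq>
      {P. prime_divisor \<XX> P \<and> P \<inter> U \<noteq> {} \<and> a \<notin> Ux (generic_point \<XX> P)} \<union>
      {P. prime_divisor \<XX> P \<and> P \<inter> U \<noteq> {} \<and> b \<notin> Ux (generic_point \<XX> P)}" by blast
    then show ?thesis
      using finite_prime_divisors_chart[OF U ab(1) an] finite_prime_divisors_chart[OF U ab(2,3)] by (meson finite_Un finite_subset)
  qed
  have "{P. prime_divisor \<XX> P \<and> f \<notin> Ux (generic_point \<XX> P)} \<subseteq>
    (\<Union>U\<in>\<G>. {P. prime_divisor \<XX> P \<and> P \<inter> U \<noteq> {} \<and> f \<notin> Ux (generic_point \<XX> P)})"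
  proof
    fix P assume P: "P \<in> {P. prime_divisor \<XX> P \<and> f \<notin> Ux (generic_point \<XX> P)}"
    then have pd: "prime_divisor \<XX> P" by blast
    have "generic_point \<XX> P \<in> TX" "generic_point \<XX> P \<in> P" using prime_divisor_generic[OF pd] unfolding height_one_def by auto
    then obtain U where "U \<in> \<G>" "generic_point \<XX> P \<in> U" using G(2) by blast
    then show "P \<in> (\<Union>U\<in>\<G>. {P. prime_divisor \<XX> P \<and> P \<inter> U \<noteq> {} \<and> f \<notin> Ux (generic_point \<XX> P)})"
      using P \<open>generic_point \<XX> P \<in> P\<close> by blast
  qed
  then show ?thesis using fin G(1) by (meson finite_UN finite_subset)
qed

end

section \<open>Orders along prime divisors\<close>

context normal_noetherian
begin

lemma stalk_cring: "y \<in> TX \<Longrightarrow> cring (stalk \<XX> y)"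
  using local_stalks unfolding local_ring_def by blast

lemma stalk_Units:
  assumes y: "y \<in> TX"
  shows "A \<in> Units (stalk \<XX> y) \<longleftrightarrow> A \<in> carrier (stalk \<XX> y) \<and> stalk_to_K \<XX> A \<in> Ux y"
proof -
  interpret S: cring "stalk \<XX> y" by (rule stalk_cring[OF y])
  note hom = stalk_to_K_hom[OF y] and im = stalk_to_K_image[OF y] and inj = stalk_to_K_inj[OF y]
  show ?thesis
  proof
    assume A: "A \<in> Units (stalk \<XX> y)"
    then have Ac: "A \<in> carrier (stalk \<XX> y)" and B: "inv\<^bsub>stalk \<XX> y\<^esub> A \<in> carrier (stalk \<XX> y)" "A \<otimes>\<^bsub>stalk \<XX> y\<^esub> inv\<^bsub>stalk \<XX> y\<^esub> A = \<one>\<^bsub>stalk \<XX> y\<^esub>" by auto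
    have "stalk_to_K \<XX> A \<otimes>\<^bsub>KX\<^esub> stalk_to_K \<XX> (inv\<^bsub>stalk \<XX> y\<^esub> A) = \<one>\<^bsub>KX\<^esub>"
      using ring_hom_mult[OF hom Ac B(1)] ring_hom_one[OF hom] unfolding B(2) by simp
    moreover have "stalk_to_K \<XX> A \<in> Ox y" "stalk_to_K \<XX> (inv\<^bsub>stalk \<XX> y\<^esub> A) \<in> Ox y" using Ac B(1) unfolding im[symmetric] by auto
    ultimately have "stalk_to_K \<XX> A \<in> Ux y" unfolding units_in_def by blast
    then show "A \<in> carrier (stalk \<XX> y) \<and> stalk_to_K \<XX> A \<in> Ux y" using Ac by blast
  next
    assume A: "A \<in> carrier (stalk \<XX> y) \<and> stalk_to_K \<XX> A \<in> Ux y"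
    then obtain w where w: "w \<in> Ox y" "stalk_to_K \<XX> A \<otimes>\<^bsub>KX\<^esub> w = \<one>\<^bsub>KX\<^esub>" unfolding units_in_def by blast
    obtain B where B: "B \<in> carrier (stalk \<XX> y)" "w = stalk_to_K \<XX> B" using w(1) unfolding im[symmetric] by blast
    have Ac: "A \<in> carrier (stalk \<XX> y)" using A by blast
    have "stalk_to_K \<XX> (A \<otimes>\<^bsub>stalk \<XX> y\<^esub> B) = stalk_to_K \<XX> \<one>\<^bsub>stalk \<XX> y\<^esub>"
      using w(2) unfolding B(2) ring_hom_mult[OF hom Ac B(1)] ring_hom_one[OF hom] .
    then have "A \<otimes>\<^bsub>stalk \<XX> y\<^esub> B = \<one>\<^bsub>stalk \<XX> y\<^esub>"
      using inj_onD[OF inj] S.m_closed[OF Ac B(1)] S.one_closed by blast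
    then show "A \<in> Units (stalk \<XX> y)" using Ac B(1) S.m_comm[OF Ac B(1)] unfolding Units_def by auto
  qed
qed

text \<open>The nonunits form an ideal by \<open>Ox_local\<close>, and a larger ideal contains a
  unit. As \<open>max_ideal\<close> is a definite description, the uniqueness contained in
  \<open>local_ring\<close> completes the identification.\<close>

lemma stalk_max_ideal:
  assumes y: "y \<in> TX"
  shows "max_ideal (stalk \<XX> y) = {A \<in> carrier (stalk \<XX> y). stalk_to_K \<XX> A \<notin> Ux y}"
    "ideal (max_ideal (stalk \<XX> y)) (stalk \<XX> y)"
proof -
  interpret S: cring "stalk \<XX> y" by (rule stalk_cring[OF y])
  note im = stalk_to_K_image[OF y]
  interpret H: ring_hom_cring "stalk \<XX> y" KX "stalk_to_K \<XX>"
    using stalk_to_K_hom[OF y] by (simp add: ring_hom_cring_def ring_hom_cring_axioms_def S.cring_axioms K.cring_axioms)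
  define M where "M = {A \<in> carrier (stalk \<XX> y). stalk_to_K \<XX> A \<notin> Ux y}"
  have hO: "stalk_to_K \<XX> A \<in> Ox y" if "A \<in> carrier (stalk \<XX> y)" for A using that unfolding im[symmetric] by blast
  note l = submodule_overD[OF Ox_local[OF y]]
  have Mm: "A \<in> M \<longleftrightarrow> A \<in> carrier (stalk \<XX> y) \<and> stalk_to_K \<XX> A \<in> Ox y - Ux y" for A unfolding M_def using hO by blast
  have id: "ideal M (stalk \<XX> y)"
  proof (rule idealI[OF S.ring_axioms])
    show "subgroup M (add_monoid (stalk \<XX> y))"
    proof (rule S.add.subgroupI)
      show "M \<subseteq> carrier (stalk \<XX> y)" unfolding M_def by blast
      have "\<zero>\<^bsub>stalk \<XX> y\<^esub> \<in> M" unfolding Mm using l(2) by simp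
      then show "M \<noteq> {}" by blast
      show "\<ominus>\<^bsub>stalk \<XX> y\<^esub> A \<in> M" if A: "A \<in> M" for A
      proof -
        have Ac: "A \<in> carrier (stalk \<XX> y)" "stalk_to_K \<XX> A \<in> Ox y - Ux y" using A unfolding Mm by auto
        have "\<zero>\<^bsub>KX\<^esub> \<ominus>\<^bsub>KX\<^esub> stalk_to_K \<XX> A \<in> Ox y - Ux y"
          by (rule K.submodule_over_minus[OF Ox_subring[OF y] Ox_local[OF y] l(2) Ac(2)])
        moreover have "\<zero>\<^bsub>KX\<^esub> \<ominus>\<^bsub>KX\<^esub> stalk_to_K \<XX> A = stalk_to_K \<XX> (\<ominus>\<^bsub>stalk \<XX> y\<^esub> A)"
          using Ac(1) by (simp add: a_minus_def)
        ultimately show ?thesis unfolding Mm using Ac(1) by simp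
      qed
      show "A \<oplus>\<^bsub>stalk \<XX> y\<^esub> B \<in> M" if A: "A \<in> M" and B: "B \<in> M" for A B
        using A B l(3)[of "stalk_to_K \<XX> A" "stalk_to_K \<XX> B"] unfolding Mm by simp
    qed
    show 1: "B \<otimes>\<^bsub>stalk \<XX> y\<^esub> A \<in> M" if A: "A \<in> M" "B \<in> carrier (stalk \<XX> y)" for A B
      using A l(4)[OF hO[OF A(2)], of "stalk_to_K \<XX> A"] unfolding Mm by simp
    show "A \<otimes>\<^bsub>stalk \<XX> y\<^esub> B \<in> M" if A: "A \<in> M" "B \<in> carrier (stalk \<XX> y)" for A B
    proof -
      have "A \<in> carrier (stalk \<XX> y)" using A unfolding Mm by blast
      then show ?thesis using 1[OF A] S.m_comm[OF _ A(2)] by simp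
    qed
  qed
  have one: "\<one>\<^bsub>stalk \<XX> y\<^esub> \<notin> M" unfolding M_def using K.units_in_facts(3)[OF Ox_subring[OF y]] by simp
  have max: "maximalideal M (stalk \<XX> y)"
  proof (rule maximalidealI[OF id])
    show "carrier (stalk \<XX> y) \<noteq> M" using one S.one_closed by blast
    fix J assume J: "ideal J (stalk \<XX> y)" "M \<subseteq> J" "J \<subseteq> carrier (stalk \<XX> y)"
    show "J = M \<or> J = carrier (stalk \<XX> y)"
    proof (cases "J = M")
      case False
      then obtain A where A: "A \<in> J" "A \<notin> M" using J(2) by blast
      then have Ac: "A \<in> carrier (stalk \<XX> y)" using J(3) by blast
      then have "A \<in> Units (stalk \<XX> y)" using A(2) unfolding stalk_Units[OF y] M_def by blast
      then have "inv\<^bsub>stalk \<XX> y\<^esub> A \<otimes>\<^bsub>stalk \<XX> y\<^esub> A = \<one>\<^bsub>stalk \<XX> y\<^esub>" "inv\<^bsub>stalk \<XX> y\<^esub> A \<in> carrier (stalk \<XX> y)" by auto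
      then have "\<one>\<^bsub>stalk \<XX> y\<^esub> \<in> J" using ideal.I_l_closed[OF J(1) A(1)] by metis
      then show ?thesis using ideal.one_imp_carrier[OF J(1)] by blast
    qed simp
  qed
  have "\<exists>!M. maximalideal M (stalk \<XX> y)" using local_stalks[OF y] unfolding local_ring_def by blast
  then have eq: "max_ideal (stalk \<XX> y) = M" unfolding max_ideal_def using max by (rule the1_equality)
  show "max_ideal (stalk \<XX> y) = {A \<in> carrier (stalk \<XX> y). stalk_to_K \<XX> A \<notin> Ux y}" unfolding eq M_def ..
  show "ideal (max_ideal (stalk \<XX> y)) (stalk \<XX> y)" unfolding eq by (rule id)
qed

text \<open>Translates the condition on uniformizers in the definition of \<open>ord\<close> from
  the stalk to the function field, where \<open>dvr_valuation\<close> applies.\<close>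

lemma stalk_max_ideal_principal:
  assumes y: "y \<in> TX" and t: "t \<in> carrier (stalk \<XX> y)"
  shows "max_ideal (stalk \<XX> y) = PIdl\<^bsub>stalk \<XX> y\<^esub> t \<longleftrightarrow> Ox y - Ux y = {stalk_to_K \<XX> t \<otimes>\<^bsub>KX\<^esub> a |a. a \<in> Ox y}"
proof -
  interpret S: cring "stalk \<XX> y" by (rule stalk_cring[OF y])
  note hom = stalk_to_K_hom[OF y] and im = stalk_to_K_image[OF y] and inj = stalk_to_K_inj[OF y]
  let ?h = "stalk_to_K \<XX>"
  have 1: "?h ` max_ideal (stalk \<XX> y) = Ox y - Ux y"
  proof (intro subset_antisym subsetI)
    fix z assume "z \<in> ?h ` max_ideal (stalk \<XX> y)"
    then obtain A where "A \<in> carrier (stalk \<XX> y)" "?h A \<notin> Ux y" "z = ?h A" unfolding stalk_max_ideal(1)[OF y] by auto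
    then show "z \<in> Ox y - Ux y" using im by auto
  next
    fix z assume z: "z \<in> Ox y - Ux y"
    then have "z \<in> ?h ` carrier (stalk \<XX> y)" using im by simp
    then obtain A where "A \<in> carrier (stalk \<XX> y)" "z = ?h A" by auto
    then show "z \<in> ?h ` max_ideal (stalk \<XX> y)" using z unfolding stalk_max_ideal(1)[OF y] by auto
  qed
  have 2: "?h ` (PIdl\<^bsub>stalk \<XX> y\<^esub> t) = {?h t \<otimes>\<^bsub>KX\<^esub> a |a. a \<in> Ox y}"
  proof (intro subset_antisym subsetI)
    fix z assume "z \<in> ?h ` (PIdl\<^bsub>stalk \<XX> y\<^esub> t)"
    then obtain A where A: "A \<in> carrier (stalk \<XX> y)" "z = ?h (A \<otimes>\<^bsub>stalk \<XX> y\<^esub> t)" unfolding cgenideal_def by auto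
    have "z = ?h t \<otimes>\<^bsub>KX\<^esub> ?h A" unfolding A(2) S.m_comm[OF A(1) t] by (rule ring_hom_mult[OF hom t A(1)])
    then show "z \<in> {?h t \<otimes>\<^bsub>KX\<^esub> a |a. a \<in> Ox y}" using A(1) unfolding im[symmetric] by blast
  next
    fix z assume "z \<in> {?h t \<otimes>\<^bsub>KX\<^esub> a |a. a \<in> Ox y}"
    then obtain a where a: "a \<in> Ox y" "z = ?h t \<otimes>\<^bsub>KX\<^esub> a" by blast
    then obtain A where A: "A \<in> carrier (stalk \<XX> y)" "a = ?h A" unfolding im[symmetric] by blast
    have "z = ?h (A \<otimes>\<^bsub>stalk \<XX> y\<^esub> t)" unfolding a(2) A(2) S.m_comm[OF A(1) t] by (rule ring_hom_mult[OF hom t A(1), symmetric])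
    then show "z \<in> ?h ` (PIdl\<^bsub>stalk \<XX> y\<^esub> t)" using A(1) unfolding cgenideal_def by blast
  qed
  have sub: "max_ideal (stalk \<XX> y) \<subseteq> carrier (stalk \<XX> y)" "PIdl\<^bsub>stalk \<XX> y\<^esub> t \<subseteq> carrier (stalk \<XX> y)"
    using stalk_max_ideal(1)[OF y] t unfolding cgenideal_def by auto
  show ?thesis unfolding 1[symmetric] 2[symmetric] using inj_on_image_eq_iff[OF inj sub] by blast
qed

text \<open>\<open>fin_part\<close> has the default value 0, so the zero function gets
  \<open>val\<close> 0 instead of infinity; the facts about \<open>val\<close> are therefore
  restricted to nonzero functions.\<close>

definition val :: "'x set \<Rightarrow> ('x set \<times> 'a) set \<Rightarrow> int" where "val P f = fin_part (ord \<XX> P f)"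

abbreviation gp where "gp P \<equiv> generic_point \<XX> P"

lemma gp_TX: "prime_divisor \<XX> P \<Longrightarrow> gp P \<in> TX"
  using prime_divisor_generic(1) unfolding height_one_def by blast

lemma ord_zero: "ord \<XX> P \<zero>\<^bsub>KX\<^esub> = Pinf"
  unfolding ord_def KX_def by (simp add: Let_def)

text \<open>The valuation of the discrete valuation ring at the generic point satisfies the definite
  description in \<open>ord\<close>: it provides one expression of f by a uniformizer and a unit,
  and any other expression, even with another uniformizer, has the same exponent.\<close>

lemma val_facts:
  assumes P: "prime_divisor \<XX> P"
  shows "\<And>f. f \<in> carrier KX \<Longrightarrow> f \<noteq> \<zero>\<^bsub>KX\<^esub> \<Longrightarrow> ord \<XX> P f = Fin (val P f)"
    "\<And>f g. f \<in> carrier KX \<Longrightarrow> f \<noteq> \<zero>\<^bsub>KX\<^esub> \<Longrightarrow> g \<in> carrier KX \<Longrightarrow> g \<noteq> \<zero>\<^bsub>KX\<^esub> \<Longrightarrow> val P (f \<otimes>\<^bsub>KX\<^esub> g) = val P f + val P g"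
    "\<And>f g. f \<in> carrier KX \<Longrightarrow> f \<noteq> \<zero>\<^bsub>KX\<^esub> \<Longrightarrow> g \<in> carrier KX \<Longrightarrow> g \<noteq> \<zero>\<^bsub>KX\<^esub> \<Longrightarrow> f \<oplus>\<^bsub>KX\<^esub> g \<noteq> \<zero>\<^bsub>KX\<^esub> \<Longrightarrow>
       min (val P f) (val P g) \<le> val P (f \<oplus>\<^bsub>KX\<^esub> g)"
    "\<And>f. f \<in> carrier KX \<Longrightarrow> f \<noteq> \<zero>\<^bsub>KX\<^esub> \<Longrightarrow> 0 \<le> val P f \<longleftrightarrow> f \<in> Ox (gp P)"
    "\<And>f. f \<in> carrier KX \<Longrightarrow> f \<noteq> \<zero>\<^bsub>KX\<^esub> \<Longrightarrow> 1 \<le> val P f \<longleftrightarrow> f \<in> Ox (gp P) - Ux (gp P)"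
proof -
  let ?y = "gp P"
  have y: "?y \<in> TX" by (rule gp_TX[OF P])
  obtain t where t: "t \<in> Ox ?y - Ux ?y" "t \<noteq> \<zero>\<^bsub>KX\<^esub>" "Ox ?y - Ux ?y = {t \<otimes>\<^bsub>KX\<^esub> a |a. a \<in> Ox ?y}"
    using height_one_uniformizer[OF prime_divisor_generic(1)[OF P]] by blast
  note im = stalk_to_K_image[OF y]
  have "t \<in> Ox ?y" using t(1) by blast
  then obtain t0 where t0: "t0 \<in> carrier (stalk \<XX> ?y)" "t = stalk_to_K \<XX> t0" unfolding im[symmetric] by blast
  \<comment> \<open>One existential statement keeps all properties attached to the same v, which is
    afterwards identified with \<open>val P\<close>.\<close>
  have "\<exists>v :: _ \<Rightarrow> int. (\<forall>f. f \<in> carrier KX \<longrightarrow> f \<noteq> \<zero>\<^bsub>KX\<^esub> \<longrightarrow> ord \<XX> P f = Fin (v f)) \<and>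
    (\<forall>f g. f \<in> carrier KX \<longrightarrow> f \<noteq> \<zero>\<^bsub>KX\<^esub> \<longrightarrow> g \<in> carrier KX \<longrightarrow> g \<noteq> \<zero>\<^bsub>KX\<^esub> \<longrightarrow> v (f \<otimes>\<^bsub>KX\<^esub> g) = v f + v g) \<and>
    (\<forall>f g. f \<in> carrier KX \<longrightarrow> f \<noteq> \<zero>\<^bsub>KX\<^esub> \<longrightarrow> g \<in> carrier KX \<longrightarrow> g \<noteq> \<zero>\<^bsub>KX\<^esub> \<longrightarrow> f \<oplus>\<^bsub>KX\<^esub> g \<noteq> \<zero>\<^bsub>KX\<^esub> \<longrightarrow>
       min (v f) (v g) \<le> v (f \<oplus>\<^bsub>KX\<^esub> g)) \<and>
    (\<forall>f. f \<in> carrier KX \<longrightarrow> f \<noteq> \<zero>\<^bsub>KX\<^esub> \<longrightarrow> (0 \<le> v f \<longleftrightarrow> f \<in> Ox ?y)) \<and>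
    (\<forall>f. f \<in> carrier KX \<longrightarrow> f \<noteq> \<zero>\<^bsub>KX\<^esub> \<longrightarrow> (1 \<le> v f \<longleftrightarrow> f \<in> Ox ?y - Ux ?y))"
  proof (rule K.dvr_valuation[OF Ox_subring[OF y] Ox_noetherian[OF y] t Ox_frac[OF y]])
    fix v :: "_ \<Rightarrow> int"
    assume v1: "\<And>f. f \<in> carrier KX \<Longrightarrow> f \<noteq> \<zero>\<^bsub>KX\<^esub> \<Longrightarrow> \<exists>u\<in>Ux ?y. f = u \<otimes>\<^bsub>KX\<^esub> t [^]\<^bsub>KX\<^esub> v f"
      and v2: "\<And>t' u n. t' \<in> Ox ?y \<Longrightarrow> Ox ?y - Ux ?y = {t' \<otimes>\<^bsub>KX\<^esub> a |a. a \<in> Ox ?y} \<Longrightarrow> u \<in> Ux ?y \<Longrightarrow> v (u \<otimes>\<^bsub>KX\<^esub> t' [^]\<^bsub>KX\<^esub> n) = n"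
      and v3: "\<And>f g. f \<in> carrier KX \<Longrightarrow> f \<noteq> \<zero>\<^bsub>KX\<^esub> \<Longrightarrow> g \<in> carrier KX \<Longrightarrow> g \<noteq> \<zero>\<^bsub>KX\<^esub> \<Longrightarrow> v (f \<otimes>\<^bsub>KX\<^esub> g) = v f + v g"
      and v4: "\<And>f g. f \<in> carrier KX \<Longrightarrow> f \<noteq> \<zero>\<^bsub>KX\<^esub> \<Longrightarrow> g \<in> carrier KX \<Longrightarrow> g \<noteq> \<zero>\<^bsub>KX\<^esub> \<Longrightarrow> f \<oplus>\<^bsub>KX\<^esub> g \<noteq> \<zero>\<^bsub>KX\<^esub> \<Longrightarrow>
       min (v f) (v g) \<le> v (f \<oplus>\<^bsub>KX\<^esub> g)"
      and v5: "\<And>f. f \<in> carrier KX \<Longrightarrow> f \<noteq> \<zero>\<^bsub>KX\<^esub> \<Longrightarrow> 0 \<le> v f \<longleftrightarrow> f \<in> Ox ?y"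
      and v6: "\<And>f. f \<in> carrier KX \<Longrightarrow> f \<noteq> \<zero>\<^bsub>KX\<^esub> \<Longrightarrow> 1 \<le> v f \<longleftrightarrow> f \<in> Ox ?y - Ux ?y"
    have ord: "ord \<XX> P f = Fin (v f)" if f: "f \<in> carrier KX" "f \<noteq> \<zero>\<^bsub>KX\<^esub>" for f
    proof -
      have "(THE n::int. \<exists>t\<in>carrier (stalk \<XX> ?y). \<exists>u\<in>Units (stalk \<XX> ?y). max_ideal (stalk \<XX> ?y) = PIdl\<^bsub>stalk \<XX> ?y\<^esub> t \<and>
                  f = stalk_to_K \<XX> u \<otimes>\<^bsub>KX\<^esub> (stalk_to_K \<XX> t) [^]\<^bsub>KX\<^esub> n) = v f"
      proof (rule the_equality)
        obtain u where u: "u \<in> Ux ?y" "f = u \<otimes>\<^bsub>KX\<^esub> t [^]\<^bsub>KX\<^esub> v f" using v1[OF f] by blast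
        have "u \<in> Ox ?y" using Ux_facts(1)[OF y u(1)] by blast
        then obtain u0 where u0: "u0 \<in> carrier (stalk \<XX> ?y)" "u = stalk_to_K \<XX> u0" unfolding im[symmetric] by blast
        have "u0 \<in> Units (stalk \<XX> ?y)" unfolding stalk_Units[OF y] using u0 u(1) by simp
        moreover have "max_ideal (stalk \<XX> ?y) = PIdl\<^bsub>stalk \<XX> ?y\<^esub> t0" unfolding stalk_max_ideal_principal[OF y t0(1)] using t(3) unfolding t0(2) .
        moreover have "f = stalk_to_K \<XX> u0 \<otimes>\<^bsub>KX\<^esub> (stalk_to_K \<XX> t0) [^]\<^bsub>KX\<^esub> v f" using u(2) unfolding t0(2) u0(2) .
        ultimately show "\<exists>t\<in>carrier (stalk \<XX> ?y). \<exists>u\<in>Units (stalk \<XX> ?y). max_ideal (stalk \<XX> ?y) = PIdl\<^bsub>stalk \<XX> ?y\<^esub> t \<and>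
                  f = stalk_to_K \<XX> u \<otimes>\<^bsub>KX\<^esub> (stalk_to_K \<XX> t) [^]\<^bsub>KX\<^esub> v f" using t0(1) by blast
      next
        fix n :: int
        assume "\<exists>t\<in>carrier (stalk \<XX> ?y). \<exists>u\<in>Units (stalk \<XX> ?y). max_ideal (stalk \<XX> ?y) = PIdl\<^bsub>stalk \<XX> ?y\<^esub> t \<and>
                  f = stalk_to_K \<XX> u \<otimes>\<^bsub>KX\<^esub> (stalk_to_K \<XX> t) [^]\<^bsub>KX\<^esub> n"
        then obtain t1 u1 where 1: "t1 \<in> carrier (stalk \<XX> ?y)" "u1 \<in> Units (stalk \<XX> ?y)" "max_ideal (stalk \<XX> ?y) = PIdl\<^bsub>stalk \<XX> ?y\<^esub> t1"
          "f = stalk_to_K \<XX> u1 \<otimes>\<^bsub>KX\<^esub> (stalk_to_K \<XX> t1) [^]\<^bsub>KX\<^esub> n" by blast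
        have t1O: "stalk_to_K \<XX> t1 \<in> Ox ?y" using 1(1) unfolding im[symmetric] by blast
        have u1U: "stalk_to_K \<XX> u1 \<in> Ux ?y" using 1(2) unfolding stalk_Units[OF y] by blast
        show "n = v f" unfolding 1(4) by (rule v2[OF t1O stalk_max_ideal_principal[OF y 1(1), THEN iffD1, OF 1(3)] u1U, symmetric])
      qed
      then show ?thesis unfolding ord_def local_ring_at_def KX_def[symmetric] Let_def using f(2) by simp
    qed
    show ?thesis using ord v3 v4 v5 v6 by (intro exI[of _ v] conjI allI impI)
  qed
  then obtain v :: "_ \<Rightarrow> int" where v: "(\<forall>f. f \<in> carrier KX \<longrightarrow> f \<noteq> \<zero>\<^bsub>KX\<^esub> \<longrightarrow> ord \<XX> P f = Fin (v f)) \<and>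
    (\<forall>f g. f \<in> carrier KX \<longrightarrow> f \<noteq> \<zero>\<^bsub>KX\<^esub> \<longrightarrow> g \<in> carrier KX \<longrightarrow> g \<noteq> \<zero>\<^bsub>KX\<^esub> \<longrightarrow> v (f \<otimes>\<^bsub>KX\<^esub> g) = v f + v g) \<and>
    (\<forall>f g. f \<in> carrier KX \<longrightarrow> f \<noteq> \<zero>\<^bsub>KX\<^esub> \<longrightarrow> g \<in> carrier KX \<longrightarrow> g \<noteq> \<zero>\<^bsub>KX\<^esub> \<longrightarrow> f \<oplus>\<^bsub>KX\<^esub> g \<noteq> \<zero>\<^bsub>KX\<^esub> \<longrightarrow>
       min (v f) (v g) \<le> v (f \<oplus>\<^bsub>KX\<^esub> g)) \<and>
    (\<forall>f. f \<in> carrier KX \<longrightarrow> f \<noteq> \<zero>\<^bsub>KX\<^esub> \<longrightarrow> (0 \<le> v f \<longleftrightarrow> f \<in> Ox ?y)) \<and>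
    (\<forall>f. f \<in> carrier KX \<longrightarrow> f \<noteq> \<zero>\<^bsub>KX\<^esub> \<longrightarrow> (1 \<le> v f \<longleftrightarrow> f \<in> Ox ?y - Ux ?y))" by (rule exE)
  have vv: "val P f = v f" if "f \<in> carrier KX" "f \<noteq> \<zero>\<^bsub>KX\<^esub>" for f using v that unfolding val_def fin_part_def by simp
  show "ord \<XX> P f = Fin (val P f)" if "f \<in> carrier KX" "f \<noteq> \<zero>\<^bsub>KX\<^esub>" for f using v vv that by simp
  show "val P (f \<otimes>\<^bsub>KX\<^esub> g) = val P f + val P g" if fg: "f \<in> carrier KX" "f \<noteq> \<zero>\<^bsub>KX\<^esub>" "g \<in> carrier KX" "g \<noteq> \<zero>\<^bsub>KX\<^esub>" for f g
  proof -
    have "f \<otimes>\<^bsub>KX\<^esub> g \<noteq> \<zero>\<^bsub>KX\<^esub>" using K.integral_iff fg by simp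
    then have "val P (f \<otimes>\<^bsub>KX\<^esub> g) = v (f \<otimes>\<^bsub>KX\<^esub> g)" using vv fg by simp
    then show ?thesis using v vv[OF fg(1,2)] vv[OF fg(3,4)] fg by simp
  qed
  show "min (val P f) (val P g) \<le> val P (f \<oplus>\<^bsub>KX\<^esub> g)"
    if fg: "f \<in> carrier KX" "f \<noteq> \<zero>\<^bsub>KX\<^esub>" "g \<in> carrier KX" "g \<noteq> \<zero>\<^bsub>KX\<^esub>" "f \<oplus>\<^bsub>KX\<^esub> g \<noteq> \<zero>\<^bsub>KX\<^esub>" for f g
    using v vv[OF fg(1,2)] vv[OF fg(3,4)] vv[OF K.a_closed[OF fg(1,3)] fg(5)] fg by simp
  show "0 \<le> val P f \<longleftrightarrow> f \<in> Ox ?y" if f: "f \<in> carrier KX" "f \<noteq> \<zero>\<^bsub>KX\<^esub>" for f using v vv[OF f] f by simp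
  show "1 \<le> val P f \<longleftrightarrow> f \<in> Ox ?y - Ux ?y" if f: "f \<in> carrier KX" "f \<noteq> \<zero>\<^bsub>KX\<^esub>" for f using v vv[OF f] f by simp
qed

text \<open>Order at least n, with the zero function of infinite order. As a predicate it stays in
  the integers and is stable under sums without a separate case for cancellation.\<close>

definition ordge :: "'x set \<Rightarrow> int \<Rightarrow> ('x set \<times> 'a) set \<Rightarrow> bool" where
  "ordge P n f \<longleftrightarrow> f = \<zero>\<^bsub>KX\<^esub> \<or> n \<le> val P f"

lemma ordge_zero [simp]: "ordge P n \<zero>\<^bsub>KX\<^esub>" unfolding ordge_def by simp

lemma ordge_mono: "ordge P n f \<Longrightarrow> m \<le> n \<Longrightarrow> ordge P m f" unfolding ordge_def by auto

lemma ordge_add: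
  assumes P: "prime_divisor \<XX> P" and fg: "f \<in> carrier KX" "g \<in> carrier KX" "ordge P n f" "ordge P n g"
  shows "ordge P n (f \<oplus>\<^bsub>KX\<^esub> g)"
proof (cases "f = \<zero>\<^bsub>KX\<^esub> \<or> g = \<zero>\<^bsub>KX\<^esub>")
  case True then show ?thesis using fg by auto
next
  case False
  then have "f \<oplus>\<^bsub>KX\<^esub> g = \<zero>\<^bsub>KX\<^esub> \<or> min (val P f) (val P g) \<le> val P (f \<oplus>\<^bsub>KX\<^esub> g)"
    using val_facts(3)[OF P fg(1) _ fg(2)] by blast
  then show ?thesis using False fg(3,4) unfolding ordge_def by auto
qed

lemma ordge_mult:
  assumes P: "prime_divisor \<XX> P" and fg: "f \<in> carrier KX" "g \<in> carrier KX" "ordge P m f" "ordge P n g"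
  shows "ordge P (m + n) (f \<otimes>\<^bsub>KX\<^esub> g)"
proof (cases "f = \<zero>\<^bsub>KX\<^esub> \<or> g = \<zero>\<^bsub>KX\<^esub>")
  case True then show ?thesis using fg by auto
next
  case False
  then have "val P (f \<otimes>\<^bsub>KX\<^esub> g) = val P f + val P g" using val_facts(2)[OF P fg(1) _ fg(2)] by simp
  then show ?thesis using False fg(3,4) unfolding ordge_def by auto
qed

lemma ordge_Ox:
  assumes P: "prime_divisor \<XX> P" and f: "f \<in> carrier KX"
  shows "ordge P 0 f \<longleftrightarrow> f \<in> Ox (gp P)"
proof (cases "f = \<zero>\<^bsub>KX\<^esub>")
  case True
  then show ?thesis using subringE(2)[OF Ox_subring[OF gp_TX[OF P]]] by simp
next
  case False
  then show ?thesis using val_facts(4)[OF P f False] unfolding ordge_def by simp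
qed

lemma ordge_nonunit:
  assumes P: "prime_divisor \<XX> P" and f: "f \<in> carrier KX"
  shows "ordge P 1 f \<longleftrightarrow> f \<in> Ox (gp P) - Ux (gp P)"
proof (cases "f = \<zero>\<^bsub>KX\<^esub>")
  case True
  then show ?thesis using submodule_overD(2)[OF Ox_local[OF gp_TX[OF P]]] by simp
next
  case False
  then show ?thesis using val_facts(5)[OF P f False] unfolding ordge_def by simp
qed

lemma ordge_uminus:
  assumes P: "prime_divisor \<XX> P" and f: "f \<in> carrier KX" "ordge P n f"
  shows "ordge P n (\<ominus>\<^bsub>KX\<^esub> f)"
proof -
  have m: "\<ominus>\<^bsub>KX\<^esub> \<one>\<^bsub>KX\<^esub> \<in> Ox (gp P)" using subringE(3,5)[OF Ox_subring[OF gp_TX[OF P]]] by blast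
  have "ordge P (0 + n) ((\<ominus>\<^bsub>KX\<^esub> \<one>\<^bsub>KX\<^esub>) \<otimes>\<^bsub>KX\<^esub> f)"
    by (rule ordge_mult[OF P _ f(1) _ f(2)]) (use ordge_Ox[OF P] m in auto)
  then show ?thesis using f(1) by (simp add: K.l_minus)
qed

lemma ordge_smult_iff:
  assumes P: "prime_divisor \<XX> P" and c: "c \<in> carrier KX" "c \<noteq> \<zero>\<^bsub>KX\<^esub>" and f: "f \<in> carrier KX"
  shows "ordge P (n + val P c) (c \<otimes>\<^bsub>KX\<^esub> f) \<longleftrightarrow> ordge P n f"
proof (cases "f = \<zero>\<^bsub>KX\<^esub>")
  case True then show ?thesis using c by simp
next
  case False
  then have "c \<otimes>\<^bsub>KX\<^esub> f \<noteq> \<zero>\<^bsub>KX\<^esub>" using K.integral_iff c f by simp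
  then show ?thesis using val_facts(2)[OF P c f False] False unfolding ordge_def by auto
qed

text \<open>One of f and g is nonzero, so the minimum of the two orders is finite and the default
  value of \<open>fin_part\<close> does not interfere.\<close>

lemma min_ord_ge:
  assumes P: "prime_divisor \<XX> P" and fg: "f \<in> carrier KX" "g \<in> carrier KX" "f \<noteq> \<zero>\<^bsub>KX\<^esub> \<or> g \<noteq> \<zero>\<^bsub>KX\<^esub>"
  shows "n \<le> fin_part (min (ord \<XX> P f) (ord \<XX> P g)) \<longleftrightarrow> ordge P n f \<and> ordge P n g"
  using val_facts(1)[OF P fg(1)] val_facts(1)[OF P fg(2)] ord_zero[of P] fg(3)
  by (cases "f = \<zero>\<^bsub>KX\<^esub>"; cases "g = \<zero>\<^bsub>KX\<^esub>") (simp_all add: ordge_def fin_part_def)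

end

section \<open>The decoration\<close>

locale snc_setup = normal_noetherian \<XX> for \<XX> :: "('x, 'a) rspace" +
  fixes D :: "'x set \<Rightarrow> int" and h :: "'x set \<Rightarrow> ('x set \<times> 'a) set set"
  assumes supp_finite: "finite (supp D)"
    and supp_prime: "P \<in> supp D \<Longrightarrow> prime_divisor \<XX> P"
    and h_carrier: "P \<in> supp D \<Longrightarrow> h P \<in> carrier (residue_field_at \<XX> P)"
begin

text \<open>A lift of the residue class \<open>h P\<close>, chosen by the property the decoration
  uses: f takes the value \<open>h P\<close> along P iff f is regular at the generic point and f - H
  is no unit there.\<close>

definition H :: "'x set \<Rightarrow> ('x set \<times> 'a) set" where
  "H P = (SOME H. H \<in> Ox (gp P) \<and> (\<forall>f. value_at \<XX> P f = Some (h P) \<longleftrightarrow>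
     f \<in> Ox (gp P) \<and> f \<ominus>\<^bsub>KX\<^esub> H \<in> Ox (gp P) - Ux (gp P)))"

text \<open>Elements of the residue field are cosets of the maximal ideal, and two cosets agree iff
  the difference of representatives lies in the ideal, that is, is no unit. The conjunct
  \<open>f \<in> Ox (gp P)\<close> excludes the value infinity.\<close>

lemma H_facts:
  assumes P: "P \<in> supp D"
  shows "H P \<in> Ox (gp P)" "value_at \<XX> P f = Some (h P) \<longleftrightarrow>
     f \<in> Ox (gp P) \<and> f \<ominus>\<^bsub>KX\<^esub> H P \<in> Ox (gp P) - Ux (gp P)"
proof -
  let ?y = "gp P" and ?R = "stalk \<XX> (gp P)"
  have y: "?y \<in> TX" by (rule gp_TX[OF supp_prime[OF P]])
  interpret S: cring ?R by (rule stalk_cring[OF y])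
  note hom = stalk_to_K_hom[OF y] and im = stalk_to_K_image[OF y] and inj = stalk_to_K_inj[OF y]
  interpret Hm: ring_hom_cring ?R KX "stalk_to_K \<XX>"
    using hom by (simp add: ring_hom_cring_def ring_hom_cring_axioms_def S.cring_axioms K.cring_axioms)
  let ?M = "max_ideal ?R"
  note M = stalk_max_ideal[OF y]
  have "h P \<in> a_rcosets\<^bsub>?R\<^esub> ?M"
    using h_carrier[OF P] unfolding residue_field_at_def residue_ring_of_def local_ring_at_def FactRing_def by simp
  then obtain A where A: "A \<in> carrier ?R" "h P = ?M +>\<^bsub>?R\<^esub> A" unfolding A_RCOSETS_def' by blast
  have "stalk_to_K \<XX> A \<in> Ox ?y \<and> (\<forall>f. value_at \<XX> P f = Some (h P) \<longleftrightarrow>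
     f \<in> Ox ?y \<and> f \<ominus>\<^bsub>KX\<^esub> stalk_to_K \<XX> A \<in> Ox ?y - Ux ?y)"
  proof (intro conjI allI)
    show AO: "stalk_to_K \<XX> A \<in> Ox ?y" using A(1) unfolding im[symmetric] by blast
    fix f
    show "value_at \<XX> P f = Some (h P) \<longleftrightarrow> f \<in> Ox ?y \<and> f \<ominus>\<^bsub>KX\<^esub> stalk_to_K \<XX> A \<in> Ox ?y - Ux ?y"
    proof (cases "f \<in> Ox ?y")
      case False
      then have "value_at \<XX> P f = None" unfolding value_at_def local_ring_at_def Let_def im by simp
      then show ?thesis using False by simp
    next
      case True
      then obtain B where B: "B \<in> carrier ?R" "f = stalk_to_K \<XX> B" unfolding im[symmetric] by blast
      have the: "(THE a. a \<in> carrier ?R \<and> stalk_to_K \<XX> a = f) = B"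
      proof (rule the_equality)
        show "B \<in> carrier ?R \<and> stalk_to_K \<XX> B = f" using B by simp
        show "a = B" if "a \<in> carrier ?R \<and> stalk_to_K \<XX> a = f" for a
          by (rule inj_onD[OF inj]) (use that B in simp_all)
      qed
      have "value_at \<XX> P f = Some (?M +>\<^bsub>?R\<^esub> B)" unfolding value_at_def local_ring_at_def Let_def im using True the by simp
      then have "value_at \<XX> P f = Some (h P) \<longleftrightarrow> ?M +>\<^bsub>?R\<^esub> B = ?M +>\<^bsub>?R\<^esub> A" unfolding A(2) by simp
      also have "\<dots> \<longleftrightarrow> B \<ominus>\<^bsub>?R\<^esub> A \<in> ?M" using S.quotient_eq_iff_same_a_r_cos[OF M(2) B(1) A(1)] by simp
      also have "\<dots> \<longleftrightarrow> stalk_to_K \<XX> (B \<ominus>\<^bsub>?R\<^esub> A) \<notin> Ux ?y" unfolding M(1) using A(1) B(1) by simp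
      also have "stalk_to_K \<XX> (B \<ominus>\<^bsub>?R\<^esub> A) = f \<ominus>\<^bsub>KX\<^esub> stalk_to_K \<XX> A" unfolding B(2) using A(1) B(1) by (simp add: a_minus_def)
      finally have "value_at \<XX> P f = Some (h P) \<longleftrightarrow> f \<ominus>\<^bsub>KX\<^esub> stalk_to_K \<XX> A \<notin> Ux ?y" .
      moreover have "f \<ominus>\<^bsub>KX\<^esub> stalk_to_K \<XX> A \<in> Ox ?y"
        unfolding a_minus_def using subringE(5,7)[OF Ox_subring[OF y]] True AO by blast
      ultimately show ?thesis using True by blast
    qed
  qed
  from someI[of "\<lambda>H. H \<in> Ox ?y \<and> (\<forall>f. value_at \<XX> P f = Some (h P) \<longleftrightarrow>
     f \<in> Ox ?y \<and> f \<ominus>\<^bsub>KX\<^esub> H \<in> Ox ?y - Ux ?y)", OF this]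
  have "H P \<in> Ox ?y \<and> (\<forall>f. value_at \<XX> P f = Some (h P) \<longleftrightarrow>
     f \<in> Ox ?y \<and> f \<ominus>\<^bsub>KX\<^esub> H P \<in> Ox ?y - Ux ?y)" unfolding H_def .
  then show "H P \<in> Ox ?y" "value_at \<XX> P f = Some (h P) \<longleftrightarrow> f \<in> Ox ?y \<and> f \<ominus>\<^bsub>KX\<^esub> H P \<in> Ox ?y - Ux ?y" by blast+
qed

lemma H_carrier:
  assumes "P \<in> supp D"
  shows "H P \<in> carrier KX"
  by (rule Ox_carrier[OF gp_TX[OF supp_prime[OF assms]] H_facts(1)[OF assms]])

text \<open>Along a component \<open>P\<close> of \<open>D\<close>, the coefficient of the decoration is
  \<open>min (ord g + 1) (ord (f - H g))\<close> for any lift \<open>H\<close> of the prescribed residue \<open>h P\<close>,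
  hence a minimum of valuations of linear forms; \<open>lat P n\<close> is the corresponding lattice.\<close>

definition lat :: "'x set \<Rightarrow> int \<Rightarrow> ('x set \<times> 'a) set \<times> ('x set \<times> 'a) set \<Rightarrow> bool" where
  "lat P n v \<longleftrightarrow> (if P \<in> supp D then ordge P (n - 1) (snd v) \<and> ordge P n (fst v \<ominus>\<^bsub>KX\<^esub> H P \<otimes>\<^bsub>KX\<^esub> snd v)
     else ordge P n (fst v) \<and> ordge P n (snd v))"

definition wt :: "'x set \<Rightarrow> ('x set \<times> 'a) set \<times> ('x set \<times> 'a) set \<Rightarrow> int" where
  "wt P v = (if P \<in> supp D \<and> quotient_value_at \<XX> P (fst v) (snd v) = Some (h P)
          then fin_part (min (ord \<XX> P (fst v)) (ord \<XX> P (snd v))) + 1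
          else fin_part (min (ord \<XX> P (fst v)) (ord \<XX> P (snd v))))"

abbreviation "VK \<equiv> plane KX"
abbreviation "WD \<equiv> snc_decoration \<XX> D h"

lemma VK_simps: "carrier VK = carrier KX \<times> carrier KX" "\<zero>\<^bsub>VK\<^esub> = (\<zero>\<^bsub>KX\<^esub>, \<zero>\<^bsub>KX\<^esub>)"
  "v \<oplus>\<^bsub>VK\<^esub> w = (fst v \<oplus>\<^bsub>KX\<^esub> fst w, snd v \<oplus>\<^bsub>KX\<^esub> snd w)" "c \<odot>\<^bsub>VK\<^esub> v = (c \<otimes>\<^bsub>KX\<^esub> fst v, c \<otimes>\<^bsub>KX\<^esub> snd v)"
  unfolding plane_def by (simp_all split: prod.split)

lemma WD_eq: "WD v = (if v = \<zero>\<^bsub>VK\<^esub> then Pinf else Fin (\<lambda>P. if prime_divisor \<XX> P then wt P v else 0))"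
proof (cases v)
  case (Pair f g)
  show ?thesis unfolding snc_decoration_def KX_def[symmetric] wt_def Pair prod.case fst_conv snd_conv ..
qed

text \<open>Along a component P of D there are two cases. If f/g has value \<open>h P\<close>, then
  f = g (H + e) with e of positive order, so f and f - H g have orders at least ord g and ord g + 1,
  and both sides say ord g >= n - 1. Otherwise f - H g cannot have larger order than g, and both
  sides say that f and g have order at least n.\<close>

lemma wt_ge:
  assumes P: "prime_divisor \<XX> P" and v: "v \<in> carrier VK" "v \<noteq> \<zero>\<^bsub>VK\<^esub>"
  shows "n \<le> wt P v \<longleftrightarrow> lat P n v"
proof -
  obtain f g where fg: "v = (f, g)" by (cases v)
  have c: "f \<in> carrier KX" "g \<in> carrier KX" using v(1) unfolding fg VK_simps by auto
  have nz: "f \<noteq> \<zero>\<^bsub>KX\<^esub> \<or> g \<noteq> \<zero>\<^bsub>KX\<^esub>" using v(2) unfolding fg VK_simps by auto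
  note m = min_ord_ge[OF P c nz]
  show ?thesis
  proof (cases "P \<in> supp D")
    case False
    then show ?thesis using m unfolding wt_def lat_def fg by simp
  next
    case True
    let ?y = "gp P"
    have y: "?y \<in> TX" by (rule gp_TX[OF P])
    note HO = H_facts(1)[OF True] and Hc = H_carrier[OF True]
    have H0: "ordge P 0 (H P)" using ordge_Ox[OF P Hc] HO by simp
    let ?d = "f \<ominus>\<^bsub>KX\<^esub> H P \<otimes>\<^bsub>KX\<^esub> g"
    have dc: "?d \<in> carrier KX" using c Hc by simp
    have Hg: "ordge P n (H P \<otimes>\<^bsub>KX\<^esub> g)" if "ordge P n g" for n
      using ordge_mult[OF P Hc c(2) H0 that] by simp
    \<comment> \<open>The value condition without division: f - H g is g times a function of
      positive order. The condition that g be nonzero reflects that f/0 has value infinity, encoded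
      by \<open>None\<close>.\<close>
    have quot: "quotient_value_at \<XX> P f g = Some (h P) \<longleftrightarrow> g \<noteq> \<zero>\<^bsub>KX\<^esub> \<and> (\<exists>e\<in>carrier KX. ordge P 1 e \<and> ?d = g \<otimes>\<^bsub>KX\<^esub> e)"
    proof (cases "g = \<zero>\<^bsub>KX\<^esub>")
      case True
      then show ?thesis unfolding quotient_value_at_def KX_def[symmetric] Let_def by simp
    next
      case False
      have gi: "g \<otimes>\<^bsub>KX\<^esub> inv\<^bsub>KX\<^esub> g = \<one>\<^bsub>KX\<^esub>" "inv\<^bsub>KX\<^esub> g \<in> carrier KX" using c(2) False K.field_Units by auto
      let ?q = "f \<otimes>\<^bsub>KX\<^esub> inv\<^bsub>KX\<^esub> g"
      have qc: "?q \<in> carrier KX" using c gi by simp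
      let ?e = "?q \<ominus>\<^bsub>KX\<^esub> H P"
      have ec: "?e \<in> carrier KX" using qc Hc by simp
      have "g \<otimes>\<^bsub>KX\<^esub> ?e = (g \<otimes>\<^bsub>KX\<^esub> inv\<^bsub>KX\<^esub> g) \<otimes>\<^bsub>KX\<^esub> f \<ominus>\<^bsub>KX\<^esub> H P \<otimes>\<^bsub>KX\<^esub> g" using c Hc gi(2) by algebra
      then have de: "?d = g \<otimes>\<^bsub>KX\<^esub> ?e" unfolding gi(1) using c(1) by simp
      have "quotient_value_at \<XX> P f g = value_at \<XX> P ?q" using False unfolding quotient_value_at_def KX_def[symmetric] Let_def by simp
      then have "quotient_value_at \<XX> P f g = Some (h P) \<longleftrightarrow> ?q \<in> Ox ?y \<and> ?e \<in> Ox ?y - Ux ?y"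
        using H_facts(2)[OF \<open>P \<in> supp D\<close>] by simp
      also have "\<dots> \<longleftrightarrow> ?e \<in> Ox ?y - Ux ?y"
      proof -
        have "?q \<in> Ox ?y" if "?e \<in> Ox ?y"
        proof -
          have "?e \<oplus>\<^bsub>KX\<^esub> H P \<in> Ox ?y" by (rule subringE(7)[OF Ox_subring[OF y] that HO])
          moreover have "?e \<oplus>\<^bsub>KX\<^esub> H P = ?q" using qc Hc by algebra
          ultimately show ?thesis by simp
        qed
        then show ?thesis by blast
      qed
      also have "\<dots> \<longleftrightarrow> ordge P 1 ?e" using ordge_nonunit[OF P ec] by simp
      also have "\<dots> \<longleftrightarrow> (\<exists>e\<in>carrier KX. ordge P 1 e \<and> ?d = g \<otimes>\<^bsub>KX\<^esub> e)"
      proof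
        assume "\<exists>e\<in>carrier KX. ordge P 1 e \<and> ?d = g \<otimes>\<^bsub>KX\<^esub> e"
        then obtain e where e: "e \<in> carrier KX" "ordge P 1 e" "?d = g \<otimes>\<^bsub>KX\<^esub> e" by blast
        then have "g \<otimes>\<^bsub>KX\<^esub> ?e = g \<otimes>\<^bsub>KX\<^esub> e" using de by simp
        then have "?e = e" using K.m_lcancel[OF False c(2) ec e(1)] by simp
        then show "ordge P 1 ?e" using e(2) by simp
      qed (use ec de in blast)
      finally show ?thesis using False by simp
    qed
    show ?thesis
    proof (cases "quotient_value_at \<XX> P f g = Some (h P)")
      case Q: True
      then obtain e where e: "g \<noteq> \<zero>\<^bsub>KX\<^esub>" "e \<in> carrier KX" "ordge P 1 e" "?d = g \<otimes>\<^bsub>KX\<^esub> e" using quot by blast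
      have fe: "f = g \<otimes>\<^bsub>KX\<^esub> (H P \<oplus>\<^bsub>KX\<^esub> e)"
      proof -
        have "f = ?d \<oplus>\<^bsub>KX\<^esub> H P \<otimes>\<^bsub>KX\<^esub> g" using c Hc by algebra
        also have "\<dots> = g \<otimes>\<^bsub>KX\<^esub> (H P \<oplus>\<^bsub>KX\<^esub> e)" unfolding e(4) using c(2) Hc e(2) by algebra
        finally show ?thesis .
      qed
      have He: "ordge P 0 (H P \<oplus>\<^bsub>KX\<^esub> e)" by (rule ordge_add[OF P Hc e(2) H0 ordge_mono[OF e(3)]]) simp
      have gf: "ordge P k f" if "ordge P k g" for k
        using ordge_mult[OF P c(2) _ that He] Hc e(2) unfolding fe by simp
      have gd: "ordge P (k + 1) ?d" if "ordge P k g" for k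
        using ordge_mult[OF P c(2) e(2) that e(3)] unfolding e(4) by simp
      have "wt P v = fin_part (min (ord \<XX> P f) (ord \<XX> P g)) + 1" unfolding wt_def fg using True Q by simp
      then have "n \<le> wt P v \<longleftrightarrow> ordge P (n - 1) f \<and> ordge P (n - 1) g" using m[of "n - 1"] by auto
      also have "\<dots> \<longleftrightarrow> ordge P (n - 1) g \<and> ordge P n ?d" using gf[of "n - 1"] gd[of "n - 1"] by auto
      finally show ?thesis unfolding lat_def fg using True by simp
    next
      case Q: False
      have "wt P v = fin_part (min (ord \<XX> P f) (ord \<XX> P g))" unfolding wt_def fg using Q by simp
      then have "n \<le> wt P v \<longleftrightarrow> ordge P n f \<and> ordge P n g" using m by simp
      also have "\<dots> \<longleftrightarrow> ordge P (n - 1) g \<and> ordge P n ?d"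
      proof
        assume a: "ordge P n f \<and> ordge P n g"
        have "ordge P n ?d" unfolding a_minus_def
          by (rule ordge_add[OF P c(1) _ conjunct1[OF a] ordge_uminus[OF P _ Hg[OF conjunct2[OF a]]]]) (use c Hc in auto)
        then show "ordge P (n - 1) g \<and> ordge P n ?d" using ordge_mono[OF conjunct2[OF a]] by simp
      next
        assume a: "ordge P (n - 1) g \<and> ordge P n ?d"
        \<comment> \<open>Only ord g = n - 1 has to be excluded. In that case (f - H g) / g would
          have positive order, and f/g would have the value \<open>h P\<close> after all.\<close>
        have gn: "ordge P n g"
        proof (rule ccontr)
          assume "\<not> ordge P n g"
          then have g0: "g \<noteq> \<zero>\<^bsub>KX\<^esub>" "val P g = n - 1" using a unfolding ordge_def by auto
          let ?e = "?d \<otimes>\<^bsub>KX\<^esub> inv\<^bsub>KX\<^esub> g"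
          have gi: "g \<otimes>\<^bsub>KX\<^esub> inv\<^bsub>KX\<^esub> g = \<one>\<^bsub>KX\<^esub>" "inv\<^bsub>KX\<^esub> g \<in> carrier KX" using c(2) g0(1) K.field_Units by auto
          have ec: "?e \<in> carrier KX" using dc gi by simp
          have "g \<otimes>\<^bsub>KX\<^esub> ?e = (g \<otimes>\<^bsub>KX\<^esub> inv\<^bsub>KX\<^esub> g) \<otimes>\<^bsub>KX\<^esub> ?d" using c(2) dc gi(2) by algebra
          then have de: "?d = g \<otimes>\<^bsub>KX\<^esub> ?e" unfolding gi(1) using dc by simp
          have "ordge P (1 + val P g) (g \<otimes>\<^bsub>KX\<^esub> ?e)" unfolding de[symmetric] g0(2) using a by simp
          then have "ordge P 1 ?e" using ordge_smult_iff[OF P c(2) g0(1) ec] by simp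
          then show False using Q quot g0(1) de ec by blast
        qed
        have "f = ?d \<oplus>\<^bsub>KX\<^esub> H P \<otimes>\<^bsub>KX\<^esub> g" using c Hc by algebra
        moreover have "ordge P n (?d \<oplus>\<^bsub>KX\<^esub> H P \<otimes>\<^bsub>KX\<^esub> g)" by (rule ordge_add[OF P dc _ conjunct2[OF a] Hg[OF gn]]) (use c Hc in simp)
        ultimately show "ordge P n f \<and> ordge P n g" using gn by simp
      qed
      finally show ?thesis unfolding lat_def fg using True by simp
    qed
  qed
qed

lemma lat_zero [simp]: "prime_divisor \<XX> P \<Longrightarrow> lat P n (\<zero>\<^bsub>KX\<^esub>, \<zero>\<^bsub>KX\<^esub>)"
  unfolding lat_def using H_carrier by (simp add: a_minus_def)

lemma lat_mono:
  assumes "lat P n v" "m \<le> n"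
  shows "lat P m v"
proof -
  have "m - 1 \<le> n - 1" using assms(2) by simp
  then show ?thesis using assms(1) ordge_mono[OF _ assms(2)] ordge_mono[of P "n - 1" _ "m - 1"]
    unfolding lat_def by (cases "P \<in> supp D") simp_all
qed

lemma lat_add:
  assumes P: "prime_divisor \<XX> P" and v: "v \<in> carrier VK" "w \<in> carrier VK" "lat P n v" "lat P n w"
  shows "lat P n (v \<oplus>\<^bsub>VK\<^esub> w)"
proof -
  have c: "fst v \<in> carrier KX" "snd v \<in> carrier KX" "fst w \<in> carrier KX" "snd w \<in> carrier KX" using v(1,2) unfolding VK_simps by auto
  show ?thesis
  proof (cases "P \<in> supp D")
    case False
    then show ?thesis using v(3,4) ordge_add[OF P] c unfolding lat_def VK_simps by simp
  next
    case True
    note Hc = H_carrier[OF True]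
    let ?v = "fst v \<ominus>\<^bsub>KX\<^esub> H P \<otimes>\<^bsub>KX\<^esub> snd v" and ?w = "fst w \<ominus>\<^bsub>KX\<^esub> H P \<otimes>\<^bsub>KX\<^esub> snd w"
    have l: "ordge P (n - 1) (snd v)" "ordge P n ?v" "ordge P (n - 1) (snd w)" "ordge P n ?w" using v(3,4) True unfolding lat_def by auto
    have "(fst v \<oplus>\<^bsub>KX\<^esub> fst w) \<ominus>\<^bsub>KX\<^esub> H P \<otimes>\<^bsub>KX\<^esub> (snd v \<oplus>\<^bsub>KX\<^esub> snd w) = ?v \<oplus>\<^bsub>KX\<^esub> ?w" using c Hc by algebra
    moreover have "ordge P n (?v \<oplus>\<^bsub>KX\<^esub> ?w)" by (rule ordge_add[OF P _ _ l(2,4)]) (use c Hc in auto)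
    moreover have "ordge P (n - 1) (snd v \<oplus>\<^bsub>KX\<^esub> snd w)" by (rule ordge_add[OF P c(2,4) l(1,3)])
    ultimately show ?thesis unfolding lat_def VK_simps using True by simp
  qed
qed

lemma lat_smult_iff:
  assumes P: "prime_divisor \<XX> P" and v: "v \<in> carrier VK" and a: "a \<in> carrier KX" "a \<noteq> \<zero>\<^bsub>KX\<^esub>"
  shows "lat P (n + val P a) (a \<odot>\<^bsub>VK\<^esub> v) \<longleftrightarrow> lat P n v"
proof -
  have c: "fst v \<in> carrier KX" "snd v \<in> carrier KX" using v unfolding VK_simps by auto
  show ?thesis
  proof (cases "P \<in> supp D")
    case False
    then show ?thesis using ordge_smult_iff[OF P a] c unfolding lat_def VK_simps by simp
  next
    case True
    note Hc = H_carrier[OF True]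
    let ?v = "fst v \<ominus>\<^bsub>KX\<^esub> H P \<otimes>\<^bsub>KX\<^esub> snd v"
    have e: "a \<otimes>\<^bsub>KX\<^esub> fst v \<ominus>\<^bsub>KX\<^esub> H P \<otimes>\<^bsub>KX\<^esub> (a \<otimes>\<^bsub>KX\<^esub> snd v) = a \<otimes>\<^bsub>KX\<^esub> ?v" using c Hc a(1) by algebra
    have "?v \<in> carrier KX" using c Hc by simp
    then have "ordge P (n + val P a) (a \<otimes>\<^bsub>KX\<^esub> ?v) \<longleftrightarrow> ordge P n ?v" by (rule ordge_smult_iff[OF P a])
    moreover have "ordge P (n + val P a - 1) (a \<otimes>\<^bsub>KX\<^esub> snd v) \<longleftrightarrow> ordge P (n - 1) (snd v)"
      using ordge_smult_iff[OF P a c(2), of "n - 1"] by (simp add: algebra_simps)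
    ultimately show ?thesis unfolding lat_def VK_simps using True e by simp
  qed
qed

lemma lat_smult:
  assumes P: "prime_divisor \<XX> P" and v: "v \<in> carrier VK" "lat P n v" and a: "a \<in> carrier KX" "ordge P k a"
  shows "lat P (n + k) (a \<odot>\<^bsub>VK\<^esub> v)"
proof (cases "a = \<zero>\<^bsub>KX\<^esub>")
  case True
  have "a \<odot>\<^bsub>VK\<^esub> v = (\<zero>\<^bsub>KX\<^esub>, \<zero>\<^bsub>KX\<^esub>)" using v(1) True unfolding VK_simps by auto
  then show ?thesis using P by simp
next
  case False
  then have "k \<le> val P a" using a(2) unfolding ordge_def by simp
  moreover have "lat P (n + val P a) (a \<odot>\<^bsub>VK\<^esub> v)" using lat_smult_iff[OF P v(1) a(1) False] v(2) by simp
  ultimately show ?thesis using lat_mono by simp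
qed

text \<open>Coefficients are accessible only through their lower bounds, by \<open>wt_ge\<close>;
  this converts such knowledge into equalities.\<close>

lemma wt_eqI:
  assumes "\<And>n::int. n \<le> a \<longleftrightarrow> n \<le> b"
  shows "a = b"
  using assms[of a] assms[of b] by simp

text \<open>Away from the components of D and from the finitely many divisors where a nonzero entry
  is not a unit, each entry has order 0 or is zero. At least one entry is nonzero, so the minimum of
  the orders is 0.\<close>

lemma wt_finite:
  assumes v: "v \<in> carrier VK" "v \<noteq> \<zero>\<^bsub>VK\<^esub>"
  shows "finite {P. prime_divisor \<XX> P \<and> wt P v \<noteq> 0}"
proof -
  obtain f g where fg: "v = (f, g)" by (cases v)
  have c: "f \<in> carrier KX" "g \<in> carrier KX" using v(1) unfolding fg VK_simps by auto
  have nz: "f \<noteq> \<zero>\<^bsub>KX\<^esub> \<or> g \<noteq> \<zero>\<^bsub>KX\<^esub>" using v(2) unfolding fg VK_simps by auto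
  define B where "B f = (if f = \<zero>\<^bsub>KX\<^esub> then {} else {P. prime_divisor \<XX> P \<and> f \<notin> Ux (gp P)})" for f
  have Bfin: "finite (B f)" if "f \<in> carrier KX" for f using finite_prime_divisors[OF that] unfolding B_def by simp
  have vB: "ord \<XX> P f = Pinf \<and> f = \<zero>\<^bsub>KX\<^esub> \<or> ord \<XX> P f = Fin 0" if P: "prime_divisor \<XX> P" "P \<notin> B f" "f \<in> carrier KX" for P f
  proof (cases "f = \<zero>\<^bsub>KX\<^esub>")
    case True then show ?thesis using ord_zero by simp
  next
    case False
    then have "f \<in> Ux (gp P)" using P unfolding B_def by simp
    then have "0 \<le> val P f \<and> \<not> 1 \<le> val P f" using val_facts(4,5)[OF P(1,3) False] Ux_facts(1)[OF gp_TX[OF P(1)]] by blast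
    then have "val P f = 0" by simp
    then show ?thesis using val_facts(1)[OF P(1,3) False] by simp
  qed
  have "{P. prime_divisor \<XX> P \<and> wt P v \<noteq> 0} \<subseteq> supp D \<union> B f \<union> B g"
  proof
    fix P assume P: "P \<in> {P. prime_divisor \<XX> P \<and> wt P v \<noteq> 0}"
    show "P \<in> supp D \<union> B f \<union> B g"
    proof (rule ccontr)
      assume n: "P \<notin> supp D \<union> B f \<union> B g"
      have "wt P v = fin_part (min (ord \<XX> P f) (ord \<XX> P g))" using n unfolding wt_def fg by simp
      moreover have "min (ord \<XX> P f) (ord \<XX> P g) = Fin 0" using vB[of P f] vB[of P g] P n c nz by auto
      ultimately show False using P by (simp add: fin_part_def)
    qed
  qed
  then show ?thesis using supp_finite Bfin c by (meson finite_Un finite_subset)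
qed

lemma VK_module: "Module.module KX VK"
proof (rule moduleI[OF K.cring_axioms])
  show "abelian_group VK"
  proof (rule abelian_groupI)
    show "\<exists>y\<in>carrier VK. y \<oplus>\<^bsub>VK\<^esub> x = \<zero>\<^bsub>VK\<^esub>" if "x \<in> carrier VK" for x
      using that by (intro bexI[of _ "(\<ominus>\<^bsub>KX\<^esub> fst x, \<ominus>\<^bsub>KX\<^esub> snd x)"]) (auto simp: VK_simps K.l_neg)
  qed (simp_all add: VK_simps mem_Times_iff K.a_ac)
qed (simp_all add: VK_simps mem_Times_iff K.l_distr K.r_distr K.m_assoc)

lemma VK_finite_dim: "finite_dim_vector_space KX VK"
  unfolding finite_dim_vector_space_def
proof (intro conjI exI ballI)
  interpret M: Module.module KX VK by (rule VK_module)
  show "field KX" by (rule KX_field)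
  show "Module.module KX VK" by (rule VK_module)
  let ?b = "\<lambda>i::nat. if i = 0 then (\<one>\<^bsub>KX\<^esub>, \<zero>\<^bsub>KX\<^esub>) else (\<zero>\<^bsub>KX\<^esub>, \<one>\<^bsub>KX\<^esub>)"
  show b: "?b \<in> {..<2} \<rightarrow> carrier VK" by (auto simp: VK_simps)
  fix v assume v: "v \<in> carrier VK"
  let ?c = "\<lambda>i::nat. if i = 0 then fst v else snd v"
  have two: "{..<2} = insert 0 (insert (1::nat) {})" by auto
  have "(\<Oplus>\<^bsub>VK\<^esub>i\<in>{..<2}. ?c i \<odot>\<^bsub>VK\<^esub> ?b i) = ?c 0 \<odot>\<^bsub>VK\<^esub> ?b 0 \<oplus>\<^bsub>VK\<^esub> (?c 1 \<odot>\<^bsub>VK\<^esub> ?b 1 \<oplus>\<^bsub>VK\<^esub> \<zero>\<^bsub>VK\<^esub>)"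
    unfolding two using v by (subst M.finsum_insert, (auto simp: VK_simps)[4])+ (auto simp: VK_simps)
  also have "\<dots> = v" using v by (auto simp: VK_simps)
  finally show "\<exists>c\<in>{..<2} \<rightarrow> carrier KX. v = (\<Oplus>\<^bsub>VK\<^esub>i\<in>{..<2}. c i \<odot>\<^bsub>VK\<^esub> ?b i)"
    using v by (intro bexI[of _ ?c]) (auto simp: VK_simps)
qed

lemma VK_smult_zero:
  assumes v: "v \<in> carrier VK" and a: "a \<in> carrier KX"
  shows "a \<odot>\<^bsub>VK\<^esub> v = \<zero>\<^bsub>VK\<^esub> \<longleftrightarrow> a = \<zero>\<^bsub>KX\<^esub> \<or> v = \<zero>\<^bsub>VK\<^esub>"
proof -
  have "fst v \<in> carrier KX" "snd v \<in> carrier KX" using v unfolding VK_simps by auto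
  then show ?thesis using K.integral_iff[OF a] unfolding VK_simps by (auto simp: prod_eq_iff)
qed

text \<open>Each axiom is checked on the lattices \<open>lat P n\<close>: multiplication by a
  nonzero a shifts n by \<open>val P a\<close>, and a sum is tested at the minimum of the two
  coefficients. The zero vector is handled separately, since the decoration is infinite
  there.\<close>

lemma WD_pre_weil: "pre_weil_decoration \<XX> VK WD"
  unfolding pre_weil_decoration_def KX_def[symmetric]
proof (intro conjI ballI)
  show "finite_dim_vector_space KX VK" by (rule VK_finite_dim)
  show "WD \<in> carrier VK \<rightarrow> extended_divisors \<XX>"
  proof
    fix v assume v: "v \<in> carrier VK"
    show "WD v \<in> extended_divisors \<XX>"
    proof (cases "v = \<zero>\<^bsub>VK\<^esub>")
      case False
      have "{P. (if prime_divisor \<XX> P then wt P v else 0) \<noteq> 0} = {P. prime_divisor \<XX> P \<and> wt P v \<noteq> 0}" by auto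
      then have "(\<lambda>P. if prime_divisor \<XX> P then wt P v else 0) \<in> weil_divisors \<XX>"
        unfolding weil_divisors_def using wt_finite[OF v False] by auto
      then show ?thesis unfolding extended_divisors_def WD_eq using False by simp
    qed (simp add: extended_divisors_def WD_eq)
  qed
  show "WD v = Pinf \<longleftrightarrow> v = \<zero>\<^bsub>VK\<^esub>" for v unfolding WD_eq by simp
next
  fix a v assume a: "a \<in> carrier KX" and v: "v \<in> carrier VK"
  show "WD (a \<odot>\<^bsub>VK\<^esub> v) = principal_divisor \<XX> a + WD v"
  proof (cases "a = \<zero>\<^bsub>KX\<^esub> \<or> v = \<zero>\<^bsub>VK\<^esub>")
    case True
    then have "a \<odot>\<^bsub>VK\<^esub> v = \<zero>\<^bsub>VK\<^esub>" using VK_smult_zero[OF v a] by blast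
    then show ?thesis using True unfolding WD_eq principal_divisor_def KX_def[symmetric] by auto
  next
    case False
    then have nz: "a \<odot>\<^bsub>VK\<^esub> v \<noteq> \<zero>\<^bsub>VK\<^esub>" using VK_smult_zero[OF v a] by blast
    have av: "a \<odot>\<^bsub>VK\<^esub> v \<in> carrier VK" using a v unfolding VK_simps by auto
    have "wt P (a \<odot>\<^bsub>VK\<^esub> v) = val P a + wt P v" if P: "prime_divisor \<XX> P" for P
    proof (rule wt_eqI)
      fix n
      have "n \<le> wt P (a \<odot>\<^bsub>VK\<^esub> v) \<longleftrightarrow> lat P ((n - val P a) + val P a) (a \<odot>\<^bsub>VK\<^esub> v)" using wt_ge[OF P av nz] by simp
      also have "\<dots> \<longleftrightarrow> lat P (n - val P a) v" by (rule lat_smult_iff[OF P v a]) (use False in blast)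
      also have "\<dots> \<longleftrightarrow> n - val P a \<le> wt P v" using wt_ge[OF P v] False by simp
      finally show "n \<le> wt P (a \<odot>\<^bsub>VK\<^esub> v) \<longleftrightarrow> n \<le> val P a + wt P v" by auto
    qed
    then show ?thesis using False nz unfolding WD_eq principal_divisor_def KX_def[symmetric] val_def[symmetric]
      by (auto simp: fun_eq_iff)
  qed
next
  fix v w assume v: "v \<in> carrier VK" and w: "w \<in> carrier VK"
  show "inf (WD v) (WD w) \<le> WD (v \<oplus>\<^bsub>VK\<^esub> w)"
  proof (cases "v = \<zero>\<^bsub>VK\<^esub> \<or> w = \<zero>\<^bsub>VK\<^esub> \<or> v \<oplus>\<^bsub>VK\<^esub> w = \<zero>\<^bsub>VK\<^esub>")
    case True
    interpret M: Module.module KX VK by (rule VK_module)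
    show ?thesis using True
    proof (elim disjE)
      assume "v = \<zero>\<^bsub>VK\<^esub>"
      then have "v \<oplus>\<^bsub>VK\<^esub> w = w" using w M.M.l_zero by simp
      then show ?thesis by simp
    next
      assume "w = \<zero>\<^bsub>VK\<^esub>"
      then have "v \<oplus>\<^bsub>VK\<^esub> w = v" using v M.M.r_zero by simp
      then show ?thesis by simp
    next
      assume "v \<oplus>\<^bsub>VK\<^esub> w = \<zero>\<^bsub>VK\<^esub>"
      then show ?thesis unfolding WD_eq by simp
    qed
  next
    case False
    have vw: "v \<oplus>\<^bsub>VK\<^esub> w \<in> carrier VK" using v w unfolding VK_simps by auto
    have "min (wt P v) (wt P w) \<le> wt P (v \<oplus>\<^bsub>VK\<^esub> w)" if P: "prime_divisor \<XX> P" for P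
    proof -
      let ?n = "min (wt P v) (wt P w)"
      have "lat P ?n v" "lat P ?n w" using wt_ge[OF P v, of ?n] wt_ge[OF P w, of ?n] False by auto
      then have "lat P ?n (v \<oplus>\<^bsub>VK\<^esub> w)" by (rule lat_add[OF P v w])
      then show ?thesis using wt_ge[OF P vw] False by simp
    qed
    then show ?thesis using False unfolding WD_eq by (auto simp: le_fun_def inf_int_def)
  qed
qed

lemma WD_nonneg:
  assumes "v \<in> carrier VK"
  shows "nonneg_on \<XX> U (WD v) \<longleftrightarrow> (\<forall>P. prime_divisor \<XX> P \<and> P \<inter> U \<noteq> {} \<longrightarrow> lat P 0 v)"
proof (cases "v = \<zero>\<^bsub>VK\<^esub>")
  case True
  then show ?thesis unfolding WD_eq nonneg_on_def by (simp add: VK_simps)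
next
  case False
  then show ?thesis unfolding WD_eq nonneg_on_def using wt_ge[OF _ assms False, of _ 0] by auto
qed

end

section \<open>Coherence\<close>

context normal_noetherian
begin

lemma Ox_nbhd:
  assumes y: "y \<in> V" "open_set V" and J: "finite J" "\<And>j. j \<in> J \<Longrightarrow> c j \<in> Ox y"
  shows "\<exists>W. open_set W \<and> y \<in> W \<and> W \<subseteq> V \<and> (\<forall>j\<in>J. c j \<in> Oo W)"
  using J
proof (induction J)
  case empty
  then show ?case using y by blast
next
  case (insert j J)
  then obtain W where W: "open_set W" "y \<in> W" "W \<subseteq> V" "\<forall>j\<in>J. c j \<in> Oo W" by auto
  have cj: "c j \<in> Ox y" using insert by blast
  obtain W' where W': "open_set W'" "y \<in> W'" "W' \<subseteq> W" "c j \<in> Oo W'" by (rule Ox_common[OF cj cj W(1,2)])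
  have "Oo W \<subseteq> Oo W'" by (rule Oo_mono[OF W(1) W'(1,3)]) (use W' in blast)
  then show ?case using W W' by (intro exI[of _ W']) auto
qed

lemma common_denominator:
  assumes U: "good U" and y: "y \<in> U" and J: "finite J" "\<And>j. j \<in> J \<Longrightarrow> c j \<in> Ox y"
  shows "\<exists>b\<in>Oo U. b \<in> Ux y \<and> (\<forall>j\<in>J. b \<otimes>\<^bsub>KX\<^esub> c j \<in> Oo U)"
  using J
proof (induction J)
  note g = good_facts[OF U]
  have yT: "y \<in> TX" using y g(3) by blast
  case empty
  show ?case using subringE(3)[OF g(5)] K.units_in_facts(3)[OF Ox_subring[OF yT]] by blast
next
  case (insert j J)
  note g = good_facts[OF U]
  have yT: "y \<in> TX" using y g(3) by blast
  note Oc = subsetD[OF subringE(1)[OF g(5)]]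
  obtain b where b: "b \<in> Oo U" "b \<in> Ux y" "\<forall>j\<in>J. b \<otimes>\<^bsub>KX\<^esub> c j \<in> Oo U" using insert by auto
  have cj: "c j \<in> Ox y" using insert by blast
  obtain a d where d: "a \<in> Oo U" "d \<in> Oo U" "d \<in> Ux y" "d \<otimes>\<^bsub>KX\<^esub> c j = a" using good_chart_facts(4)[OF U y cj] by blast
  have bd: "b \<otimes>\<^bsub>KX\<^esub> d \<in> Oo U" "b \<otimes>\<^bsub>KX\<^esub> d \<in> Ux y" using subringE(6)[OF g(5) b(1) d(2)] Ux_facts(2)[OF yT b(2) d(3)] by auto
  have "(b \<otimes>\<^bsub>KX\<^esub> d) \<otimes>\<^bsub>KX\<^esub> c k \<in> Oo U" if k: "k \<in> insert j J" for k
  proof (cases "k = j")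
    case True
    have "(b \<otimes>\<^bsub>KX\<^esub> d) \<otimes>\<^bsub>KX\<^esub> c j = b \<otimes>\<^bsub>KX\<^esub> a" unfolding d(4)[symmetric] using Oc[OF b(1)] Oc[OF d(2)] Ox_carrier[OF yT cj] by algebra
    then show ?thesis using subringE(6)[OF g(5) b(1) d(1)] True by simp
  next
    case False
    then have kJ: "k \<in> J" using k by blast
    have ck: "c k \<in> carrier KX" using Ox_carrier[OF yT] insert.prems k by blast
    have "(b \<otimes>\<^bsub>KX\<^esub> d) \<otimes>\<^bsub>KX\<^esub> c k = d \<otimes>\<^bsub>KX\<^esub> (b \<otimes>\<^bsub>KX\<^esub> c k)" using Oc[OF b(1)] Oc[OF d(2)] ck by algebra
    moreover have "b \<otimes>\<^bsub>KX\<^esub> c k \<in> Oo U" using b(3) kJ by blast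
    ultimately show ?thesis using subringE(6)[OF g(5) d(2)] by simp
  qed
  then show ?case using bd by blast
qed

lemma Oo_ordge:
  assumes U: "open_set U" and P: "prime_divisor \<XX> P" "P \<inter> U \<noteq> {}" and a: "a \<in> Oo U"
  shows "a \<in> carrier KX" "ordge P 0 a"
proof -
  have gU: "gp P \<in> U" using prime_divisor_generic(3)[OF P(1,2) U] .
  then have aO: "a \<in> Ox (gp P)" using OxI[OF U _ a] by blast
  show ac: "a \<in> carrier KX" using Ox_carrier[OF gp_TX[OF P(1)] aO] .
  show "ordge P 0 a" using ordge_Ox[OF P(1) ac] aO by blast
qed

text \<open>For each P some function on U is a unit at y and a unit only at points outside P, hence
  has positive order along P; a product of powers of these functions has the orders demanded. With y
  = \<eta> the result clears poles, and with a given y it extends local sections to the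
  chart.\<close>

lemma vanishing_function:
  assumes U: "good U" and y: "y \<in> U" and S: "finite S" "\<And>P. P \<in> S \<Longrightarrow> prime_divisor \<XX> P \<and> P \<inter> U \<noteq> {} \<and> y \<notin> P"
  shows "\<exists>b\<in>Oo U. b \<in> Ux y \<and> (\<forall>P\<in>S. ordge P (int (n P)) b)"
  using S
proof (induction S)
  have yT: "y \<in> TX" using y good_facts(3)[OF U] by blast
  case empty
  show ?case using subringE(3)[OF good_facts(5)[OF U]] K.units_in_facts(3)[OF Ox_subring[OF yT]] by blast
next
  case (insert P S)
  note g = good_facts[OF U]
  have yT: "y \<in> TX" using y g(3) by blast
  note Oc = subsetD[OF subringE(1)[OF g(5)]]
  have "\<exists>b\<in>Oo U. b \<in> Ux y \<and> (\<forall>P\<in>S. ordge P (int (n P)) b)" by (rule insert.IH) (use insert.prems in blast)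
  then obtain b where b: "b \<in> Oo U" "b \<in> Ux y" "\<And>P. P \<in> S \<Longrightarrow> ordge P (int (n P)) b" by blast
  have P: "prime_divisor \<XX> P" "P \<inter> U \<noteq> {}" "y \<notin> P" using insert.prems by auto
  have clP: "closedin (topol \<XX>) P" using prime_divisor_generic(2)[OF P(1)] unfolding irreducible_closed_def by blast
  let ?V = "U \<inter> (TX - P)"
  have V: "open_set ?V" "?V \<subseteq> U" "y \<in> ?V" using g(1) clP y P(3) yT by (auto simp: closedin_def)
  obtain e where e: "e \<in> Oo U" "e \<in> Ux y" "\<And>z. z \<in> U \<Longrightarrow> e \<in> Ux z \<Longrightarrow> z \<in> ?V" using good_chart_facts(3)[OF U y V] by blast
  have gU: "gp P \<in> U" "gp P \<in> P" using prime_divisor_generic(3)[OF P(1,2) g(1)] prime_divisor_generic(5)[OF P(1)] by auto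
  have "e \<notin> Ux (gp P)" using e(3)[OF gU(1)] gU(2) by blast
  moreover have "e \<in> Ox (gp P)" using good_chart_facts(1)[OF U gU(1)] e(1) by blast
  ultimately have e1: "ordge P 1 e" using ordge_nonunit[OF P(1) Oc[OF e(1)]] by blast
  have ek: "e [^]\<^bsub>KX\<^esub> k \<in> Oo U \<and> e [^]\<^bsub>KX\<^esub> k \<in> Ux y \<and> ordge P (int k) (e [^]\<^bsub>KX\<^esub> k)" for k :: nat
  proof (induction k)
    case 0
    show ?case using subringE(3)[OF g(5)] K.units_in_facts(3)[OF Ox_subring[OF yT]] Oo_ordge(2)[OF g(1) P(1,2) subringE(3)[OF g(5)]] by simp
  next
    case (Suc k)
    have "ordge P (int k + 1) (e [^]\<^bsub>KX\<^esub> k \<otimes>\<^bsub>KX\<^esub> e)" by (rule ordge_mult[OF P(1)]) (use Suc e1 Oc[OF e(1)] in auto)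
    then show ?case using Suc subringE(6)[OF g(5) _ e(1)] Ux_facts(2)[OF yT _ e(2)] by (simp add: add.commute)
  qed
  let ?c = "e [^]\<^bsub>KX\<^esub> n P"
  have "b \<otimes>\<^bsub>KX\<^esub> ?c \<in> Oo U" "b \<otimes>\<^bsub>KX\<^esub> ?c \<in> Ux y" using subringE(6)[OF g(5) b(1)] Ux_facts(2)[OF yT b(2)] ek by auto
  moreover have "ordge Q (int (n Q)) (b \<otimes>\<^bsub>KX\<^esub> ?c)" if Q: "Q \<in> insert P S" for Q
  proof (cases "Q = P")
    case True
    have "ordge P (0 + int (n P)) (b \<otimes>\<^bsub>KX\<^esub> ?c)"
      by (rule ordge_mult[OF P(1) Oc[OF b(1)] _ Oo_ordge(2)[OF g(1) P(1,2) b(1)]]) (use ek Oc in auto)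
    then show ?thesis using True by simp
  next
    case False
    then have QS: "Q \<in> S" using Q by blast
    have Qp: "prime_divisor \<XX> Q" "Q \<inter> U \<noteq> {}" using insert.prems Q by auto
    have "ordge Q (int (n Q) + 0) (b \<otimes>\<^bsub>KX\<^esub> ?c)"
      by (rule ordge_mult[OF Qp(1) Oc[OF b(1)] _ b(3)[OF QS] Oo_ordge(2)[OF g(1) Qp]]) (use ek Oc in auto)
    then show ?thesis by simp
  qed
  ultimately show ?case by blast
qed

lemma eta_notin_prime_divisor:
  assumes P: "prime_divisor \<XX> P"
  shows "\<eta> \<notin> P"
proof
  assume e: "\<eta> \<in> P"
  have irr: "irreducible_closed (topol \<XX>) P" and n: "P \<noteq> TX" using P unfolding prime_divisor_iff[OF irreducible_TX] by blast+
  have cl: "closedin (topol \<XX>) P" using irr unfolding irreducible_closed_def by blast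
  have "(topol \<XX>) closure_of {\<eta>} \<subseteq> P" by (rule closure_of_minimal) (use e cl in auto)
  then show False using n closedin_subset[OF cl] unfolding eta_closure by blast
qed

end

section \<open>The sheaf of the decoration\<close>

context snc_setup
begin

text \<open>For the empty set this is all of the plane, whereas the sheaf has only zero there; hence
  the conditions of nonemptiness in \<open>FD_simps\<close>.\<close>

definition FF :: "'x set \<Rightarrow> (('x set \<times> 'a) set \<times> ('x set \<times> 'a) set) set" where
  "FF U = {v \<in> carrier VK. \<forall>P. prime_divisor \<XX> P \<and> P \<inter> U \<noteq> {} \<longrightarrow> lat P 0 v}"

abbreviation "FD \<equiv> decoration_sheaf \<XX> VK WD"

lemma FD_simps:
  "U \<noteq> {} \<Longrightarrow> carrier (msections FD U) = FF U" "carrier (msections FD {}) = {\<zero>\<^bsub>VK\<^esub>}"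
  "\<zero>\<^bsub>msections FD U\<^esub> = \<zero>\<^bsub>VK\<^esub>" "v \<oplus>\<^bsub>msections FD U\<^esub> w = v \<oplus>\<^bsub>VK\<^esub> w"
  "U \<noteq> {} \<Longrightarrow> a \<odot>\<^bsub>msections FD U\<^esub> v = section_to_K \<XX> U a \<odot>\<^bsub>VK\<^esub> v" "a \<odot>\<^bsub>msections FD {}\<^esub> v = \<zero>\<^bsub>VK\<^esub>"
  "mrestr FD U V v = (if V = {} then \<zero>\<^bsub>VK\<^esub> else v)"
proof -
  show "carrier (msections FD U) = FF U" if "U \<noteq> {}"
    using that WD_nonneg[of _ U] unfolding decoration_sheaf_def FF_def by (simp cong: conj_cong)
qed (simp_all add: decoration_sheaf_def)

lemma FF_VK: "v \<in> FF U \<Longrightarrow> v \<in> carrier VK" unfolding FF_def by blast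

lemma FF_mono: "V \<subseteq> U \<Longrightarrow> FF U \<subseteq> FF V" unfolding FF_def by blast

lemma FF_zero: "\<zero>\<^bsub>VK\<^esub> \<in> FF U" unfolding FF_def by (simp add: VK_simps)

lemma FF_add: "v \<in> FF U \<Longrightarrow> w \<in> FF U \<Longrightarrow> v \<oplus>\<^bsub>VK\<^esub> w \<in> FF U"
proof -
  assume v: "v \<in> FF U" and w: "w \<in> FF U"
  have c: "v \<oplus>\<^bsub>VK\<^esub> w \<in> carrier VK" using FF_VK[OF v] FF_VK[OF w] unfolding VK_simps by auto
  show ?thesis using c v w lat_add[OF _ FF_VK[OF v] FF_VK[OF w]] unfolding FF_def by blast
qed

lemma FF_smult:
  assumes U: "open_set U" and a: "a \<in> Oo U" "a \<in> carrier KX" and v: "v \<in> FF U"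
  shows "a \<odot>\<^bsub>VK\<^esub> v \<in> FF U"
proof -
  have vc: "v \<in> carrier VK" by (rule FF_VK[OF v])
  have c: "a \<odot>\<^bsub>VK\<^esub> v \<in> carrier VK" using vc a(2) unfolding VK_simps by auto
  have "lat P 0 (a \<odot>\<^bsub>VK\<^esub> v)" if P: "prime_divisor \<XX> P" "P \<inter> U \<noteq> {}" for P
  proof -
    have "lat P 0 v" using v P unfolding FF_def by blast
    then have "lat P (0 + 0) (a \<odot>\<^bsub>VK\<^esub> v)" by (rule lat_smult[OF P(1) vc _ a(2) Oo_ordge(2)[OF U P a(1)]])
    then show ?thesis by simp
  qed
  then show ?thesis unfolding FF_def using c by blast
qed

lemma FD_module:
  assumes U: "open_set U"
  shows "Module.module (sections \<XX> U) (msections FD U)"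
proof (cases "U = {}")
  case True
  show ?thesis
  proof (rule moduleI[OF cring_sections[OF U]])
    show "abelian_group (msections FD U)"
      unfolding True by (rule abelian_groupI) (simp_all add: FD_simps VK_simps)
  qed (simp_all add: True FD_simps VK_simps)
next
  case False
  interpret R: cring "sections \<XX> U" by (rule cring_sections[OF U])
  interpret M: Module.module KX VK by (rule VK_module)
  interpret Hm: ring_hom_cring "sections \<XX> U" KX "section_to_K \<XX> U"
    using section_to_K_hom[OF U False] by (simp add: ring_hom_cring_def ring_hom_cring_axioms_def R.cring_axioms K.cring_axioms)
  note S = FD_simps(1,5)[OF False] FD_simps(3,4)
  have kO: "section_to_K \<XX> U a \<in> Oo U" if "a \<in> carrier (sections \<XX> U)" for a using that unfolding Oo_def by blast
  show ?thesis
  proof (rule moduleI[OF R.cring_axioms])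
    show "abelian_group (msections FD U)"
    proof (rule abelian_groupI; unfold S)
      show "\<zero>\<^bsub>VK\<^esub> \<in> FF U" by (rule FF_zero)
      fix x assume x: "x \<in> FF U"
      note xc = FF_VK[OF x]
      show "\<zero>\<^bsub>VK\<^esub> \<oplus>\<^bsub>VK\<^esub> x = x" using M.M.l_zero[OF xc] .
      \<comment> \<open>The sections over U are closed under scalars from \<open>Oo U\<close>, so
        the negative of x is taken as its multiple by -1.\<close>
      let ?y = "section_to_K \<XX> U (\<ominus>\<^bsub>sections \<XX> U\<^esub> \<one>\<^bsub>sections \<XX> U\<^esub>) \<odot>\<^bsub>VK\<^esub> x"
      have "?y \<in> FF U" by (rule FF_smult[OF U kO _ x]) simp_all
      moreover have "?y \<oplus>\<^bsub>VK\<^esub> x = \<zero>\<^bsub>VK\<^esub>" using xc by (simp add: VK_simps mem_Times_iff K.l_minus K.l_neg)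
      ultimately show "\<exists>y\<in>FF U. y \<oplus>\<^bsub>VK\<^esub> x = \<zero>\<^bsub>VK\<^esub>" by blast
      fix y assume y: "y \<in> FF U"
      note yc = FF_VK[OF y]
      show "x \<oplus>\<^bsub>VK\<^esub> y \<in> FF U" by (rule FF_add[OF x y])
      show "x \<oplus>\<^bsub>VK\<^esub> y = y \<oplus>\<^bsub>VK\<^esub> x" by (rule M.M.a_comm[OF xc yc])
      fix z assume z: "z \<in> FF U"
      show "x \<oplus>\<^bsub>VK\<^esub> y \<oplus>\<^bsub>VK\<^esub> z = x \<oplus>\<^bsub>VK\<^esub> (y \<oplus>\<^bsub>VK\<^esub> z)" by (rule M.M.a_assoc[OF xc yc FF_VK[OF z]])
    qed
  next
    fix a x assume a: "a \<in> carrier (sections \<XX> U)" and x: "x \<in> carrier (msections FD U)"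
    have xF: "x \<in> FF U" using x unfolding S .
    note xc = FF_VK[OF xF]
    show "a \<odot>\<^bsub>msections FD U\<^esub> x \<in> carrier (msections FD U)" unfolding S by (rule FF_smult[OF U kO[OF a] _ xF]) (use a in simp)
    fix b assume b: "b \<in> carrier (sections \<XX> U)"
    show "(a \<oplus>\<^bsub>sections \<XX> U\<^esub> b) \<odot>\<^bsub>msections FD U\<^esub> x = a \<odot>\<^bsub>msections FD U\<^esub> x \<oplus>\<^bsub>msections FD U\<^esub> b \<odot>\<^bsub>msections FD U\<^esub> x"
      unfolding S Hm.hom_add[OF a b] by (rule M.smult_l_distr[OF Hm.hom_closed[OF a] Hm.hom_closed[OF b] xc])
    show "(a \<otimes>\<^bsub>sections \<XX> U\<^esub> b) \<odot>\<^bsub>msections FD U\<^esub> x = a \<odot>\<^bsub>msections FD U\<^esub> (b \<odot>\<^bsub>msections FD U\<^esub> x)"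
      unfolding S Hm.hom_mult[OF a b] by (rule M.smult_assoc1[OF Hm.hom_closed[OF a] Hm.hom_closed[OF b] xc])
  next
    fix x assume "x \<in> carrier (msections FD U)"
    then show "\<one>\<^bsub>sections \<XX> U\<^esub> \<odot>\<^bsub>msections FD U\<^esub> x = x" unfolding S using M.smult_one[OF FF_VK] by simp
  next
    fix a x y assume a: "a \<in> carrier (sections \<XX> U)" and x: "x \<in> carrier (msections FD U)" "y \<in> carrier (msections FD U)"
    have xc: "x \<in> carrier VK" "y \<in> carrier VK" using x FF_VK unfolding S by auto
    show "a \<odot>\<^bsub>msections FD U\<^esub> (x \<oplus>\<^bsub>msections FD U\<^esub> y) = a \<odot>\<^bsub>msections FD U\<^esub> x \<oplus>\<^bsub>msections FD U\<^esub> a \<odot>\<^bsub>msections FD U\<^esub> y"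
      unfolding S by (rule M.smult_r_distr[OF Hm.hom_closed[OF a] xc])
  qed
qed

lemma FD_carrier_sub: "V \<noteq> {} \<Longrightarrow> V \<subseteq> U \<Longrightarrow> s \<in> carrier (msections FD U) \<Longrightarrow> s \<in> carrier (msections FD V)"
  using FF_mono[of V U] by (cases "U = {}") (auto simp: FD_simps)

text \<open>Restriction to a nonempty open set is the identity on vectors of the plane. Nonempty
  open sets meet, so compatible sections over them are one and the same vector, and its coefficients
  are nonnegative along each divisor that meets some member of the cover.\<close>

lemma FD_sheaf: "sheaf_of_modules \<XX> FD"
proof (intro sheaf_of_modules.intro sheaf_of_modules_axioms.intro)
  interpret M: Module.module KX VK by (rule VK_module)
  show "ringed_space \<XX>" by (rule ringed_space_axioms)
  show "Module.module (sections \<XX> U) (msections FD U)" if "open_set U" for U by (rule FD_module[OF that])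
  show "mrestr FD U V s \<in> carrier (msections FD V)" if "open_set U" "open_set V" "V \<subseteq> U" "s \<in> carrier (msections FD U)" for U V s
    using FD_carrier_sub[OF _ that(3,4)] by (cases "V = {}") (auto simp: FD_simps)
  show "mrestr FD U V (s \<oplus>\<^bsub>msections FD U\<^esub> t) = mrestr FD U V s \<oplus>\<^bsub>msections FD V\<^esub> mrestr FD U V t"
    if "open_set U" "open_set V" "V \<subseteq> U" "s \<in> carrier (msections FD U)" "t \<in> carrier (msections FD U)" for U V s t
    by (cases "V = {}") (simp_all add: FD_simps)
  show "mrestr FD U V (a \<odot>\<^bsub>msections FD U\<^esub> s) = restr \<XX> U V a \<odot>\<^bsub>msections FD V\<^esub> mrestr FD U V s"
    if h: "open_set U" "open_set V" "V \<subseteq> U" "a \<in> carrier (sections \<XX> U)" "s \<in> carrier (msections FD U)" for U V a s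
  proof (cases "V = {}")
    case True then show ?thesis by (simp add: FD_simps)
  next
    case False
    then have "U \<noteq> {}" using h(3) by blast
    then show ?thesis using section_to_K_restr[OF h(1-3) False h(4)] False by (simp add: FD_simps)
  qed
  show "mrestr FD U U s = s" if "open_set U" "s \<in> carrier (msections FD U)" for U s
    using that by (cases "U = {}") (auto simp: FD_simps)
  show "mrestr FD V W (mrestr FD U V s) = mrestr FD U W s"
    if "open_set U" "open_set V" "open_set W" "W \<subseteq> V" "V \<subseteq> U" "s \<in> carrier (msections FD U)" for U V W s
    using that by (cases "V = {}") (auto simp: FD_simps)
next
  fix \<U> s t assume U: "\<And>U. U \<in> \<U> \<Longrightarrow> open_set U" and s: "s \<in> carrier (msections FD (\<Union>\<U>))" and t: "t \<in> carrier (msections FD (\<Union>\<U>))"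
    and eq: "\<And>U. U \<in> \<U> \<Longrightarrow> mrestr FD (\<Union>\<U>) U s = mrestr FD (\<Union>\<U>) U t"
  show "s = t"
  proof (cases "\<Union>\<U> = {}")
    case True show ?thesis using s t unfolding True FD_simps by simp
  next
    case False
    then obtain U where "U \<in> \<U>" "U \<noteq> {}" by blast
    then show ?thesis using eq[of U] by (simp add: FD_simps)
  qed
next
  fix \<U> \<sigma> assume U: "\<And>U. U \<in> \<U> \<Longrightarrow> open_set U" and s: "\<And>U. U \<in> \<U> \<Longrightarrow> \<sigma> U \<in> carrier (msections FD U)"
    and comp: "\<And>U V. U \<in> \<U> \<Longrightarrow> V \<in> \<U> \<Longrightarrow> mrestr FD U (U \<inter> V) (\<sigma> U) = mrestr FD V (U \<inter> V) (\<sigma> V)"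
  show "\<exists>t\<in>carrier (msections FD (\<Union>\<U>)). \<forall>U\<in>\<U>. mrestr FD (\<Union>\<U>) U t = \<sigma> U"
  proof (cases "\<Union>\<U> = {}")
    case True
    then have "\<forall>U\<in>\<U>. U = {}" by blast
    then have "\<forall>U\<in>\<U>. mrestr FD (\<Union>\<U>) U \<zero>\<^bsub>VK\<^esub> = \<sigma> U" using s by (force simp: FD_simps)
    then show ?thesis unfolding True FD_simps by blast
  next
    case False
    then obtain U0 where U0: "U0 \<in> \<U>" "U0 \<noteq> {}" by blast
    have same: "\<sigma> V = \<sigma> U0" if V: "V \<in> \<U>" "V \<noteq> {}" for V
    proof -
      have "V \<inter> U0 \<noteq> {}" by (rule open_inter_nonempty[OF U[OF V(1)] V(2) U[OF U0(1)] U0(2)])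
      then show ?thesis using comp[OF V(1) U0(1)] by (simp add: FD_simps)
    qed
    have "\<sigma> U0 \<in> carrier VK" using s[OF U0(1)] FF_VK U0(2) by (simp add: FD_simps)
    moreover have "lat P 0 (\<sigma> U0)" if P: "prime_divisor \<XX> P" "P \<inter> \<Union>\<U> \<noteq> {}" for P
    proof -
      obtain V where V: "V \<in> \<U>" "P \<inter> V \<noteq> {}" using P(2) by blast
      then have Vne: "V \<noteq> {}" by blast
      have "\<sigma> V \<in> FF V" using s[OF V(1)] Vne by (simp add: FD_simps)
      then show ?thesis using same[OF V(1) Vne] P(1) V(2) unfolding FF_def by auto
    qed
    ultimately have "\<sigma> U0 \<in> FF (\<Union>\<U>)" unfolding FF_def by blast
    moreover have "mrestr FD (\<Union>\<U>) V (\<sigma> U0) = \<sigma> V" if V: "V \<in> \<U>" for V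
      using same[OF V] s[OF V] by (cases "V = {}") (auto simp: FD_simps)
    ultimately show ?thesis using FD_simps(1)[OF False] by blast
  qed
qed

lemma FD_lin_comb:
  assumes U: "open_set U" and V: "open_set V" "V \<noteq> {}" "V \<subseteq> U" and s: "\<And>i. i < n \<Longrightarrow> s i \<in> FF U"
    and a: "\<And>i. i < n \<Longrightarrow> a i \<in> carrier (sections \<XX> V)"
  shows "lin_comb FD U n s V a =
    ((\<Oplus>\<^bsub>KX\<^esub>i\<in>{..<n}. section_to_K \<XX> V (a i) \<otimes>\<^bsub>KX\<^esub> fst (s i)), (\<Oplus>\<^bsub>KX\<^esub>i\<in>{..<n}. section_to_K \<XX> V (a i) \<otimes>\<^bsub>KX\<^esub> snd (s i)))"
  using s a
proof (induction n)
  interpret M: Module.module "sections \<XX> V" "msections FD V" by (rule FD_module[OF V(1)])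
  case 0
  show ?case unfolding lin_comb_def by (simp add: FD_simps VK_simps)
next
  interpret M: Module.module "sections \<XX> V" "msections FD V" by (rule FD_module[OF V(1)])
  case (Suc n)
  have ins: "{..<Suc n} = insert n {..<n}" by auto
  let ?k = "\<lambda>i. section_to_K \<XX> V (a i)"
  have kc: "?k i \<in> carrier KX" if "i < Suc n" for i using ring_hom_closed[OF section_to_K_hom[OF V(1,2)] Suc.prems(2)[OF that]] .
  have sc: "fst (s i) \<in> carrier KX" "snd (s i) \<in> carrier KX" if "i < Suc n" for i
    using FF_VK[OF Suc.prems(1)[OF that]] unfolding VK_simps by auto
  have tc: "a i \<odot>\<^bsub>msections FD V\<^esub> mrestr FD U V (s i) \<in> carrier (msections FD V)" if "i < Suc n" for i
  proof (rule M.smult_closed[OF Suc.prems(2)[OF that]])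
    show "mrestr FD U V (s i) \<in> carrier (msections FD V)"
      using Suc.prems(1)[OF that] FF_mono[OF V(3)] V(2) by (auto simp: FD_simps)
  qed
  have "lin_comb FD U (Suc n) s V a = a n \<odot>\<^bsub>msections FD V\<^esub> mrestr FD U V (s n) \<oplus>\<^bsub>msections FD V\<^esub> lin_comb FD U n s V a"
    unfolding lin_comb_def ins by (rule M.M.finsum_insert) (use tc in auto)
  also have "lin_comb FD U n s V a = ((\<Oplus>\<^bsub>KX\<^esub>i\<in>{..<n}. ?k i \<otimes>\<^bsub>KX\<^esub> fst (s i)), (\<Oplus>\<^bsub>KX\<^esub>i\<in>{..<n}. ?k i \<otimes>\<^bsub>KX\<^esub> snd (s i)))"
    by (rule Suc.IH) (use Suc.prems in auto)
  also have "a n \<odot>\<^bsub>msections FD V\<^esub> mrestr FD U V (s n) \<oplus>\<^bsub>msections FD V\<^esub> ((\<Oplus>\<^bsub>KX\<^esub>i\<in>{..<n}. ?k i \<otimes>\<^bsub>KX\<^esub> fst (s i)), (\<Oplus>\<^bsub>KX\<^esub>i\<in>{..<n}. ?k i \<otimes>\<^bsub>KX\<^esub> snd (s i)))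
    = (?k n \<otimes>\<^bsub>KX\<^esub> fst (s n) \<oplus>\<^bsub>KX\<^esub> (\<Oplus>\<^bsub>KX\<^esub>i\<in>{..<n}. ?k i \<otimes>\<^bsub>KX\<^esub> fst (s i)), ?k n \<otimes>\<^bsub>KX\<^esub> snd (s n) \<oplus>\<^bsub>KX\<^esub> (\<Oplus>\<^bsub>KX\<^esub>i\<in>{..<n}. ?k i \<otimes>\<^bsub>KX\<^esub> snd (s i)))"
    using V(2) by (simp add: FD_simps VK_simps)
  also have "?k n \<otimes>\<^bsub>KX\<^esub> fst (s n) \<oplus>\<^bsub>KX\<^esub> (\<Oplus>\<^bsub>KX\<^esub>i\<in>{..<n}. ?k i \<otimes>\<^bsub>KX\<^esub> fst (s i)) = (\<Oplus>\<^bsub>KX\<^esub>i\<in>{..<Suc n}. ?k i \<otimes>\<^bsub>KX\<^esub> fst (s i))"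
    unfolding ins by (rule K.finsum_insert[symmetric]) (use kc sc in auto)
  also have "?k n \<otimes>\<^bsub>KX\<^esub> snd (s n) \<oplus>\<^bsub>KX\<^esub> (\<Oplus>\<^bsub>KX\<^esub>i\<in>{..<n}. ?k i \<otimes>\<^bsub>KX\<^esub> snd (s i)) = (\<Oplus>\<^bsub>KX\<^esub>i\<in>{..<Suc n}. ?k i \<otimes>\<^bsub>KX\<^esub> snd (s i))"
    unfolding ins by (rule K.finsum_insert[symmetric]) (use kc sc in auto)
  finally show ?case .
qed

lemma FF_generators:
  assumes U: "good U"
  obtains m :: nat and s where "\<And>j. j < m \<Longrightarrow> s j \<in> FF U"
    "\<And>v. v \<in> FF U \<Longrightarrow> \<exists>c\<in>{..<m} \<rightarrow> Oo U. fst v = (\<Oplus>\<^bsub>KX\<^esub>j\<in>{..<m}. c j \<otimes>\<^bsub>KX\<^esub> fst (s j)) \<and> snd v = (\<Oplus>\<^bsub>KX\<^esub>j\<in>{..<m}. c j \<otimes>\<^bsub>KX\<^esub> snd (s j))"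
proof -
  note g = good_facts[OF U]
  note Oc = subsetD[OF subringE(1)[OF g(5)]]
  define S where "S = {P \<in> supp D. P \<inter> U \<noteq> {}}"
  have S: "finite S" "\<And>P. P \<in> S \<Longrightarrow> prime_divisor \<XX> P \<and> P \<inter> U \<noteq> {} \<and> \<eta> \<notin> P"
    using supp_finite supp_prime eta_notin_prime_divisor unfolding S_def by auto
  \<comment> \<open>A section has at most a simple pole along a component of D: ord g >= -1 and ord
    (f - H g) >= 0 give ord f >= -1. Hence order one is enough for d. Being a unit at \<eta> means
    that d is nonzero.\<close>
  have "\<exists>b\<in>Oo U. b \<in> Ux \<eta> \<and> (\<forall>P\<in>S. ordge P (int 1) b)" by (rule vanishing_function[OF U g(4) S])
  then obtain d where d: "d \<in> Oo U" "d \<in> Ux \<eta>" "\<And>P. P \<in> S \<Longrightarrow> ordge P 1 d" by auto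
  have dc: "d \<in> carrier KX" "d \<noteq> \<zero>\<^bsub>KX\<^esub>" using d(2) Ux_eta by auto
  have dO: "d \<otimes>\<^bsub>KX\<^esub> fst v \<in> Oo U \<and> d \<otimes>\<^bsub>KX\<^esub> snd v \<in> Oo U" if v: "v \<in> FF U" for v
  proof -
    have c: "fst v \<in> carrier KX" "snd v \<in> carrier KX" using FF_VK[OF v] unfolding VK_simps by auto
    have reg: "d \<otimes>\<^bsub>KX\<^esub> fst v \<in> Ox (gp P) \<and> d \<otimes>\<^bsub>KX\<^esub> snd v \<in> Ox (gp P)" if P: "prime_divisor \<XX> P" "P \<inter> U \<noteq> {}" for P
    proof -
      have l: "lat P 0 v" using v P unfolding FF_def by blast
      have "ordge P 0 (d \<otimes>\<^bsub>KX\<^esub> fst v) \<and> ordge P 0 (d \<otimes>\<^bsub>KX\<^esub> snd v)"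
      proof (cases "P \<in> supp D")
        case True
        note Hc = H_carrier[OF True]
        have H0: "ordge P 0 (H P)" using ordge_Ox[OF P(1) Hc] H_facts(1)[OF True] by simp
        let ?e = "fst v \<ominus>\<^bsub>KX\<^esub> H P \<otimes>\<^bsub>KX\<^esub> snd v"
        have l': "ordge P (- 1) (snd v)" "ordge P 0 ?e" using l True unfolding lat_def by auto
        have "ordge P (0 + - 1) (H P \<otimes>\<^bsub>KX\<^esub> snd v)" by (rule ordge_mult[OF P(1) Hc c(2) H0 l'(1)])
        then have "ordge P (- 1) (?e \<oplus>\<^bsub>KX\<^esub> H P \<otimes>\<^bsub>KX\<^esub> snd v)"
          using ordge_mono[OF l'(2), of "- 1"] Hc c by (intro ordge_add[OF P(1)]) auto
        moreover have "?e \<oplus>\<^bsub>KX\<^esub> H P \<otimes>\<^bsub>KX\<^esub> snd v = fst v" using Hc c by algebra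
        ultimately have l1: "ordge P (- 1) (fst v)" by simp
        have d1: "ordge P 1 d" using d(3) True P(2) unfolding S_def by blast
        show ?thesis using ordge_mult[OF P(1) dc(1) c(1) d1 l1] ordge_mult[OF P(1) dc(1) c(2) d1 l'(1)] by simp
      next
        case False
        then have l': "ordge P 0 (fst v)" "ordge P 0 (snd v)" using l unfolding lat_def by auto
        have d0: "ordge P 0 d" by (rule Oo_ordge(2)[OF g(1) P d(1)])
        show ?thesis using ordge_mult[OF P(1) dc(1) c(1) d0 l'(1)] ordge_mult[OF P(1) dc(1) c(2) d0 l'(2)] by simp
      qed
      then show ?thesis using ordge_Ox[OF P(1)] dc c by simp
    qed
    show ?thesis using hartogs[OF U, of "d \<otimes>\<^bsub>KX\<^esub> fst v"] hartogs[OF U, of "d \<otimes>\<^bsub>KX\<^esub> snd v"] reg dc c by simp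
  qed
  \<comment> \<open>The pair (d f, d g) padded with zeros, to fit \<open>vectors_over\<close> with
    length 2.\<close>
  define enc where "enc v = (\<lambda>i::nat. if i = 0 then d \<otimes>\<^bsub>KX\<^esub> fst v else if i = 1 then d \<otimes>\<^bsub>KX\<^esub> snd v else \<zero>\<^bsub>KX\<^esub>)" for v
  define V where "V = enc ` FF U"
  have fs: "fst v \<in> carrier KX" "snd v \<in> carrier KX" if "v \<in> FF U" for v using FF_VK[OF that] unfolding VK_simps by auto
  have VO: "w i \<in> Oo U" if "w \<in> V" for w i using that dO subringE(2)[OF g(5)] unfolding V_def enc_def by auto
  have Vz: "w i = \<zero>\<^bsub>KX\<^esub>" if "w \<in> V" "i \<ge> 2" for w i using that unfolding V_def enc_def by auto
  have Vv: "vectors_over KX (Oo U) V"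
    unfolding vectors_over_def
  proof (intro conjI ballI allI)
    show "w i \<in> carrier KX" if "w \<in> V" for w i using VO[OF that] Oc by blast
    have "(\<lambda>i. \<zero>\<^bsub>KX\<^esub>) = enc \<zero>\<^bsub>VK\<^esub>" using dc unfolding enc_def by (auto simp: VK_simps fun_eq_iff)
    then show "(\<lambda>i. \<zero>\<^bsub>KX\<^esub>) \<in> V" unfolding V_def using FF_zero by (rule image_eqI)
  next
    fix x y assume "x \<in> V" "y \<in> V"
    then obtain v w where vw: "v \<in> FF U" "w \<in> FF U" "x = enc v" "y = enc w" unfolding V_def by blast
    have "(\<lambda>i. x i \<oplus>\<^bsub>KX\<^esub> y i) = enc (v \<oplus>\<^bsub>VK\<^esub> w)"
      unfolding vw(3,4) enc_def using fs[OF vw(1)] fs[OF vw(2)] dc by (intro ext) (simp add: VK_simps K.r_distr)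
    then show "(\<lambda>i. x i \<oplus>\<^bsub>KX\<^esub> y i) \<in> V" unfolding V_def using FF_add[OF vw(1,2)] by (rule image_eqI)
  next
    fix a x assume a: "a \<in> Oo U" and "x \<in> V"
    then obtain v where v: "v \<in> FF U" "x = enc v" unfolding V_def by blast
    have "(\<lambda>i. a \<otimes>\<^bsub>KX\<^esub> x i) = enc (a \<odot>\<^bsub>VK\<^esub> v)"
      unfolding v(2) enc_def using fs[OF v(1)] Oc[OF a] dc by (intro ext) (simp add: VK_simps K.m_lcomm)
    then show "(\<lambda>i. a \<otimes>\<^bsub>KX\<^esub> x i) \<in> V" unfolding V_def using FF_smult[OF g(1) a Oc[OF a] v(1)] by (rule image_eqI)
  qed
  show ?thesis
  proof (rule K.vectors_over_generators[OF g(5,6) Vv, where n = 2])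
    show "w i \<in> Oo U" if "w \<in> V" for w i by (rule VO[OF that])
    show "w i = \<zero>\<^bsub>KX\<^esub>" if "w \<in> V" "i \<ge> 2" for w i by (rule Vz[OF that])
  next
    fix m :: nat and gg :: "nat \<Rightarrow> nat \<Rightarrow> ('x set \<times> 'a) set"
    assume gV: "\<And>j. j < m \<Longrightarrow> gg j \<in> V"
      and gen: "\<And>v. v \<in> V \<Longrightarrow> \<exists>c\<in>{..<m} \<rightarrow> Oo U. \<forall>i. v i = (\<Oplus>\<^bsub>KX\<^esub>j\<in>{..<m}. c j \<otimes>\<^bsub>KX\<^esub> gg j i)"
    have "\<forall>j\<in>{..<m}. \<exists>v. v \<in> FF U \<and> gg j = enc v" using gV unfolding V_def by blast
    then obtain s where s: "\<forall>j\<in>{..<m}. s j \<in> FF U \<and> gg j = enc (s j)" using bchoice[of "{..<m}" "\<lambda>j v. v \<in> FF U \<and> gg j = enc v"] by blast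
    show ?thesis
    proof (rule that[of m s])
      show "s j \<in> FF U" if "j < m" for j using s that by blast
      fix v assume v: "v \<in> FF U"
      then have "enc v \<in> V" unfolding V_def by blast
      then obtain c where c: "c \<in> {..<m} \<rightarrow> Oo U" "\<And>i. enc v i = (\<Oplus>\<^bsub>KX\<^esub>j\<in>{..<m}. c j \<otimes>\<^bsub>KX\<^esub> gg j i)" using gen by blast
      have cc: "c j \<in> carrier KX" if "j < m" for j using c(1) that Oc by blast
      \<comment> \<open>The coefficients found for the multiples by d serve the original vectors,
        because d is a nonzero common factor.\<close>
      have cancel: "x = (\<Oplus>\<^bsub>KX\<^esub>j\<in>{..<m}. c j \<otimes>\<^bsub>KX\<^esub> e j)"
        if x: "x \<in> carrier KX" "\<And>j. j < m \<Longrightarrow> e j \<in> carrier KX" "d \<otimes>\<^bsub>KX\<^esub> x = (\<Oplus>\<^bsub>KX\<^esub>j\<in>{..<m}. c j \<otimes>\<^bsub>KX\<^esub> (d \<otimes>\<^bsub>KX\<^esub> e j))" for x e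
      proof -
        have ce: "(\<lambda>j. c j \<otimes>\<^bsub>KX\<^esub> e j) \<in> {..<m} \<rightarrow> carrier KX" using cc x(2) by auto
        have "d \<otimes>\<^bsub>KX\<^esub> x = (\<Oplus>\<^bsub>KX\<^esub>j\<in>{..<m}. d \<otimes>\<^bsub>KX\<^esub> (c j \<otimes>\<^bsub>KX\<^esub> e j))"
          unfolding x(3) by (rule K.finsum_cong') (use cc x(2) dc in \<open>auto simp: K.m_lcomm\<close>)
        also have "\<dots> = d \<otimes>\<^bsub>KX\<^esub> (\<Oplus>\<^bsub>KX\<^esub>j\<in>{..<m}. c j \<otimes>\<^bsub>KX\<^esub> e j)" by (rule K.finsum_rdistr[symmetric]) (use ce dc in auto)
        finally show ?thesis using K.m_lcancel[OF dc(2,1) x(1) K.finsum_closed[OF ce]] by simp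
      qed
      have sc: "fst (s j) \<in> carrier KX" "snd (s j) \<in> carrier KX" if "j < m" for j using s fs that by auto
      have "d \<otimes>\<^bsub>KX\<^esub> fst v = (\<Oplus>\<^bsub>KX\<^esub>j\<in>{..<m}. c j \<otimes>\<^bsub>KX\<^esub> (d \<otimes>\<^bsub>KX\<^esub> fst (s j)))"
      proof -
        have "d \<otimes>\<^bsub>KX\<^esub> fst v = (\<Oplus>\<^bsub>KX\<^esub>j\<in>{..<m}. c j \<otimes>\<^bsub>KX\<^esub> gg j 0)" using c(2)[of 0] by (simp add: enc_def)
        also have "\<dots> = (\<Oplus>\<^bsub>KX\<^esub>j\<in>{..<m}. c j \<otimes>\<^bsub>KX\<^esub> (d \<otimes>\<^bsub>KX\<^esub> fst (s j)))"
          by (rule K.finsum_cong') (use cc sc dc s in \<open>auto simp: enc_def\<close>)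
        finally show ?thesis .
      qed
      moreover have "d \<otimes>\<^bsub>KX\<^esub> snd v = (\<Oplus>\<^bsub>KX\<^esub>j\<in>{..<m}. c j \<otimes>\<^bsub>KX\<^esub> (d \<otimes>\<^bsub>KX\<^esub> snd (s j)))"
      proof -
        have "d \<otimes>\<^bsub>KX\<^esub> snd v = (\<Oplus>\<^bsub>KX\<^esub>j\<in>{..<m}. c j \<otimes>\<^bsub>KX\<^esub> gg j 1)" using c(2)[of 1] by (simp add: enc_def)
        also have "\<dots> = (\<Oplus>\<^bsub>KX\<^esub>j\<in>{..<m}. c j \<otimes>\<^bsub>KX\<^esub> (d \<otimes>\<^bsub>KX\<^esub> snd (s j)))"
          by (rule K.finsum_cong') (use cc sc dc s in \<open>auto simp: enc_def\<close>)
        finally show ?thesis .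
      qed
      ultimately show "\<exists>c\<in>{..<m} \<rightarrow> Oo U. fst v = (\<Oplus>\<^bsub>KX\<^esub>j\<in>{..<m}. c j \<otimes>\<^bsub>KX\<^esub> fst (s j)) \<and> snd v = (\<Oplus>\<^bsub>KX\<^esub>j\<in>{..<m}. c j \<otimes>\<^bsub>KX\<^esub> snd (s j))"
        using c(1) cancel[of "fst v" "\<lambda>j. fst (s j)", OF fs(1)[OF v] sc(1)] cancel[of "snd v" "\<lambda>j. snd (s j)", OF fs(2)[OF v] sc(2)] by blast
    qed
  qed
qed

lemma FF_localize:
  assumes U: "good U" and V: "open_set V" "V \<subseteq> U" "y \<in> V" and t: "t \<in> FF V"
  shows "\<exists>b\<in>Oo U. b \<in> Ux y \<and> b \<odot>\<^bsub>VK\<^esub> t \<in> FF U"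
proof (cases "t = \<zero>\<^bsub>VK\<^esub>")
  case True
  note g = good_facts[OF U]
  have yT: "y \<in> TX" using V g(3) by blast
  have "\<one>\<^bsub>KX\<^esub> \<odot>\<^bsub>VK\<^esub> t = \<zero>\<^bsub>VK\<^esub>" unfolding True by (simp add: VK_simps)
  then show ?thesis using FF_zero subringE(3)[OF g(5)] K.units_in_facts(3)[OF Ox_subring[OF yT]] by (intro bexI[of _ "\<one>\<^bsub>KX\<^esub>"]) auto
next
  case False
  note g = good_facts[OF U]
  have tc: "t \<in> carrier VK" by (rule FF_VK[OF t])
  define S where "S = {P. prime_divisor \<XX> P \<and> P \<inter> U \<noteq> {} \<and> wt P t < 0}"
  have "S \<subseteq> {P. prime_divisor \<XX> P \<and> wt P t \<noteq> 0}" unfolding S_def by auto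
  then have "finite S" by (rule finite_subset[OF _ wt_finite[OF tc False]])
  \<comment> \<open>A divisor through y meets V, where t has nonnegative coefficients.\<close>
  moreover have "prime_divisor \<XX> P \<and> P \<inter> U \<noteq> {} \<and> y \<notin> P" if P: "P \<in> S" for P
  proof -
    have p: "prime_divisor \<XX> P" "P \<inter> U \<noteq> {}" "wt P t < 0" using P unfolding S_def by auto
    have "\<not> lat P 0 t" using wt_ge[OF p(1) tc False, of 0] p(3) by simp
    then have "P \<inter> V = {}" using t p(1) unfolding FF_def by blast
    then show ?thesis using p V(3) by blast
  qed
  \<comment> \<open>The order demanded of b along P is the pole order \<open>- wt P t\<close>,
    positive on S, so that b t has a nonnegative coefficient there; along other divisors regularity
    of b is enough.\<close>
  ultimately have "\<exists>b\<in>Oo U. b \<in> Ux y \<and> (\<forall>P\<in>S. ordge P (int (nat (- wt P t))) b)"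
    by (intro vanishing_function[OF U]) (use V in auto)
  then obtain b where b: "b \<in> Oo U" "b \<in> Ux y" "\<And>P. P \<in> S \<Longrightarrow> ordge P (int (nat (- wt P t))) b" by blast
  have bc: "b \<in> carrier KX" using b(1) subringE(1)[OF g(5)] by blast
  have "lat P 0 (b \<odot>\<^bsub>VK\<^esub> t)" if P: "prime_divisor \<XX> P" "P \<inter> U \<noteq> {}" for P
  proof -
    have l: "lat P (wt P t) t" using wt_ge[OF P(1) tc False, of "wt P t"] by simp
    show ?thesis
    proof (cases "wt P t < 0")
      case True
      then have "ordge P (- wt P t) b" using b(3)[of P] P unfolding S_def by simp
      then have "lat P (wt P t + - wt P t) (b \<odot>\<^bsub>VK\<^esub> t)" by (rule lat_smult[OF P(1) tc l bc])
      then show ?thesis by simp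
    next
      case False
      then have "lat P 0 t" using lat_mono[OF l] by simp
      then have "lat P (0 + 0) (b \<odot>\<^bsub>VK\<^esub> t)" by (rule lat_smult[OF P(1) tc _ bc Oo_ordge(2)[OF g(1) P b(1)]])
      then show ?thesis by simp
    qed
  qed
  moreover have "b \<odot>\<^bsub>VK\<^esub> t \<in> carrier VK" using bc tc by (auto simp: VK_simps)
  ultimately have "b \<odot>\<^bsub>VK\<^esub> t \<in> FF U" unfolding FF_def by blast
  then show ?thesis using b by blast
qed

end

lemma (in cring) relation_add:
  assumes "x \<in> {..<n::nat} \<rightarrow> carrier R" "u \<in> {..<n} \<rightarrow> carrier R" "v \<in> {..<n} \<rightarrow> carrier R"
    and "(\<Oplus>i\<in>{..<n}. u i \<otimes> x i) = \<zero>" "(\<Oplus>i\<in>{..<n}. v i \<otimes> x i) = \<zero>"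
  shows "(\<Oplus>i\<in>{..<n}. (u i \<oplus> v i) \<otimes> x i) = \<zero>"
proof -
  have "(\<Oplus>i\<in>{..<n}. (u i \<oplus> v i) \<otimes> x i) = (\<Oplus>i\<in>{..<n}. u i \<otimes> x i \<oplus> v i \<otimes> x i)"
    by (rule finsum_cong') (use assms(1-3) in \<open>auto simp: l_distr Pi_iff\<close>)
  also have "\<dots> = (\<Oplus>i\<in>{..<n}. u i \<otimes> x i) \<oplus> (\<Oplus>i\<in>{..<n}. v i \<otimes> x i)"
    by (rule finsum_addf) (use assms(1-3) in auto)
  finally show ?thesis using assms(4,5) by simp
qed

lemma (in cring) relation_smult:
  assumes "x \<in> {..<n::nat} \<rightarrow> carrier R" "u \<in> {..<n} \<rightarrow> carrier R" "c \<in> carrier R"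
    and "(\<Oplus>i\<in>{..<n}. u i \<otimes> x i) = \<zero>"
  shows "(\<Oplus>i\<in>{..<n}. (c \<otimes> u i) \<otimes> x i) = \<zero>"
proof -
  have "(\<Oplus>i\<in>{..<n}. (c \<otimes> u i) \<otimes> x i) = (\<Oplus>i\<in>{..<n}. c \<otimes> (u i \<otimes> x i))"
    by (rule finsum_cong') (use assms(1-3) in \<open>auto simp: m_assoc Pi_iff\<close>)
  also have "\<dots> = c \<otimes> (\<Oplus>i\<in>{..<n}. u i \<otimes> x i)"
    by (rule finsum_rdistr[symmetric]) (use assms(1-3) in auto)
  finally show ?thesis using assms(3,4) by simp
qed

lemma (in field) divide_sum:
  assumes b: "b \<in> carrier R" "b \<noteq> \<zero>" and x: "x \<in> carrier R"
    and c: "\<And>j. j < m \<Longrightarrow> c j \<in> carrier R" and e: "\<And>j. j < m \<Longrightarrow> e j \<in> carrier R"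
    and eq: "b \<otimes> x = (\<Oplus>j\<in>{..<m::nat}. c j \<otimes> e j)"
  shows "x = (\<Oplus>j\<in>{..<m}. (inv b \<otimes> c j) \<otimes> e j)"
proof -
  have bu: "b \<in> Units R" using b field_Units by blast
  have ib: "inv b \<in> carrier R" "inv b \<otimes> b = \<one>" using bu by simp_all
  have "x = inv b \<otimes> (b \<otimes> x)" using ib b x by (simp add: m_assoc[symmetric])
  also have "\<dots> = (\<Oplus>j\<in>{..<m}. inv b \<otimes> (c j \<otimes> e j))" unfolding eq by (rule finsum_rdistr) (use c e ib in auto)
  also have "\<dots> = (\<Oplus>j\<in>{..<m}. (inv b \<otimes> c j) \<otimes> e j)" by (rule finsum_cong') (use c e ib in \<open>auto simp: m_assoc\<close>)
  finally show ?thesis .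
qed

context normal_noetherian
begin

text \<open>Clearing denominators gives an expansion of b t with coefficients in
  \<open>Oo U\<close>. Since b is a unit at y, the finitely many quotients are regular on one
  neighbourhood of y and come from sections there, which is the form that
  \<open>generated_over\<close> asks for.\<close>

lemma local_quotients:
  assumes U: "good U" and V: "open_set V" "V \<subseteq> U" "y \<in> V" and b: "b \<in> Ux y" and c: "c \<in> {..<m::nat} \<rightarrow> Oo U"
  shows "\<exists>W a. open_set W \<and> y \<in> W \<and> W \<subseteq> V \<and> a \<in> {..<m} \<rightarrow> carrier (sections \<XX> W) \<and>
    (\<forall>j<m. section_to_K \<XX> W (a j) = inv\<^bsub>KX\<^esub> b \<otimes>\<^bsub>KX\<^esub> c j)"
proof -
  note g = good_facts[OF U]
  have yU: "y \<in> U" and yT: "y \<in> TX" using V g(3) by auto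
  have ib: "inv\<^bsub>KX\<^esub> b \<in> Ox y" using Ux_facts(1)[OF yT b] unfolding units_in_def by blast
  have "inv\<^bsub>KX\<^esub> b \<otimes>\<^bsub>KX\<^esub> c j \<in> Ox y" if "j \<in> {..<m}" for j
    using subringE(6)[OF Ox_subring[OF yT] ib] c that good_chart_facts(1)[OF U yU] by blast
  then have "\<exists>W. open_set W \<and> y \<in> W \<and> W \<subseteq> V \<and> (\<forall>j\<in>{..<m}. inv\<^bsub>KX\<^esub> b \<otimes>\<^bsub>KX\<^esub> c j \<in> Oo W)"
    by (intro Ox_nbhd[OF V(3,1)]) auto
  then obtain W where W: "open_set W" "y \<in> W" "W \<subseteq> V" "\<forall>j\<in>{..<m}. inv\<^bsub>KX\<^esub> b \<otimes>\<^bsub>KX\<^esub> c j \<in> Oo W" by blast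
  have "\<forall>j\<in>{..<m}. \<exists>a. a \<in> carrier (sections \<XX> W) \<and> section_to_K \<XX> W a = inv\<^bsub>KX\<^esub> b \<otimes>\<^bsub>KX\<^esub> c j"
    using W(4) unfolding Oo_def image_iff by metis
  then obtain a where "\<forall>j\<in>{..<m}. a j \<in> carrier (sections \<XX> W) \<and> section_to_K \<XX> W (a j) = inv\<^bsub>KX\<^esub> b \<otimes>\<^bsub>KX\<^esub> c j"
    using bchoice[of "{..<m}" "\<lambda>j a. a \<in> carrier (sections \<XX> W) \<and> section_to_K \<XX> W a = inv\<^bsub>KX\<^esub> b \<otimes>\<^bsub>KX\<^esub> c j"] by blast
  then show ?thesis using W(1-3) by (intro exI[of _ W] exI[of _ a]) auto
qed

end

context snc_setup
begin

lemma FD_finite_type: "finite_type_sheaf \<XX> FD"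
  unfolding finite_type_sheaf_def
proof
  fix x assume x: "x \<in> TX"
  obtain U where U: "good U" "x \<in> U" by (rule good_at[OF x])
  note g = good_facts[OF U(1)]
  show "\<exists>U n s. open_set U \<and> x \<in> U \<and> s \<in> {..<n} \<rightarrow> carrier (msections FD U) \<and> generated_over \<XX> FD U n s"
  proof (rule FF_generators[OF U(1)])
    fix m :: nat and s
    assume s: "\<And>j. j < m \<Longrightarrow> s j \<in> FF U"
      and gen: "\<And>v. v \<in> FF U \<Longrightarrow> \<exists>c\<in>{..<m} \<rightarrow> Oo U. fst v = (\<Oplus>\<^bsub>KX\<^esub>j\<in>{..<m}. c j \<otimes>\<^bsub>KX\<^esub> fst (s j)) \<and> snd v = (\<Oplus>\<^bsub>KX\<^esub>j\<in>{..<m}. c j \<otimes>\<^bsub>KX\<^esub> snd (s j))"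
    have sc: "fst (s j) \<in> carrier KX" "snd (s j) \<in> carrier KX" if "j < m" for j using FF_VK[OF s[OF that]] unfolding VK_simps by auto
    have "generated_over \<XX> FD U m s"
      unfolding generated_over_def
    proof (intro allI impI, elim conjE)
      fix V t y assume V: "open_set V" "V \<subseteq> U" and t0: "t \<in> carrier (msections FD V)" and y: "y \<in> V"
      have t: "t \<in> FF V" using t0 y FD_simps(1)[of V] by blast
      have tc: "fst t \<in> carrier KX" "snd t \<in> carrier KX" using FF_VK[OF t] unfolding VK_simps by auto
      have yT: "y \<in> TX" using y V(2) g(3) by blast
      obtain b where b: "b \<in> Oo U" "b \<in> Ux y" "b \<odot>\<^bsub>VK\<^esub> t \<in> FF U" using FF_localize[OF U(1) V y t] by blast
      have bc: "b \<in> carrier KX" "b \<noteq> \<zero>\<^bsub>KX\<^esub>" using Ux_facts(1)[OF yT b(2)] by auto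
      obtain c where c: "c \<in> {..<m} \<rightarrow> Oo U"
        "b \<otimes>\<^bsub>KX\<^esub> fst t = (\<Oplus>\<^bsub>KX\<^esub>j\<in>{..<m}. c j \<otimes>\<^bsub>KX\<^esub> fst (s j))" "b \<otimes>\<^bsub>KX\<^esub> snd t = (\<Oplus>\<^bsub>KX\<^esub>j\<in>{..<m}. c j \<otimes>\<^bsub>KX\<^esub> snd (s j))"
        using gen[OF b(3)] by (auto simp: VK_simps)
      have cc: "c j \<in> carrier KX" if "j < m" for j using c(1) that subringE(1)[OF g(5)] by blast
      obtain W a where W: "open_set W" "y \<in> W" "W \<subseteq> V" "a \<in> {..<m} \<rightarrow> carrier (sections \<XX> W)"
        "\<forall>j<m. section_to_K \<XX> W (a j) = inv\<^bsub>KX\<^esub> b \<otimes>\<^bsub>KX\<^esub> c j"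
        using local_quotients[OF U(1) V y b(2) c(1)] by blast
      have Wne: "W \<noteq> {}" using W(2) by blast
      have "inv\<^bsub>KX\<^esub> b \<in> carrier KX" by (rule K.Units_inv_closed) (use bc K.field_Units in blast)
      then have kc: "inv\<^bsub>KX\<^esub> b \<otimes>\<^bsub>KX\<^esub> c j \<in> carrier KX" if "j < m" for j using K.m_closed cc[OF that] by simp
      have "lin_comb FD U m s W a =
          ((\<Oplus>\<^bsub>KX\<^esub>i\<in>{..<m}. section_to_K \<XX> W (a i) \<otimes>\<^bsub>KX\<^esub> fst (s i)), (\<Oplus>\<^bsub>KX\<^esub>i\<in>{..<m}. section_to_K \<XX> W (a i) \<otimes>\<^bsub>KX\<^esub> snd (s i)))"
        by (rule FD_lin_comb[OF g(1) W(1) Wne]) (use W V s in auto)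
      also have "(\<Oplus>\<^bsub>KX\<^esub>i\<in>{..<m}. section_to_K \<XX> W (a i) \<otimes>\<^bsub>KX\<^esub> fst (s i)) = (\<Oplus>\<^bsub>KX\<^esub>j\<in>{..<m}. (inv\<^bsub>KX\<^esub> b \<otimes>\<^bsub>KX\<^esub> c j) \<otimes>\<^bsub>KX\<^esub> fst (s j))"
        by (rule K.finsum_cong') (use W(5) kc sc in auto)
      also have "\<dots> = fst t" by (rule K.divide_sum[symmetric, OF bc tc(1) cc sc(1) c(2)])
      also have "(\<Oplus>\<^bsub>KX\<^esub>i\<in>{..<m}. section_to_K \<XX> W (a i) \<otimes>\<^bsub>KX\<^esub> snd (s i)) = (\<Oplus>\<^bsub>KX\<^esub>j\<in>{..<m}. (inv\<^bsub>KX\<^esub> b \<otimes>\<^bsub>KX\<^esub> c j) \<otimes>\<^bsub>KX\<^esub> snd (s j))"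
        by (rule K.finsum_cong') (use W(5) kc sc in auto)
      also have "\<dots> = snd t" by (rule K.divide_sum[symmetric, OF bc tc(2) cc sc(2) c(3)])
      finally have "mrestr FD V W t = lin_comb FD U m s W a" using Wne by (simp add: FD_simps)
      then show "\<exists>W a. open_set W \<and> y \<in> W \<and> W \<subseteq> V \<and> a \<in> {..<m} \<rightarrow> carrier (sections \<XX> W) \<and> mrestr FD V W t = lin_comb FD U m s W a"
        using W(1-4) by blast
    qed
    moreover have "s \<in> {..<m} \<rightarrow> carrier (msections FD U)" using s FD_simps(1)[OF g(2)] by auto
    ultimately show ?thesis using g(1) U(2) by blast
  qed
qed

end

section \<open>Relations between finitely many sections\<close>

locale sheaf_relations = snc_setup \<XX> D h for \<XX> :: "('x, 'a) rspace" and D h +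
  fixes U :: "'x set" and n :: nat and s
  assumes openU: "open_set U" and s: "i < n \<Longrightarrow> s i \<in> FF U"
begin

abbreviation "RS \<equiv> relation_sheaf \<XX> FD U n s"

text \<open>A relation between the \<open>s i\<close>, written as two linear equations over the
  function field. In this form it does not depend on an open set, so relations over different open
  sets can be compared.\<close>

definition krel where
  "krel \<tau> \<longleftrightarrow> (\<Oplus>\<^bsub>KX\<^esub>i\<in>{..<n}. \<tau> i \<otimes>\<^bsub>KX\<^esub> fst (s i)) = \<zero>\<^bsub>KX\<^esub> \<and> (\<Oplus>\<^bsub>KX\<^esub>i\<in>{..<n}. \<tau> i \<otimes>\<^bsub>KX\<^esub> snd (s i)) = \<zero>\<^bsub>KX\<^esub>"

lemma s_carrier: "(\<lambda>i. fst (s i)) \<in> {..<n} \<rightarrow> carrier KX" "(\<lambda>i. snd (s i)) \<in> {..<n} \<rightarrow> carrier KX"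
  using FF_VK[OF s] by (auto simp: VK_simps mem_Times_iff)

lemma krel_zero: "krel (\<lambda>i. \<zero>\<^bsub>KX\<^esub>)"
proof -
  have "(\<Oplus>\<^bsub>KX\<^esub>i\<in>{..<n}. \<zero>\<^bsub>KX\<^esub> \<otimes>\<^bsub>KX\<^esub> x i) = \<zero>\<^bsub>KX\<^esub>" if "x \<in> {..<n} \<rightarrow> carrier KX" for x
  proof -
    have "(\<Oplus>\<^bsub>KX\<^esub>i\<in>{..<n}. \<zero>\<^bsub>KX\<^esub> \<otimes>\<^bsub>KX\<^esub> x i) = (\<Oplus>\<^bsub>KX\<^esub>i\<in>{..<n}. \<zero>\<^bsub>KX\<^esub>)" by (rule K.finsum_cong'[OF refl]) (use that in \<open>simp_all add: Pi_iff\<close>)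
    then show ?thesis by (simp add: K.finsum_zero)
  qed
  then show ?thesis unfolding krel_def using s_carrier by blast
qed

lemma krel_add:
  assumes "u \<in> {..<n} \<rightarrow> carrier KX" "v \<in> {..<n} \<rightarrow> carrier KX" "krel u" "krel v"
  shows "krel (\<lambda>i. u i \<oplus>\<^bsub>KX\<^esub> v i)"
  using assms(3,4) unfolding krel_def
  by (elim conjE) (intro conjI K.relation_add[OF s_carrier(1) assms(1,2)] K.relation_add[OF s_carrier(2) assms(1,2)])

lemma krel_smult:
  assumes "u \<in> {..<n} \<rightarrow> carrier KX" "c \<in> carrier KX" "krel u"
  shows "krel (\<lambda>i. c \<otimes>\<^bsub>KX\<^esub> u i)"
  using assms(3) unfolding krel_def
  by (elim conjE) (intro conjI K.relation_smult[OF s_carrier(1) assms(1,2)] K.relation_smult[OF s_carrier(2) assms(1,2)])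

lemma krel_cong:
  assumes "v \<in> {..<n} \<rightarrow> carrier KX" "\<And>i. i < n \<Longrightarrow> u i = v i"
  shows "krel u \<longleftrightarrow> krel v"
proof -
  have "(\<Oplus>\<^bsub>KX\<^esub>i\<in>{..<n}. u i \<otimes>\<^bsub>KX\<^esub> x i) = (\<Oplus>\<^bsub>KX\<^esub>i\<in>{..<n}. v i \<otimes>\<^bsub>KX\<^esub> x i)" if "x \<in> {..<n} \<rightarrow> carrier KX" for x
    by (rule K.finsum_cong') (use that assms in auto)
  then show ?thesis unfolding krel_def using s_carrier by simp
qed

lemma RS_simps:
  "\<zero>\<^bsub>msections RS V\<^esub> = (\<lambda>i\<in>{..<n}. \<zero>\<^bsub>sections \<XX> V\<^esub>)"
  "a \<oplus>\<^bsub>msections RS V\<^esub> b = (\<lambda>i\<in>{..<n}. a i \<oplus>\<^bsub>sections \<XX> V\<^esub> b i)"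
  "c \<odot>\<^bsub>msections RS V\<^esub> a = (\<lambda>i\<in>{..<n}. c \<otimes>\<^bsub>sections \<XX> V\<^esub> a i)"
  "mrestr RS V W a = (\<lambda>i\<in>{..<n}. restr \<XX> V W (a i))"
  unfolding relation_sheaf_def by simp_all

lemma RS_carrier:
  assumes V: "open_set V" "V \<noteq> {}" "V \<subseteq> U"
  shows "t \<in> carrier (msections RS V) \<longleftrightarrow> t \<in> {..<n} \<rightarrow>\<^sub>E carrier (sections \<XX> V) \<and> krel (\<lambda>i. section_to_K \<XX> V (t i))"
proof -
  have "lin_comb FD U n s V t = \<zero>\<^bsub>msections FD V\<^esub> \<longleftrightarrow> krel (\<lambda>i. section_to_K \<XX> V (t i))" if t: "t \<in> {..<n} \<rightarrow>\<^sub>E carrier (sections \<XX> V)"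
  proof -
    have "lin_comb FD U n s V t = ((\<Oplus>\<^bsub>KX\<^esub>i\<in>{..<n}. section_to_K \<XX> V (t i) \<otimes>\<^bsub>KX\<^esub> fst (s i)), (\<Oplus>\<^bsub>KX\<^esub>i\<in>{..<n}. section_to_K \<XX> V (t i) \<otimes>\<^bsub>KX\<^esub> snd (s i)))"
      by (rule FD_lin_comb[OF openU V s]) (use t in auto)
    then show ?thesis unfolding krel_def FD_simps VK_simps by simp
  qed
  then show ?thesis unfolding relation_sheaf_def by auto
qed

lemma RS_restr:
  assumes V: "open_set V" "V \<subseteq> U" and W: "open_set W" "W \<noteq> {}" "W \<subseteq> V" and t: "t \<in> carrier (msections RS V)"
  shows "mrestr RS V W t \<in> carrier (msections RS W)"
    "\<And>i. i < n \<Longrightarrow> section_to_K \<XX> W (mrestr RS V W t i) = section_to_K \<XX> V (t i)"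
proof -
  have Vne: "V \<noteq> {}" and WU: "W \<subseteq> U" using V W by auto
  have tt: "t \<in> {..<n} \<rightarrow>\<^sub>E carrier (sections \<XX> V)" "krel (\<lambda>i. section_to_K \<XX> V (t i))" using t unfolding RS_carrier[OF V(1) Vne V(2)] by auto
  have tc: "t i \<in> carrier (sections \<XX> V)" if "i < n" for i using tt(1) that by auto
  have r: "restr \<XX> V W (t i) \<in> carrier (sections \<XX> W)" if "i < n" for i
    by (rule ring_hom_closed[OF restr_hom[OF V(1) W(1,3)] tc[OF that]])
  show e: "section_to_K \<XX> W (mrestr RS V W t i) = section_to_K \<XX> V (t i)" if "i < n" for i
    unfolding RS_simps using section_to_K_restr[OF V(1) W(1,3,2) tc[OF that]] that by simp
  have "krel (\<lambda>i. section_to_K \<XX> W (mrestr RS V W t i))"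
    by (rule iffD2[OF krel_cong tt(2)]) (use e tc ring_hom_closed[OF section_to_K_hom[OF V(1) Vne]] in auto)
  moreover have "mrestr RS V W t \<in> {..<n} \<rightarrow>\<^sub>E carrier (sections \<XX> W)" unfolding RS_simps using r by auto
  ultimately show "mrestr RS V W t \<in> carrier (msections RS W)" unfolding RS_carrier[OF W(1,2) WU] by blast
qed

context
  fixes W assumes W: "open_set W" "W \<noteq> {}" "W \<subseteq> U"
begin

interpretation R: cring "sections \<XX> W" by (rule cring_sections[OF W(1)])

interpretation Hm: ring_hom_cring "sections \<XX> W" KX "section_to_K \<XX> W"
  using section_to_K_hom[OF W(1,2)] by (simp add: ring_hom_cring_def ring_hom_cring_axioms_def R.cring_axioms K.cring_axioms)

lemma RS_carrierD:
  assumes "t \<in> carrier (msections RS W)"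
  shows "t \<in> {..<n} \<rightarrow>\<^sub>E carrier (sections \<XX> W)" "krel (\<lambda>i. section_to_K \<XX> W (t i))"
    "\<And>i. i < n \<Longrightarrow> t i \<in> carrier (sections \<XX> W)" "(\<lambda>i. section_to_K \<XX> W (t i)) \<in> {..<n} \<rightarrow> carrier KX"
  using assms unfolding RS_carrier[OF W] by auto

lemma RS_carrierI:
  assumes "\<And>i. i < n \<Longrightarrow> t i \<in> carrier (sections \<XX> W)" "krel u" "\<And>i. i < n \<Longrightarrow> section_to_K \<XX> W (t i) = u i"
  shows "(\<lambda>i\<in>{..<n}. t i) \<in> carrier (msections RS W)"
proof -
  have "u \<in> {..<n} \<rightarrow> carrier KX" using assms(1) assms(3)[symmetric] by auto
  then have "krel (\<lambda>i. section_to_K \<XX> W ((\<lambda>i\<in>{..<n}. t i) i))" by (rule iffD2[OF krel_cong assms(2)]) (use assms(3) in simp)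
  then show ?thesis unfolding RS_carrier[OF W] using assms(1) by auto
qed

lemma RS_smult_closed:
  assumes c: "c \<in> carrier (sections \<XX> W)" and t: "t \<in> carrier (msections RS W)"
  shows "c \<odot>\<^bsub>msections RS W\<^esub> t \<in> carrier (msections RS W)"
  unfolding RS_simps by (rule RS_carrierI[OF _ krel_smult[OF RS_carrierD(4)[OF t] Hm.hom_closed[OF c] RS_carrierD(2)[OF t]]])
    (use RS_carrierD(3)[OF t] c in simp_all)

text \<open>The finite sums in \<open>lin_comb\<close> are taken in this additive structure; the
  computation in \<open>RS_lin_comb\<close> rests on it.\<close>

lemma RS_abelian_monoid: "abelian_monoid (msections RS W)"
proof (rule abelian_monoidI)
  show "\<zero>\<^bsub>msections RS W\<^esub> \<in> carrier (msections RS W)"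
    unfolding RS_simps by (rule RS_carrierI[OF _ krel_zero]) simp_all
  fix x assume x: "x \<in> carrier (msections RS W)"
  note x' = RS_carrierD[OF x]
  show "\<zero>\<^bsub>msections RS W\<^esub> \<oplus>\<^bsub>msections RS W\<^esub> x = x"
    unfolding RS_simps using x'(3) PiE_arb[OF x'(1)] by (intro ext) simp
  fix y assume y: "y \<in> carrier (msections RS W)"
  note y' = RS_carrierD[OF y]
  show "x \<oplus>\<^bsub>msections RS W\<^esub> y \<in> carrier (msections RS W)"
    unfolding RS_simps by (rule RS_carrierI[OF _ krel_add[OF x'(4) y'(4) x'(2) y'(2)]]) (use x'(3) y'(3) in simp_all)
  show "x \<oplus>\<^bsub>msections RS W\<^esub> y = y \<oplus>\<^bsub>msections RS W\<^esub> x"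
    unfolding RS_simps using x'(3) y'(3) by (intro ext) (simp add: R.a_comm)
  fix z assume z: "z \<in> carrier (msections RS W)"
  note z' = RS_carrierD[OF z]
  show "x \<oplus>\<^bsub>msections RS W\<^esub> y \<oplus>\<^bsub>msections RS W\<^esub> z = x \<oplus>\<^bsub>msections RS W\<^esub> (y \<oplus>\<^bsub>msections RS W\<^esub> z)"
    unfolding RS_simps using x'(3) y'(3) z'(3) by (intro ext) (simp add: R.a_assoc)
qed

lemma RS_lin_comb:
  assumes V: "open_set V" "V \<subseteq> U" "W \<subseteq> V"
    and r: "\<And>j. j < m \<Longrightarrow> r j \<in> carrier (msections RS V)" and a: "\<And>j. j < m \<Longrightarrow> a j \<in> carrier (sections \<XX> W)"
  shows "lin_comb RS V m r W a \<in> carrier (msections RS W) \<and>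
    (\<forall>i<n. section_to_K \<XX> W (lin_comb RS V m r W a i) =
      (\<Oplus>\<^bsub>KX\<^esub>j\<in>{..<m}. section_to_K \<XX> W (a j) \<otimes>\<^bsub>KX\<^esub> section_to_K \<XX> V (r j i)))"
  using r a
proof (induction m)
  interpret M: abelian_monoid "msections RS W" by (rule RS_abelian_monoid)
  case 0
  show ?case unfolding lin_comb_def by (simp add: M.zero_closed) (simp add: RS_simps)
next
  interpret M: abelian_monoid "msections RS W" by (rule RS_abelian_monoid)
  case (Suc m)
  have ins: "{..<Suc m} = insert m {..<m}" by auto
  let ?l = "lin_comb RS V m r W a" and ?t = "\<lambda>j. a j \<odot>\<^bsub>msections RS W\<^esub> mrestr RS V W (r j)"
  have IH: "?l \<in> carrier (msections RS W)"
    "\<And>i. i < n \<Longrightarrow> section_to_K \<XX> W (?l i) = (\<Oplus>\<^bsub>KX\<^esub>j\<in>{..<m}. section_to_K \<XX> W (a j) \<otimes>\<^bsub>KX\<^esub> section_to_K \<XX> V (r j i))"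
    using Suc.IH Suc.prems by simp_all
  have rr: "mrestr RS V W (r j) \<in> carrier (msections RS W)" if "j < Suc m" for j
    by (rule RS_restr(1)[OF V(1,2) W(1,2) V(3) Suc.prems(1)[OF that]])
  have tc: "?t j \<in> carrier (msections RS W)" if "j < Suc m" for j
    by (rule RS_smult_closed[OF Suc.prems(2)[OF that] rr[OF that]])
  have eq: "lin_comb RS V (Suc m) r W a = ?t m \<oplus>\<^bsub>msections RS W\<^esub> ?l"
    unfolding lin_comb_def ins by (rule M.finsum_insert) (use tc in auto)
  have "section_to_K \<XX> W (lin_comb RS V (Suc m) r W a i) = (\<Oplus>\<^bsub>KX\<^esub>j\<in>{..<Suc m}. section_to_K \<XX> W (a j) \<otimes>\<^bsub>KX\<^esub> section_to_K \<XX> V (r j i))" if i: "i < n" for i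
  proof -
    have am: "a m \<in> carrier (sections \<XX> W)" and rm: "mrestr RS V W (r m) i \<in> carrier (sections \<XX> W)" and li: "?l i \<in> carrier (sections \<XX> W)"
      using Suc.prems(2) RS_carrierD(3)[OF rr i] RS_carrierD(3)[OF IH(1) i] by simp_all
    have e: "section_to_K \<XX> W (mrestr RS V W (r j) i) = section_to_K \<XX> V (r j i)" if "j < Suc m" for j
      by (rule RS_restr(2)[OF V(1,2) W(1,2) V(3) Suc.prems(1)[OF that] i])
    have rc: "section_to_K \<XX> V (r j i) \<in> carrier KX" if "j < Suc m" for j
      using e[OF that] Hm.hom_closed[OF RS_carrierD(3)[OF rr[OF that] i]] by simp
    have "lin_comb RS V (Suc m) r W a i = a m \<otimes>\<^bsub>sections \<XX> W\<^esub> mrestr RS V W (r m) i \<oplus>\<^bsub>sections \<XX> W\<^esub> ?l i"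
      unfolding eq RS_simps(2,3) using i by simp
    then have "section_to_K \<XX> W (lin_comb RS V (Suc m) r W a i) = section_to_K \<XX> W (a m) \<otimes>\<^bsub>KX\<^esub> section_to_K \<XX> V (r m i)
        \<oplus>\<^bsub>KX\<^esub> (\<Oplus>\<^bsub>KX\<^esub>j\<in>{..<m}. section_to_K \<XX> W (a j) \<otimes>\<^bsub>KX\<^esub> section_to_K \<XX> V (r j i))"
      using am rm li e[of m] IH(2)[OF i] by simp
    also have "\<dots> = (\<Oplus>\<^bsub>KX\<^esub>j\<in>{..<Suc m}. section_to_K \<XX> W (a j) \<otimes>\<^bsub>KX\<^esub> section_to_K \<XX> V (r j i))"
      unfolding ins by (rule K.finsum_insert[symmetric]) (use rc Suc.prems(2) in auto)
    finally show ?thesis .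
  qed
  moreover have "lin_comb RS V (Suc m) r W a \<in> carrier (msections RS W)"
    unfolding eq using M.a_closed tc[of m] IH(1) by simp
  ultimately show ?case by blast
qed

end

text \<open>The relations with coefficients in \<open>Oo U1\<close> form a finitely generated module
  of vectors over a Noetherian ring. Near any point of the chart a relation acquires such
  coefficients after multiplication by a common denominator that is a unit there, so the same
  generators work on the whole intersection.\<close>

lemma RS_generated:
  assumes U1: "good U1" and x: "x \<in> U \<inter> U1"
  shows "\<exists>m r. r \<in> {..<m} \<rightarrow> carrier (msections RS (U \<inter> U1)) \<and> generated_over (open_subspace \<XX> U) RS (U \<inter> U1) m r"
proof -
  note g = good_facts[OF U1]
  note Oc = subsetD[OF subringE(1)[OF g(5)]]
  define U' where "U' = U \<inter> U1"
  have U': "open_set U'" "U' \<noteq> {}" "U' \<subseteq> U" "U' \<subseteq> U1" using openU g(1) x unfolding U'_def by auto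
  \<comment> \<open>The module is formed over the Noetherian ring \<open>Oo U1\<close>, although the
    sections \<open>s\<close> are given over U and the intersection need not be affine: relations
    are equations over the function field, and coefficients from \<open>Oo U1\<close> restrict to
    the intersection.\<close>
  define N where "N = {\<tau>. (\<forall>i. \<tau> i \<in> Oo U1) \<and> (\<forall>i\<ge>n. \<tau> i = \<zero>\<^bsub>KX\<^esub>) \<and> krel \<tau>}"
  have N: "vectors_over KX (Oo U1) N"
    unfolding vectors_over_def
  proof (intro conjI ballI allI)
    show "v i \<in> carrier KX" if "v \<in> N" for v i using that Oc unfolding N_def by blast
    show "(\<lambda>i. \<zero>\<^bsub>KX\<^esub>) \<in> N" unfolding N_def using subringE(2)[OF g(5)] krel_zero by simp
    show "(\<lambda>i. v i \<oplus>\<^bsub>KX\<^esub> w i) \<in> N" if "v \<in> N" "w \<in> N" for v w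
      using that krel_add[of v w] subringE(7)[OF g(5)] Oc unfolding N_def by auto
    show "(\<lambda>i. a \<otimes>\<^bsub>KX\<^esub> v i) \<in> N" if "a \<in> Oo U1" "v \<in> N" for a v
      using that krel_smult[of v a] subringE(6)[OF g(5)] Oc unfolding N_def by auto
  qed
  show ?thesis unfolding U'_def[symmetric]
  proof (rule K.vectors_over_generators[OF g(5,6) N, where n = n])
    show "v i \<in> Oo U1" if "v \<in> N" for v i using that unfolding N_def by blast
    show "v i = \<zero>\<^bsub>KX\<^esub>" if "v \<in> N" "i \<ge> n" for v i using that unfolding N_def by blast
  next
    fix m :: nat and e :: "nat \<Rightarrow> nat \<Rightarrow> ('x set \<times> 'a) set"
    assume e: "\<And>j. j < m \<Longrightarrow> e j \<in> N"
      and gen: "\<And>v. v \<in> N \<Longrightarrow> \<exists>c\<in>{..<m} \<rightarrow> Oo U1. \<forall>i. v i = (\<Oplus>\<^bsub>KX\<^esub>j\<in>{..<m}. c j \<otimes>\<^bsub>KX\<^esub> e j i)"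
    have eO: "e j i \<in> Oo U1" and ek: "krel (e j)" if "j < m" for i j using e[OF that] unfolding N_def by blast+
    have sub: "Oo U1 \<subseteq> Oo U'" by (rule Oo_mono[OF g(1) U'(1,4,2)])
    have "\<exists>a. a \<in> carrier (sections \<XX> U') \<and> section_to_K \<XX> U' a = e j i" if "j < m" for i j
    proof -
      have "e j i \<in> section_to_K \<XX> U' ` carrier (sections \<XX> U')" using subsetD[OF sub eO[OF that]] unfolding Oo_def .
      then show ?thesis by (elim imageE) (rule exI, auto)
    qed
    then have "\<forall>j i. \<exists>a. j < m \<longrightarrow> a \<in> carrier (sections \<XX> U') \<and> section_to_K \<XX> U' a = e j i" by blast
    then obtain q where q: "\<And>j i. j < m \<Longrightarrow> q j i \<in> carrier (sections \<XX> U') \<and> section_to_K \<XX> U' (q j i) = e j i" by metis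
    define r where "r j = (\<lambda>i\<in>{..<n}. q j i)" for j
    have r: "r j \<in> carrier (msections RS U')" if "j < m" for j
      unfolding r_def by (rule RS_carrierI[OF U'(1-3) _ ek[OF that]]) (use q that in auto)
    have re: "section_to_K \<XX> U' (r j i) = e j i" if "j < m" "i < n" for i j unfolding r_def using q that by simp
    have "generated_over (open_subspace \<XX> U) RS U' m r"
      unfolding generated_over_def
    proof (intro allI impI, elim conjE)
      fix V t y assume "openin (topol (open_subspace \<XX> U)) V" and VU': "V \<subseteq> U'" and t: "t \<in> carrier (msections RS V)" and y: "y \<in> V"
      then have V: "open_set V" "V \<noteq> {}" "V \<subseteq> U" "V \<subseteq> U1" using openin_open_subtopology[OF openU] U' by (auto simp: open_subspace_def)
      have yT: "y \<in> TX" using y V(4) g(3) by blast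
      note t' = RS_carrierD[OF V(1-3) t]
      \<comment> \<open>The section t is undefined as a vector from index n on; zeros there make its
        image a vector of length n in the sense of \<open>N\<close>.\<close>
      define \<tau> where "\<tau> i = (if i < n then section_to_K \<XX> V (t i) else \<zero>\<^bsub>KX\<^esub>)" for i
      have \<tau>c: "\<tau> i \<in> carrier KX" for i using t'(4) unfolding \<tau>_def by auto
      have \<tau>k: "krel \<tau>" by (rule iffD2[OF krel_cong[OF t'(4)] t'(2)]) (simp add: \<tau>_def)
      have "\<tau> i \<in> Ox y" if "i \<in> {..<n}" for i
        using OxI[OF V(1) y, of "\<tau> i"] t'(3)[of i] that unfolding \<tau>_def Oo_def by auto
      then have "\<exists>b\<in>Oo U1. b \<in> Ux y \<and> (\<forall>i\<in>{..<n}. b \<otimes>\<^bsub>KX\<^esub> \<tau> i \<in> Oo U1)"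
        by (intro common_denominator[OF U1]) (use y V in auto)
      then obtain b where b: "b \<in> Oo U1" "b \<in> Ux y" "\<forall>i\<in>{..<n}. b \<otimes>\<^bsub>KX\<^esub> \<tau> i \<in> Oo U1" by blast
      have bc: "b \<in> carrier KX" "b \<noteq> \<zero>\<^bsub>KX\<^esub>" using Ux_facts(1)[OF yT b(2)] by auto
      have "b \<otimes>\<^bsub>KX\<^esub> \<tau> i \<in> Oo U1" for i
        using b(3) subringE(2)[OF g(5)] bc by (cases "i < n") (auto simp: \<tau>_def)
      moreover have "krel (\<lambda>i. b \<otimes>\<^bsub>KX\<^esub> \<tau> i)" by (rule krel_smult[OF _ bc(1) \<tau>k]) (use \<tau>c in auto)
      ultimately have "(\<lambda>i. b \<otimes>\<^bsub>KX\<^esub> \<tau> i) \<in> N" unfolding N_def using bc by (simp add: \<tau>_def)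
      then obtain c where c: "c \<in> {..<m} \<rightarrow> Oo U1" "\<And>i. b \<otimes>\<^bsub>KX\<^esub> \<tau> i = (\<Oplus>\<^bsub>KX\<^esub>j\<in>{..<m}. c j \<otimes>\<^bsub>KX\<^esub> e j i)"
        using gen by blast
      have cc: "c j \<in> carrier KX" if "j < m" for j using c(1) that Oc by blast
      have ec: "e j i \<in> carrier KX" if "j < m" for i j using Oc[OF eO[OF that]] .
      obtain W a where W: "open_set W" "y \<in> W" "W \<subseteq> V" "a \<in> {..<m} \<rightarrow> carrier (sections \<XX> W)"
        "\<forall>j<m. section_to_K \<XX> W (a j) = inv\<^bsub>KX\<^esub> b \<otimes>\<^bsub>KX\<^esub> c j"
        using local_quotients[OF U1 V(1,4) y b(2) c(1)] by blast
      have W': "W \<noteq> {}" "W \<subseteq> U" "W \<subseteq> U'" using W(2,3) V VU' by auto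
      have "inv\<^bsub>KX\<^esub> b \<in> carrier KX" by (rule K.Units_inv_closed) (use bc K.field_Units in blast)
      then have kc: "inv\<^bsub>KX\<^esub> b \<otimes>\<^bsub>KX\<^esub> c j \<in> carrier KX" if "j < m" for j using K.m_closed cc[OF that] by simp
      have L: "lin_comb RS U' m r W a \<in> carrier (msections RS W)"
        "\<And>i. i < n \<Longrightarrow> section_to_K \<XX> W (lin_comb RS U' m r W a i) = (\<Oplus>\<^bsub>KX\<^esub>j\<in>{..<m}. section_to_K \<XX> W (a j) \<otimes>\<^bsub>KX\<^esub> section_to_K \<XX> U' (r j i))"
        using RS_lin_comb[OF W(1) W'(1,2) U'(1,3) W'(3), of m r a] r W(4) by auto
      note T = RS_restr[OF V(1,3) W(1) W'(1) W(3) t]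
      \<comment> \<open>Sections over W embed into the function field, so the expansion is verified
        there, where both sides equal \<open>\<tau> i\<close>.\<close>
      have "mrestr RS V W t i = lin_comb RS U' m r W a i" if i: "i < n" for i
      proof (rule inj_onD[OF section_to_K_inj[OF W(1) W'(1)]])
        have "section_to_K \<XX> W (lin_comb RS U' m r W a i) = (\<Oplus>\<^bsub>KX\<^esub>j\<in>{..<m}. section_to_K \<XX> W (a j) \<otimes>\<^bsub>KX\<^esub> section_to_K \<XX> U' (r j i))" by (rule L(2)[OF i])
        also have "\<dots> = (\<Oplus>\<^bsub>KX\<^esub>j\<in>{..<m}. (inv\<^bsub>KX\<^esub> b \<otimes>\<^bsub>KX\<^esub> c j) \<otimes>\<^bsub>KX\<^esub> e j i)"
          by (rule K.finsum_cong') (use W(5) kc ec re i in auto)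
        also have "\<dots> = \<tau> i" by (rule K.divide_sum[symmetric, OF bc \<tau>c cc ec c(2)])
        finally show "section_to_K \<XX> W (mrestr RS V W t i) = section_to_K \<XX> W (lin_comb RS U' m r W a i)"
          using T(2)[OF i] i by (simp add: \<tau>_def)
        show "mrestr RS V W t i \<in> carrier (sections \<XX> W)" by (rule RS_carrierD(3)[OF W(1) W'(1,2) T(1) i])
        show "lin_comb RS U' m r W a i \<in> carrier (sections \<XX> W)" by (rule RS_carrierD(3)[OF W(1) W'(1,2) L(1) i])
      qed
      then have "mrestr RS V W t = lin_comb RS U' m r W a"
        by (intro PiE_ext[OF RS_carrierD(1)[OF W(1) W'(1,2) T(1)] RS_carrierD(1)[OF W(1) W'(1,2) L(1)]]) simp
      then show "\<exists>W a. openin (topol (open_subspace \<XX> U)) W \<and> y \<in> W \<and> W \<subseteq> V \<and>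
          a \<in> {..<m} \<rightarrow> carrier (sections (open_subspace \<XX> U) W) \<and> mrestr RS V W t = lin_comb RS U' m r W a"
        using W(1-4) W'(2) openin_open_subtopology[OF openU, of W] by (intro exI[of _ W] exI[of _ a]) (simp add: open_subspace_def)
    qed
    moreover have "r \<in> {..<m} \<rightarrow> carrier (msections RS U')" using r by auto
    ultimately show "\<exists>m r. r \<in> {..<m} \<rightarrow> carrier (msections RS U') \<and> generated_over (open_subspace \<XX> U) RS U' m r" by blast
  qed
qed

lemma RS_finite_type: "finite_type_sheaf (open_subspace \<XX> U) RS"
  unfolding finite_type_sheaf_def
proof
  fix x assume "x \<in> topspace (topol (open_subspace \<XX> U))"
  then have x: "x \<in> TX" "x \<in> U" by (auto simp: open_subspace_def)
  obtain U1 where U1: "good U1" "x \<in> U1" by (rule good_at[OF x(1)])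
  have xx: "x \<in> U \<inter> U1" using x U1 by blast
  have "openin (topol (open_subspace \<XX> U)) (U \<inter> U1)"
    using openin_open_subtopology[OF openU, of "U \<inter> U1"] openU good_facts(1)[OF U1(1)] by (auto simp: open_subspace_def)
  then show "\<exists>U' m r. openin (topol (open_subspace \<XX> U)) U' \<and> x \<in> U' \<and> r \<in> {..<m} \<rightarrow> carrier (msections RS U') \<and>
      generated_over (open_subspace \<XX> U) RS U' m r"
    using xx RS_generated[OF U1(1) xx] by blast
qed

end

context snc_setup
begin

lemma relation_sheaf_finite_type:
  assumes U: "open_set U" and s: "s \<in> {..<n} \<rightarrow> carrier (msections FD U)"
  shows "finite_type_sheaf (open_subspace \<XX> U) (relation_sheaf \<XX> FD U n s)"
proof (cases "U = {}")
  case True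
  have "topol (open_subspace \<XX> U) = subtopology (topol \<XX>) U" unfolding open_subspace_def by simp
  then have "topspace (topol (open_subspace \<XX> U)) = {}" using True topspace_subtopology_subset[of "{}"] by simp
  then show ?thesis unfolding finite_type_sheaf_def by simp
next
  case False
  have "sheaf_relations \<XX> D h U n s"
    using snc_setup_axioms U s unfolding FD_simps(1)[OF False] sheaf_relations_def sheaf_relations_axioms_def by blast
  then show ?thesis by (rule sheaf_relations.RS_finite_type)
qed

lemma FD_coherent: "coherent \<XX> FD"
  unfolding coherent_def
proof (intro conjI allI impI)
  show "sheaf_of_modules \<XX> FD" by (rule FD_sheaf)
  show "finite_type_sheaf \<XX> FD" by (rule FD_finite_type)
  show "finite_type_sheaf (open_subspace \<XX> U) (relation_sheaf \<XX> FD U n s)"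
    if "open_set U \<and> s \<in> {..<n} \<rightarrow> carrier (msections FD U)" for U n s
    by (rule relation_sheaf_finite_type) (use that in blast)+
qed

lemma WD_weil: "weil_decoration \<XX> VK WD"
  unfolding weil_decoration_def using WD_pre_weil FD_coherent by blast

end

section \<open>Finite Noetherian affine covers of varieties\<close>

lemma scalar_map_hom:
  assumes k: "cring k" and X: "ringed_space \<XX>" and m: "lrs_morphism \<XX> (Spec k) \<pi>" and U: "openin (topol \<XX>) U"
  shows "scalar_map k \<XX> \<pi> U \<in> ring_hom k (sections \<XX> U)"
proof -
  interpret ringed_space \<XX> by (rule X)
  interpret k: plain_cring k using k by (simp add: plain_cring_def)
  let ?S = "prime_spectrum k" and ?T = "topspace (topol \<XX>)"
  have top: "topol (Spec k) = zariski_topology k" by (simp add: Spec_def)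
  have S: "openin (zariski_topology k) ?S" using openin_topspace[of "zariski_topology k"] unfolding k.topspace_zariski .
  note m' = m[unfolded lrs_morphism_def top]
  have "pt \<pi> ` ?T \<subseteq> ?S" using continuous_map_image_subset_topspace[OF m'[THEN conjunct1]] unfolding k.topspace_zariski .
  then have pre: "preimage \<XX> \<pi> ?S = ?T" unfolding preimage_def by blast
  have pull: "pull \<pi> ?S \<in> ring_hom (sections (Spec k) ?S) (sections \<XX> ?T)"
    using m'[THEN conjunct2, THEN conjunct1, rule_format, OF S] unfolding pre .
  have T: "openin (topol \<XX>) ?T" "U \<subseteq> ?T" using openin_subset[OF U] by simp_all
  have "scalar_map k \<XX> \<pi> U = restr \<XX> ?T U \<circ> (pull \<pi> ?S \<circ> (\<lambda>c. const_section k c ?S))"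
    unfolding scalar_map_def const_section_def by (intro ext) simp
  then show ?thesis
    using ring_hom_trans[OF ring_hom_trans[OF k.const_section_hom[OF S] pull] restr_hom[OF T(1) U T(2)]] by simp
qed

text \<open>The image of the field k in the sections is Noetherian, and the sections arise from it
  by adjoining finitely many elements, so Hilbert's basis theorem applies to each member of the
  cover.\<close>

lemma finite_type_noetherian_cover:
  assumes k: "field k" and X: "ringed_space \<XX>" and m: "lrs_morphism \<XX> (Spec k) \<pi>" and f: "finite_type_over k \<XX> \<pi>"
  shows "\<exists>\<U>. finite \<U> \<and> \<Union>\<U> = topspace (topol \<XX>) \<and>
    (\<forall>U\<in>\<U>. affine_open \<XX> U \<and> noetherian_over (sections \<XX> U) (carrier (sections \<XX> U)))"
proof -
  interpret ringed_space \<XX> by (rule X)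
  interpret k: field k by (rule k)
  obtain \<U> where U: "finite \<U>" "\<Union>\<U> = topspace (topol \<XX>)"
    "\<And>U. U \<in> \<U> \<Longrightarrow> affine_open \<XX> U \<and> (\<exists>S\<subseteq>carrier (sections \<XX> U). finite S \<and>
      generate_ring (sections \<XX> U) (scalar_map k \<XX> \<pi> U ` carrier k \<union> S) = carrier (sections \<XX> U))"
    using f unfolding finite_type_over_def by blast
  have "noetherian_over (sections \<XX> V) (carrier (sections \<XX> V))" if V: "V \<in> \<U>" for V
  proof -
    have o: "openin (topol \<XX>) V" using U(3)[OF V] unfolding affine_open_def by blast
    interpret R: cring "sections \<XX> V" by (rule cring_sections[OF o])
    note h = scalar_map_hom[OF k.cring_axioms X m o]
    obtain S where S: "S \<subseteq> carrier (sections \<XX> V)" "finite S"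
      "generate_ring (sections \<XX> V) (scalar_map k \<XX> \<pi> V ` carrier k \<union> S) = carrier (sections \<XX> V)"
      using U(3)[OF V] by blast
    show ?thesis
      by (rule R.noetherian_over_generate_ring[OF S(2,1) subring_hom_image[OF k.cring_axioms R.cring_axioms h]
            noetherian_over_hom_image[OF k.cring_axioms R.cring_axioms h k.noetherian_over_field] S(3)])
  qed
  then have "\<forall>U\<in>\<U>. affine_open \<XX> U \<and> noetherian_over (sections \<XX> U) (carrier (sections \<XX> U))"
    using U(3) by simp
  then show ?thesis using U(1,2) by (intro exI[of _ \<U>]) simp
qed

theorem theoremC:
  fixes k :: "'k ring"
    and \<XX> :: "('x, 'a) rspace"
    and \<pi> :: "('x, 'a, 'k set, 'k set \<Rightarrow> ('k \<times> 'k) set) rmorphism"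
    and D :: "'x set \<Rightarrow> int"
    and h :: "'x set \<Rightarrow> ('x set \<times> 'a) set set"
  assumes "algebraically_closed k" and "char_zero k"
    and "normal_variety k \<XX> \<pi>"
    and "snc_divisor \<XX> D"
    and "\<And>P. P \<in> supp D \<Longrightarrow> h P \<in> Units (residue_field_at \<XX> P)"
  shows "weil_decoration \<XX> (plane (function_field \<XX>)) (snc_decoration \<XX> D h)"
proof -
  have k: "field k" by (rule algebraically_closed.axioms(1)[OF assms(1)])
  have int: "integral_scheme \<XX>" and n: "normal_scheme \<XX>" and m: "lrs_morphism \<XX> (Spec k) \<pi>" and f: "finite_type_over k \<XX> \<pi>"
    using assms(3) unfolding normal_variety_def by blast+
  interpret locally_ringed_space \<XX> using n unfolding normal_scheme_def scheme_def by blast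
  interpret integral_space \<XX> by unfold_locales (rule int)
  interpret normal_noetherian \<XX>
    by unfold_locales (rule n, rule finite_type_noetherian_cover[OF k ringed_space_axioms m f])
  have D: "D \<in> weil_divisors \<XX>" using assms(4) unfolding snc_divisor_def by blast
  interpret snc_setup \<XX> D h
  proof
    show "finite (supp D)" using D unfolding weil_divisors_def supp_def by blast
    show "prime_divisor \<XX> P" if "P \<in> supp D" for P using D that unfolding weil_divisors_def supp_def by blast
    show "h P \<in> carrier (residue_field_at \<XX> P)" if "P \<in> supp D" for P using assms(5)[OF that] unfolding Units_def by blast
  qed
  show ?thesis using WD_weil unfolding KX_def .
qed

end
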